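(* Let $1\le T\le n$ and $A\sim\mathsf{GOE}(n)$. Let $f_t,g_t\colon(\mathbb{R}^n)^{t-1}\to\mathbb{R}^n$, $t\in[T]$, be $L$-Lipschitz continuous for all $t\in[T]$ (with $f_1,g_1$ constant vectors), and let $(x_t)_{t\in[T]}$ be the generalized first-order method $x_t=Af_t(x_{<t})+g_t(x_{<t})$. Let the parameters $(m_t)_{t\in[T]}$ and $\Sigma=(\Sigma_{st})_{s,t\in[T]}$ be matched to $(f,g)$ by the state evolution construction described in the context, and assume $\Sigma$ is positive definite. Let $(y_t)_{t\in[T]}$ be the comparison process $y_t=m_t(y_{<t})+w_t$. Then there exists a coupling (joint distribution) of $(x_t)_{t\in[T]}$ and $(y_t)_{t\in[T]}$ such that $$\mathbb{P}\Big(\max_{t\in[T]}\|x_t-y_t\|\ge C\sqrt r\Big)\le 2e^{-r}\qquad\text{for all }0\le r\le n,$$ where $C>0$ is a constant depending only on $T$, $L$, and the largest and smallest eigenvalues of $\Sigma$.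
   Context: $\mathsf{GOE}(n)$ denotes the law of a symmetric $n\times n$ random matrix with independent $\mathsf{N}(0,2/n)$ diagonal entries and independent $\mathsf{N}(0,1/n)$ entries below the diagonal. $\|\cdot\|$ is the Euclidean norm; a function on $(\mathbb{R}^n)^{t-1}$ is Lipschitz with respect to the Euclidean norm of the stacked vector $x_{<t}=(x_1,\dots,x_{t-1})$. The comparison process is $y_t=m_t(y_{<t})+w_t$, where $(w_t)_{t\in[T]}$ is a mean-zero Gaussian process in $\mathbb{R}^n$ with $\operatorname{cov}(w_s,w_t)=\Sigma_{st}\mathrm{I}_n$ and $m_t\colon(\mathbb{R}^n)^{t-1}\to\mathbb{R}^n$ ($m_1$ constant). State evolution (matching of $(m,\Sigma)$ to $(f,g)$): set $m_1=g_1$ and $\Sigma_{11}=\frac1n\|f_1\|^2$. For $t\ge2$, given $m_s$ ($s<t$) and $\Sigma_{<t}=(\Sigma_{rs})_{r,s<t}$, let $w_{<t}$ be mean-zero Gaussian with $\operatorname{cov}(w_r,w_s)=\Sigma_{rs}\mathrm{I}_n$ and $y_s=m_s(y_{<s})+w_s$ for $s<t$; define for $s<t$ $$b_{st}=\frac1n\sum_{r<t}[\Sigma_{<t}^{+}]_{sr}\,\mathbb{E}\langle w_r,f_t(y_{<t})\rangle,\qquad m_t=g_t+\sum_{s<t}b_{st}f_s,$$ and $\Sigma_{st}=\Sigma_{ts}=\frac1n\mathbb{E}\langle f_s(y_{<s}),f_t(y_{<t})\rangle$ for $s\le t$, where $(\cdot)^+$ is the Moore–Penrose pseudoinverse and $w_r=y_r-m_r(y_{<r})$.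 *)

theory Defs
  imports "HOL-Probability.Probability"
begin

(* Vectors of R^n are represented as nat => real; only the coordinates 0..n-1 matter.
   Time indices run over {1..T}; a history x_{<t} is a map nat => (nat => real)
   whose entries 1..t-1 are x_1,...,x_{t-1}. *)

definition vinner :: "nat \<Rightarrow> (nat \<Rightarrow> real) \<Rightarrow> (nat \<Rightarrow> real) \<Rightarrow> real" where
  "vinner n x y = (\<Sum>i<n. x i * y i)"

definition vnorm :: "nat \<Rightarrow> (nat \<Rightarrow> real) \<Rightarrow> real" where
  "vnorm n x = sqrt (\<Sum>i<n. (x i)\<^sup>2)"

definition trunc :: "nat \<Rightarrow> (nat \<Rightarrow> real) \<Rightarrow> (nat \<Rightarrow> real)" where
  "trunc n v = (\<lambda>i. if i < n then v i else 0)"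

definition matvec :: "nat \<Rightarrow> (nat \<Rightarrow> nat \<Rightarrow> real) \<Rightarrow> (nat \<Rightarrow> real) \<Rightarrow> (nat \<Rightarrow> real)" where
  "matvec n A v = (\<lambda>i. \<Sum>j<n. A i j * v j)"

definition hist_lipschitz :: "nat \<Rightarrow> nat \<Rightarrow> real \<Rightarrow> ((nat \<Rightarrow> nat \<Rightarrow> real) \<Rightarrow> (nat \<Rightarrow> real)) \<Rightarrow> bool" where
  "hist_lipschitz n t L F \<longleftrightarrow>
     (\<forall>xs ys. vnorm n (\<lambda>i. F xs i - F ys i)
               \<le> L * sqrt (\<Sum>s\<in>{1..<t}. (vnorm n (\<lambda>i. xs s i - ys s i))\<^sup>2))"

(* history generated by x_t = F t (x_{<t}); hist F k s = x_s for 1 <= s <= k, 0 otherwise *)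
primrec hist :: "(nat \<Rightarrow> (nat \<Rightarrow> nat \<Rightarrow> real) \<Rightarrow> (nat \<Rightarrow> real)) \<Rightarrow> nat \<Rightarrow> (nat \<Rightarrow> nat \<Rightarrow> real)" where
  "hist F 0 = (\<lambda>s i. 0)"
| "hist F (Suc k) = (hist F k)(Suc k := F (Suc k) (hist F k))"

definition fun2_space :: "(nat \<Rightarrow> nat \<Rightarrow> real) measure" where
  "fun2_space = PiM UNIV (\<lambda>_. PiM UNIV (\<lambda>_. borel))"

definition gauss :: "real \<Rightarrow> real measure" where
  "gauss v = density lborel (normal_density 0 (sqrt v))"

definition GOE :: "nat \<Rightarrow> (nat \<Rightarrow> nat \<Rightarrow> real) measure" where
  "GOE n = distr
     (PiM {(i,j). i \<le> j \<and> j < n} (\<lambda>(i,j). if i = j then gauss (2 / real n) else gauss (1 / real n)))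
     fun2_space
     (\<lambda>u i j. if i < n \<and> j < n then (if i \<le> j then u (i,j) else u (j,i)) else 0)"

definition fom_traj :: "nat \<Rightarrow> nat \<Rightarrow> (nat \<Rightarrow> (nat \<Rightarrow> nat \<Rightarrow> real) \<Rightarrow> (nat \<Rightarrow> real))
     \<Rightarrow> (nat \<Rightarrow> (nat \<Rightarrow> nat \<Rightarrow> real) \<Rightarrow> (nat \<Rightarrow> real)) \<Rightarrow> (nat \<Rightarrow> nat \<Rightarrow> real) \<Rightarrow> (nat \<Rightarrow> nat \<Rightarrow> real)" where
  "fom_traj n T f g A = hist (\<lambda>t xs. trunc n (\<lambda>i. matvec n A (f t xs) i + g t xs i)) T"

definition cmp_traj :: "nat \<Rightarrow> nat \<Rightarrow> (nat \<Rightarrow> (nat \<Rightarrow> nat \<Rightarrow> real) \<Rightarrow> (nat \<Rightarrow> real))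
     \<Rightarrow> (nat \<Rightarrow> nat \<Rightarrow> real) \<Rightarrow> (nat \<Rightarrow> nat \<Rightarrow> real)" where
  "cmp_traj n k m w = hist (\<lambda>t ys. trunc n (\<lambda>i. m t ys i + w t i)) k"

(* mean-zero Gaussian process (w_t)_{t in [T]} in R^n with cov(w_s,w_t) = Sig s t * I_n,
   realised as w_r = sum_k R r k z_k with z_k iid standard Gaussian vectors, R R^T = Sig *)
definition gauss_proc :: "nat \<Rightarrow> nat \<Rightarrow> (nat \<Rightarrow> nat \<Rightarrow> real) \<Rightarrow> (nat \<Rightarrow> nat \<Rightarrow> real) measure" where
  "gauss_proc n T Sig =
     (let R = (SOME R :: nat \<Rightarrow> nat \<Rightarrow> real.
                 \<forall>r\<in>{1..T}. \<forall>s\<in>{1..T}. (\<Sum>k\<in>{1..T}. R r k * R s k) = Sig r s)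
      in distr (PiM {1..T} (\<lambda>_. PiM {..<n} (\<lambda>_. gauss 1))) fun2_space
           (\<lambda>z r i. if r \<in> {1..T} \<and> i < n then (\<Sum>k\<in>{1..T}. R r k * z k i) else 0))"

definition mat_mult_on :: "nat set \<Rightarrow> (nat \<Rightarrow> nat \<Rightarrow> real) \<Rightarrow> (nat \<Rightarrow> nat \<Rightarrow> real) \<Rightarrow> (nat \<Rightarrow> nat \<Rightarrow> real)" where
  "mat_mult_on I A B = (\<lambda>i j. \<Sum>k\<in>I. A i k * B k j)"

definition pinv_on :: "nat set \<Rightarrow> (nat \<Rightarrow> nat \<Rightarrow> real) \<Rightarrow> (nat \<Rightarrow> nat \<Rightarrow> real)" where
  "pinv_on I A = (THE X. (\<forall>i j. (i \<notin> I \<or> j \<notin> I) \<longrightarrow> X i j = 0)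
      \<and> (\<forall>i\<in>I. \<forall>j\<in>I. mat_mult_on I (mat_mult_on I A X) A i j = A i j)
      \<and> (\<forall>i\<in>I. \<forall>j\<in>I. mat_mult_on I (mat_mult_on I X A) X i j = X i j)
      \<and> (\<forall>i\<in>I. \<forall>j\<in>I. mat_mult_on I A X i j = mat_mult_on I A X j i)
      \<and> (\<forall>i\<in>I. \<forall>j\<in>I. mat_mult_on I X A i j = mat_mult_on I X A j i))"

definition state_evolution :: "nat \<Rightarrow> nat \<Rightarrow> (nat \<Rightarrow> (nat \<Rightarrow> nat \<Rightarrow> real) \<Rightarrow> (nat \<Rightarrow> real))
     \<Rightarrow> (nat \<Rightarrow> (nat \<Rightarrow> nat \<Rightarrow> real) \<Rightarrow> (nat \<Rightarrow> real))
     \<Rightarrow> (nat \<Rightarrow> (nat \<Rightarrow> nat \<Rightarrow> real) \<Rightarrow> (nat \<Rightarrow> real)) \<Rightarrow> (nat \<Rightarrow> nat \<Rightarrow> real) \<Rightarrow> bool" where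
  "state_evolution n T f g m Sig \<longleftrightarrow>
     (let G = gauss_proc n T Sig in
       m 1 = g 1
     \<and> Sig 1 1 = vinner n (f 1 (\<lambda>s i. 0)) (f 1 (\<lambda>s i. 0)) / real n
     \<and> (\<forall>t\<in>{2..T}. m t = (\<lambda>ys i. g t ys i +
           (\<Sum>s\<in>{1..<t}.
              ((1 / real n) * (\<Sum>r\<in>{1..<t}. pinv_on {1..<t} Sig s r *
                  (\<integral>w. vinner n (w r) (f t (cmp_traj n (t - 1) m w)) \<partial>G))) * f s ys i)))
     \<and> (\<forall>t\<in>{1..T}. \<forall>s\<in>{1..t}.
           Sig s t = (1 / real n) *
              (\<integral>w. vinner n (f s (cmp_traj n (s - 1) m w)) (f t (cmp_traj n (t - 1) m w)) \<partial>G)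
         \<and> Sig t s = Sig s t))"

definition pos_def_on :: "nat set \<Rightarrow> (nat \<Rightarrow> nat \<Rightarrow> real) \<Rightarrow> bool" where
  "pos_def_on I S \<longleftrightarrow> (\<forall>s\<in>I. \<forall>t\<in>I. S s t = S t s) \<and>
     (\<forall>v. (\<exists>s\<in>I. v s \<noteq> 0) \<longrightarrow> (\<Sum>s\<in>I. \<Sum>t\<in>I. v s * S s t * v t) > 0)"

definition eigenvalues_on :: "nat set \<Rightarrow> (nat \<Rightarrow> nat \<Rightarrow> real) \<Rightarrow> real set" where
  "eigenvalues_on I S = {c. \<exists>v. (\<exists>s\<in>I. v s \<noteq> 0) \<and> (\<forall>s\<in>I. (\<Sum>t\<in>I. S s t * v t) = c * v s)}"

definition lambda_max :: "nat set \<Rightarrow> (nat \<Rightarrow> nat \<Rightarrow> real) \<Rightarrow> real" where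
  "lambda_max I S = Max (eigenvalues_on I S)"

definition lambda_min :: "nat set \<Rightarrow> (nat \<Rightarrow> nat \<Rightarrow> real) \<Rightarrow> real" where
  "lambda_min I S = Min (eigenvalues_on I S)"

end

theory Submission
  imports Defs
begin

text \<open>
  The matrix is revealed along the Gram--Schmidt directions \<open>u\<^sub>1, u\<^sub>2, ...\<close> of \<open>f\<^sub>1(x), f\<^sub>2(x), ...\<close>. Since
  \<open>u\<^sub>s\<close> depends only on what has been revealed before, replacing successively the rows and columns of a GOE matrix in these
  directions by independent standard Gaussian vectors \<open>z\<^sub>1, z\<^sub>2, ...\<close> again gives a GOE matrix, and the iteration driven
  by that matrix is a function of \<open>z\<close> alone:
  \<open>x\<^sub>t = g\<^sub>t + \<Sum>\<^sub>s \<langle>u\<^sub>s, f\<^sub>t\<rangle> a\<^sub>s\<close>, where \<open>a\<^sub>s\<close> is, up to small corrections, \<open>(z\<^sub>s + \<Sum>\<^sub>j\<^sub><\<^sub>s \<langle>z\<^sub>j, u\<^sub>s\<rangle> u\<^sub>j) / sqrt n\<close>.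
  The comparison process is driven by the same noise, \<open>w\<^sub>t = \<Sum>\<^sub>s R\<^sub>t\<^sub>s z\<^sub>s\<close> with \<open>R\<close> the Cholesky factor of \<open>\<Sigma>\<close>.

  Each \<open>f\<^sub>t(y)\<close> is a Lipschitz function of \<open>z\<close> with a constant independent of \<open>n\<close>. Gaussian concentration, obtained from
  Maurey's property tau and the one-dimensional Prekopa--Leindler inequality, therefore puts \<open>\<langle>f\<^sub>s(y), f\<^sub>t(y)\<rangle>\<close> within
  \<open>O(sqrt (n r))\<close> of \<open>n \<Sigma>\<^sub>s\<^sub>t\<close>, and likewise \<open>\<langle>z\<^sub>s, f\<^sub>t(y)\<rangle>\<close> close to its mean, outside an event of probability
  \<open>2 exp (- r)\<close>. On the complement, induction on \<open>t\<close> shows that \<open>\<langle>u\<^sub>s, f\<^sub>t(x)\<rangle> / sqrt n\<close> is close to \<open>R\<^sub>t\<^sub>s\<close> and that the terms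
  \<open>\<langle>z\<^sub>j, u\<^sub>s\<rangle> u\<^sub>j\<close> add up to the memory term \<open>\<Sum>\<^sub>s b\<^sub>s\<^sub>t f\<^sub>s\<close>.
\<close>

section \<open>Gaussian concentration\<close>

text \<open>Gram--Schmidt normalisation is not Lipschitz in the noise, so concentration is never
  claimed for \<open>x\<close>. Probability enters only through inner products of \<open>z\<close>
  and \<open>f t (y z)\<close>, where \<open>y\<close> is a plain Lipschitz recursion; on the good
  event the passage to \<open>x\<close> is deterministic. It works because the coefficients of the
  \<open>f t (x z)\<close> in the basis form a lower triangular factor of their Gram matrix, and
  such factors of nearby Gram matrices are near as long as the pivots stay away from 0. This is
  where the smallest eigenvalue of \<Sigma> enters. In the same spirit the pseudoinverse in the
  memory coefficients is traded for a triangular system with matrix \<open>R\<close>.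

  The constant must not see \<open>n\<close>, \<open>f\<close>, \<open>g\<close> or the noise.
  Bounds are therefore stated for functions on a set of instances with one constant for the whole
  set (\<open>dominated\<close>); in the end this set collects all problems with the same
  \<open>T\<close>, \<open>L\<close> and extreme eigenvalues.

  Levels \<open>r < 1/2\<close> are free because \<open>2 * exp (- r) > 1\<close> there, and
  \<open>r \<ge> 1/2\<close> lets additive constants and the size of the union bound be absorbed
  into multiples of \<open>r\<close>.\<close>

text \<open>Property tau is usually stated for \<open>exp (Q f)\<close> and
  \<open>exp (- f)\<close>, with \<open>Q f\<close> the infimal convolution of \<open>f\<close> and
  the cost. Quantifying over all admissible pairs \<open>a\<close>, \<open>b\<close> expresses the
  same trade-off without the infimum, whose measurability would be a question of its own.\<close>

definition prop_tau :: "'a measure \<Rightarrow> ('a \<Rightarrow> 'a \<Rightarrow> real) \<Rightarrow> bool" where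
  "prop_tau M c \<longleftrightarrow> (\<forall>a\<in>borel_measurable M. \<forall>b\<in>borel_measurable M.
     (\<forall>x\<in>space M. \<forall>y\<in>space M. a x * b y \<le> ennreal (exp (c x y))) \<longrightarrow>
     (\<integral>\<^sup>+x. a x \<partial>M) * (\<integral>\<^sup>+y. b y \<partial>M) \<le> 1)"

section \<open>The one-dimensional Prekopa--Leindler inequality for the Gaussian kernel\<close>

lemma nn_integral_layer_cake:
  fixes h :: "real \<Rightarrow> ennreal"
  assumes [measurable]: "h \<in> borel_measurable borel"
  shows "(\<integral>\<^sup>+x. h x \<partial>lborel) = (\<integral>\<^sup>+s. indicator {0<..} s * emeasure lborel {x. ennreal s < h x} \<partial>lborel)"
proof -
  have v: "(\<integral>\<^sup>+s. indicator {s. 0 < s \<and> ennreal s < v} s \<partial>lborel) = v" for v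
  proof (cases v)
    case (real r)
    then have "{s. 0 < s \<and> ennreal s < v} = {0<..<r}"
      by (auto simp: ennreal_less_iff)
    then show ?thesis using real by simp
  next
    case top
    then have "{s. 0 < s \<and> ennreal s < v} = {0::real<..}" by auto
    moreover have "emeasure lborel {0::real<..} = \<infinity>"
    proof (rule ccontr)
      assume ne: "emeasure lborel {0::real<..} \<noteq> \<infinity>"
      then obtain r where r: "r \<ge> 0" "emeasure lborel {0::real<..} = ennreal r"
        by (metis ennreal_cases infinity_ennreal_def)
      have "emeasure lborel {0<..<r+1} \<le> emeasure lborel {0::real<..}"
        by (rule emeasure_mono) auto
      then show False using r by simp
    qed
    ultimately show ?thesis using top by simp
  qed
  have "(\<integral>\<^sup>+x. h x \<partial>lborel) = (\<integral>\<^sup>+x. \<integral>\<^sup>+s. indicator {s. 0 < s \<and> ennreal s < h x} s \<partial>lborel \<partial>lborel)"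
    by (simp only: v)
  also have "\<dots> = (\<integral>\<^sup>+x. \<integral>\<^sup>+s. indicator {p. 0 < snd p \<and> ennreal (snd p) < h (fst p)} (x, s) \<partial>lborel \<partial>lborel)"
    by (intro nn_integral_cong) (auto simp: indicator_def)
  also have "\<dots> = (\<integral>\<^sup>+s. \<integral>\<^sup>+x. indicator {p. 0 < snd p \<and> ennreal (snd p) < h (fst p)} (x, s) \<partial>lborel \<partial>lborel)"
    by (rule lborel_pair.Fubini'[symmetric]) measurable
  also have "\<dots> = (\<integral>\<^sup>+s. \<integral>\<^sup>+x. indicator {0<..} s * indicator {x. ennreal s < h x} x \<partial>lborel \<partial>lborel)"
    by (intro nn_integral_cong) (auto simp: indicator_def)
  also have "\<dots> = (\<integral>\<^sup>+s. indicator {0<..} s * emeasure lborel {x. ennreal s < h x} \<partial>lborel)"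
    by (intro nn_integral_cong) (simp add: nn_integral_cmult)
  finally show ?thesis .
qed

text \<open>One-dimensional Brunn--Minkowski against an interval. Passing to the hulls of
  \<open>A\<close> and \<open>B\<close> only enlarges them, and the lengths of the hulls add up to
  the length of the hull of the sumset; the sumset itself is never measured.\<close>

lemma emeasure_add_le_of_sum_bounded:
  fixes A B :: "real set"
  assumes "A \<noteq> {}" "B \<noteq> {}" "c \<ge> 0" and AB: "\<And>x y. x \<in> A \<Longrightarrow> y \<in> B \<Longrightarrow> \<bar>x + y\<bar> \<le> 2 * c"
  assumes [measurable]: "A \<in> sets lborel" "B \<in> sets lborel"
  shows "emeasure lborel A + emeasure lborel B \<le> ennreal (4 * c)"
proof -
  have bdA: "bdd_above A" "bdd_below A" and bdB: "bdd_above B" "bdd_below B"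
  proof -
    obtain a b where ab: "a \<in> A" "b \<in> B" using assms by blast
    have "\<bar>x\<bar> \<le> 2*c + \<bar>b\<bar>" if "x \<in> A" for x using AB[OF that ab(2)] by linarith
    then show "bdd_above A" "bdd_below A" by (fastforce intro!: bdd_aboveI[of _ "2*c+\<bar>b\<bar>"] bdd_belowI[of _ "-(2*c+\<bar>b\<bar>)"])+
    have "\<bar>x\<bar> \<le> 2*c + \<bar>a\<bar>" if "x \<in> B" for x using AB[OF ab(1) that] by linarith
    then show "bdd_above B" "bdd_below B" by (fastforce intro!: bdd_aboveI[of _ "2*c+\<bar>a\<bar>"] bdd_belowI[of _ "-(2*c+\<bar>a\<bar>)"])+
  qed
  have s: "Sup A + Sup B \<le> 2*c"
  proof -
    have "Sup B \<le> 2*c - x" if "x \<in> A" for x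
      by (rule cSup_least[OF assms(2)]) (use AB[OF that] in fastforce)
    then have "Sup A \<le> 2*c - Sup B" by (intro cSup_least[OF assms(1)]) (smt (verit))
    then show ?thesis by simp
  qed
  have i: "Inf A + Inf B \<ge> -2*c"
  proof -
    have "Inf B \<ge> -2*c - x" if "x \<in> A" for x
      by (rule cInf_greatest[OF assms(2)]) (use AB[OF that] in fastforce)
    then have "Inf A \<ge> -2*c - Inf B" by (intro cInf_greatest[OF assms(1)]) (smt (verit))
    then show ?thesis by simp
  qed
  have A: "Inf A \<le> Sup A" "Inf B \<le> Sup B"
    using cInf_le_cSup bdA bdB assms by blast+
  have "emeasure lborel A \<le> emeasure lborel {Inf A..Sup A}"
    by (rule emeasure_mono) (auto intro!: cInf_lower cSup_upper bdA)
  moreover have "emeasure lborel B \<le> emeasure lborel {Inf B..Sup B}"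
    by (rule emeasure_mono) (auto intro!: cInf_lower cSup_upper bdB)
  ultimately have "emeasure lborel A + emeasure lborel B \<le> ennreal (Sup A - Inf A) + ennreal (Sup B - Inf B)"
    using A by (simp add: add_mono)
  also have "\<dots> = ennreal (Sup A - Inf A + (Sup B - Inf B))" using A by (simp add: ennreal_plus)
  also have "\<dots> \<le> ennreal (4*c)" using s i by (intro ennreal_leI) linarith
  finally show ?thesis .
qed

lemma gauss_kernel_superlevel:
  fixes s :: real assumes "0 < s" "s < 1"
  shows "{x::real. s < exp (- x\<^sup>2 / 2)} = {- sqrt (- 2 * ln s) <..< sqrt (- 2 * ln s)}"
proof -
  have "s < exp (- x\<^sup>2 / 2) \<longleftrightarrow> \<bar>x\<bar> < sqrt (- 2 * ln s)" for x
  proof -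
    have "s < exp (- x\<^sup>2 / 2) \<longleftrightarrow> exp (ln s) < exp (- x\<^sup>2 / 2)" using assms by simp
    also have "\<dots> \<longleftrightarrow> ln s < - x\<^sup>2 / 2" by (rule exp_less_cancel_iff)
    also have "\<dots> \<longleftrightarrow> x\<^sup>2 < - 2 * ln s" by linarith
    also have "\<dots> \<longleftrightarrow> sqrt (x\<^sup>2) < sqrt (- 2 * ln s)" by (rule real_sqrt_less_iff[symmetric])
    finally show ?thesis by simp
  qed
  then show ?thesis by (simp only: abs_less_iff set_eq_iff mem_Collect_eq greaterThanLessThan_iff) linarith
qed

text \<open>Since the two suprema agree, at each level the superlevel sets of \<open>h\<close> and
  \<open>k\<close> are both empty or both non-empty. Brunn--Minkowski breaks down when just one set
  is empty, so this is what allows its use level by level; integrating over the levels gives the sum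
  of the integrals.\<close>

lemma prekopa_leindler_gauss_balanced:
  fixes h k :: "real \<Rightarrow> ennreal"
  assumes [measurable]: "h \<in> borel_measurable borel" "k \<in> borel_measurable borel"
    and hk: "\<And>x y. h x * k y \<le> ennreal (exp (- ((x + y) / 2)\<^sup>2 / 2)) ^ 2"
    and sup: "(SUP x. h x) = (SUP x. k x)"
  shows "(\<integral>\<^sup>+x. h x \<partial>lborel) + (\<integral>\<^sup>+x. k x \<partial>lborel) \<le> 2 * (\<integral>\<^sup>+x. ennreal (exp (- x\<^sup>2 / 2)) \<partial>lborel)"
proof -
  have le: "emeasure lborel {x. ennreal s < h x} + emeasure lborel {x. ennreal s < k x} \<le>
     2 * emeasure lborel {x. ennreal s < ennreal (exp (- x\<^sup>2 / 2))}" if s: "s > 0" for s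
  proof (cases "ennreal s < (SUP x. h x)")
    case False
    then have "{x. ennreal s < h x} = {}" "{x. ennreal s < k x} = {}"
      using sup by (auto simp: not_less) (metis SUP_upper UNIV_I order_trans SUP_le_iff)+
    then show ?thesis by simp
  next
    case True
    then obtain x0 where x0: "ennreal s < h x0" by (auto simp: less_SUP_iff)
    from True have "ennreal s < (SUP x. k x)" using sup by simp
    then obtain y0 where y0: "ennreal s < k y0" by (auto simp: less_SUP_iff)
    have key: "s < exp (- ((x + y) / 2)\<^sup>2 / 2)" if "ennreal s < h x" "ennreal s < k y" for x y
    proof -
      have "ennreal s * ennreal s < h x * k y"
      proof -
        have "0 < h x" "0 < k y" using that by (auto intro: le_less_trans[OF zero_le])
        have "ennreal s * ennreal s < h x * ennreal s"
          using that s by (intro ennreal_mult_strict_right_mono) auto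
        also have "\<dots> \<le> h x * k y" using that by (intro mult_left_mono) auto
        finally show ?thesis .
      qed
      also have "\<dots> \<le> ennreal ((exp (- ((x + y) / 2)\<^sup>2 / 2)) ^ 2)"
        using hk[of x y] by (simp add: ennreal_power)
      finally have "ennreal (s^2) < ennreal ((exp (- ((x + y) / 2)\<^sup>2 / 2)) ^ 2)"
        using s by (simp add: ennreal_mult power2_eq_square)
      then have "s^2 < (exp (- ((x + y) / 2)\<^sup>2 / 2)) ^ 2" by (subst (asm) ennreal_less_iff) auto
      then show ?thesis by (rule power2_less_imp_less) simp
    qed
    have "s < exp (- ((x0 + y0) / 2)\<^sup>2 / 2)" using key x0 y0 by blast
    also have "\<dots> \<le> 1" by simp
    finally have s1: "s < 1" .
    define c where "c = sqrt (- 2 * ln s)"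
    have c0: "c \<ge> 0" unfolding c_def using s s1 by simp
    have "emeasure lborel {x. ennreal s < h x} + emeasure lborel {x. ennreal s < k x} \<le> ennreal (4 * c)"
    proof (rule emeasure_add_le_of_sum_bounded)
      fix x y assume "x \<in> {x. ennreal s < h x}" "y \<in> {x. ennreal s < k x}"
      then have "(x + y) / 2 \<in> {x::real. s < exp (- x\<^sup>2 / 2)}" using key by auto
      then show "\<bar>x + y\<bar> \<le> 2 * c" unfolding gauss_kernel_superlevel[OF s s1] c_def[symmetric] by auto
    qed (use x0 y0 c0 in auto)
    also have "\<dots> = 2 * ennreal (c - - c)" using c0 by (simp flip: ennreal_numeral ennreal_mult)
    also have "ennreal (c - - c) = emeasure lborel {- c <..< c}" using c0 by simp
    also have "{- c <..< c} = {x. ennreal s < ennreal (exp (- x\<^sup>2 / 2))}"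
      using gauss_kernel_superlevel[OF s s1] s by (simp add: c_def ennreal_less_iff)
    finally show ?thesis .
  qed
  have "(\<integral>\<^sup>+x. h x \<partial>lborel) + (\<integral>\<^sup>+x. k x \<partial>lborel) =
    (\<integral>\<^sup>+s. indicator {0<..} s * emeasure lborel {x. ennreal s < h x}
        + indicator {0<..} s * emeasure lborel {x. ennreal s < k x} \<partial>lborel)"
    by (subst (1 2) nn_integral_layer_cake) (auto simp: nn_integral_add)
  also have "\<dots> \<le> (\<integral>\<^sup>+s. 2 * (indicator {0<..} s * emeasure lborel {x. ennreal s < ennreal (exp (- x\<^sup>2 / 2))}) \<partial>lborel)"
    using le by (intro nn_integral_mono) (simp add: indicator_def)
  also have "\<dots> = 2 * (\<integral>\<^sup>+s. (indicator {0<..} s * emeasure lborel {x. ennreal s < ennreal (exp (- x\<^sup>2 / 2))}) \<partial>lborel)"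
    by (subst nn_integral_cmult) auto
  also have "\<dots> = 2 * (\<integral>\<^sup>+x. ennreal (exp (- x\<^sup>2 / 2)) \<partial>lborel)"
    by (subst (2) nn_integral_layer_cake) auto
  finally show ?thesis .
qed

text \<open>Scaling \<open>h\<close> by \<open>c\<close> and \<open>k\<close> by \<open>1/c\<close>
  keeps the product of the integrals and equalises the suprema. The additive bound for the scaled
  pair then becomes multiplicative by AM-GM.\<close>

lemma prekopa_leindler_gauss:
  fixes h k :: "real \<Rightarrow> ennreal"
  assumes [measurable]: "h \<in> borel_measurable borel" "k \<in> borel_measurable borel"
    and hk: "\<And>x y. h x * k y \<le> ennreal (exp (- ((x + y) / 2)\<^sup>2 / 2)) ^ 2"
  shows "(\<integral>\<^sup>+x. h x \<partial>lborel) * (\<integral>\<^sup>+x. k x \<partial>lborel) \<le> (\<integral>\<^sup>+x. ennreal (exp (- x\<^sup>2 / 2)) \<partial>lborel)^2"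
proof -
  let ?M = "SUP x. h x" and ?N = "SUP x. k x" and ?I = "\<integral>\<^sup>+x. ennreal (exp (- x\<^sup>2 / 2)) \<partial>lborel"
  have "?M * ?N \<le> 1"
  proof -
    have "h x * k y \<le> 1" for x y
    proof -
      have "ennreal (exp (- ((x + y) / 2)\<^sup>2 / 2)) ^ 2 \<le> 1 ^ 2" by (intro power_mono) auto
      then show ?thesis using hk[of x y] order_trans by fastforce
    qed
    then show ?thesis
      by (subst SUP_mult_right_ennreal, intro SUP_least, subst SUP_mult_left_ennreal, intro SUP_least) auto
  qed
  show ?thesis
  proof (cases "?M = 0 \<or> ?N = 0")
    case True
    then have "(\<forall>x. h x = 0) \<or> (\<forall>x. k x = 0)" by (metis SUP_upper UNIV_I le_zero_eq)
    then show ?thesis by auto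
  next
    case False
    have fin: "u \<noteq> top" if "u * v \<le> 1" "v \<noteq> 0" for u v :: ennreal
      using that by (auto simp: ennreal_top_mult top_unique)
    \<comment> \<open>A product at most 1 of two non-zero suprema forces both to be finite, so that
      the scaling factor is a real number.\<close>
    have "?M \<noteq> top" using False \<open>?M * ?N \<le> 1\<close> by (intro fin) blast+
    moreover have "?N \<noteq> top" using False \<open>?M * ?N \<le> 1\<close> by (intro fin[of ?N ?M]) (simp_all only: mult.commute, blast)
    ultimately obtain m n where mn: "m > 0" "n > 0" "?M = ennreal m" "?N = ennreal n"
      using False by (metis ennreal_cases ennreal_eq_0_iff less_eq_real_def not_le)
    define c where "c = sqrt (n / m)"
    have c: "c > 0" using mn by (simp add: c_def)
    define h' where "h' x = ennreal c * h x" for x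
    define k' where "k' x = ennreal (1/c) * k x" for x
    have [measurable]: "h' \<in> borel_measurable borel" "k' \<in> borel_measurable borel"
      by (auto simp: h'_def[abs_def] k'_def[abs_def])
    have one: "ennreal c * ennreal (1/c) = 1" using c by (simp flip: ennreal_mult)
    have cm: "c * m = 1/c * n"
    proof -
      have "c * c = n / m" using mn by (simp add: c_def)
      then show ?thesis using c mn by (simp add: field_simps)
    qed
    have bal: "(\<integral>\<^sup>+x. h' x \<partial>lborel) + (\<integral>\<^sup>+x. k' x \<partial>lborel) \<le> 2 * ?I"
    proof (rule prekopa_leindler_gauss_balanced)
      show "h' x * k' y \<le> ennreal (exp (- ((x + y) / 2)\<^sup>2 / 2)) ^ 2" for x y
      proof -
        have "h' x * k' y = (ennreal c * ennreal (1/c)) * (h x * k y)"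
          unfolding h'_def k'_def by (simp only: mult_ac)
        then show ?thesis using hk one by simp
      qed
      have "(SUP x. h' x) = ennreal c * ?M" "(SUP x. k' x) = ennreal (1/c) * ?N"
        unfolding h'_def k'_def by (simp_all add: SUP_mult_left_ennreal)
      then show "(SUP x. h' x) = (SUP x. k' x)" using mn c cm by (simp flip: ennreal_mult)
    qed auto
    have Ifin: "?I < top"
    proof -
      have "?I = (\<integral>\<^sup>+x. ennreal (sqrt (2*pi)) * ennreal (normal_density 0 1 x) \<partial>lborel)"
        by (intro nn_integral_cong) (simp add: normal_density_def flip: ennreal_mult)
      also have "\<dots> = ennreal (sqrt (2*pi)) * 1"
        by (subst nn_integral_cmult) (auto simp: nn_integral_eq_integral)
      finally show ?thesis by simp
    qed
    let ?H = "\<integral>\<^sup>+x. h' x \<partial>lborel" and ?K = "\<integral>\<^sup>+x. k' x \<partial>lborel"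
    have fin: "?H + ?K < top" using bal Ifin by (meson ennreal_mult_less_top ennreal_numeral_less_top order.strict_trans1)
    have ex: "\<exists>r\<ge>0. v = ennreal r" if "v < top" for v :: ennreal
      using that by (cases v) auto
    obtain i where i: "i \<ge> 0" "?I = ennreal i" using ex[OF Ifin] by blast
    obtain p where p: "p \<ge> 0" "?H = ennreal p" using ex[of ?H] fin by auto
    obtain q where q: "q \<ge> 0" "?K = ennreal q" using ex[of ?K] fin by auto
    have "ennreal (p + q) \<le> ennreal (2 * i)" using bal i p q by (simp add: ennreal_mult)
    then have "p + q \<le> 2 * i" using i by (subst (asm) ennreal_le_iff) auto
    moreover have "4 * (p * q) \<le> (p + q)^2" using zero_le_power2[of "p - q"] by (simp add: power2_eq_square algebra_simps)
    moreover have "(p + q)^2 \<le> (2 * i)^2" using p q \<open>p + q \<le> 2 * i\<close> by (intro power_mono) auto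
    ultimately have "p * q \<le> i^2" by (simp add: power2_eq_square)
    then have "?H * ?K \<le> ?I^2" using i p q by (simp add: ennreal_power flip: ennreal_mult)
    moreover have "?H * ?K = (ennreal c * ennreal (1/c)) * ((\<integral>\<^sup>+x. h x \<partial>lborel) * (\<integral>\<^sup>+x. k x \<partial>lborel))"
      unfolding h'_def k'_def by (subst (1 2) nn_integral_cmult) (simp_all add: mult_ac)
    ultimately show ?thesis using one by simp
  qed
qed

section \<open>Property tau: the Gaussian case and tensorization\<close>

lemma gauss_1: "gauss 1 = std_normal_distribution"
  by (simp add: gauss_def)

text \<open>The cost is dictated by the identity
  \<open>- x^2/2 - y^2/2 + (x - y)^2/4 = - ((x + y)/2)^2\<close>: multiplied by the Gaussian kernel,
  \<open>a\<close> and \<open>b\<close> meet the hypothesis of Prekopa--Leindler with the same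
  kernel at the midpoint.\<close>

lemma prop_tau_gauss: "prop_tau (gauss 1) (\<lambda>x y. (x - y)\<^sup>2 / 4)"
  unfolding prop_tau_def
proof (intro ballI impI)
  fix a b :: "real \<Rightarrow> ennreal"
  assume a: "a \<in> borel_measurable (gauss 1)" and b: "b \<in> borel_measurable (gauss 1)"
    and "\<forall>x\<in>space (gauss 1). \<forall>y\<in>space (gauss 1). a x * b y \<le> ennreal (exp ((x - y)\<^sup>2 / 4))"
  then have ab: "a x * b y \<le> ennreal (exp ((x - y)\<^sup>2 / 4))" for x y by (simp add: gauss_1)
  have [measurable]: "a \<in> borel_measurable borel" "b \<in> borel_measurable borel"
    using a b by (simp_all add: gauss_1)
  define \<phi> where "\<phi> x = ennreal (exp (- x\<^sup>2 / 2))" for x :: real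
  have [measurable]: "\<phi> \<in> borel_measurable borel" by (simp add: \<phi>_def[abs_def])
  let ?s = "ennreal (sqrt (2*pi))"
  have nd: "?s * (ennreal (std_normal_density x)) = \<phi> x" for x
    by (simp add: std_normal_density_def \<phi>_def flip: ennreal_mult)
  have I: "(\<integral>\<^sup>+x. \<phi> x * g x \<partial>lborel) = ?s * (\<integral>\<^sup>+x. g x \<partial>gauss 1)"
    if [measurable]: "g \<in> borel_measurable borel" for g
    unfolding gauss_1 by (subst nn_integral_density) (auto simp flip: nn_integral_cmult nd simp: mult_ac)
  have I1: "(\<integral>\<^sup>+x. \<phi> x \<partial>lborel) = ?s"
  proof -
    have "(\<integral>\<^sup>+x. 1 \<partial>gauss 1) = 1" unfolding gauss_1
      using prob_space.emeasure_space_1[OF prob_space_normal_density[of 1 0]] by simp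
    then show ?thesis using I[of "\<lambda>_. 1"] by simp
  qed
  have "(\<integral>\<^sup>+x. \<phi> x * a x \<partial>lborel) * (\<integral>\<^sup>+x. \<phi> x * b x \<partial>lborel) \<le> (\<integral>\<^sup>+x. ennreal (exp (- x\<^sup>2 / 2)) \<partial>lborel)^2"
  proof (rule prekopa_leindler_gauss)
    fix x y :: real
    have "\<phi> x * a x * (\<phi> y * b y) = (\<phi> x * \<phi> y) * (a x * b y)" by (simp only: mult_ac)
    also have "\<dots> \<le> (\<phi> x * \<phi> y) * ennreal (exp ((x - y)\<^sup>2 / 4))" by (intro mult_left_mono ab) auto
    also have "\<dots> = ennreal (exp (- x\<^sup>2 / 2 + - y\<^sup>2 / 2 + (x - y)\<^sup>2 / 4))"
      unfolding \<phi>_def by (simp only: exp_add) (simp add: ennreal_mult)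
    also have "- x\<^sup>2 / 2 + - y\<^sup>2 / 2 + (x - y)\<^sup>2 / 4 = 2 * (- ((x + y) / 2)\<^sup>2 / 2)"
      by (simp add: power2_eq_square field_simps)
    also have "ennreal (exp \<dots>) = ennreal (exp (- ((x + y) / 2)\<^sup>2 / 2)) ^ 2"
      by (simp add: ennreal_power flip: exp_of_nat_mult)
    finally show "\<phi> x * a x * (\<phi> y * b y) \<le> ennreal (exp (- ((x + y) / 2)\<^sup>2 / 2)) ^ 2" .
  qed auto
  then have "?s * (\<integral>\<^sup>+x. a x \<partial>gauss 1) * (?s * (\<integral>\<^sup>+x. b x \<partial>gauss 1)) \<le> ?s^2"
    unfolding \<phi>_def[symmetric] by (simp only: I I1 \<open>a \<in> borel_measurable borel\<close> \<open>b \<in> borel_measurable borel\<close>)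
  then have "?s^2 * ((\<integral>\<^sup>+x. a x \<partial>gauss 1) * (\<integral>\<^sup>+x. b x \<partial>gauss 1)) \<le> ?s^2 * 1"
    by (simp add: power2_eq_square mult_ac)
  then show "(\<integral>\<^sup>+x. a x \<partial>gauss 1) * (\<integral>\<^sup>+x. b x \<partial>gauss 1) \<le> 1"
    using ennreal_mult_le_mult_iff[of "?s^2" _ 1] by (simp add: ennreal_power)
qed

text \<open>Tensorization: with the other coordinates of \<open>x\<close> and \<open>y\<close>
  frozen, property tau in coordinate \<open>i\<close> bounds the product \<open>A x * B y\<close> of
  partial integrals by the exponential of the remaining cost, and that is what the induction
  hypothesis asks for.\<close>

lemma prop_tau_PiM:
  assumes "finite I" and M: "\<And>i. prob_space (M i)" and tau: "\<And>i. i \<in> I \<Longrightarrow> prop_tau (M i) (c i)"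
  shows "prop_tau (PiM I M) (\<lambda>x y. \<Sum>i\<in>I. c i (x i) (y i))"
  using assms(1) tau
proof (induction I)
  case empty
  interpret product_prob_space M by (simp add: product_prob_space_def product_prob_space_axioms_def product_sigma_finite_def M prob_space_imp_sigma_finite)
  show ?case unfolding prop_tau_def
    by (simp add: PiM_empty nn_integral_count_space_finite)
next
  case (insert i I)
  interpret product_prob_space M by (simp add: product_prob_space_def product_prob_space_axioms_def product_sigma_finite_def M prob_space_imp_sigma_finite)
  show ?case unfolding prop_tau_def
  proof (intro ballI impI)
    fix a b :: "('a \<Rightarrow> 'b) \<Rightarrow> ennreal"
    assume a[measurable]: "a \<in> borel_measurable (PiM (insert i I) M)" and b[measurable]: "b \<in> borel_measurable (PiM (insert i I) M)"
      and ab: "\<forall>x\<in>space (PiM (insert i I) M). \<forall>y\<in>space (PiM (insert i I) M).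
            a x * b y \<le> ennreal (exp (\<Sum>j\<in>insert i I. c j (x j) (y j)))"
    define A where "A x = (\<integral>\<^sup>+u. a (x(i := u)) \<partial>M i)" for x
    define B where "B x = (\<integral>\<^sup>+u. b (x(i := u)) \<partial>M i)" for x
    have A[measurable]: "A \<in> borel_measurable (PiM I M)"
      unfolding A_def[abs_def]
      by (rule M.borel_measurable_nn_integral)
        (use measurable_compose[OF measurable_add_dim[of i I M] a] in \<open>simp add: split_beta'\<close>)
    have B[measurable]: "B \<in> borel_measurable (PiM I M)"
      unfolding B_def[abs_def]
      by (rule M.borel_measurable_nn_integral)
        (use measurable_compose[OF measurable_add_dim[of i I M] b] in \<open>simp add: split_beta'\<close>)
    have sp: "x(i := u) \<in> space (PiM (insert i I) M)" if "x \<in> space (PiM I M)" "u \<in> space (M i)" for x u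
      using that by (auto simp: space_PiM PiE_iff extensional_def)
    have AB: "A x * B y \<le> ennreal (exp (\<Sum>j\<in>I. c j (x j) (y j)))"
      if x: "x \<in> space (PiM I M)" and y: "y \<in> space (PiM I M)" for x y
    proof -
      let ?s = "\<Sum>j\<in>I. c j (x j) (y j)"
      have [measurable]: "(\<lambda>u. a (x(i := u))) \<in> borel_measurable (M i)" "(\<lambda>u. b (y(i := u))) \<in> borel_measurable (M i)"
        using measurable_compose[OF measurable_component_update[OF x \<open>i \<notin> I\<close>] a]
          measurable_compose[OF measurable_component_update[OF y \<open>i \<notin> I\<close>] b] by auto
      have "(\<integral>\<^sup>+u. a (x(i := u)) \<partial>M i) * (\<integral>\<^sup>+u. ennreal (exp (- ?s)) * b (y(i := u)) \<partial>M i) \<le> 1"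
      proof (rule insert.prems[of i, unfolded prop_tau_def, rule_format])
        fix u v assume "u \<in> space (M i)" "v \<in> space (M i)"
        then have "a (x(i := u)) * b (y(i := v)) \<le> ennreal (exp (\<Sum>j\<in>insert i I. c j ((x(i := u)) j) ((y(i := v)) j)))"
          using ab sp x y by blast
        also have "(\<Sum>j\<in>insert i I. c j ((x(i := u)) j) ((y(i := v)) j)) = c i u v + ?s"
        proof -
          have "(\<Sum>j\<in>I. c j ((x(i := u)) j) ((y(i := v)) j)) = ?s"
            using insert.hyps by (intro sum.cong) auto
          then show ?thesis using insert.hyps by (simp add: sum.insert)
        qed
        finally have le: "a (x(i := u)) * b (y(i := v)) \<le> ennreal (exp (c i u v + ?s))" .
        have "ennreal (exp (- ?s)) * (a (x(i := u)) * b (y(i := v))) \<le> ennreal (exp (- ?s)) * ennreal (exp (c i u v + ?s))"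
          by (intro mult_left_mono le) auto
        also have "\<dots> = ennreal (exp (c i u v))" by (simp flip: ennreal_mult exp_add)
        finally show "a (x(i := u)) * (ennreal (exp (- ?s)) * b (y(i := v))) \<le> ennreal (exp (c i u v))"
          by (simp only: mult_ac)
      qed auto
      then have "ennreal (exp (- ?s)) * (A x * B y) \<le> 1"
        unfolding A_def B_def by (subst (asm) nn_integral_cmult) (auto simp: mult_ac)
      then have "ennreal (exp ?s) * (ennreal (exp (- ?s)) * (A x * B y)) \<le> ennreal (exp ?s) * 1"
        by (intro mult_left_mono) auto
      then show ?thesis by (simp flip: mult.assoc ennreal_mult exp_add)
    qed
    have "(\<integral>\<^sup>+x. A x \<partial>PiM I M) * (\<integral>\<^sup>+x. B x \<partial>PiM I M) \<le> 1"
      using insert.IH insert.prems AB unfolding prop_tau_def by (auto simp: A B)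
    then show "(\<integral>\<^sup>+x. a x \<partial>PiM (insert i I) M) * (\<integral>\<^sup>+x. b x \<partial>PiM (insert i I) M) \<le> 1"
      unfolding A_def B_def using insert.hyps by (subst (1 2) product_nn_integral_insert) auto
  qed
qed

section \<open>Concentration of Lipschitz functions under property tau\<close>

lemma exp_sum_bounds:
  fixes u :: real
  shows "u\<^sup>2 \<le> 2 * (exp u + exp (- u))" "\<bar>u\<bar> \<le> exp u + exp (- u)"
proof -
  define v where "v = \<bar>u\<bar>"
  have "exp v \<le> exp u + exp (- u)" by (cases "u \<ge> 0") (auto simp: v_def)
  moreover have "1 + v + v\<^sup>2 / 2 \<le> exp v" by (rule exp_lower_Taylor_quadratic) (simp add: v_def)
  moreover have "v \<ge> 0" "v\<^sup>2 \<ge> 0" by (simp_all add: v_def)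
  ultimately have "v\<^sup>2 \<le> 2 * (exp u + exp (- u))" "v \<le> exp u + exp (- u)" by argo+
  then show "u\<^sup>2 \<le> 2 * (exp u + exp (- u))" "\<bar>u\<bar> \<le> exp u + exp (- u)" by (simp_all add: v_def)
qed

text \<open>\<open>D\<close> is to be read as a squared distance; dividing it by 4 gives the cost
  found for the Gaussian.\<close>

locale tau_space = prob_space M for M :: "'a measure" +
  fixes D :: "'a \<Rightarrow> 'a \<Rightarrow> real"
  assumes tau: "prop_tau M (\<lambda>x y. D x y / 4)"
begin

text \<open>Young's inequality \<open>l * d \<le> l^2 * K^2 + d^2 / (4 * K^2)\<close> for
  \<open>d = \<phi> x - \<phi> y\<close> makes \<open>exp (l * \<phi> - l^2 * K^2)\<close> and
  \<open>exp (- l * \<phi>)\<close> an admissible pair. The bound lives in \<open>ennreal\<close>,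
  so no integrability of \<phi> is presupposed.\<close>

lemma lipschitz_exp_product:
  assumes [measurable]: "\<phi> \<in> borel_measurable M" and K: "K > 0"
    and lip: "\<And>x y. x \<in> space M \<Longrightarrow> y \<in> space M \<Longrightarrow> (\<phi> x - \<phi> y)\<^sup>2 \<le> K\<^sup>2 * D x y"
  shows "(\<integral>\<^sup>+x. ennreal (exp (l * \<phi> x)) \<partial>M) * (\<integral>\<^sup>+x. ennreal (exp (- l * \<phi> x)) \<partial>M) \<le> ennreal (exp (l\<^sup>2 * K\<^sup>2))"
proof -
  have "(\<integral>\<^sup>+x. ennreal (exp (l * \<phi> x - l\<^sup>2 * K\<^sup>2)) \<partial>M) * (\<integral>\<^sup>+x. ennreal (exp (- l * \<phi> x)) \<partial>M) \<le> 1"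
  proof (rule tau[unfolded prop_tau_def, rule_format])
    fix x y assume xy: "x \<in> space M" "y \<in> space M"
    define d where "d = \<phi> x - \<phi> y"
    have "4 * K\<^sup>2 * (l * d) \<le> (2 * K\<^sup>2 * l)\<^sup>2 + d\<^sup>2"
      using zero_le_power2[of "2 * K\<^sup>2 * l - d"] by (simp add: power2_eq_square algebra_simps)
    also have "\<dots> \<le> (2 * K\<^sup>2 * l)\<^sup>2 + K\<^sup>2 * D x y" using lip[OF xy] by (simp add: d_def)
    also have "\<dots> = 4 * K\<^sup>2 * (l\<^sup>2 * K\<^sup>2 + D x y / 4)" by (simp add: power2_eq_square algebra_simps)
    finally have "l * d \<le> l\<^sup>2 * K\<^sup>2 + D x y / 4" using K by (subst (asm) mult_le_cancel_left_pos) auto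
    then have "l * \<phi> x - l\<^sup>2 * K\<^sup>2 + - l * \<phi> y \<le> D x y / 4" by (simp add: d_def algebra_simps)
    then show "ennreal (exp (l * \<phi> x - l\<^sup>2 * K\<^sup>2)) * ennreal (exp (- l * \<phi> y)) \<le> ennreal (exp (D x y / 4))"
      by (simp flip: ennreal_mult exp_add)
  qed auto
  note le1 = this
  have eq: "ennreal (exp (l\<^sup>2 * K\<^sup>2)) * ennreal (exp (l * \<phi> x - l\<^sup>2 * K\<^sup>2)) = ennreal (exp (l * \<phi> x))" for x
  proof -
    have "exp (l\<^sup>2 * K\<^sup>2) * exp (l * \<phi> x - l\<^sup>2 * K\<^sup>2) = exp (l * \<phi> x)" by (simp flip: exp_add)
    then show ?thesis by (simp flip: ennreal_mult)
  qed
  have "(\<integral>\<^sup>+x. ennreal (exp (l * \<phi> x)) \<partial>M) =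
      ennreal (exp (l\<^sup>2 * K\<^sup>2)) * (\<integral>\<^sup>+x. ennreal (exp (l * \<phi> x - l\<^sup>2 * K\<^sup>2)) \<partial>M)"
    unfolding eq[symmetric] by (rule nn_integral_cmult) simp
  then show ?thesis
    using mult_left_mono[OF le1, of "ennreal (exp (l\<^sup>2 * K\<^sup>2))"] by (simp only: mult.assoc mult_1_right zero_le)
qed

text \<open>The product bound yields finiteness directly: the factor with \<open>- l\<close> is not
  0, hence the factor with \<open>l\<close> cannot be infinite. No truncation of \<phi> is
  involved.\<close>

lemma lipschitz_exp_integrable:
  assumes [measurable]: "\<phi> \<in> borel_measurable M" and K: "K > 0"
    and lip: "\<And>x y. x \<in> space M \<Longrightarrow> y \<in> space M \<Longrightarrow> (\<phi> x - \<phi> y)\<^sup>2 \<le> K\<^sup>2 * D x y"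
  shows "integrable M (\<lambda>x. exp (l * \<phi> x))"
proof (rule integrableI_nonneg)
  let ?E = "\<lambda>l. \<integral>\<^sup>+x. ennreal (exp (l * \<phi> x)) \<partial>M"
  have "?E (- l) \<noteq> 0"
  proof
    assume "?E (- l) = 0"
    then have "AE x in M. ennreal (exp (- l * \<phi> x)) = 0" by (subst (asm) nn_integral_0_iff_AE) auto
    then have "AE x in M. False" by eventually_elim (simp add: ennreal_eq_0_iff not_le)
    then show False by (simp add: AE_False)
  qed
  moreover have "?E l * ?E (- l) \<noteq> top"
    using lipschitz_exp_product[OF assms, of l] by (metis ennreal_less_top not_le top.not_eq_extremum order_le_less_trans less_irrefl)
  ultimately show "?E l < \<infinity>"
    using ennreal_mult_less_top[of "?E l" "?E (- l)"] by (auto simp: less_top[symmetric])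
qed auto

lemma lipschitz_integrable:
  assumes [measurable]: "\<phi> \<in> borel_measurable M" and K: "K > 0"
    and lip: "\<And>x y. x \<in> space M \<Longrightarrow> y \<in> space M \<Longrightarrow> (\<phi> x - \<phi> y)\<^sup>2 \<le> K\<^sup>2 * D x y"
  shows "integrable M \<phi>" "integrable M (\<lambda>x. (\<phi> x)\<^sup>2)"
proof -
  have i: "integrable M (\<lambda>x. exp (l * \<phi> x))" for l by (rule lipschitz_exp_integrable[OF assms])
  have i2: "integrable M (\<lambda>x. exp (\<phi> x) + exp (- \<phi> x))" using i[of 1] i[of "-1"] by simp
  show "integrable M \<phi>" by (rule Bochner_Integration.integrable_bound[OF i2]) (use exp_sum_bounds in auto)
  have "integrable M (\<lambda>x. 2 * (exp (\<phi> x) + exp (- \<phi> x)))" by (rule integrable_mult_right[OF i2])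
  then show "integrable M (\<lambda>x. (\<phi> x)\<^sup>2)" by (rule Bochner_Integration.integrable_bound) (use exp_sum_bounds in auto)
qed

lemma lipschitz_mgf:
  assumes [measurable]: "\<phi> \<in> borel_measurable M" and K: "K > 0"
    and lip: "\<And>x y. x \<in> space M \<Longrightarrow> y \<in> space M \<Longrightarrow> (\<phi> x - \<phi> y)\<^sup>2 \<le> K\<^sup>2 * D x y"
  shows "integrable M (\<lambda>x. exp (l * (\<phi> x - expectation \<phi>)))"
    and "expectation (\<lambda>x. exp (l * (\<phi> x - expectation \<phi>))) \<le> exp (l\<^sup>2 * K\<^sup>2)"
proof -
  define \<psi> where "\<psi> x = \<phi> x - expectation \<phi>" for x
  have [measurable]: "\<psi> \<in> borel_measurable M" by (simp add: \<psi>_def[abs_def])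
  have lip': "(\<psi> x - \<psi> y)\<^sup>2 \<le> K\<^sup>2 * D x y" if "x \<in> space M" "y \<in> space M" for x y
    using lip[OF that] by (simp add: \<psi>_def)
  have i: "integrable M (\<lambda>x. exp (l * \<psi> x))" for l by (rule lipschitz_exp_integrable[OF _ K lip']) auto
  then show "integrable M (\<lambda>x. exp (l * (\<phi> x - expectation \<phi>)))" by (simp add: \<psi>_def)
  have int: "integrable M \<psi>" by (rule lipschitz_integrable[OF _ K lip']) auto
  have E0: "expectation \<psi> = 0"
    unfolding \<psi>_def using lipschitz_integrable(1)[OF assms] by (simp add: prob_space)
  have "expectation (\<lambda>x. 1 + - l * \<psi> x) \<le> expectation (\<lambda>x. exp (- l * \<psi> x))"
  proof (rule integral_mono)
    show "integrable M (\<lambda>x. 1 + - l * \<psi> x)" using int by simp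
    show "1 + - l * \<psi> x \<le> exp (- l * \<psi> x)" for x by (rule exp_ge_add_one_self)
  qed (rule i)
  then have ge1: "1 \<le> expectation (\<lambda>x. exp (- l * \<psi> x))" using E0 int by (simp add: prob_space)
  have "ennreal (expectation (\<lambda>x. exp (l * \<psi> x)) * expectation (\<lambda>x. exp (- l * \<psi> x))) \<le> ennreal (exp (l\<^sup>2 * K\<^sup>2))"
    using lipschitz_exp_product[OF _ K lip', of l] i[of l] i[of "- l"]
    by (simp add: nn_integral_eq_integral ennreal_mult)
  then have le: "expectation (\<lambda>x. exp (l * \<psi> x)) * expectation (\<lambda>x. exp (- l * \<psi> x)) \<le> exp (l\<^sup>2 * K\<^sup>2)"
    by (subst (asm) ennreal_le_iff) auto
  have "expectation (\<lambda>x. exp (l * \<psi> x)) * 1 \<le> expectation (\<lambda>x. exp (l * \<psi> x)) * expectation (\<lambda>x. exp (- l * \<psi> x))"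
    by (intro mult_left_mono ge1 integral_nonneg_AE) auto
  with le show "expectation (\<lambda>x. exp (l * (\<phi> x - expectation \<phi>))) \<le> exp (l\<^sup>2 * K\<^sup>2)"
    by (simp add: \<psi>_def)
qed

lemma lipschitz_upper_tail:
  assumes [measurable]: "\<phi> \<in> borel_measurable M" and K: "K > 0"
    and lip: "\<And>x y. x \<in> space M \<Longrightarrow> y \<in> space M \<Longrightarrow> (\<phi> x - \<phi> y)\<^sup>2 \<le> K\<^sup>2 * D x y" and s: "s \<ge> 0"
  shows "prob {x\<in>space M. \<phi> x - expectation \<phi> \<ge> s} \<le> exp (- s\<^sup>2 / (4 * K\<^sup>2))"
proof -
  \<comment> \<open>The minimiser of the Chernoff exponent \<open>l^2 * K^2 - l * s\<close>.\<close>
  define l where "l = s / (2 * K\<^sup>2)"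
  have l: "l \<ge> 0" using s by (simp add: l_def)
  have "prob {x\<in>space M. \<phi> x - expectation \<phi> \<ge> s} \<le> prob {x\<in>space M. exp (l * (\<phi> x - expectation \<phi>)) \<ge> exp (l * s)}"
    using l by (intro finite_measure_mono) (auto intro: mult_left_mono)
  also have "\<dots> \<le> expectation (\<lambda>x. exp (l * (\<phi> x - expectation \<phi>))) / exp (l * s)"
    using integral_Markov_inequality_measure[OF lipschitz_mgf(1)[OF assms(1-3)], where A="{}" and c="exp (l * s)"] by simp
  also have "\<dots> \<le> exp (l\<^sup>2 * K\<^sup>2) / exp (l * s)"
    by (intro divide_right_mono lipschitz_mgf(2)[OF assms(1-3)]) auto
  also have "\<dots> = exp (l\<^sup>2 * K\<^sup>2 - l * s)" by (simp add: exp_diff)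
  also have "l\<^sup>2 * K\<^sup>2 - l * s = - s\<^sup>2 / (4 * K\<^sup>2)" using K by (simp add: l_def field_simps power2_eq_square)
  finally show ?thesis .
qed

lemma lipschitz_tail:
  assumes [measurable]: "\<phi> \<in> borel_measurable M" and K: "K > 0"
    and lip: "\<And>x y. x \<in> space M \<Longrightarrow> y \<in> space M \<Longrightarrow> (\<phi> x - \<phi> y)\<^sup>2 \<le> K\<^sup>2 * D x y" and s: "s \<ge> 0"
  shows "prob {x\<in>space M. \<bar>\<phi> x - expectation \<phi>\<bar> \<ge> s} \<le> 2 * exp (- s\<^sup>2 / (4 * K\<^sup>2))"
proof -
  have 1: "prob {x\<in>space M. \<phi> x - expectation \<phi> \<ge> s} \<le> exp (- s\<^sup>2 / (4 * K\<^sup>2))"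
    by (rule lipschitz_upper_tail[OF assms])
  have "prob {x\<in>space M. - \<phi> x - expectation (\<lambda>x. - \<phi> x) \<ge> s} \<le> exp (- s\<^sup>2 / (4 * K\<^sup>2))"
    by (rule lipschitz_upper_tail) (use K s lip in \<open>auto simp: power2_commute\<close>)
  then have 2: "prob {x\<in>space M. expectation \<phi> - \<phi> x \<ge> s} \<le> exp (- s\<^sup>2 / (4 * K\<^sup>2))" by simp
  have "prob {x\<in>space M. \<bar>\<phi> x - expectation \<phi>\<bar> \<ge> s} \<le>
      prob ({x\<in>space M. \<phi> x - expectation \<phi> \<ge> s} \<union> {x\<in>space M. expectation \<phi> - \<phi> x \<ge> s})"
    by (intro finite_measure_mono) auto
  also have "\<dots> \<le> prob {x\<in>space M. \<phi> x - expectation \<phi> \<ge> s} + prob {x\<in>space M. expectation \<phi> - \<phi> x \<ge> s}"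
    by (rule measure_Un_le) auto
  finally show ?thesis using 1 2 by simp
qed

lemma lipschitz_variance:
  assumes [measurable]: "\<phi> \<in> borel_measurable M" and K: "K > 0"
    and lip: "\<And>x y. x \<in> space M \<Longrightarrow> y \<in> space M \<Longrightarrow> (\<phi> x - \<phi> y)\<^sup>2 \<le> K\<^sup>2 * D x y"
  shows "variance \<phi> \<le> 12 * K\<^sup>2"
proof -
  let ?\<psi> = "\<lambda>x. \<phi> x - expectation \<phi>"
  note m = lipschitz_mgf[OF assms]
  have i2: "integrable M (\<lambda>x. (?\<psi> x)\<^sup>2)"
    by (rule lipschitz_integrable(2)[OF _ K]) (use lip in auto)
  \<comment> \<open>Exponential moments are taken at \<open>1/K\<close> and \<open>- 1/K\<close>,
    where each is at most \<open>exp 1 \<le> 3\<close>; hence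
    \<open>2 * (3 + 3) = 12\<close>.\<close>
  have "(\<integral>x. (?\<psi> x)\<^sup>2 / K\<^sup>2 \<partial>M) \<le> (\<integral>x. 2 * (exp (1/K * ?\<psi> x) + exp (- (1/K) * ?\<psi> x)) \<partial>M)"
  proof (rule integral_mono)
    show "integrable M (\<lambda>x. 2 * (exp (1/K * ?\<psi> x) + exp (- (1/K) * ?\<psi> x)))"
      by (intro integrable_mult_right Bochner_Integration.integrable_add m)
    show "(?\<psi> x)\<^sup>2 / K\<^sup>2 \<le> 2 * (exp (1/K * ?\<psi> x) + exp (- (1/K) * ?\<psi> x))" for x
      using exp_sum_bounds(1)[of "1/K * ?\<psi> x"] by (simp add: power_mult_distrib power_divide field_simps)
  qed (use i2 in simp)
  also have "\<dots> = 2 * ((\<integral>x. exp (1/K * ?\<psi> x) \<partial>M) + (\<integral>x. exp (- (1/K) * ?\<psi> x) \<partial>M))"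
    using Bochner_Integration.integral_add[OF m(1)[of "1/K"] m(1)[of "- (1/K)"]] by (subst integral_mult_right_zero) (rule arg_cong)
  also have "\<dots> \<le> 2 * (exp 1 + exp 1)"
    using m(2)[of "1/K"] m(2)[of "- (1/K)"] K by (intro mult_left_mono add_mono) (auto simp: power_divide)
  also have "\<dots> \<le> 12" using exp_le by simp
  finally show ?thesis using K i2 by (simp add: field_simps)
qed


text \<open>With \<phi> the norm, \<mu> its mean and \<open>t = \<phi> - \<mu>\<close>, the
  deviation of the square is \<open>t^2 + 2 * \<mu> * t\<close> minus the variance. Since
  \<open>\<mu> \<le> d * sqrt n\<close>, the cross term has order \<open>sqrt (n * r)\<close>; the
  assumption \<open>r \<le> n\<close> brings the square, and \<open>1/2 \<le> r\<close> the
  variance, below that order.\<close>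

lemma lipschitz_sq_norm_tail:
  assumes [measurable]: "\<And>i. i < n \<Longrightarrow> (\<lambda>x. V x i) \<in> borel_measurable M" and K: "K > 0"
    and lip: "\<And>x y. x \<in> space M \<Longrightarrow> y \<in> space M \<Longrightarrow> (vnorm n (\<lambda>i. V x i - V y i))\<^sup>2 \<le> K\<^sup>2 * D x y"
    and d: "d \<ge> 0" "expectation (\<lambda>x. (vnorm n (V x))\<^sup>2) \<le> d\<^sup>2 * n"
    and r: "1/2 \<le> r" "r \<le> n" and \<rho>: "\<rho> \<ge> 0"
  shows "integrable M (\<lambda>x. (vnorm n (V x))\<^sup>2)"
    and "prob {x\<in>space M. \<bar>(vnorm n (V x))\<^sup>2 - expectation (\<lambda>x. (vnorm n (V x))\<^sup>2)\<bar>
          > (4 * \<rho> * K\<^sup>2 + 4 * d * K * sqrt \<rho> + 24 * K\<^sup>2) * sqrt (n * r)} \<le> 2 * exp (- \<rho> * r)"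
proof -
  let ?\<phi> = "\<lambda>x. vnorm n (V x)"
  have meas[measurable]: "?\<phi> \<in> borel_measurable M" unfolding vnorm_def by measurable
  have lip': "(?\<phi> x - ?\<phi> y)\<^sup>2 \<le> K\<^sup>2 * D x y" if "x \<in> space M" "y \<in> space M" for x y
  proof -
    have tri: "vnorm n a \<le> vnorm n b + vnorm n (\<lambda>i. a i - b i)" for a b :: "nat \<Rightarrow> real"
      using L2_set_triangle_ineq[of b "\<lambda>i. a i - b i" "{..<n}"] by (simp add: vnorm_def L2_set_def)
    have "vnorm n (\<lambda>i. V y i - V x i) = vnorm n (\<lambda>i. V x i - V y i)"
      by (simp add: vnorm_def power2_commute)
    then have "\<bar>?\<phi> x - ?\<phi> y\<bar> \<le> vnorm n (\<lambda>i. V x i - V y i)"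
      using tri[of "V x" "V y"] tri[of "V y" "V x"] by linarith
    then have "(?\<phi> x - ?\<phi> y)\<^sup>2 \<le> (vnorm n (\<lambda>i. V x i - V y i))\<^sup>2"
      by (metis abs_ge_zero power2_abs power_mono)
    then show ?thesis using lip[OF that] by simp
  qed
  note a = meas K lip'
  show i2: "integrable M (\<lambda>x. (?\<phi> x)\<^sup>2)" by (rule lipschitz_integrable(2)[OF a])
  define \<mu> where "\<mu> = expectation ?\<phi>"
  define E where "E = expectation (\<lambda>x. (?\<phi> x)\<^sup>2)"
  have var: "variance ?\<phi> = E - \<mu>\<^sup>2" unfolding E_def \<mu>_def
    by (rule variance_eq[OF lipschitz_integrable(1)[OF a] i2])
  have v: "0 \<le> E - \<mu>\<^sup>2" "E - \<mu>\<^sup>2 \<le> 12 * K\<^sup>2"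
    using var lipschitz_variance[OF a] variance_positive[of ?\<phi>] by auto
  have \<mu>0: "\<mu> \<ge> 0" unfolding \<mu>_def by (rule integral_nonneg_AE) (simp add: vnorm_def sum_nonneg)
  have n: "real n > 0" using r by linarith
  have \<mu>: "\<mu> \<le> d * sqrt n"
  proof (rule power2_le_imp_le)
    show "\<mu>\<^sup>2 \<le> (d * sqrt n)\<^sup>2" using v d by (simp add: E_def power_mult_distrib)
  qed (use d in simp)
  \<comment> \<open>Chosen so that the exponent \<open>s^2 / (4 * K^2)\<close> of the tail bound is
    \<open>\<rho> * r\<close>.\<close>
  define s where "s = 2 * K * sqrt (\<rho> * r)"
  have s0: "s \<ge> 0" using K \<rho> r by (simp add: s_def)
  have s2: "s\<^sup>2 = 4 * \<rho> * K\<^sup>2 * r" using K \<rho> r by (simp add: s_def power_mult_distrib)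
  have rn: "r \<le> sqrt (n * r)"
    using r by (intro real_le_rsqrt) (simp add: power2_eq_square mult_right_mono)
  have imp: "\<bar>(?\<phi> x)\<^sup>2 - E\<bar> \<le> (4 * \<rho> * K\<^sup>2 + 4 * d * K * sqrt \<rho> + 24 * K\<^sup>2) * sqrt (n * r)"
    if "\<bar>?\<phi> x - \<mu>\<bar> < s" for x
  proof -
    define t where "t = ?\<phi> x - \<mu>"
    have t: "\<bar>t\<bar> \<le> s" using that by (simp add: t_def)
    have "(?\<phi> x)\<^sup>2 - E = t\<^sup>2 + 2 * \<mu> * t - (E - \<mu>\<^sup>2)" by (simp add: t_def power2_eq_square algebra_simps)
    then have "\<bar>(?\<phi> x)\<^sup>2 - E\<bar> \<le> \<bar>t\<^sup>2 + 2 * \<mu> * t\<bar> + 12 * K\<^sup>2" using v by linarith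
    also have "\<bar>t\<^sup>2 + 2 * \<mu> * t\<bar> \<le> \<bar>t\<^sup>2\<bar> + \<bar>2 * \<mu> * t\<bar>" by (rule abs_triangle_ineq)
    also have "\<bar>t\<^sup>2\<bar> \<le> s\<^sup>2" using t s0 by (simp add: power2_le_iff_abs_le)
    also have "\<bar>2 * \<mu> * t\<bar> \<le> 2 * (d * sqrt n) * s"
      using t s0 \<mu> \<mu>0 d unfolding abs_mult by (intro mult_mono) auto
    also have "2 * (d * sqrt n) * s = 4 * d * K * sqrt \<rho> * sqrt (n * r)"
      by (simp add: s_def real_sqrt_mult)
    also have "s\<^sup>2 \<le> 4 * \<rho> * K\<^sup>2 * sqrt (n * r)" unfolding s2 using \<rho> K rn by (intro mult_left_mono) auto
    also have "12 * K\<^sup>2 \<le> 24 * K\<^sup>2 * sqrt (n * r)"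
    proof -
      have "12 * K\<^sup>2 * 1 \<le> 12 * K\<^sup>2 * (2 * sqrt (n * r))" using rn r by (intro mult_left_mono) auto
      then show ?thesis by simp
    qed
    finally show ?thesis by (simp add: algebra_simps)
  qed
  have "prob {x\<in>space M. \<bar>(?\<phi> x)\<^sup>2 - E\<bar> > (4 * \<rho> * K\<^sup>2 + 4 * d * K * sqrt \<rho> + 24 * K\<^sup>2) * sqrt (n * r)}
      \<le> prob {x\<in>space M. \<bar>?\<phi> x - \<mu>\<bar> \<ge> s}"
    by (intro finite_measure_mono) (use imp in \<open>force simp: not_less[symmetric]\<close>, measurable)
  also have "\<dots> \<le> 2 * exp (- s\<^sup>2 / (4 * K\<^sup>2))" unfolding \<mu>_def by (rule lipschitz_tail[OF a s0])
  also have "- s\<^sup>2 / (4 * K\<^sup>2) = - \<rho> * r" unfolding s2 using K by simp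
  finally show "prob {x\<in>space M. \<bar>(?\<phi> x)\<^sup>2 - expectation (\<lambda>x. (?\<phi> x)\<^sup>2)\<bar>
          > (4 * \<rho> * K\<^sup>2 + 4 * d * K * sqrt \<rho> + 24 * K\<^sup>2) * sqrt (n * r)} \<le> 2 * exp (- \<rho> * r)"
    unfolding E_def .
qed

text \<open>Polarisation: \<open>V + W\<close> and \<open>V - W\<close> are
  \<open>2 * K\<close>-Lipschitz with second moments at most \<open>(2 * d)^2 * n\<close>, and the
  inner product is a quarter of the difference of their squared norms. Two deviations of size
  \<open>c\<close> thus give \<open>c / 2\<close>, and the two tails add up to the factor 4.\<close>

lemma lipschitz_inner_tail:
  assumes V[measurable]: "\<And>i. i < n \<Longrightarrow> (\<lambda>x. V x i) \<in> borel_measurable M" and W[measurable]: "\<And>i. i < n \<Longrightarrow> (\<lambda>x. W x i) \<in> borel_measurable M" and K: "K > 0"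
    and lipV: "\<And>x y. x \<in> space M \<Longrightarrow> y \<in> space M \<Longrightarrow> (vnorm n (\<lambda>i. V x i - V y i))\<^sup>2 \<le> K\<^sup>2 * D x y"
    and lipW: "\<And>x y. x \<in> space M \<Longrightarrow> y \<in> space M \<Longrightarrow> (vnorm n (\<lambda>i. W x i - W y i))\<^sup>2 \<le> K\<^sup>2 * D x y"
    and d: "d \<ge> 0" "expectation (\<lambda>x. (vnorm n (V x))\<^sup>2) \<le> d\<^sup>2 * n" "expectation (\<lambda>x. (vnorm n (W x))\<^sup>2) \<le> d\<^sup>2 * n"
    and r: "1/2 \<le> r" "r \<le> n" and \<rho>: "\<rho> \<ge> 0"
  shows "integrable M (\<lambda>x. vinner n (V x) (W x))" (is ?int)
    and "prob {x\<in>space M. \<bar>vinner n (V x) (W x) - expectation (\<lambda>x. vinner n (V x) (W x))\<bar>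
          > (8 * \<rho> * K\<^sup>2 + 8 * d * K * sqrt \<rho> + 48 * K\<^sup>2) * sqrt (n * r)} \<le> 4 * exp (- \<rho> * r)" (is ?tail)
proof -
  define P where "P x i = V x i + W x i" for x i
  define Q where "Q x i = V x i - W x i" for x i
  have K2: "2 * K > 0" using K by simp
  have [measurable]: "(\<lambda>x. P x i) \<in> borel_measurable M" "(\<lambda>x. Q x i) \<in> borel_measurable M" if "i < n" for i
    using V[OF that] W[OF that] by (auto simp: P_def Q_def)
  have sq: "(vnorm n a)\<^sup>2 = (\<Sum>i<n. (a i)\<^sup>2)" for a by (simp add: vnorm_def sum_nonneg)
  have par: "(vnorm n (\<lambda>i. a i + b i))\<^sup>2 \<le> 2 * (vnorm n a)\<^sup>2 + 2 * (vnorm n b)\<^sup>2"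
    "(vnorm n (\<lambda>i. a i - b i))\<^sup>2 \<le> 2 * (vnorm n a)\<^sup>2 + 2 * (vnorm n b)\<^sup>2" for a b
  proof -
    have "(u + v)\<^sup>2 \<le> 2 * u\<^sup>2 + 2 * v\<^sup>2" "(u - v)\<^sup>2 \<le> 2 * u\<^sup>2 + 2 * v\<^sup>2" for u v :: real
      using zero_le_power2[of "u - v"] zero_le_power2[of "u + v"] by (simp_all add: power2_eq_square algebra_simps)
    then show "(vnorm n (\<lambda>i. a i + b i))\<^sup>2 \<le> 2 * (vnorm n a)\<^sup>2 + 2 * (vnorm n b)\<^sup>2"
      "(vnorm n (\<lambda>i. a i - b i))\<^sup>2 \<le> 2 * (vnorm n a)\<^sup>2 + 2 * (vnorm n b)\<^sup>2"
      unfolding sq by (simp_all add: sum_distrib_left sum_mono flip: sum.distrib)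
  qed
  have lP: "(vnorm n (\<lambda>i. P x i - P y i))\<^sup>2 \<le> (2 * K)\<^sup>2 * D x y" if "x \<in> space M" "y \<in> space M" for x y
    using par(1)[of "\<lambda>i. V x i - V y i" "\<lambda>i. W x i - W y i"] lipV[OF that] lipW[OF that]
    by (simp add: P_def algebra_simps)
  have lQ: "(vnorm n (\<lambda>i. Q x i - Q y i))\<^sup>2 \<le> (2 * K)\<^sup>2 * D x y" if "x \<in> space M" "y \<in> space M" for x y
    using par(2)[of "\<lambda>i. V x i - V y i" "\<lambda>i. W x i - W y i"] lipV[OF that] lipW[OF that]
    by (simp add: Q_def algebra_simps)
  note iV = lipschitz_sq_norm_tail(1)[OF V K lipV d(1,2) r \<rho>]
  note iW = lipschitz_sq_norm_tail(1)[OF W K lipW d(1,3) r \<rho>]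
  have iVW: "integrable M (\<lambda>x. 2 * (vnorm n (V x))\<^sup>2 + 2 * (vnorm n (W x))\<^sup>2)" using iV iW by simp
  have [measurable]: "(\<lambda>x. vnorm n (P x)) \<in> borel_measurable M" "(\<lambda>x. vnorm n (Q x)) \<in> borel_measurable M"
    unfolding vnorm_def by measurable
  have iP: "integrable M (\<lambda>x. (vnorm n (P x))\<^sup>2)" and iQ: "integrable M (\<lambda>x. (vnorm n (Q x))\<^sup>2)"
  proof -
    show "integrable M (\<lambda>x. (vnorm n (P x))\<^sup>2)"
      by (rule Bochner_Integration.integrable_bound[OF iVW]) (measurable, use par(1) in \<open>auto simp: P_def[abs_def]\<close>)
    show "integrable M (\<lambda>x. (vnorm n (Q x))\<^sup>2)"
      by (rule Bochner_Integration.integrable_bound[OF iVW]) (measurable, use par(2) in \<open>auto simp: Q_def[abs_def]\<close>)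
  qed
  have d2: "2 * d \<ge> 0" using d by simp
  have eP: "expectation (\<lambda>x. (vnorm n (P x))\<^sup>2) \<le> (2 * d)\<^sup>2 * n" and eQ: "expectation (\<lambda>x. (vnorm n (Q x))\<^sup>2) \<le> (2 * d)\<^sup>2 * n"
  proof -
    have "expectation (\<lambda>x. (vnorm n (P x))\<^sup>2) \<le> expectation (\<lambda>x. 2 * (vnorm n (V x))\<^sup>2 + 2 * (vnorm n (W x))\<^sup>2)"
      "expectation (\<lambda>x. (vnorm n (Q x))\<^sup>2) \<le> expectation (\<lambda>x. 2 * (vnorm n (V x))\<^sup>2 + 2 * (vnorm n (W x))\<^sup>2)"
      by (intro integral_mono iP iQ iVW; use par in \<open>simp add: P_def[abs_def] Q_def[abs_def]\<close>)+
    moreover have "expectation (\<lambda>x. 2 * (vnorm n (V x))\<^sup>2 + 2 * (vnorm n (W x))\<^sup>2) \<le> (2 * d)\<^sup>2 * n"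
      using d iV iW by simp
    ultimately show "expectation (\<lambda>x. (vnorm n (P x))\<^sup>2) \<le> (2 * d)\<^sup>2 * n" "expectation (\<lambda>x. (vnorm n (Q x))\<^sup>2) \<le> (2 * d)\<^sup>2 * n"
      by linarith+
  qed
  let ?EP = "expectation (\<lambda>x. (vnorm n (P x))\<^sup>2)" and ?EQ = "expectation (\<lambda>x. (vnorm n (Q x))\<^sup>2)"
  have pol: "vinner n (V x) (W x) = ((vnorm n (P x))\<^sup>2 - (vnorm n (Q x))\<^sup>2) / 4" for x
    unfolding sq vinner_def P_def Q_def
    by (simp add: sum_subtractf[symmetric] sum_divide_distrib power2_eq_square algebra_simps)
  show ?int unfolding pol using iP iQ by simp
  have E: "expectation (\<lambda>x. vinner n (V x) (W x)) = (?EP - ?EQ) / 4" unfolding pol using iP iQ by simp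
  define c where "c = (4 * \<rho> * (2 * K)\<^sup>2 + 4 * (2 * d) * (2 * K) * sqrt \<rho> + 24 * (2 * K)\<^sup>2) * sqrt (n * r)"
  have cc: "(8 * \<rho> * K\<^sup>2 + 8 * d * K * sqrt \<rho> + 48 * K\<^sup>2) * sqrt (n * r) = c / 2"
    by (simp add: c_def power2_eq_square algebra_simps)
  let ?A = "{x\<in>space M. \<bar>(vnorm n (P x))\<^sup>2 - ?EP\<bar> > c}" and ?B = "{x\<in>space M. \<bar>(vnorm n (Q x))\<^sup>2 - ?EQ\<bar> > c}"
  have tP: "prob ?A \<le> 2 * exp (- \<rho> * r)" unfolding c_def
    by (rule lipschitz_sq_norm_tail(2)[OF _ K2 lP d2 eP r \<rho>]) auto
  have tQ: "prob ?B \<le> 2 * exp (- \<rho> * r)" unfolding c_def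
    by (rule lipschitz_sq_norm_tail(2)[OF _ K2 lQ d2 eQ r \<rho>]) auto
  have "prob {x\<in>space M. \<bar>vinner n (V x) (W x) - expectation (\<lambda>x. vinner n (V x) (W x))\<bar> > c / 2} \<le> prob (?A \<union> ?B)"
  proof (rule finite_measure_mono)
    show "{x\<in>space M. \<bar>vinner n (V x) (W x) - expectation (\<lambda>x. vinner n (V x) (W x))\<bar> > c / 2} \<subseteq> ?A \<union> ?B"
      unfolding E unfolding pol by (auto simp: field_simps abs_if split: if_splits)
  qed measurable
  also have "\<dots> \<le> prob ?A + prob ?B" by (rule measure_Un_le) measurable
  finally show ?tail unfolding cc using tP tQ by linarith
qed

end

section \<open>Laws of symmetric Gaussian vectors and matrices\<close>

text \<open>The phase \<open>d\<close> turns the sine part of the characteristic function into a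
  cosine integral, so test functions stay real. Arbitrary finite mass is allowed because the lemma
  is applied to weighted laws; Levy's uniqueness theorem is reached by normalising.\<close>

lemma finite_measure_eq_of_cos_integrals:
  fixes M N :: "real measure"
  assumes "finite_measure M" "finite_measure N" and [measurable_cong]: "sets M = sets borel" "sets N = sets borel"
    and eq: "\<And>s d. (\<integral>x. cos (s * x + d) \<partial>M) = (\<integral>x. cos (s * x + d) \<partial>N)"
  shows "M = N"
proof -
  interpret M: finite_measure M by fact
  interpret N: finite_measure N by fact
  define m where "m = measure M UNIV"
  have spM: "space M = UNIV" and spN: "space N = UNIV"
    using assms(3,4) by (auto dest: sets_eq_imp_space_eq)
  have mN: "measure N UNIV = m" using eq[of 0 0] by (simp add: m_def spM spN)
  have eM: "emeasure M UNIV = ennreal m" "emeasure N UNIV = ennreal m"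
    using mN M.emeasure_eq_measure N.emeasure_eq_measure by (auto simp: m_def)
  show ?thesis
  proof (cases "m = 0")
    case True
    have z: "emeasure L A = 0" if "emeasure L UNIV = 0" "sets L = sets borel" for L :: "real measure" and A
      using emeasure_mono[of A UNIV L] that emeasure_notin_sets[of A L] by (cases "A \<in> sets L") auto
    show ?thesis by (rule measure_eqI) (use z eM True assms in auto)
  next
    case False
    then have m: "m > 0" by (simp add: m_def order_less_le)
    let ?d = "\<lambda>L. density L (\<lambda>_. ennreal (1 / m))"
    have dist: "real_distribution (?d L)" if "emeasure L UNIV = ennreal m" "sets L = sets borel" for L :: "real measure"
    proof -
      have "space L = UNIV" using that(2) by (auto dest: sets_eq_imp_space_eq)
      have "prob_space (?d L)"
        by (rule prob_spaceI) (use that m \<open>space L = UNIV\<close> in \<open>simp add: emeasure_density flip: ennreal_mult\<close>)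
      then show ?thesis using that by (simp add: real_distribution_def real_distribution_axioms_def)
    qed
    have "?d M = ?d N"
    proof (rule Levy_uniqueness[OF dist dist])
      have "char (?d M) t = char (?d N) t" for t
      proof -
        have ch: "char (?d L) t = complex_of_real (1 / m) * Complex (\<integral>x. cos (t * x + 0) \<partial>L) (\<integral>x. cos (t * x + - pi/2) \<partial>L)"
          if "finite_measure L" and [measurable_cong]: "sets L = sets borel" for L :: "real measure"
        proof -
          interpret L: finite_measure L by fact
          have i: "integrable L (\<lambda>x. iexp (t * x))"
            by (rule L.integrable_const_bound[of _ 1]) auto
          have "char (?d L) t = (\<integral>x. (1 / m) *\<^sub>R iexp (t * x) \<partial>L)"
            unfolding char_def using m by (subst integral_density) auto
          also have "\<dots> = complex_of_real (1 / m) * (\<integral>x. iexp (t * x) \<partial>L)"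
            by (simp add: scaleR_conv_of_real)
          also have "(\<integral>x. iexp (t * x) \<partial>L) = Complex (\<integral>x. Re (iexp (t * x)) \<partial>L) (\<integral>x. Im (iexp (t * x)) \<partial>L)"
            using i by (simp add: complex_eq_iff integral_Re integral_Im)
          also have "\<dots> = Complex (\<integral>x. cos (t * x + 0) \<partial>L) (\<integral>x. cos (t * x + - pi/2) \<partial>L)"
            by (simp add: Re_exp Im_exp cos_diff cos_add)
          finally show ?thesis .
        qed
        show ?thesis unfolding ch[OF assms(1,3)] ch[OF assms(2,4)] eq ..
      qed
      then show "char (?d M) = char (?d N)" by auto
    qed (use eM assms in auto)
    then have "density (?d M) (\<lambda>_. ennreal m) = density (?d N) (\<lambda>_. ennreal m)" by simp
    moreover have "density (?d L) (\<lambda>_. ennreal m) = L" for L :: "real measure"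
      using m by (simp add: density_density_eq density_1 flip: ennreal_mult)
    ultimately show ?thesis by metis
  qed
qed

text \<open>Cosine test functions are exchanged for indicators one coordinate at a time: the
  induction has indicators on \<open>J\<close> and the cosine of a linear form on the other
  coordinates. The law of a new coordinate \<open>k\<close> under a suitable weight is determined by
  integrals of the previous stage, via the one-dimensional lemma.\<close>

lemma PiM_measure_eq_of_cos_integrals:
  fixes M N :: "('i \<Rightarrow> real) measure"
  assumes I: "finite I" and M: "prob_space M" and N: "prob_space N"
    and [measurable_cong]: "sets M = sets (PiM I (\<lambda>_. borel))" "sets N = sets (PiM I (\<lambda>_. borel))"
    and eq: "\<And>t d. (\<integral>x. cos ((\<Sum>i\<in>I. t i * x i) + d) \<partial>M) = (\<integral>x. cos ((\<Sum>i\<in>I. t i * x i) + d) \<partial>N)"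
  shows "M = N"
proof -
  interpret M: prob_space M by fact
  interpret N: prob_space N by fact
  let ?p = "\<lambda>J B x. \<Prod>i\<in>J. (indicator (B i) (x i) :: real)"
  have p01: "0 \<le> ?p J B x" "?p J B x \<le> 1" for J :: "'i set" and B and x :: "'i \<Rightarrow> real"
    by (auto intro: prod_nonneg prod_le_1)
  have claim: "(\<integral>x. ?p J B x * cos ((\<Sum>i\<in>I-J. t i * x i) + d) \<partial>M) = (\<integral>x. ?p J B x * cos ((\<Sum>i\<in>I-J. t i * x i) + d) \<partial>N)"
    if "J \<subseteq> I" "\<And>i. i \<in> J \<Longrightarrow> B i \<in> sets borel" for J B t d
    using finite_subset[OF that(1) I] that
  proof (induction J arbitrary: t d)
    case empty
    then show ?case using eq by simp
  next
    case (insert k J)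
    let ?K = "I - insert k J"
    let ?\<theta> = "\<lambda>x. \<Sum>i\<in>?K. t i * x i"
    have kI: "k \<in> I" and JI: "J \<subseteq> I" and kJ: "k \<notin> J" using insert by auto
    have BJ: "B i \<in> sets borel" if "i \<in> J" for i using insert.prems that by auto
    have Bk[measurable]: "B k \<in> sets borel" using insert.prems by auto
    have IJ: "I - J = insert k ?K" "finite ?K" "k \<notin> ?K" using kI kJ I by auto
    \<comment> \<open>The summand 1 makes the weight non-negative, so that it is a density. It
      disappears again in the difference of the weights for \<open>d\<close> and
      \<open>d + pi\<close>, which is twice the cosine times the indicators.\<close>
    define w where "w c x = ?p J B x * (1 + cos (?\<theta> x + c))" for c x
    have w0: "0 \<le> w c x" and w2: "w c x \<le> 2" for c x
    proof -
      have "0 \<le> 1 + cos (?\<theta> x + c)" using cos_ge_minus_one[of "?\<theta> x + c"] by linarith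
      then show "0 \<le> w c x" unfolding w_def using p01 by (intro mult_nonneg_nonneg) auto
      have "w c x \<le> 1 * 2" unfolding w_def using p01 \<open>0 \<le> 1 + cos (?\<theta> x + c)\<close> by (intro mult_mono) auto
      then show "w c x \<le> 2" by simp
    qed
    have law: "distr (density M (\<lambda>x. ennreal (w c x))) borel (\<lambda>x. x k) = distr (density N (\<lambda>x. ennreal (w c x))) borel (\<lambda>x. x k)" for c
    proof (rule finite_measure_eq_of_cos_integrals)
      have fin: "finite_measure (distr (density L (\<lambda>x. ennreal (w c x))) borel (\<lambda>x. x k))
        \<and> (\<forall>s e. (\<integral>y. cos (s * y + e) \<partial>distr (density L (\<lambda>x. ennreal (w c x))) borel (\<lambda>x. x k)) =
             (\<integral>x. ?p J B x * cos ((\<Sum>i\<in>I-J. (if i = k then s else 0) * x i) + e) \<partial>L)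
           + (\<integral>x. ?p J B x * cos ((\<Sum>i\<in>I-J. (if i = k then s else t i) * x i) + (e + c)) \<partial>L) / 2
           + (\<integral>x. ?p J B x * cos ((\<Sum>i\<in>I-J. (if i = k then s else - t i) * x i) + (e - c)) \<partial>L) / 2)"
        if L: "prob_space L" and [measurable_cong]: "sets L = sets (PiM I (\<lambda>_. borel))" for L
      proof (intro conjI allI)
        interpret L: prob_space L by fact
        have [measurable]: "(\<lambda>x. x i) \<in> borel_measurable L" if "i \<in> I" for i
          using that by measurable
        have [measurable]: "(\<lambda>x. indicator (B i) (x i) :: real) \<in> borel_measurable L" if "i \<in> J" for i
        proof -
          have [measurable]: "B i \<in> sets borel" "i \<in> I" using BJ that JI by auto
          show ?thesis by measurable
        qed
        have pm: "?p J B \<in> borel_measurable L" by measurable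
        have lin: "(\<lambda>x. \<Sum>i\<in>A. u i * x i) \<in> borel_measurable L" if "A \<subseteq> I" for A and u :: "'i \<Rightarrow> real"
          using that by (intro borel_measurable_sum borel_measurable_times) auto
        have wm[measurable]: "w c \<in> borel_measurable L" 
        proof -
          have [measurable]: "?\<theta> \<in> borel_measurable L" by (rule lin) blast
          show ?thesis unfolding w_def[abs_def] using pm by measurable
        qed
        have "emeasure (density L (\<lambda>x. ennreal (w c x))) (space L) \<le> ennreal 2 * emeasure L (space L)"
        proof -
          have "emeasure (density L (\<lambda>x. ennreal (w c x))) (space L) = (\<integral>\<^sup>+x. ennreal (w c x) \<partial>L)"
            by (subst emeasure_density) (auto intro!: nn_integral_cong simp: indicator_def)
          also have "\<dots> \<le> (\<integral>\<^sup>+x. ennreal 2 \<partial>L)" by (intro nn_integral_mono ennreal_leI w2)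
          finally show ?thesis by simp
        qed
        also have "\<dots> < top" by (simp add: L.emeasure_space_1)
        finally have "finite_measure (density L (\<lambda>x. ennreal (w c x)))" by (intro finite_measureI) auto
        then show "finite_measure (distr (density L (\<lambda>x. ennreal (w c x))) borel (\<lambda>x. x k))"
          using kI by (intro finite_measure.finite_measure_distr) auto
        fix s e
        have int: "integrable L (\<lambda>x. ?p J B x * cos ((\<Sum>i\<in>I-J. u i * x i) + a))" for u a
        proof (rule L.integrable_const_bound[of _ 1])
          have "\<bar>?p J B x * cos ((\<Sum>i\<in>I-J. u i * x i) + a)\<bar> \<le> 1" for x
            using p01[of B x J] unfolding abs_mult by (intro mult_le_one) auto
          then show "AE x in L. norm (?p J B x * cos ((\<Sum>i\<in>I-J. u i * x i) + a)) \<le> 1" by simp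
          show "(\<lambda>x. ?p J B x * cos ((\<Sum>i\<in>I-J. u i * x i) + a)) \<in> borel_measurable L"
          proof -
            have [measurable]: "(\<lambda>x. \<Sum>i\<in>I-J. u i * x i) \<in> borel_measurable L" by (rule lin) blast
            show ?thesis using pm by measurable
          qed
        qed
        have "(\<integral>y. cos (s * y + e) \<partial>distr (density L (\<lambda>x. ennreal (w c x))) borel (\<lambda>x. x k)) = (\<integral>x. w c x * cos (s * x k + e) \<partial>L)"
          using kI by (subst integral_distr, measurable, subst integral_density) (auto simp: w0)
        also have "\<dots> = (\<integral>x. ?p J B x * cos ((\<Sum>i\<in>I-J. (if i = k then s else 0) * x i) + e)
           + ?p J B x * cos ((\<Sum>i\<in>I-J. (if i = k then s else t i) * x i) + (e + c)) / 2
           + ?p J B x * cos ((\<Sum>i\<in>I-J. (if i = k then s else - t i) * x i) + (e - c)) / 2 \<partial>L)"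
        proof (rule Bochner_Integration.integral_cong[OF refl])
          fix x :: "'i \<Rightarrow> real"
          have 1: "(\<Sum>i\<in>I-J. (if i = k then s else 0) * x i) = s * x k"
            unfolding IJ(1) using IJ(2,3) by simp
          have 2: "(\<Sum>i\<in>I-J. (if i = k then s else u i) * x i) = s * x k + (\<Sum>i\<in>?K. u i * x i)" for u
            unfolding IJ(1) using IJ(2,3) by (auto intro!: sum.cong)
          have 3: "(\<Sum>i\<in>?K. - t i * x i) = - ?\<theta> x" by (simp add: sum_negf)
          \<comment> \<open>Product-to-sum formula: a cosine in \<open>x k\<close> times the cosine
            in the weight is a sum of cosines of linear forms on \<open>I - J\<close>, which the
            induction hypothesis covers.\<close>
          have c: "cos (s * x k + ?\<theta> x + (e + c)) + cos (s * x k + - ?\<theta> x + (e - c)) = 2 * (cos (?\<theta> x + c) * cos (s * x k + e))"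
          proof -
            define P Q where "P = ?\<theta> x + c" and "Q = s * x k + e"
            have "s * x k + ?\<theta> x + (e + c) = Q + P" "s * x k + - ?\<theta> x + (e - c) = Q - P"
              by (simp_all add: P_def Q_def)
            then show ?thesis unfolding P_def[symmetric] Q_def[symmetric] by (simp add: cos_add cos_diff)
          qed
          show "w c x * cos (s * x k + e) = ?p J B x * cos ((\<Sum>i\<in>I-J. (if i = k then s else 0) * x i) + e)
           + ?p J B x * cos ((\<Sum>i\<in>I-J. (if i = k then s else t i) * x i) + (e + c)) / 2
           + ?p J B x * cos ((\<Sum>i\<in>I-J. (if i = k then s else - t i) * x i) + (e - c)) / 2"
            unfolding 1 2 3 w_def using arg_cong[OF c, of "\<lambda>v. ?p J B x * v"] by (simp add: algebra_simps)
        qed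
        also have "\<dots> = (\<integral>x. ?p J B x * cos ((\<Sum>i\<in>I-J. (if i = k then s else 0) * x i) + e) \<partial>L)
           + (\<integral>x. ?p J B x * cos ((\<Sum>i\<in>I-J. (if i = k then s else t i) * x i) + (e + c)) \<partial>L) / 2
           + (\<integral>x. ?p J B x * cos ((\<Sum>i\<in>I-J. (if i = k then s else - t i) * x i) + (e - c)) \<partial>L) / 2"
          using int by simp
        finally show "(\<integral>y. cos (s * y + e) \<partial>distr (density L (\<lambda>x. ennreal (w c x))) borel (\<lambda>x. x k)) =
             (\<integral>x. ?p J B x * cos ((\<Sum>i\<in>I-J. (if i = k then s else 0) * x i) + e) \<partial>L)
           + (\<integral>x. ?p J B x * cos ((\<Sum>i\<in>I-J. (if i = k then s else t i) * x i) + (e + c)) \<partial>L) / 2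
           + (\<integral>x. ?p J B x * cos ((\<Sum>i\<in>I-J. (if i = k then s else - t i) * x i) + (e - c)) \<partial>L) / 2" .
      qed
      show "finite_measure (distr (density M (\<lambda>x. ennreal (w c x))) borel (\<lambda>x. x k))"
        "finite_measure (distr (density N (\<lambda>x. ennreal (w c x))) borel (\<lambda>x. x k))"
        using fin M N assms by auto
      show "(\<integral>y. cos (s * y + e) \<partial>distr (density M (\<lambda>x. ennreal (w c x))) borel (\<lambda>x. x k)) =
        (\<integral>y. cos (s * y + e) \<partial>distr (density N (\<lambda>x. ennreal (w c x))) borel (\<lambda>x. x k))" for s e
        using fin[OF M assms(4)] fin[OF N assms(5)] insert.IH[OF JI BJ] by simp
    qed auto
    have val: "(\<integral>x. ?p (insert k J) B x * cos (?\<theta> x + d) \<partial>L) =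
       (measure (distr (density L (\<lambda>x. ennreal (w d x))) borel (\<lambda>x. x k)) (B k)
        - measure (distr (density L (\<lambda>x. ennreal (w (d + pi) x))) borel (\<lambda>x. x k)) (B k)) / 2"
      if L: "prob_space L" and [measurable_cong]: "sets L = sets (PiM I (\<lambda>_. borel))" for L
    proof -
      interpret L: prob_space L by fact
      have [measurable]: "(\<lambda>x. x i) \<in> borel_measurable L" if "i \<in> I" for i
        using that by measurable
      have [measurable]: "(\<lambda>x. indicator (B i) (x i) :: real) \<in> borel_measurable L" if "i \<in> J" for i
      proof -
        have [measurable]: "B i \<in> sets borel" "i \<in> I" using BJ that JI by auto
        show ?thesis by measurable
      qed
      have pm: "?p J B \<in> borel_measurable L" by measurable
      have lin: "(\<lambda>x. \<Sum>i\<in>A. u i * x i) \<in> borel_measurable L" if "A \<subseteq> I" for A and u :: "'i \<Rightarrow> real"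
        using that by (intro borel_measurable_sum borel_measurable_times) auto
      have wm[measurable]: "w c \<in> borel_measurable L" for c 
      proof -
        have [measurable]: "?\<theta> \<in> borel_measurable L" by (rule lin) blast
        show ?thesis unfolding w_def[abs_def] using pm by measurable
      qed
      have [measurable]: "(\<lambda>x. x k) \<in> borel_measurable L" using kI by auto
      have iw: "integrable L (\<lambda>x. w c x * indicator (B k) (x k))" for c
      proof (rule L.integrable_const_bound[of _ 2])
        have "\<bar>w c x * indicator (B k) (x k)\<bar> \<le> 2" for x
          using w0[of c x] w2[of c x] by (auto simp: indicator_def)
        then show "AE x in L. norm (w c x * indicator (B k) (x k)) \<le> 2" by simp
      qed measurable
      have ms: "measure (distr (density L (\<lambda>x. ennreal (w c x))) borel (\<lambda>x. x k)) (B k) = (\<integral>x. w c x * indicator (B k) (x k) \<partial>L)" for c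
      proof -
        have "emeasure (distr (density L (\<lambda>x. ennreal (w c x))) borel (\<lambda>x. x k)) (B k) =
          (\<integral>\<^sup>+x. ennreal (w c x) * indicator ((\<lambda>x. x k) -` B k \<inter> space L) x \<partial>L)"
          by (subst emeasure_distr, measurable, subst emeasure_density) auto
        also have "\<dots> = (\<integral>\<^sup>+x. ennreal (w c x * indicator (B k) (x k)) \<partial>L)"
          by (intro nn_integral_cong) (auto simp: indicator_def)
        also have "\<dots> = ennreal (\<integral>x. w c x * indicator (B k) (x k) \<partial>L)"
          using iw w0 by (intro nn_integral_eq_integral) auto
        finally show ?thesis using w0 by (simp add: measure_def integral_nonneg_AE)
      qed
      have "(\<integral>x. ?p (insert k J) B x * cos (?\<theta> x + d) \<partial>L) =
         (\<integral>x. (w d x * indicator (B k) (x k) - w (d + pi) x * indicator (B k) (x k)) / 2 \<partial>L)"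
      proof (rule Bochner_Integration.integral_cong[OF refl])
        fix x :: "'i \<Rightarrow> real"
        have "cos (?\<theta> x + (d + pi)) = - cos (?\<theta> x + d)"
          using cos_periodic_pi[of "?\<theta> x + d"] by (simp add: add.assoc)
        then show "?p (insert k J) B x * cos (?\<theta> x + d) =
            (w d x * indicator (B k) (x k) - w (d + pi) x * indicator (B k) (x k)) / 2"
          unfolding w_def using insert.hyps by (simp add: algebra_simps)
      qed
      also have "\<dots> = ((\<integral>x. w d x * indicator (B k) (x k) \<partial>L) - (\<integral>x. w (d + pi) x * indicator (B k) (x k) \<partial>L)) / 2"
        using iw by simp
      finally show ?thesis unfolding ms .
    qed
    show ?case unfolding val[OF M assms(4)] val[OF N assms(5)] law ..
  qed
  show ?thesis
  proof (rule measure_eqI_PiM_finite[OF I assms(4,5)])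
    fix A :: "'i \<Rightarrow> real set" assume A: "\<And>i. i \<in> I \<Longrightarrow> A i \<in> sets borel"
    \<comment> \<open>For \<open>J = I\<close> the cosine factor is \<open>cos 0 = 1\<close>, and
      the claim becomes equality of the two measures on boxes.\<close>
    have v: "measure L (Pi\<^sub>E I A) = (\<integral>x. ?p I A x * cos ((\<Sum>i\<in>I-I. 0 * x i) + 0) \<partial>L)"
      if "prob_space L" "sets L = sets (PiM I (\<lambda>_. borel))" for L
    proof -
      have sp: "space L = (\<Pi>\<^sub>E i\<in>I. UNIV)" using sets_eq_imp_space_eq[OF that(2)] by (simp add: space_PiM)
      have "(\<integral>x. ?p I A x * cos ((\<Sum>i\<in>I-I. 0 * x i) + 0) \<partial>L) = (\<integral>x. indicator (Pi\<^sub>E I A) x \<partial>L)"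
      proof (rule Bochner_Integration.integral_cong[OF refl])
        fix x assume "x \<in> space L"
        then have x: "x \<in> extensional I" by (auto simp: sp PiE_iff)
        show "?p I A x * cos ((\<Sum>i\<in>I-I. 0 * x i) + 0) = indicator (Pi\<^sub>E I A) x"
        proof (cases "x \<in> Pi\<^sub>E I A")
          case True
          then show ?thesis by (auto simp: PiE_iff intro!: prod.neutral)
        next
          case False
          then obtain i where "i \<in> I" "x i \<notin> A i" using x by (auto simp: PiE_iff)
          then have "?p I A x = 0" using I by (intro prod_zero) (auto simp: indicator_def)
          then show ?thesis using False by simp
        qed
      qed
      also have "\<dots> = measure L (Pi\<^sub>E I A)"
        using A I that(2) sp by (subst Bochner_Integration.integral_indicator) (auto simp: Int_absorb2 intro!: arg_cong2[where f=measure] sets_PiM_I_finite)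
      finally show ?thesis by simp
    qed
    show "emeasure M (Pi\<^sub>E I A) = emeasure N (Pi\<^sub>E I A)"
      using v[OF M assms(4)] v[OF N assms(5)] claim[of I A "\<lambda>_. 0" 0] A
      by (simp add: M.emeasure_eq_measure N.emeasure_eq_measure)
  next
    show "range (\<lambda>_::nat. Pi\<^sub>E I (\<lambda>_. UNIV)) \<subseteq> prod_algebra I (\<lambda>_. borel)"
      using I by (auto intro!: prod_algebraI_finite)
  qed (auto simp: space_PiM)
qed

section \<open>Characteristic functions of the Gaussian noise and of the GOE\<close>

lemma prob_space_gauss: "v > 0 \<Longrightarrow> prob_space (gauss v)"
  unfolding gauss_def by (rule prob_space_normal_density) simp

lemma sets_gauss[simp, measurable_cong]: "sets (gauss v) = sets borel"
  by (simp add: gauss_def)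

lemma space_gauss[simp]: "space (gauss v) = UNIV"
  by (simp add: gauss_def)

lemma char_gauss:
  assumes "v > 0"
  shows "(\<integral>x. iexp (t * x) \<partial>gauss v) = complex_of_real (exp (- (v * t\<^sup>2) / 2))"
proof -
  let ?s = "sqrt v"
  interpret prob_space "gauss v" by (rule prob_space_gauss[OF assms])
  have "distr (gauss v) lborel (\<lambda>x. x) = gauss v" by (rule distr_id2) (simp add: gauss_def)
  then have "distributed (gauss v) lborel (\<lambda>x. x) (normal_density 0 ?s)"
    unfolding distributed_def by (simp add: gauss_def)
  then have "distributed (gauss v) lborel (\<lambda>x. (x - 0) / ?s) std_normal_density"
    using normal_standard_normal_convert[of ?s "\<lambda>x. x" 0] assms by simp
  then have d: "distr (gauss v) lborel (\<lambda>x. x / ?s) = std_normal_distribution"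
    by (simp add: distributed_def)
  have "(\<integral>x. iexp (t * x) \<partial>gauss v) = (\<integral>x. iexp (t * ?s * (x / ?s)) \<partial>gauss v)"
    using assms by (intro Bochner_Integration.integral_cong) auto
  also have "\<dots> = (\<integral>x. iexp (t * ?s * x) \<partial>distr (gauss v) lborel (\<lambda>x. x / ?s))"
    by (rule integral_distr[symmetric]) auto
  also have "\<dots> = char std_normal_distribution (t * ?s)" unfolding d char_def ..
  also have "\<dots> = complex_of_real (exp (- (v * t\<^sup>2) / 2))"
    using assms by (simp add: char_std_normal_distribution power_mult_distrib mult.commute)
  finally show ?thesis .
qed

lemma char_PiM:
  assumes I: "finite I" and M: "\<And>i. prob_space (M i)" and g: "\<And>i. i \<in> I \<Longrightarrow> g i \<in> borel_measurable (M i)"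
  shows "(\<integral>x. iexp (\<Sum>i\<in>I. g i (x i)) \<partial>PiM I M) = (\<Prod>i\<in>I. \<integral>x. iexp (g i x) \<partial>M i)"
proof -
  interpret product_sigma_finite M
    by (simp add: product_sigma_finite_def M prob_space_imp_sigma_finite)
  have "(\<integral>x. iexp (\<Sum>i\<in>I. g i (x i)) \<partial>PiM I M) = (\<integral>x. (\<Prod>i\<in>I. iexp (g i (x i))) \<partial>PiM I M)"
    using I by (simp add: exp_sum sum_distrib_left)
  also have "\<dots> = (\<Prod>i\<in>I. \<integral>x. iexp (g i x) \<partial>M i)"
    by (intro product_integral_prod I prob_space.integrable_iexp M) (use g in \<open>auto intro!: borel_measurable_of_real\<close>)
  finally show ?thesis .
qed

lemma char_PiM_gauss:
  assumes I: "finite I" and v: "\<And>i. v i > 0"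
  shows "(\<integral>x. iexp (\<Sum>i\<in>I. t i * x i) \<partial>PiM I (\<lambda>i. gauss (v i))) = complex_of_real (exp (- (\<Sum>i\<in>I. v i * (t i)\<^sup>2) / 2))"
proof -
  have "(\<integral>x. iexp (\<Sum>i\<in>I. t i * x i) \<partial>PiM I (\<lambda>i. gauss (v i))) = (\<Prod>i\<in>I. \<integral>x. iexp (t i * x) \<partial>gauss (v i))"
    by (rule char_PiM[OF I]) (auto simp: prob_space_gauss v)
  also have "\<dots> = (\<Prod>i\<in>I. complex_of_real (exp (- (v i * (t i)\<^sup>2) / 2)))"
    by (simp only: char_gauss v)
  also have "\<dots> = complex_of_real (exp (\<Sum>i\<in>I. - (v i * (t i)\<^sup>2) / 2))"
    by (simp add: exp_sum I)
  finally show ?thesis by (simp add: sum_negf sum_divide_distrib)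
qed

text \<open>A real characteristic function means that the sine integral vanishes; one number
  \<open>e\<close> then fixes the cosine integrals for all phases.\<close>

lemma cos_integral_of_char:
  assumes "prob_space M" and [measurable]: "X \<in> borel_measurable M"
    and eq: "(\<integral>x. iexp (X x) \<partial>M) = complex_of_real e"
  shows "(\<integral>x. cos (X x + d) \<partial>M) = e * cos d"
proof -
  have i: "integrable M (\<lambda>x. iexp (X x))" by (rule prob_space.integrable_iexp[OF assms(1)]) auto
  have "(\<integral>x. cos (X x + d) \<partial>M) = (\<integral>x. Re (iexp (X x) * iexp d) \<partial>M)"
    by (intro Bochner_Integration.integral_cong) (auto simp: Re_exp Im_exp cos_add)
  also have "\<dots> = Re (\<integral>x. iexp (X x) * iexp d \<partial>M)"
    by (rule integral_Re) (intro integrable_mult_left i)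
  also have "(\<integral>x. iexp (X x) * iexp d \<partial>M) = complex_of_real e * iexp d" using eq by simp
  finally show ?thesis by (simp add: Re_exp)
qed

definition noise_space :: "nat \<Rightarrow> nat \<Rightarrow> (nat \<Rightarrow> nat \<Rightarrow> real) measure" where
  "noise_space n T = PiM {1..T} (\<lambda>_. PiM {..<n} (\<lambda>_. gauss 1))"

lemma prob_space_gauss_vec: "prob_space (PiM {..<n::nat} (\<lambda>_. gauss 1))"
  by (intro prob_space_PiM prob_space_gauss) simp

lemma prob_space_noise: "prob_space (noise_space n T)"
  unfolding noise_space_def by (intro prob_space_PiM prob_space_gauss_vec)

lemma sets_noise_space[measurable_cong]:
  "sets (noise_space n T) = sets (PiM {1..T} (\<lambda>_. PiM {..<n} (\<lambda>_. borel)))"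
  unfolding noise_space_def by (intro sets_PiM_cong) auto

lemma PiM_component2:
  assumes "i \<in> I" "j \<in> J"
  shows "(\<lambda>z. z i j) \<in> borel_measurable (PiM I (\<lambda>_. PiM J (\<lambda>_. borel)))"
  by (rule measurable_compose[of "\<lambda>z. z i" _ "PiM J (\<lambda>_. borel)" "\<lambda>x. x j"])
    (intro measurable_component_singleton assms)+

lemma noise_component: "r \<in> {1..T} \<Longrightarrow> i < n \<Longrightarrow> (\<lambda>z. z r i) \<in> borel_measurable (noise_space n T)"
  unfolding measurable_cong_sets[OF sets_noise_space refl] by (rule PiM_component2) auto

lemma char_noise:
  "(\<integral>z. iexp (\<Sum>r\<in>{1..T}. \<Sum>i<n. t r i * z r i) \<partial>noise_space n T) = complex_of_real (exp (- (\<Sum>r\<in>{1..T}. \<Sum>i<n. (t r i)\<^sup>2) / 2))"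
proof -
  have "(\<integral>z. iexp (\<Sum>r\<in>{1..T}. \<Sum>i<n. t r i * z r i) \<partial>noise_space n T) =
     (\<Prod>r\<in>{1..T}. \<integral>x. iexp (\<Sum>i<n. t r i * x i) \<partial>PiM {..<n} (\<lambda>_. gauss 1))"
    unfolding noise_space_def
    by (rule char_PiM) (auto simp: prob_space_gauss_vec intro!: borel_measurable_sum borel_measurable_times measurable_component_singleton[THEN measurable_compose] cong: measurable_cong_sets)
  also have "\<dots> = (\<Prod>r\<in>{1..T}. complex_of_real (exp (- (\<Sum>i<n. (t r i)\<^sup>2) / 2)))"
    using char_PiM_gauss[of "{..<n}" "\<lambda>_. 1"] by simp
  also have "\<dots> = complex_of_real (exp (\<Sum>r\<in>{1..T}. - (\<Sum>i<n. (t r i)\<^sup>2) / 2))"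
    by (simp add: exp_sum)
  finally show ?thesis by (simp add: sum_negf sum_divide_distrib)
qed

lemma measurable_fun2_iff:
  "X \<in> measurable M fun2_space \<longleftrightarrow> (\<forall>i j. (\<lambda>w. X w i j) \<in> borel_measurable M)"
proof
  assume X: "X \<in> measurable M fun2_space"
  have "(\<lambda>w. X w i j) \<in> borel_measurable M" for i j
    by (rule measurable_compose[OF X, of "\<lambda>x. x i j", unfolded fun2_space_def, OF PiM_component2]) auto
  then show "\<forall>i j. (\<lambda>w. X w i j) \<in> borel_measurable M" by blast
next
  assume *: "\<forall>i j. (\<lambda>w. X w i j) \<in> borel_measurable M"
  show "X \<in> measurable M fun2_space" unfolding fun2_space_def
    by (intro measurable_PiM_single') (use * in \<open>auto simp: space_PiM intro!: measurable_PiM_single'\<close>)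
qed

lemma fun2_component[measurable]: "(\<lambda>x. x i j) \<in> borel_measurable fun2_space"
  using measurable_fun2_iff[of "\<lambda>x. x" fun2_space] by simp

lemma space_fun2[simp]: "space fun2_space = UNIV"
  by (simp add: fun2_space_def space_PiM PiE_UNIV_domain)

text \<open>Carries the uniqueness result from finite products to the infinite product
  \<open>fun2_space\<close>: both arrays vanish off \<open>I\<close>, so the restriction
  \<open>rs\<close> loses nothing and \<open>ext\<close> undoes it.\<close>

lemma fun2_law_eqI:
  fixes X :: "'a \<Rightarrow> nat \<Rightarrow> nat \<Rightarrow> real" and Y :: "'b \<Rightarrow> nat \<Rightarrow> nat \<Rightarrow> real"
  assumes M: "prob_space M" and N: "prob_space N" and I: "finite I"
    and X[measurable]: "X \<in> measurable M fun2_space" and Y[measurable]: "Y \<in> measurable N fun2_space"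
    and X0: "\<And>w i j. (i, j) \<notin> I \<Longrightarrow> X w i j = 0" and Y0: "\<And>w i j. (i, j) \<notin> I \<Longrightarrow> Y w i j = 0"
    and eq: "\<And>t d. (\<integral>w. cos ((\<Sum>(i,j)\<in>I. t i j * X w i j) + d) \<partial>M) = (\<integral>w. cos ((\<Sum>(i,j)\<in>I. t i j * Y w i j) + d) \<partial>N)"
  shows "distr M fun2_space X = distr N fun2_space Y"
proof -
  let ?P = "PiM I (\<lambda>_. borel) :: (nat \<times> nat \<Rightarrow> real) measure"
  define rs where "rs = (\<lambda>(x::nat \<Rightarrow> nat \<Rightarrow> real). \<lambda>p\<in>I. x (fst p) (snd p))"
  define ext where "ext = (\<lambda>(u::nat \<times> nat \<Rightarrow> real) i j. if (i, j) \<in> I then u (i, j) else 0)"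
  have [measurable]: "rs \<in> measurable fun2_space ?P" unfolding rs_def by measurable
  have [measurable]: "ext \<in> measurable ?P fun2_space"
  proof -
    have "(\<lambda>w. w (i, j)) \<in> borel_measurable ?P" if "(i, j) \<in> I" for i j
      by (rule measurable_component_singleton[OF that])
    then have "(\<lambda>w. if (i, j) \<in> I then w (i, j) else 0) \<in> borel_measurable ?P" for i j
      by (cases "(i, j) \<in> I") auto
    then show ?thesis unfolding measurable_fun2_iff ext_def by blast
  qed
  have rsX: "ext (rs (X w)) = X w" for w using X0 by (auto simp: ext_def rs_def fun_eq_iff)
  have rsY: "ext (rs (Y w)) = Y w" for w using Y0 by (auto simp: ext_def rs_def fun_eq_iff)
  have ci: "(\<integral>x. cos ((\<Sum>p\<in>I. t p * x p) + d) \<partial>distr L ?P (\<lambda>w. rs (Z w))) = (\<integral>w. cos ((\<Sum>(i,j)\<in>I. t (i, j) * Z w i j) + d) \<partial>L)"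
    if [measurable]: "Z \<in> measurable L fun2_space" for L and Z :: "'c \<Rightarrow> nat \<Rightarrow> nat \<Rightarrow> real" and t d
    by (subst integral_distr) (auto intro!: Bochner_Integration.integral_cong arg_cong[where f=cos] sum.cong simp: rs_def)
  have "distr M ?P (\<lambda>w. rs (X w)) = distr N ?P (\<lambda>w. rs (Y w))"
  proof (rule PiM_measure_eq_of_cos_integrals[OF I])
    show "prob_space (distr M ?P (\<lambda>w. rs (X w)))" "prob_space (distr N ?P (\<lambda>w. rs (Y w)))"
      by (intro prob_space.prob_space_distr M N; measurable)+
    fix t :: "nat \<times> nat \<Rightarrow> real" and d
    show "(\<integral>x. cos ((\<Sum>p\<in>I. t p * x p) + d) \<partial>distr M ?P (\<lambda>w. rs (X w))) = (\<integral>x. cos ((\<Sum>p\<in>I. t p * x p) + d) \<partial>distr N ?P (\<lambda>w. rs (Y w)))"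
      unfolding ci[OF X] ci[OF Y] by (rule eq[of "\<lambda>i j. t (i, j)"])
  qed auto
  then have "distr (distr M ?P (\<lambda>w. rs (X w))) fun2_space ext = distr (distr N ?P (\<lambda>w. rs (Y w))) fun2_space ext" by simp
  then show ?thesis by (simp add: distr_distr comp_def rsX rsY)
qed

definition mix_noise :: "nat \<Rightarrow> nat \<Rightarrow> (nat \<Rightarrow> nat \<Rightarrow> real) \<Rightarrow> (nat \<Rightarrow> nat \<Rightarrow> real) \<Rightarrow> nat \<Rightarrow> nat \<Rightarrow> real" where
  "mix_noise n T R z r i = (if r \<in> {1..T} \<and> i < n then (\<Sum>k\<in>{1..T}. R r k * z k i) else 0)"

lemma mix_noise_measurable[measurable]: "mix_noise n T R \<in> measurable (noise_space n T) fun2_space"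
proof -
  have "(\<lambda>z. mix_noise n T R z r i) \<in> borel_measurable (noise_space n T)" for r i
    unfolding mix_noise_def by (cases "r \<in> {1..T} \<and> i < n") (auto intro!: borel_measurable_sum borel_measurable_times noise_component)
  then show ?thesis unfolding measurable_fun2_iff by blast
qed

lemma cos_integral_mix_noise:
  "(\<integral>z. cos ((\<Sum>(r,i)\<in>{1..T}\<times>{..<n}. t r i * mix_noise n T R z r i) + d) \<partial>noise_space n T) =
    exp (- (\<Sum>i<n. \<Sum>r\<in>{1..T}. \<Sum>s\<in>{1..T}. t r i * t s i * (\<Sum>k\<in>{1..T}. R r k * R s k)) / 2) * cos d"
proof (rule cos_integral_of_char[OF prob_space_noise])
  show "(\<lambda>z. \<Sum>(r,i)\<in>{1..T}\<times>{..<n}. t r i * mix_noise n T R z r i) \<in> borel_measurable (noise_space n T)"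
    by (auto simp: split_beta')
  have 1: "(\<Sum>(r,i)\<in>{1..T}\<times>{..<n}. t r i * mix_noise n T R z r i) = (\<Sum>k\<in>{1..T}. \<Sum>i<n. (\<Sum>r\<in>{1..T}. t r i * R r k) * z k i)" for z
  proof -
    have "(\<Sum>(r,i)\<in>{1..T}\<times>{..<n}. t r i * mix_noise n T R z r i) = (\<Sum>r\<in>{1..T}. \<Sum>i<n. \<Sum>k\<in>{1..T}. t r i * R r k * z k i)"
      by (subst sum.cartesian_product[symmetric]) (auto simp: mix_noise_def sum_distrib_left mult.assoc intro!: sum.cong)
    also have "\<dots> = (\<Sum>r\<in>{1..T}. \<Sum>k\<in>{1..T}. \<Sum>i<n. t r i * R r k * z k i)"
      by (intro sum.cong refl sum.swap)
    also have "\<dots> = (\<Sum>k\<in>{1..T}. \<Sum>r\<in>{1..T}. \<Sum>i<n. t r i * R r k * z k i)" by (rule sum.swap)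
    also have "\<dots> = (\<Sum>k\<in>{1..T}. \<Sum>i<n. \<Sum>r\<in>{1..T}. t r i * R r k * z k i)"
      by (intro sum.cong refl sum.swap)
    finally show ?thesis by (simp add: sum_distrib_right)
  qed
  have 2: "(\<Sum>k\<in>{1..T}. \<Sum>i<n. (\<Sum>r\<in>{1..T}. t r i * R r k)\<^sup>2) =
    (\<Sum>i<n. \<Sum>r\<in>{1..T}. \<Sum>s\<in>{1..T}. t r i * t s i * (\<Sum>k\<in>{1..T}. R r k * R s k))"
  proof -
    have "(\<Sum>k\<in>{1..T}. \<Sum>i<n. (\<Sum>r\<in>{1..T}. t r i * R r k)\<^sup>2) =
      (\<Sum>i<n. \<Sum>k\<in>{1..T}. \<Sum>r\<in>{1..T}. \<Sum>s\<in>{1..T}. t r i * R r k * (t s i * R s k))"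
      by (subst sum.swap) (simp add: power2_eq_square sum_product)
    also have "\<dots> = (\<Sum>i<n. \<Sum>r\<in>{1..T}. \<Sum>k\<in>{1..T}. \<Sum>s\<in>{1..T}. t r i * R r k * (t s i * R s k))"
      by (intro sum.cong refl sum.swap)
    also have "\<dots> = (\<Sum>i<n. \<Sum>r\<in>{1..T}. \<Sum>s\<in>{1..T}. \<Sum>k\<in>{1..T}. t r i * R r k * (t s i * R s k))"
      by (intro sum.cong refl sum.swap)
    finally show ?thesis by (simp add: sum_distrib_left mult_ac)
  qed
  show "(\<integral>z. iexp (\<Sum>(r,i)\<in>{1..T}\<times>{..<n}. t r i * mix_noise n T R z r i) \<partial>noise_space n T) = complex_of_real
     (exp (- (\<Sum>i<n. \<Sum>r\<in>{1..T}. \<Sum>s\<in>{1..T}. t r i * t s i * (\<Sum>k\<in>{1..T}. R r k * R s k)) / 2))"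
    unfolding 1 char_noise 2 ..
qed

text \<open>Rotational invariance of the standard Gaussian: the law depends on \<open>R\<close> only
  through \<open>R R^T\<close>. This frees the comparison process from the unspecified root chosen
  by \<open>SOME\<close> in \<open>gauss_proc\<close>, and with sign matrices it yields the symmetry
  of the noise.\<close>

lemma mix_noise_law_eq:
  assumes "\<And>r s. r \<in> {1..T} \<Longrightarrow> s \<in> {1..T} \<Longrightarrow> (\<Sum>k\<in>{1..T}. R r k * R s k) = (\<Sum>k\<in>{1..T}. Q r k * Q s k)"
  shows "distr (noise_space n T) fun2_space (mix_noise n T R) = distr (noise_space n T) fun2_space (mix_noise n T Q)"
proof (rule fun2_law_eqI[OF prob_space_noise prob_space_noise, of "{1..T} \<times> {..<n}"])
  show "(\<integral>z. cos ((\<Sum>(r,i)\<in>{1..T}\<times>{..<n}. t r i * mix_noise n T R z r i) + d) \<partial>noise_space n T) =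
    (\<integral>z. cos ((\<Sum>(r,i)\<in>{1..T}\<times>{..<n}. t r i * mix_noise n T Q z r i) + d) \<partial>noise_space n T)" for t d
    unfolding cos_integral_mix_noise using assms by simp
qed (auto simp: mix_noise_def)

lemma gauss_proc_eq_mix_noise:
  assumes "\<And>r s. r \<in> {1..T} \<Longrightarrow> s \<in> {1..T} \<Longrightarrow> (\<Sum>k\<in>{1..T}. R r k * R s k) = S r s"
  shows "gauss_proc n T S = distr (noise_space n T) fun2_space (mix_noise n T R)"
proof -
  define Q where "Q = (SOME R :: nat \<Rightarrow> nat \<Rightarrow> real.
                 \<forall>r\<in>{1..T}. \<forall>s\<in>{1..T}. (\<Sum>k\<in>{1..T}. R r k * R s k) = S r s)"
  have Q: "\<forall>r\<in>{1..T}. \<forall>s\<in>{1..T}. (\<Sum>k\<in>{1..T}. Q r k * Q s k) = S r s"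
    unfolding Q_def by (rule someI[of _ R]) (use assms in auto)
  have "gauss_proc n T S = distr (noise_space n T) fun2_space (mix_noise n T Q)"
    unfolding gauss_proc_def Q_def[symmetric] Let_def noise_space_def mix_noise_def[abs_def] ..
  also have "\<dots> = distr (noise_space n T) fun2_space (mix_noise n T R)"
    by (rule mix_noise_law_eq) (use Q assms in auto)
  finally show ?thesis .
qed

text \<open>Pairs \<open>(i, j)\<close> with \<open>(j, i)\<close>, because only the entries on and
  above the diagonal are independent coordinates of the GOE.\<close>

lemma sum_square_split:
  fixes F :: "nat \<Rightarrow> nat \<Rightarrow> 'a::comm_monoid_add"
  shows "(\<Sum>i<n. \<Sum>j<n. F i j) = (\<Sum>(i,j)\<in>{(i,j). i \<le> j \<and> j < n}. F i j + (if i = j then 0 else F j i))"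
proof -
  let ?I = "{(i,j). i \<le> j \<and> j < n}" and ?J = "{(i,j). i < j \<and> j < n}" and ?K = "{(i,j). j < i \<and> i < n}"
  have fin: "finite ?I" "finite ?J" "finite ?K"
    by (rule finite_subset[of _ "{..<n} \<times> {..<n}"]; auto)+
  have "(\<Sum>i<n. \<Sum>j<n. F i j) = (\<Sum>(i,j)\<in>?I \<union> ?K. F i j)"
    by (subst sum.cartesian_product) (auto intro!: sum.cong)
  also have "\<dots> = (\<Sum>(i,j)\<in>?I. F i j) + (\<Sum>(i,j)\<in>?K. F i j)"
    by (rule sum.union_disjoint) (use fin in auto)
  also have "(\<Sum>(i,j)\<in>?K. F i j) = (\<Sum>(i,j)\<in>?J. F j i)"
    by (rule sum.reindex_bij_witness[of _ prod.swap prod.swap]) auto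
  also have "\<dots> = (\<Sum>(i,j)\<in>?I. if i = j then 0 else F j i)"
    by (rule sum.mono_neutral_cong_left) (use fin in \<open>auto split: if_splits\<close>)
  finally show ?thesis by (simp add: sum.distrib split_beta')
qed

definition sym_ext :: "nat \<Rightarrow> (nat \<times> nat \<Rightarrow> real) \<Rightarrow> nat \<Rightarrow> nat \<Rightarrow> real" where
  "sym_ext n u i j = (if i < n \<and> j < n then (if i \<le> j then u (i,j) else u (j,i)) else 0)"

definition goe_entries :: "nat \<Rightarrow> (nat \<times> nat \<Rightarrow> real) measure" where
  "goe_entries n = PiM {(i,j). i \<le> j \<and> j < n} (\<lambda>p. gauss (if fst p = snd p then 2 / real n else 1 / real n))"

lemma GOE_eq_distr: "GOE n = distr (goe_entries n) fun2_space (sym_ext n)"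
  unfolding GOE_def goe_entries_def sym_ext_def[abs_def]
  by (intro arg_cong[where f="\<lambda>M. distr M _ _"] PiM_cong) auto

lemma prob_space_goe_entries: "n > 0 \<Longrightarrow> prob_space (goe_entries n)"
  unfolding goe_entries_def by (intro prob_space_PiM prob_space_gauss) auto

lemma sym_ext_measurable[measurable]: "sym_ext n \<in> measurable (goe_entries n) fun2_space"
proof -
  have c: "(\<lambda>u. u p) \<in> borel_measurable (goe_entries n)" if "p \<in> {(i,j). i \<le> j \<and> j < n}" for p
    using measurable_component_singleton[OF that, of "\<lambda>p. gauss (if fst p = snd p then 2 / real n else 1 / real n)"]
    unfolding goe_entries_def by (simp cong: measurable_cong_sets)
  have "(\<lambda>u. sym_ext n u i j) \<in> borel_measurable (goe_entries n)" for i j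
    unfolding sym_ext_def by (cases "i < n \<and> j < n"; cases "i \<le> j") (auto intro: c)
  then show ?thesis unfolding measurable_fun2_iff by blast
qed

lemma prob_space_GOE: "n > 0 \<Longrightarrow> prob_space (GOE n)"
  unfolding GOE_eq_distr by (intro prob_space.prob_space_distr prob_space_goe_entries) auto

lemma sets_GOE[simp, measurable_cong]: "sets (GOE n) = sets fun2_space"
  by (simp add: GOE_eq_distr)

lemma space_GOE[simp]: "space (GOE n) = UNIV"
  by (simp add: GOE_eq_distr)

text \<open>The exponent is the squared Frobenius norm of \<open>t + t^T\<close> over
  \<open>4 n\<close>: a diagonal entry contributes \<open>(2 t_ii)^2\<close>, an off-diagonal pair
  is counted twice. The doubled variance on the diagonal is exactly what makes it a Frobenius norm,
  hence rotation invariant.\<close>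

lemma char_sym_ext:
  assumes n: "n > 0"
  shows "(\<integral>u. iexp (\<Sum>i<n. \<Sum>j<n. t i j * sym_ext n u i j) \<partial>goe_entries n) =
    complex_of_real (exp (- (\<Sum>i<n. \<Sum>j<n. (t i j + t j i)\<^sup>2) / (4 * n)))"
proof -
  let ?I = "{(i,j). i \<le> j \<and> j < n}"
  let ?v = "\<lambda>p. if fst p = snd p then 2 / real n else 1 / real n"
  have fin: "finite ?I" by (rule finite_subset[of _ "{..<n} \<times> {..<n}"]) auto
  define c where "c p = t (fst p) (snd p) + (if fst p = snd p then 0 else t (snd p) (fst p))" for p
  have 1: "(\<Sum>i<n. \<Sum>j<n. t i j * sym_ext n u i j) = (\<Sum>p\<in>?I. c p * u p)" for u
    unfolding sum_square_split by (intro sum.cong refl) (auto simp: c_def sym_ext_def algebra_simps)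
  have 2: "(\<Sum>i<n. \<Sum>j<n. (t i j + t j i)\<^sup>2 / (4 * n)) = (\<Sum>p\<in>?I. ?v p * (c p)\<^sup>2 / 2)"
    unfolding sum_square_split using n by (intro sum.cong refl) (auto simp: c_def power2_eq_square field_simps)
  have "(\<integral>u. iexp (\<Sum>i<n. \<Sum>j<n. t i j * sym_ext n u i j) \<partial>goe_entries n) = complex_of_real (exp (- (\<Sum>p\<in>?I. ?v p * (c p)\<^sup>2) / 2))"
    unfolding 1 goe_entries_def by (rule char_PiM_gauss[OF fin]) (use n in auto)
  then show ?thesis using 2 by (simp add: sum_divide_distrib)
qed

lemma char_GOE:
  assumes n: "n > 0"
  shows "(\<integral>B. iexp (\<Sum>i<n. \<Sum>j<n. t i j * B i j) \<partial>GOE n) =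
    complex_of_real (exp (- (\<Sum>i<n. \<Sum>j<n. (t i j + t j i)\<^sup>2) / (4 * n)))"
  unfolding GOE_eq_distr char_sym_ext[OF n, symmetric] by (rule integral_distr) auto

section \<open>Resampling a GOE matrix along a direction\<close>

text \<open>The product \<open>(I - u u^T) B (I - u u^T)\<close> multiplied out: for a unit vector
  \<open>u\<close>, the two-sided compression of \<open>B\<close> to the orthogonal complement of
  \<open>u\<close>.\<close>

definition compress :: "nat \<Rightarrow> (nat \<Rightarrow> real) \<Rightarrow> (nat \<Rightarrow> nat \<Rightarrow> real) \<Rightarrow> nat \<Rightarrow> nat \<Rightarrow> real" where
  "compress n u B i j = B i j - u i * (\<Sum>k<n. u k * B k j) - (\<Sum>k<n. B i k * u k) * u j
     + (\<Sum>k<n. \<Sum>l<n. u k * B k l * u l) * u i * u j"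

lemma compress_inner:
  "(\<Sum>i<n. \<Sum>j<n. t i j * compress n u B i j) = (\<Sum>i<n. \<Sum>j<n. t i j * B i j)
     - (\<Sum>j<n. (\<Sum>k<n. u k * t k j) * (\<Sum>k<n. u k * B k j))
     - (\<Sum>i<n. (\<Sum>k<n. t i k * u k) * (\<Sum>k<n. B i k * u k))
     + (\<Sum>k<n. \<Sum>l<n. u k * t k l * u l) * (\<Sum>k<n. \<Sum>l<n. u k * B k l * u l)"
proof -
  let ?bl = "\<lambda>j. \<Sum>k<n. u k * B k j" and ?br = "\<lambda>i. \<Sum>k<n. B i k * u k" and ?q = "\<Sum>k<n. \<Sum>l<n. u k * B k l * u l"
  have "(\<Sum>i<n. \<Sum>j<n. t i j * compress n u B i j) = (\<Sum>i<n. \<Sum>j<n. t i j * B i j)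
    - (\<Sum>i<n. \<Sum>j<n. u i * t i j * ?bl j) - (\<Sum>i<n. \<Sum>j<n. t i j * u j * ?br i) + (\<Sum>i<n. \<Sum>j<n. u i * t i j * u j * ?q)"
    unfolding compress_def by (simp add: sum_subtractf[symmetric] sum.distrib[symmetric] algebra_simps)
  also have "(\<Sum>i<n. \<Sum>j<n. u i * t i j * ?bl j) = (\<Sum>j<n. (\<Sum>k<n. u k * t k j) * ?bl j)"
    by (subst sum.swap) (simp add: sum_distrib_right)
  also have "(\<Sum>i<n. \<Sum>j<n. t i j * u j * ?br i) = (\<Sum>i<n. (\<Sum>k<n. t i k * u k) * ?br i)"
    by (simp only: sum_distrib_right)
  also have "(\<Sum>i<n. \<Sum>j<n. u i * t i j * u j * ?q) = (\<Sum>k<n. \<Sum>l<n. u k * t k l * u l) * ?q"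
    by (simp only: sum_distrib_right)
  finally show ?thesis .
qed

lemma compress_adjoint:
  "(\<Sum>i<n. \<Sum>j<n. t i j * compress n u B i j) = (\<Sum>i<n. \<Sum>j<n. compress n u t i j * B i j)"
  using compress_inner[of t n u B] compress_inner[of B n u t] by (simp add: mult.commute)

text \<open>Pythagoras for the splitting of a symmetric matrix into its blocks along \<open>u\<close> and \<open>u\<close>'s complement.\<close>

lemma compress_norm:
  fixes S :: "nat \<Rightarrow> nat \<Rightarrow> real"
  assumes sym: "\<And>i j. S i j = S j i" and u: "(\<Sum>i<n. (u i)\<^sup>2) = 1"
  defines "p \<equiv> \<lambda>i. \<Sum>k<n. S i k * u k" and "q \<equiv> \<Sum>k<n. \<Sum>l<n. u k * S k l * u l"
  shows "(\<Sum>i<n. \<Sum>j<n. (compress n u S i j)\<^sup>2) + 2 * (\<Sum>i<n. (p i - q * u i)\<^sup>2) + q\<^sup>2 = (\<Sum>i<n. \<Sum>j<n. (S i j)\<^sup>2)"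
proof -
  have pl: "(\<Sum>k<n. u k * S k j) = p j" for j unfolding p_def using sym by (simp add: mult.commute)
  have pr: "(\<Sum>k<n. S j k * u k) = p j" for j by (simp add: p_def)
  have q: "q = (\<Sum>k<n. u k * p k)" unfolding p_def q_def by (simp add: sum_distrib_left mult.assoc)
  have C: "compress n u S i j = S i j - u i * p j - p i * u j + q * u i * u j" for i j
    unfolding compress_def pl q_def[symmetric] by (simp add: p_def)
  have l0: "(\<Sum>k<n. u k * compress n u S k j) = 0" for j
  proof -
    have "(\<Sum>k<n. u k * compress n u S k j) = (\<Sum>k<n. u k * S k j) - (\<Sum>k<n. (u k)\<^sup>2) * p j - (\<Sum>k<n. u k * p k) * u j + q * (\<Sum>k<n. (u k)\<^sup>2) * u j"
      unfolding C by (simp add: sum_subtractf[symmetric] sum.distrib[symmetric] sum_distrib_left sum_distrib_right power2_eq_square algebra_simps)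
    then show ?thesis using pl u q by simp
  qed
  have r0: "(\<Sum>k<n. compress n u S i k * u k) = 0" for i
    using l0[of i] unfolding C using sym by (simp add: mult.commute algebra_simps)
  have q0: "(\<Sum>k<n. \<Sum>l<n. u k * compress n u S k l * u l) = 0"
    using r0 by (simp add: mult.assoc flip: sum_distrib_left)
  have "(\<Sum>i<n. \<Sum>j<n. (compress n u S i j)\<^sup>2) = (\<Sum>i<n. \<Sum>j<n. compress n u S i j * S i j)"
    using compress_inner[of "compress n u S" n u S] by (simp add: l0 r0 q0 power2_eq_square)
  also have "\<dots> = (\<Sum>i<n. \<Sum>j<n. S i j * S i j) - (\<Sum>j<n. p j * p j) - (\<Sum>j<n. p j * p j) + q * q"
    using compress_inner[of S n u S] compress_adjoint[of S n u S] by (simp add: pl pr q_def[symmetric])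
  finally have 1: "(\<Sum>i<n. \<Sum>j<n. (compress n u S i j)\<^sup>2) = (\<Sum>i<n. \<Sum>j<n. S i j * S i j) - 2 * (\<Sum>j<n. p j * p j) + q * q" by simp
  have "(\<Sum>i<n. (p i - q * u i)\<^sup>2) = (\<Sum>i<n. p i * p i) - 2 * q * (\<Sum>i<n. u i * p i) + q * q * (\<Sum>i<n. (u i)\<^sup>2)"
    by (simp add: sum_subtractf[symmetric] sum.distrib[symmetric] sum_distrib_left power2_eq_square algebra_simps)
  then have 2: "(\<Sum>i<n. (p i - q * u i)\<^sup>2) = (\<Sum>i<n. p i * p i) - q * q" using u q by simp
  show ?thesis using 1 2 by (simp add: power2_eq_square)
qed

text \<open>Replace the row and column of \<open>B\<close> in direction \<open>u\<close> by fresh Gaussian noise \<open>\<zeta>\<close>.\<close>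

definition resample :: "nat \<Rightarrow> (nat \<Rightarrow> real) \<Rightarrow> (nat \<Rightarrow> real) \<Rightarrow> (nat \<Rightarrow> nat \<Rightarrow> real) \<Rightarrow> nat \<Rightarrow> nat \<Rightarrow> real" where
  "resample n u \<zeta> B i j = (if i < n \<and> j < n then compress n u B i j +
      ((\<zeta> i - vinner n u \<zeta> * u i) * u j + u i * (\<zeta> j - vinner n u \<zeta> * u j) + sqrt 2 * vinner n u \<zeta> * u i * u j) / sqrt n else 0)"

text \<open>The zero vector is what Gram--Schmidt returns in a degenerate step. Resampling along it
  leaves the \<open>n\<close> by \<open>n\<close> block of \<open>B\<close> as it is, so the GOE law
  is preserved in both cases.\<close>

definition unit_or_zero :: "nat \<Rightarrow> (nat \<Rightarrow> real) \<Rightarrow> bool" where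
  "unit_or_zero n u \<longleftrightarrow> vinner n u u = 1 \<or> (\<forall>i<n. u i = 0)"

text \<open>Splits a linear functional of the resampled matrix into one of the noise and one of
  \<open>B\<close>, ready for a product of characteristic functions. The factor
  \<open>sqrt 2 / 2\<close> is the \<open>sqrt 2\<close> in \<open>resample\<close> times a half,
  since \<open>q\<close> counts both \<open>t\<close> and its transpose.\<close>

lemma resample_inner:
  fixes t :: "nat \<Rightarrow> nat \<Rightarrow> real" and u :: "nat \<Rightarrow> real" and n :: nat
  defines "p \<equiv> \<lambda>i. \<Sum>k<n. (t i k + t k i) * u k" and "q \<equiv> \<Sum>k<n. \<Sum>l<n. u k * (t k l + t l k) * u l"
  shows "(\<Sum>i<n. \<Sum>j<n. t i j * resample n u \<zeta> B i j) =
    (\<Sum>k<n. ((p k - q * u k + sqrt 2 / 2 * q * u k) / sqrt n) * \<zeta> k) + (\<Sum>i<n. \<Sum>j<n. compress n u t i j * B i j)"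
proof -
  let ?c = "vinner n u \<zeta>"
  have q2: "2 * (\<Sum>i<n. \<Sum>j<n. t i j * u i * u j) = q"
  proof -
    have "q = (\<Sum>k<n. \<Sum>l<n. u k * t k l * u l) + (\<Sum>k<n. \<Sum>l<n. u k * t l k * u l)"
      unfolding q_def by (simp add: sum.distrib[symmetric] algebra_simps)
    also have "(\<Sum>k<n. \<Sum>l<n. u k * t l k * u l) = (\<Sum>k<n. \<Sum>l<n. u k * t k l * u l)"
      by (subst sum.swap) (simp add: mult_ac)
    finally show ?thesis by (simp add: mult_ac)
  qed
  have p2: "(\<Sum>i<n. p i * w i) = (\<Sum>i<n. \<Sum>j<n. t i j * (w i * u j + u i * w j))" for w
  proof -
    have "(\<Sum>i<n. p i * w i) = (\<Sum>i<n. \<Sum>j<n. t i j * w i * u j) + (\<Sum>i<n. \<Sum>j<n. t j i * w i * u j)"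
      unfolding p_def by (simp add: sum_distrib_right sum_distrib_left sum.distrib[symmetric] algebra_simps)
    also have "(\<Sum>i<n. \<Sum>j<n. t j i * w i * u j) = (\<Sum>i<n. \<Sum>j<n. t i j * w j * u i)" by (rule sum.swap)
    finally show ?thesis by (simp add: sum.distrib[symmetric] algebra_simps)
  qed
  have pu: "(\<Sum>i<n. p i * u i) = q" using p2[of u] q2 by (simp add: sum_distrib_left algebra_simps)
  have "(\<Sum>i<n. \<Sum>j<n. t i j * resample n u \<zeta> B i j) =
     (\<Sum>i<n. \<Sum>j<n. t i j * compress n u B i j) +
     (\<Sum>i<n. \<Sum>j<n. t i j * (\<zeta> i * u j + u i * \<zeta> j)) / sqrt n
     + (sqrt 2 - 2) * ?c * (\<Sum>i<n. \<Sum>j<n. t i j * u i * u j) / sqrt n"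
    unfolding resample_def
    by (simp add: sum_distrib_left sum_divide_distrib sum.distrib[symmetric])
      (intro sum.cong refl, simp add: add_divide_distrib diff_divide_distrib algebra_simps)
  also have "(\<Sum>i<n. \<Sum>j<n. t i j * compress n u B i j) = (\<Sum>i<n. \<Sum>j<n. compress n u t i j * B i j)" by (rule compress_adjoint)
  also have "(\<Sum>i<n. \<Sum>j<n. t i j * (\<zeta> i * u j + u i * \<zeta> j)) = (\<Sum>i<n. p i * \<zeta> i)" by (rule p2[symmetric])
  also have "(\<Sum>i<n. \<Sum>j<n. t i j * u i * u j) = q / 2" using q2 by simp
  finally have A: "(\<Sum>i<n. \<Sum>j<n. t i j * resample n u \<zeta> B i j) = (\<Sum>i<n. \<Sum>j<n. compress n u t i j * B i j) +
     ((\<Sum>i<n. p i * \<zeta> i) / sqrt n + (sqrt 2 - 2) * ?c * (q / 2) / sqrt n)" by simp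
  have "(\<Sum>i<n. p i * \<zeta> i) / sqrt n + (sqrt 2 - 2) * ?c * (q / 2) / sqrt n =
     (\<Sum>k<n. ((p k - q * u k + sqrt 2 / 2 * q * u k) / sqrt n) * \<zeta> k)"
    unfolding vinner_def by (simp add: sum_distrib_left sum_distrib_right sum_divide_distrib sum.distrib[symmetric])
      (intro sum.cong refl, simp add: add_divide_distrib diff_divide_distrib algebra_simps)
  then show ?thesis unfolding A by simp
qed

text \<open>\<open>compress_norm\<close> for \<open>t + t^T\<close> in the units of
  \<open>char_GOE\<close>. The component along \<open>u u^T\<close> carries
  \<open>sqrt 2 / 2\<close>; its square times the overall factor 2 restores \<open>q^2\<close>. This
  fixes the \<open>sqrt 2\<close> in \<open>resample\<close>.\<close>

lemma resample_variance:
  fixes t :: "nat \<Rightarrow> nat \<Rightarrow> real"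
  assumes u: "unit_or_zero n u"
  defines "p \<equiv> \<lambda>i. \<Sum>k<n. (t i k + t k i) * u k" and "q \<equiv> \<Sum>k<n. \<Sum>l<n. u k * (t k l + t l k) * u l"
  shows "(\<Sum>k<n. (p k - q * u k + sqrt 2 / 2 * q * u k)\<^sup>2) * 2 + (\<Sum>i<n. \<Sum>j<n. (compress n u t i j + compress n u t j i)\<^sup>2)
    = (\<Sum>i<n. \<Sum>j<n. (t i j + t j i)\<^sup>2)"
proof -
  define S where "S = (\<lambda>i j. t i j + t j i)"
  have cS: "compress n u t i j + compress n u t j i = compress n u S i j" if "i < n" "j < n" for i j
  proof -
    have "(\<Sum>k<n. \<Sum>l<n. u k * t k l * u l) = (\<Sum>k<n. \<Sum>l<n. u k * t l k * u l)" by (subst sum.swap) (simp add: mult_ac)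
    then have "(\<Sum>k<n. \<Sum>l<n. u k * S k l * u l) = 2 * (\<Sum>k<n. \<Sum>l<n. u k * t k l * u l)"
      by (simp add: S_def algebra_simps sum.distrib)
    then show ?thesis unfolding compress_def S_def by (simp add: algebra_simps sum.distrib)
  qed
  show ?thesis
  proof (cases "vinner n u u = 1")
    case False
    then have "u i = 0" if "i < n" for i using u that by (auto simp: unit_or_zero_def)
    then show ?thesis by (simp add: p_def q_def compress_def)
  next
    case True
    then have u1: "(\<Sum>i<n. (u i)\<^sup>2) = 1" by (simp add: vinner_def power2_eq_square)
    have pu: "(\<Sum>k<n. p k * u k) = q" unfolding p_def q_def by (simp add: sum_distrib_right sum_distrib_left mult_ac)
    have orth: "(\<Sum>k<n. (p k - q * u k) * u k) = 0"
    proof -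
      have "(\<Sum>k<n. (p k - q * u k) * u k) = (\<Sum>k<n. p k * u k) - q * (\<Sum>k<n. (u k)\<^sup>2)"
        by (simp add: left_diff_distrib sum_subtractf sum_distrib_left power2_eq_square mult.assoc)
      then show ?thesis using pu u1 by simp
    qed
    let ?a = "\<lambda>k. p k - q * u k"
    have sq: "(\<Sum>k<n. (x k + e * u k)\<^sup>2) = (\<Sum>k<n. (x k)\<^sup>2) + 2 * e * (\<Sum>k<n. x k * u k) + e\<^sup>2 * (\<Sum>k<n. (u k)\<^sup>2)" for x e
      by (simp add: power2_sum power_mult_distrib sum.distrib sum_distrib_left mult_ac)
    have "(\<Sum>k<n. (?a k + sqrt 2 / 2 * q * u k)\<^sup>2) = (\<Sum>k<n. (?a k)\<^sup>2) + q\<^sup>2 / 2"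
      unfolding sq orth u1 by (simp add: power_mult_distrib power_divide)
    then have 1: "(\<Sum>k<n. (?a k + sqrt 2 / 2 * q * u k)\<^sup>2) * 2 = 2 * (\<Sum>k<n. (?a k)\<^sup>2) + q\<^sup>2" by simp
    have 2: "(\<Sum>i<n. \<Sum>j<n. (compress n u S i j)\<^sup>2) + 2 * (\<Sum>i<n. (p i - q * u i)\<^sup>2) + q\<^sup>2 = (\<Sum>i<n. \<Sum>j<n. (S i j)\<^sup>2)"
      unfolding p_def q_def using compress_norm[of S u n] u1 by (simp add: S_def add.commute)
    have 3: "(\<Sum>i<n. \<Sum>j<n. (compress n u t i j + compress n u t j i)\<^sup>2) = (\<Sum>i<n. \<Sum>j<n. (compress n u S i j)\<^sup>2)"
      using cS by (intro sum.cong refl) auto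
    show ?thesis using 1 2 3 by (simp add: S_def)
  qed
qed

lemma resample_measurable:
  assumes "\<And>i. i < n \<Longrightarrow> (\<lambda>w. u w i) \<in> borel_measurable M" "\<And>i. i < n \<Longrightarrow> (\<lambda>w. \<zeta> w i) \<in> borel_measurable M"
    and B: "B \<in> measurable M fun2_space"
  shows "(\<lambda>w. resample n (u w) (\<zeta> w) (B w)) \<in> measurable M fun2_space"
proof -
  have [measurable]: "(\<lambda>w. B w i j) \<in> borel_measurable M" for i j using B by (simp add: measurable_fun2_iff)
  have "(\<lambda>w. resample n (u w) (\<zeta> w) (B w) i j) \<in> borel_measurable M" for i j
  proof (cases "i < n \<and> j < n")
    case True
    then have [measurable]: "(\<lambda>w. u w i) \<in> borel_measurable M" "(\<lambda>w. u w j) \<in> borel_measurable M"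
       "(\<lambda>w. \<zeta> w i) \<in> borel_measurable M" "(\<lambda>w. \<zeta> w j) \<in> borel_measurable M" using assms by auto
    have [measurable]: "(\<lambda>w. vinner n (u w) (\<zeta> w)) \<in> borel_measurable M"
      unfolding vinner_def using assms by (auto intro!: borel_measurable_sum borel_measurable_times)
    have "(\<lambda>w. \<Sum>k<n. u w k * B w k j) \<in> borel_measurable M" "(\<lambda>w. \<Sum>k<n. B w i k * u w k) \<in> borel_measurable M"
      "(\<lambda>w. \<Sum>k<n. \<Sum>l<n. u w k * B w k l * u w l) \<in> borel_measurable M"
      using assms by (auto intro!: borel_measurable_sum borel_measurable_times)
    then have [measurable]: "(\<lambda>w. compress n (u w) (B w) i j) \<in> borel_measurable M" unfolding compress_def by measurable
    show ?thesis using True by (simp only: resample_def simp_thms if_True) measurable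
  next
    case False
    then show ?thesis by (simp only: resample_def if_False) simp
  qed
  then show ?thesis unfolding measurable_fun2_iff by blast
qed

lemma gauss_vec_component:
  assumes "i < n"
  shows "(\<lambda>\<zeta>. \<zeta> i) \<in> borel_measurable (PiM {..<n} (\<lambda>_. gauss 1))"
proof -
  have eq: "sets (PiM {..<n} (\<lambda>_. gauss 1)) = sets (PiM {..<n} (\<lambda>_. borel))" by (intro sets_PiM_cong) auto
  show ?thesis unfolding measurable_cong_sets[OF eq refl] using assms by (intro measurable_component_singleton) auto
qed

text \<open>Any linear functional of the result is a sum of independent Gaussian parts from \<zeta>
  and \<open>B\<close>; by \<open>resample_variance\<close> their exponents add up to that of the
  GOE, and these functionals determine the law.\<close>

lemma resample_GOE:
  assumes n: "n > 0" and u: "unit_or_zero n u"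
  shows "distr (PiM {..<n} (\<lambda>_. gauss 1) \<Otimes>\<^sub>M GOE n) fun2_space (\<lambda>(\<zeta>, B). resample n u \<zeta> B) = GOE n"
proof -
  let ?N = "PiM {..<n} (\<lambda>_. gauss 1)"
  interpret N: prob_space ?N by (rule prob_space_gauss_vec)
  interpret G: prob_space "GOE n" by (rule prob_space_GOE[OF n])
  interpret NG: pair_prob_space ?N "GOE n" ..
  have c: "(\<lambda>w. fst w i) \<in> borel_measurable (?N \<Otimes>\<^sub>M GOE n)" if "i < n" for i
    using gauss_vec_component[OF that] by (rule measurable_compose[OF measurable_fst])
  have m[measurable]: "(\<lambda>w. resample n u (fst w) (snd w)) \<in> measurable (?N \<Otimes>\<^sub>M GOE n) fun2_space"
    by (rule resample_measurable) (auto simp: c)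
  have "distr (?N \<Otimes>\<^sub>M GOE n) fun2_space (\<lambda>w. resample n u (fst w) (snd w)) = distr (goe_entries n) fun2_space (sym_ext n)"
  proof (rule fun2_law_eqI[OF _ prob_space_goe_entries[OF n], of _ "{..<n} \<times> {..<n}"])
    fix t :: "nat \<Rightarrow> nat \<Rightarrow> real" and d :: real
    define p where "p = (\<lambda>i. \<Sum>k<n. (t i k + t k i) * u k)"
    define q where "q = (\<Sum>k<n. \<Sum>l<n. u k * (t k l + t l k) * u l)"
    define a where "a k = (p k - q * u k + sqrt 2 / 2 * q * u k) / sqrt n" for k
    let ?s = "compress n u t"
    let ?E = "exp (- (\<Sum>i<n. \<Sum>j<n. (t i j + t j i)\<^sup>2) / (4 * n))"
    have lin: "(\<Sum>i<n. \<Sum>j<n. t i j * resample n u \<zeta> B i j) = (\<Sum>k<n. a k * \<zeta> k) + (\<Sum>i<n. \<Sum>j<n. ?s i j * B i j)" for \<zeta> B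
      unfolding a_def p_def q_def by (rule resample_inner)
    have [measurable]: "(\<lambda>w. resample n u (fst w) (snd w) i j) \<in> borel_measurable (?N \<Otimes>\<^sub>M GOE n)" for i j
      using m unfolding measurable_fun2_iff by blast
    have "(\<integral>w. iexp (\<Sum>i<n. \<Sum>j<n. t i j * resample n u (fst w) (snd w) i j) \<partial>(?N \<Otimes>\<^sub>M GOE n))
       = (\<integral>\<zeta>. (\<integral>B. iexp (\<Sum>i<n. \<Sum>j<n. t i j * resample n u \<zeta> B i j) \<partial>GOE n) \<partial>?N)"
      by (subst NG.integral_fst'[symmetric]) (auto intro!: NG.integrable_iexp)
    also have "\<dots> = (\<integral>\<zeta>. iexp (\<Sum>k<n. a k * \<zeta> k) * (\<integral>B. iexp (\<Sum>i<n. \<Sum>j<n. ?s i j * B i j) \<partial>GOE n) \<partial>?N)"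
      unfolding lin by (simp add: distrib_left exp_add)
    also have "\<dots> = complex_of_real (exp (- (\<Sum>k<n. (a k)\<^sup>2) / 2)) * complex_of_real (exp (- (\<Sum>i<n. \<Sum>j<n. (?s i j + ?s j i)\<^sup>2) / (4 * n)))"
      unfolding char_GOE[OF n] using char_PiM_gauss[of "{..<n}" "\<lambda>_. 1" a] by simp
    also have "\<dots> = complex_of_real (exp (- (\<Sum>k<n. (a k)\<^sup>2) / 2 + - (\<Sum>i<n. \<Sum>j<n. (?s i j + ?s j i)\<^sup>2) / (4 * n)))"
      by (simp only: exp_add of_real_mult)
    also have "- (\<Sum>k<n. (a k)\<^sup>2) / 2 + - (\<Sum>i<n. \<Sum>j<n. (?s i j + ?s j i)\<^sup>2) / (4 * n) = - (\<Sum>i<n. \<Sum>j<n. (t i j + t j i)\<^sup>2) / (4 * n)"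
    proof -
      define X where "X = (\<Sum>k<n. (p k - q * u k + sqrt 2 / 2 * q * u k)\<^sup>2)"
      have X: "(\<Sum>k<n. (a k)\<^sup>2) = X / n"
        unfolding a_def X_def using n by (simp add: power_divide sum_divide_distrib[symmetric])
      have XY: "X * 2 + (\<Sum>i<n. \<Sum>j<n. (?s i j + ?s j i)\<^sup>2) = (\<Sum>i<n. \<Sum>j<n. (t i j + t j i)\<^sup>2)"
        unfolding X_def p_def q_def by (rule resample_variance[OF u])
      show ?thesis unfolding X XY[symmetric] using n by (simp add: field_simps)
    qed
    finally have ch: "(\<integral>w. iexp (\<Sum>(i,j)\<in>{..<n}\<times>{..<n}. t i j * resample n u (fst w) (snd w) i j) \<partial>(?N \<Otimes>\<^sub>M GOE n)) = complex_of_real ?E"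
      by (simp only: sum.cartesian_product)
    have ch2: "(\<integral>w. iexp (\<Sum>(i,j)\<in>{..<n}\<times>{..<n}. t i j * sym_ext n w i j) \<partial>goe_entries n) = complex_of_real ?E"
      using char_sym_ext[OF n, of t] by (simp only: sum.cartesian_product)
    have m2: "(\<lambda>w. \<Sum>(i,j)\<in>{..<n}\<times>{..<n}. t i j * sym_ext n w i j) \<in> borel_measurable (goe_entries n)"
      using sym_ext_measurable[of n] unfolding measurable_fun2_iff by (auto simp: split_beta' intro!: borel_measurable_sum borel_measurable_times)
    have m1: "(\<lambda>w. \<Sum>(i,j)\<in>{..<n}\<times>{..<n}. t i j * resample n u (fst w) (snd w) i j) \<in> borel_measurable (?N \<Otimes>\<^sub>M GOE n)"
      by (auto simp: split_beta' intro!: borel_measurable_sum borel_measurable_times)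
    show "(\<integral>w. cos ((\<Sum>(i,j)\<in>{..<n}\<times>{..<n}. t i j * resample n u (fst w) (snd w) i j) + d) \<partial>(?N \<Otimes>\<^sub>M GOE n)) =
      (\<integral>w. cos ((\<Sum>(i,j)\<in>{..<n}\<times>{..<n}. t i j * sym_ext n w i j) + d) \<partial>goe_entries n)"
      using cos_integral_of_char[OF NG.prob_space_axioms m1 ch] cos_integral_of_char[OF prob_space_goe_entries[OF n] m2 ch2] by simp
  qed (auto simp: NG.prob_space_axioms resample_def sym_ext_def)
  then show ?thesis by (simp add: GOE_eq_distr split_beta')
qed

section \<open>Iterated resampling along adapted directions\<close>

text \<open>The last direction is resampled innermost and \<open>u 1\<close> outermost. The outer
  layers know only the earlier noise vectors, so the GOE law can be restored layer by layer from the
  inside, whereas the images of the basis vectors are read off from the outside.\<close>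

primrec rebuild :: "nat \<Rightarrow> (nat \<Rightarrow> nat \<Rightarrow> real) \<Rightarrow> (nat \<Rightarrow> nat \<Rightarrow> real) \<Rightarrow> nat \<Rightarrow> (nat \<Rightarrow> nat \<Rightarrow> real) \<Rightarrow> nat \<Rightarrow> nat \<Rightarrow> real" where
  "rebuild n u z 0 B = B"
| "rebuild n u z (Suc k) B = rebuild n u z k (resample n (u (Suc k)) (z (Suc k)) B)"

lemma resample_cong:
  assumes "\<And>i. i < n \<Longrightarrow> u i = u' i" "\<And>i. i < n \<Longrightarrow> \<zeta> i = \<zeta>' i"
  shows "resample n u \<zeta> B = resample n u' \<zeta>' B"
proof (intro ext)
  fix i j
  have "vinner n u \<zeta> = vinner n u' \<zeta>'" using assms by (simp add: vinner_def)
  moreover have "compress n u B i j = compress n u' B i j" if "i < n" "j < n"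
    using assms that by (simp add: compress_def)
  ultimately show "resample n u \<zeta> B i j = resample n u' \<zeta>' B i j"
    using assms by (simp add: resample_def)
qed

lemma rebuild_cong:
  assumes "\<And>j i. j \<in> {1..k} \<Longrightarrow> i < n \<Longrightarrow> u j i = u' j i" "\<And>j i. j \<in> {1..k} \<Longrightarrow> i < n \<Longrightarrow> z j i = z' j i"
  shows "rebuild n u z k B = rebuild n u' z' k B"
  using assms
proof (induction k arbitrary: B)
  case (Suc k)
  have "resample n (u (Suc k)) (z (Suc k)) B = resample n (u' (Suc k)) (z' (Suc k)) B"
    by (rule resample_cong) (use Suc.prems in auto)
  then show ?case using Suc by simp
qed simp

lemma rebuild_add: "\<exists>B'. rebuild n u z (k + m) B = rebuild n u z k B'"
  by (induction m arbitrary: B) auto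

lemma rebuild_measurable:
  assumes "\<And>j i. j \<in> {1..k} \<Longrightarrow> i < n \<Longrightarrow> (\<lambda>w. u w j i) \<in> borel_measurable M"
    "\<And>j i. j \<in> {1..k} \<Longrightarrow> i < n \<Longrightarrow> (\<lambda>w. z w j i) \<in> borel_measurable M"
    and "B \<in> measurable M fun2_space"
  shows "(\<lambda>w. rebuild n (u w) (z w) k (B w)) \<in> measurable M fun2_space"
  using assms
proof (induction k arbitrary: B)
  case (Suc k)
  have "(\<lambda>w. resample n (u w (Suc k)) (z w (Suc k)) (B w)) \<in> measurable M fun2_space"
    by (rule resample_measurable) (use Suc.prems in auto)
  then show ?case using Suc by simp
qed simp

text \<open>Integrating over one coordinate a second time changes nothing. This lets the integral
  over that coordinate be done first while all others stay fixed.\<close>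

lemma nn_integral_PiM_resample:
  assumes I: "finite I" "k \<in> I" and M: "\<And>i. prob_space (M i)" and f: "f \<in> borel_measurable (PiM I M)"
  shows "(\<integral>\<^sup>+x. f x \<partial>PiM I M) = (\<integral>\<^sup>+x. (\<integral>\<^sup>+y. f (x(k := y)) \<partial>M k) \<partial>PiM I M)"
proof -
  interpret product_prob_space M
    by (simp add: product_prob_space_def product_prob_space_axioms_def product_sigma_finite_def M prob_space_imp_sigma_finite)
  let ?J = "I - {k}"
  have IJ: "insert k ?J = I" "finite ?J" "k \<notin> ?J" using I by auto
  have f': "f \<in> borel_measurable (PiM (insert k ?J) M)" using f IJ by simp
  have "(\<lambda>p. f ((fst p)(k := snd p))) \<in> borel_measurable (PiM I M \<Otimes>\<^sub>M M k)"
  proof -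
    have "(\<lambda>p. (fst p)(k := snd p)) \<in> measurable (PiM I M \<Otimes>\<^sub>M M k) (PiM I M)"
      by (rule measurable_fun_upd[where J = I]) (use I in auto)
    then show ?thesis using f by (rule measurable_compose)
  qed
  then have g: "(\<lambda>x. \<integral>\<^sup>+y. f (x(k := y)) \<partial>M k) \<in> borel_measurable (PiM I M)"
    by (intro M.borel_measurable_nn_integral) (simp add: split_beta')
  have "(\<integral>\<^sup>+x. (\<integral>\<^sup>+y. f (x(k := y)) \<partial>M k) \<partial>PiM I M) = (\<integral>\<^sup>+x. (\<integral>\<^sup>+y'. (\<integral>\<^sup>+y. f (x(k := y', k := y)) \<partial>M k) \<partial>M k) \<partial>PiM ?J M)"
    using product_nn_integral_insert[OF IJ(2,3), of "\<lambda>x. \<integral>\<^sup>+y. f (x(k := y)) \<partial>M k"] g IJ by simp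
  also have "\<dots> = (\<integral>\<^sup>+x. (\<integral>\<^sup>+y. f (x(k := y)) \<partial>M k) \<partial>PiM ?J M)"
    by (simp add: M.emeasure_space_1)
  also have "\<dots> = (\<integral>\<^sup>+x. f x \<partial>PiM I M)"
    using product_nn_integral_insert[OF IJ(2,3) f'] IJ by simp
  finally show ?thesis ..
qed

definition adapted :: "nat \<Rightarrow> nat \<Rightarrow> ((nat \<Rightarrow> nat \<Rightarrow> real) \<Rightarrow> nat \<Rightarrow> nat \<Rightarrow> real) \<Rightarrow> bool" where
  "adapted n T U \<longleftrightarrow> (\<forall>z z' k i. k \<in> {1..T} \<longrightarrow> i < n \<longrightarrow>
     (\<forall>j\<in>{1..<k}. \<forall>i<n. z j i = z' j i) \<longrightarrow> U z k i = U z' k i)"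

text \<open>By adaptedness none of the directions \<open>1\<close> to \<open>Suc k\<close> changes
  when \<open>z (Suc k)\<close> is replaced by \<zeta>. For the integral over \<zeta> and
  \<open>B\<close> the innermost layer is thus a resampling along a fixed vector, which
  \<open>resample_GOE\<close> removes.\<close>

lemma rebuild_nn_integral:
  assumes n: "n > 0" and ad: "adapted n T U"
    and U: "\<And>z k. k \<in> {1..T} \<Longrightarrow> unit_or_zero n (U z k)"
    and Um: "\<And>k i. k \<in> {1..T} \<Longrightarrow> i < n \<Longrightarrow> (\<lambda>z. U z k i) \<in> borel_measurable (noise_space n T)"
    and h: "h \<in> borel_measurable fun2_space" and "k \<le> T"
  shows "(\<integral>\<^sup>+z. (\<integral>\<^sup>+B. h (rebuild n (U z) z k B) \<partial>GOE n) \<partial>noise_space n T) = (\<integral>\<^sup>+B. h B \<partial>GOE n)"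
  using \<open>k \<le> T\<close>
proof (induction k)
  case 0
  show ?case by (simp add: prob_space.emeasure_space_1[OF prob_space_noise])
next
  case (Suc k)
  let ?N = "noise_space n T" and ?v = "PiM {..<n} (\<lambda>_. gauss 1)"
  interpret v: prob_space ?v by (rule prob_space_gauss_vec)
  interpret G: prob_space "GOE n" by (rule prob_space_GOE[OF n])
  interpret vG: pair_prob_space ?v "GOE n" ..
  have kT: "Suc k \<in> {1..T}" using Suc.prems by auto
  have rm: "(\<lambda>p. rebuild n (U (fst p)) (fst p) k' (snd p)) \<in> measurable (?N \<Otimes>\<^sub>M GOE n) fun2_space" if "k' \<le> T" for k'
    by (rule rebuild_measurable)
      (use that in \<open>auto intro!: measurable_compose[OF measurable_fst] Um noise_component\<close>)
  have hm: "(\<lambda>z. \<integral>\<^sup>+B. h (rebuild n (U z) z (Suc k) B) \<partial>GOE n) \<in> borel_measurable ?N"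
    using measurable_compose[OF rm[OF Suc.prems] h]
    by (intro G.borel_measurable_nn_integral) (simp add: split_beta')
  have "(\<integral>\<^sup>+z. (\<integral>\<^sup>+B. h (rebuild n (U z) z (Suc k) B) \<partial>GOE n) \<partial>?N) =
    (\<integral>\<^sup>+z. (\<integral>\<^sup>+\<zeta>. (\<integral>\<^sup>+B. h (rebuild n (U (z(Suc k := \<zeta>))) (z(Suc k := \<zeta>)) (Suc k) B) \<partial>GOE n) \<partial>?v) \<partial>?N)"
    using hm unfolding noise_space_def
    by (intro nn_integral_PiM_resample) (use kT prob_space_gauss_vec in auto)
  also have "\<dots> = (\<integral>\<^sup>+z. (\<integral>\<^sup>+B. h (rebuild n (U z) z k B) \<partial>GOE n) \<partial>?N)"
  proof (rule nn_integral_cong)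
    fix z :: "nat \<Rightarrow> nat \<Rightarrow> real"
    have Ueq: "U (z(Suc k := \<zeta>)) j i = U z j i" if "j \<in> {1..Suc k}" "i < n" for j i \<zeta>
      using ad that kT unfolding adapted_def by fastforce
    have red: "rebuild n (U (z(Suc k := \<zeta>))) (z(Suc k := \<zeta>)) (Suc k) B = rebuild n (U z) z k (resample n (U z (Suc k)) \<zeta> B)" for \<zeta> B
    proof -
      have "rebuild n (U (z(Suc k := \<zeta>))) (z(Suc k := \<zeta>)) (Suc k) B =
          rebuild n (U (z(Suc k := \<zeta>))) (z(Suc k := \<zeta>)) k (resample n (U z (Suc k)) \<zeta> B)"
        using resample_cong[of n "U (z(Suc k := \<zeta>)) (Suc k)" "U z (Suc k)" \<zeta> \<zeta> B] Ueq by simp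
      also have "\<dots> = rebuild n (U z) z k (resample n (U z (Suc k)) \<zeta> B)"
        by (rule rebuild_cong) (use Ueq in auto)
      finally show ?thesis .
    qed
    have gm: "(\<lambda>B. h (rebuild n (U z) z k B)) \<in> borel_measurable fun2_space"
      by (rule measurable_compose[OF rebuild_measurable h]) auto
    have rs: "(\<lambda>w. resample n (U z (Suc k)) (fst w) (snd w)) \<in> measurable (?v \<Otimes>\<^sub>M GOE n) fun2_space"
      by (rule resample_measurable) (auto intro!: measurable_compose[OF measurable_fst] gauss_vec_component)
    have "(\<integral>\<^sup>+\<zeta>. (\<integral>\<^sup>+B. h (rebuild n (U z) z k (resample n (U z (Suc k)) \<zeta> B)) \<partial>GOE n) \<partial>?v) =
      (\<integral>\<^sup>+w. h (rebuild n (U z) z k (resample n (U z (Suc k)) (fst w) (snd w))) \<partial>(?v \<Otimes>\<^sub>M GOE n))"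
      using G.nn_integral_fst[OF measurable_compose[OF rs gm]] by simp
    also have "\<dots> = (\<integral>\<^sup>+B. h (rebuild n (U z) z k B) \<partial>distr (?v \<Otimes>\<^sub>M GOE n) fun2_space (\<lambda>w. resample n (U z (Suc k)) (fst w) (snd w)))"
      by (rule nn_integral_distr[symmetric, OF rs]) (simp add: gm)
    also have "\<dots> = (\<integral>\<^sup>+B. h (rebuild n (U z) z k B) \<partial>GOE n)"
      using resample_GOE[OF n U[OF kT]] by (simp add: split_beta')
    finally show "(\<integral>\<^sup>+\<zeta>. (\<integral>\<^sup>+B. h (rebuild n (U (z(Suc k := \<zeta>))) (z(Suc k := \<zeta>)) (Suc k) B) \<partial>GOE n) \<partial>?v) =
      (\<integral>\<^sup>+B. h (rebuild n (U z) z k B) \<partial>GOE n)" unfolding red .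
  qed
  also have "\<dots> = (\<integral>\<^sup>+B. h B \<partial>GOE n)" using Suc by simp
  finally show ?case .
qed

lemma rebuild_law:
  assumes n: "n > 0" and ad: "adapted n T U"
    and U: "\<And>z k. k \<in> {1..T} \<Longrightarrow> unit_or_zero n (U z k)"
    and Um: "\<And>k i. k \<in> {1..T} \<Longrightarrow> i < n \<Longrightarrow> (\<lambda>z. U z k i) \<in> borel_measurable (noise_space n T)"
  shows "(\<lambda>(z, B). rebuild n (U z) z T B) \<in> measurable (noise_space n T \<Otimes>\<^sub>M GOE n) fun2_space"
    and "distr (noise_space n T \<Otimes>\<^sub>M GOE n) fun2_space (\<lambda>(z, B). rebuild n (U z) z T B) = GOE n"
proof -
  interpret G: prob_space "GOE n" by (rule prob_space_GOE[OF n])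
  have "(\<lambda>p. rebuild n (U (fst p)) (fst p) T (snd p)) \<in> measurable (noise_space n T \<Otimes>\<^sub>M GOE n) fun2_space"
    by (rule rebuild_measurable) (auto intro!: measurable_compose[OF measurable_fst] Um noise_component)
  then show m: "(\<lambda>(z, B). rebuild n (U z) z T B) \<in> measurable (noise_space n T \<Otimes>\<^sub>M GOE n) fun2_space"
    by (simp add: split_beta')
  show "distr (noise_space n T \<Otimes>\<^sub>M GOE n) fun2_space (\<lambda>(z, B). rebuild n (U z) z T B) = GOE n"
  proof (rule measure_eqI)
    fix A assume "A \<in> sets (distr (noise_space n T \<Otimes>\<^sub>M GOE n) fun2_space (\<lambda>(z, B). rebuild n (U z) z T B))"
    then have A[measurable]: "A \<in> sets fun2_space" by simp
    have i: "indicator A \<in> borel_measurable fun2_space" by measurable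
    have "emeasure (distr (noise_space n T \<Otimes>\<^sub>M GOE n) fun2_space (\<lambda>(z, B). rebuild n (U z) z T B)) A
      = (\<integral>\<^sup>+x. indicator A x \<partial>distr (noise_space n T \<Otimes>\<^sub>M GOE n) fun2_space (\<lambda>(z, B). rebuild n (U z) z T B))"
      by simp
    also have "\<dots> = (\<integral>\<^sup>+p. indicator A (case p of (z, B) \<Rightarrow> rebuild n (U z) z T B) \<partial>(noise_space n T \<Otimes>\<^sub>M GOE n))"
      by (rule nn_integral_distr[OF m]) simp
    also have "\<dots> = (\<integral>\<^sup>+z. (\<integral>\<^sup>+B. indicator A (rebuild n (U z) z T B) \<partial>GOE n) \<partial>noise_space n T)"
      using G.nn_integral_fst[OF measurable_compose[OF m i]] by simp
    also have "\<dots> = (\<integral>\<^sup>+B. indicator A B \<partial>GOE n)"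
      by (rule rebuild_nn_integral[OF n ad U Um i]) auto
    finally show "emeasure (distr (noise_space n T \<Otimes>\<^sub>M GOE n) fun2_space (\<lambda>(z, B). rebuild n (U z) z T B)) A = emeasure (GOE n) A"
      by simp
  qed simp
qed

section \<open>The rebuilt matrix applied to vectors\<close>

lemma vinner_commute: "vinner n x y = vinner n y x"
  by (simp add: vinner_def mult.commute)

lemma vinner_cong_right: "(\<And>i. i < n \<Longrightarrow> a i = b i) \<Longrightarrow> vinner n w a = vinner n w b"
  by (simp add: vinner_def)

lemma vinner_right_linear:
  "vinner n w (\<lambda>i. a i + b i) = vinner n w a + vinner n w b"
  "vinner n w (\<lambda>i. a i - b i) = vinner n w a - vinner n w b"
  "vinner n w (\<lambda>i. c * a i) = c * vinner n w a"
  by (simp_all add: vinner_def algebra_simps sum.distrib sum_subtractf sum_distrib_left)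

lemma compress_matvec:
  "matvec n (compress n u B) v i = matvec n B v i - u i * vinner n u (matvec n B v) - matvec n B u i * vinner n u v
     + vinner n u (matvec n B u) * u i * vinner n u v"
proof -
  have "(\<Sum>j<n. (\<Sum>k<n. u k * B k j) * v j) = vinner n u (matvec n B v)"
    unfolding vinner_def matvec_def sum_distrib_left sum_distrib_right by (subst sum.swap) (simp add: mult_ac)
  moreover have "(\<Sum>k<n. \<Sum>l<n. u k * B k l * u l) = vinner n u (matvec n B u)"
    unfolding vinner_def matvec_def sum_distrib_left by (simp add: mult_ac)
  moreover have "(\<Sum>k<n. B i k * u k) = matvec n B u i" by (simp add: matvec_def)
  ultimately show ?thesis
    unfolding matvec_def[of n "compress n u B"] compress_def
    by (simp add: left_diff_distrib distrib_right sum.distrib sum_subtractf mult.assoc flip: sum_distrib_left)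
      (simp add: matvec_def vinner_def)
qed

lemma resample_matvec:
  assumes "i < n"
  shows "matvec n (resample n u \<zeta> B) v i = matvec n (compress n u B) v i +
    ((\<zeta> i - vinner n u \<zeta> * u i) * vinner n u v + u i * (vinner n \<zeta> v - vinner n u \<zeta> * vinner n u v)
       + sqrt 2 * vinner n u \<zeta> * u i * vinner n u v) / sqrt n"
proof -
  have "matvec n (resample n u \<zeta> B) v i = (\<Sum>j<n. compress n u B i j * v j +
    ((\<zeta> i - vinner n u \<zeta> * u i) * (u j * v j) + (u i * (\<zeta> j * v j) - u i * vinner n u \<zeta> * (u j * v j)) + sqrt 2 * vinner n u \<zeta> * u i * (u j * v j)) / sqrt n)"
    unfolding matvec_def resample_def using assms by (intro sum.cong refl) (simp add: field_simps)
  also have "\<dots> = matvec n (compress n u B) v i + 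
    ((\<zeta> i - vinner n u \<zeta> * u i) * vinner n u v + (u i * vinner n \<zeta> v - u i * vinner n u \<zeta> * vinner n u v) + sqrt 2 * vinner n u \<zeta> * u i * vinner n u v) / sqrt n"
    by (simp add: sum.distrib sum_subtractf vinner_def matvec_def flip: sum_distrib_left sum_divide_distrib)
  finally show ?thesis by (simp add: algebra_simps)
qed

lemma resample_matvec_orthogonal:
  assumes "i < n" "vinner n u v = 0"
  shows "matvec n (resample n u \<zeta> B) v i = matvec n B v i - u i * vinner n u (matvec n B v) + u i * vinner n \<zeta> v / sqrt n"
  using assms by (simp add: resample_matvec compress_matvec)

lemma resample_matvec_unit:
  assumes "i < n" "vinner n u u = 1"
  shows "matvec n (resample n u \<zeta> B) u i = (\<zeta> i + (sqrt 2 - 1) * vinner n u \<zeta> * u i) / sqrt n"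
  using assms vinner_commute[of n \<zeta> u] by (simp add: resample_matvec compress_matvec algebra_simps)

text \<open>Each layer whose direction is orthogonal to \<open>v\<close> removes the component of
  the image along \<open>u j\<close> and puts the inner product of \<open>z j\<close> with
  \<open>v\<close> there instead. Orthogonality among the \<open>u j\<close> keeps the layers from
  interfering.\<close>

lemma rebuild_matvec_orthogonal:
  assumes "\<And>j. j \<in> {1..k} \<Longrightarrow> vinner n (u j) v = 0"
    and "\<And>j l. j \<in> {1..k} \<Longrightarrow> l \<in> {1..k} \<Longrightarrow> j \<noteq> l \<Longrightarrow> vinner n (u j) (u l) = 0" and "i < n"
  shows "matvec n (rebuild n u z k B) v i = matvec n B v i - (\<Sum>j\<in>{1..k}. u j i * vinner n (u j) (matvec n B v))
     + (\<Sum>j\<in>{1..k}. u j i * vinner n (z j) v) / sqrt n"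
  using assms
proof (induction k arbitrary: B)
  case (Suc k)
  let ?w = "u (Suc k)" and ?B = "resample n (u (Suc k)) (z (Suc k)) B"
  have r: "matvec n ?B v l = matvec n B v l - ?w l * vinner n ?w (matvec n B v) + ?w l * vinner n (z (Suc k)) v / sqrt n"
    if "l < n" for l
    by (rule resample_matvec_orthogonal) (use that Suc.prems in auto)
  have "vinner n (u j) (matvec n ?B v) = vinner n (u j) (matvec n B v)" if j: "j \<in> {1..k}" for j
  proof -
    have "vinner n (u j) (matvec n ?B v) = vinner n (u j) (matvec n B v) - vinner n (u j) ?w * vinner n ?w (matvec n B v)
       + vinner n (u j) ?w * (vinner n (z (Suc k)) v / sqrt n)"
    proof -
      have "vinner n (u j) (matvec n ?B v) = vinner n (u j) (\<lambda>l. matvec n B v l - vinner n ?w (matvec n B v) * ?w l + (vinner n (z (Suc k)) v / sqrt n) * ?w l)"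
        using r by (intro vinner_cong_right) (simp add: mult.commute)
      then show ?thesis by (simp only: vinner_right_linear) simp
    qed
    moreover have "vinner n (u j) ?w = 0" using Suc.prems j by auto
    ultimately show ?thesis by simp
  qed
  then have "(\<Sum>j\<in>{1..k}. u j i * vinner n (u j) (matvec n ?B v)) = (\<Sum>j\<in>{1..k}. u j i * vinner n (u j) (matvec n B v))"
    by simp
  moreover have "matvec n (rebuild n u z k ?B) v i = matvec n ?B v i - (\<Sum>j\<in>{1..k}. u j i * vinner n (u j) (matvec n ?B v))
     + (\<Sum>j\<in>{1..k}. u j i * vinner n (z j) v) / sqrt n"
    by (rule Suc.IH) (use Suc.prems in auto)
  ultimately show ?case using r[OF \<open>i < n\<close>] by (simp add: add_divide_distrib)
qed simp

text \<open>The layers inside that of \<open>u s\<close> only produce some matrix \<open>B'\<close>,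
  whose action on \<open>u s\<close> is overwritten by the resampling along \<open>u s\<close>; the
  layers outside have directions orthogonal to \<open>u s\<close>. The result does not involve
  \<open>B\<close>, and therefore the iteration can be run from \<open>z\<close> alone.\<close>

lemma rebuild_matvec_basis:
  assumes s: "s \<in> {1..T}" and unit: "vinner n (u s) (u s) = 1"
    and orth: "\<And>j l. j \<in> {1..T} \<Longrightarrow> l \<in> {1..T} \<Longrightarrow> j \<noteq> l \<Longrightarrow> vinner n (u j) (u l) = 0" and i: "i < n"
  shows "matvec n (rebuild n u z T B) (u s) i = (z s i + (sqrt 2 - 1) * vinner n (u s) (z s) * u s i
     - (\<Sum>j\<in>{1..<s}. u j i * vinner n (u j) (z s)) + (\<Sum>j\<in>{1..<s}. u j i * vinner n (z j) (u s))) / sqrt n"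
proof -
  obtain k where k: "s = Suc k" using s by (cases s) auto
  obtain B' where "rebuild n u z (s + (T - s)) B = rebuild n u z s B'" using rebuild_add by blast
  moreover have "s + (T - s) = T" using s by auto
  ultimately have B': "rebuild n u z T B = rebuild n u z k (resample n (u s) (z s) B')" using k by simp
  let ?B = "resample n (u s) (z s) B'"
  have r: "matvec n ?B (u s) l = (z s l + (sqrt 2 - 1) * vinner n (u s) (z s) * u s l) / sqrt n" if "l < n" for l
    by (rule resample_matvec_unit[OF that unit])
  have "vinner n (u j) (matvec n ?B (u s)) = vinner n (u j) (z s) / sqrt n" if j: "j \<in> {1..k}" for j
  proof -
    have "vinner n (u j) (matvec n ?B (u s)) = vinner n (u j) (z s) / sqrt n + (sqrt 2 - 1) * vinner n (u s) (z s) * vinner n (u j) (u s) / sqrt n"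
    proof -
      have "vinner n (u j) (matvec n ?B (u s)) = vinner n (u j) (\<lambda>l. (1 / sqrt n) * (z s l + (sqrt 2 - 1) * vinner n (u s) (z s) * u s l))"
        using r by (intro vinner_cong_right) simp
      then show ?thesis by (simp only: vinner_right_linear) (simp add: add_divide_distrib)
    qed
    moreover have "vinner n (u j) (u s) = 0" using orth j s k by auto
    ultimately show ?thesis by simp
  qed
  then have "(\<Sum>j\<in>{1..k}. u j i * vinner n (u j) (matvec n ?B (u s))) = (\<Sum>j\<in>{1..k}. u j i * vinner n (u j) (z s)) / sqrt n"
    by (simp add: sum_divide_distrib)
  moreover have "matvec n (rebuild n u z k ?B) (u s) i = matvec n ?B (u s) i - (\<Sum>j\<in>{1..k}. u j i * vinner n (u j) (matvec n ?B (u s)))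
     + (\<Sum>j\<in>{1..k}. u j i * vinner n (z j) (u s)) / sqrt n"
    by (rule rebuild_matvec_orthogonal) (use orth s k i in auto)
  moreover have "{1..<s} = {1..k}" using k by auto
  ultimately show ?thesis unfolding B' using r[OF i] by (simp add: add_divide_distrib diff_divide_distrib)
qed

section \<open>The coupled first-order method\<close>

lemma sets_fun2_space: "sets fun2_space = sets borel"
proof -
  have "sets (PiM UNIV (\<lambda>_::nat. borel :: real measure)) = sets borel" by (rule sets_PiM_equal_borel)
  then have "sets fun2_space = sets (PiM UNIV (\<lambda>_::nat. borel :: (nat \<Rightarrow> real) measure))"
    unfolding fun2_space_def by (rule sets_PiM_cong[OF refl])
  also have "\<dots> = sets borel" by (rule sets_PiM_equal_borel)
  finally show ?thesis .
qed

lemma continuous_on_component2: "continuous_on UNIV (\<lambda>x :: nat \<Rightarrow> nat \<Rightarrow> real. x s i)"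
  by (rule continuous_on_product_then_coordinatewise, rule continuous_on_product_coordinates)

lemma abs_le_vnorm: "i < n \<Longrightarrow> \<bar>x i\<bar> \<le> vnorm n x"
  unfolding vnorm_def using member_le_sum[of i "{..<n}" "\<lambda>i. (x i)\<^sup>2"] by (intro real_le_rsqrt) auto

text \<open>The Lipschitz bound involves finitely many coordinates, each continuous in the product
  topology. As the Borel sets of that topology are those of \<open>fun2_space\<close>, measurability
  of \<open>f\<close> and \<open>g\<close> follows from the Lipschitz hypothesis.\<close>

lemma hist_lipschitz_continuous:
  assumes "hist_lipschitz n t L F" "i < n"
  shows "continuous_on UNIV (\<lambda>xs. F xs i)"
proof -
  have "((\<lambda>xs. F xs i) \<longlongrightarrow> F ys i) (at ys)" for ys
  proof (rule LIM_zero_cancel, rule Lim_null_comparison)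
    let ?b = "\<lambda>xs. L * sqrt (\<Sum>s\<in>{1..<t}. (vnorm n (\<lambda>i. xs s i - ys s i))\<^sup>2)"
    have "norm (F xs i - F ys i) \<le> ?b xs" for xs
      unfolding real_norm_def
      by (rule order_trans[OF abs_le_vnorm[OF assms(2), of "\<lambda>i. F xs i - F ys i"] assms(1)[unfolded hist_lipschitz_def, rule_format]])
    then show "\<forall>\<^sub>F xs in at ys. norm (F xs i - F ys i) \<le> ?b xs" by simp
    have "continuous_on UNIV ?b" unfolding vnorm_def
      by (intro continuous_intros continuous_on_component2)
    then have "(?b \<longlongrightarrow> ?b ys) (at ys)" unfolding continuous_on_def by blast
    moreover have "?b ys = 0" by (simp add: vnorm_def)
    ultimately show "(?b \<longlongrightarrow> 0) (at ys)" by metis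
  qed
  then show ?thesis by (simp add: continuous_on_def)
qed

definition nonanticipative :: "nat \<Rightarrow> nat \<Rightarrow> ((nat \<Rightarrow> nat \<Rightarrow> real) \<Rightarrow> (nat \<Rightarrow> real)) \<Rightarrow> bool" where
  "nonanticipative n t F \<longleftrightarrow> (\<forall>xs ys. (\<forall>s\<in>{1..<t}. \<forall>i<n. xs s i = ys s i) \<longrightarrow> (\<forall>i<n. F xs i = F ys i))"

definition components_measurable :: "nat \<Rightarrow> ((nat \<Rightarrow> nat \<Rightarrow> real) \<Rightarrow> (nat \<Rightarrow> real)) \<Rightarrow> bool" where
  "components_measurable n F \<longleftrightarrow> (\<forall>i<n. (\<lambda>xs. F xs i) \<in> borel_measurable fun2_space)"

text \<open>For histories that agree before \<open>t\<close> the right-hand side of the Lipschitz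
  bound is 0, so causality is built into \<open>hist_lipschitz\<close> although \<open>F\<close>
  formally receives the whole history.\<close>

lemma hist_lipschitz_nonanticipative:
  assumes "hist_lipschitz n t L F"
  shows "nonanticipative n t F"
  unfolding nonanticipative_def
proof (intro allI impI)
  fix xs ys :: "nat \<Rightarrow> nat \<Rightarrow> real" and i assume eq: "\<forall>s\<in>{1..<t}. \<forall>i<n. xs s i = ys s i" and i: "i < n"
  have z: "(\<Sum>s\<in>{1..<t}. (vnorm n (\<lambda>i. xs s i - ys s i))\<^sup>2) = 0"
    by (intro sum.neutral ballI) (use eq in \<open>simp add: vnorm_def\<close>)
  have "vnorm n (\<lambda>i. F xs i - F ys i) \<le> 0"
    using assms[unfolded hist_lipschitz_def, rule_format, of xs ys] unfolding z by simp
  then show "F xs i = F ys i" using abs_le_vnorm[OF i, of "\<lambda>i. F xs i - F ys i"] by simp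
qed

lemma hist_lipschitz_components_measurable:
  assumes "hist_lipschitz n t L F"
  shows "components_measurable n F"
  unfolding components_measurable_def
  using borel_measurable_continuous_onI[OF hist_lipschitz_continuous[OF assms]]
  by (simp add: measurable_cong_sets[OF sets_fun2_space refl])

lemma hist_outside: "s = 0 \<or> k < s \<Longrightarrow> hist F k s = (\<lambda>i. 0)"
  by (induction k) auto

lemma hist_mono: "s \<le> k \<Longrightarrow> hist F k s = hist F s s"
  by (induction k) (auto simp: le_Suc_eq)

lemma hist_step: "s \<in> {1..k} \<Longrightarrow> hist F k s = F s (hist F (s - 1))"
  using hist_mono[of s k F] by (cases s) auto

lemma hist_agree: "s < t \<Longrightarrow> t \<le> Suc k \<Longrightarrow> hist F (t - 1) s = hist F k s"
  using hist_mono[of s k F] hist_mono[of s "t - 1" F] by auto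

lemma hist_cong: "(\<And>t xs. t \<in> {1..k} \<Longrightarrow> F t xs = G t xs) \<Longrightarrow> hist F k = hist G k"
  by (induction k) auto

lemma trunc_cong: "(\<And>i. i < n \<Longrightarrow> a i = b i) \<Longrightarrow> trunc n a = trunc n b"
  by (auto simp: trunc_def)

text \<open>\<open>hist\<close> feeds step \<open>s\<close> with the history cut off at
  \<open>s - 1\<close>. Causality allows the full trajectory in its place, which turns the recursion
  into a system of equations for a single array.\<close>

lemma hist_trunc_step:
  assumes "s \<in> {1..k}" "nonanticipative n s (F s)"
  shows "hist (\<lambda>t xs. trunc n (F t xs)) k s = trunc n (F s (hist (\<lambda>t xs. trunc n (F t xs)) k))"
proof -
  let ?H = "hist (\<lambda>t xs. trunc n (F t xs))"
  have "?H (s - 1) r i = ?H k r i" if "r \<in> {1..<s}" for r i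
    using hist_agree[of r s k] that assms(1) by auto
  then have "trunc n (F s (?H (s - 1))) = trunc n (F s (?H k))"
    by (intro trunc_cong) (use assms(2) in \<open>auto simp: nonanticipative_def\<close>)
  then show ?thesis using hist_step[OF assms(1), of "\<lambda>t xs. trunc n (F t xs)"] by simp
qed

text \<open>The converse reading: an array that solves the equations is the trajectory. It serves to
  recognise the coupled iteration as the first-order method.\<close>

lemma hist_unique:
  assumes "\<And>s. s \<in> {1..k} \<Longrightarrow> X s = F s X" "\<And>s. s \<notin> {1..k} \<Longrightarrow> X s = (\<lambda>i. 0)"
    and "\<And>s xs ys. s \<in> {1..k} \<Longrightarrow> (\<And>r. r \<in> {1..<s} \<Longrightarrow> xs r = ys r) \<Longrightarrow> F s xs = F s ys"
  shows "hist F k = X"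
proof
  fix s
  show "hist F k s = X s"
  proof (induction s rule: less_induct)
    case (less s)
    show ?case
    proof (cases "s \<in> {1..k}")
      case True
      have "hist F (s - 1) r = X r" if "r \<in> {1..<s}" for r
        using less[of r] hist_agree[of r s k F] that True by auto
      then show ?thesis using assms(1,3)[OF True] hist_step[OF True, of F] by metis
    next
      case False
      then show ?thesis using hist_outside[of s k F] assms(2) by (cases "s = 0") auto
    qed
  qed
qed

lemma hist_measurable:
  assumes "\<And>t X i. t \<in> {1..k} \<Longrightarrow> X \<in> measurable M fun2_space \<Longrightarrow> (\<lambda>w. F w t (X w) i) \<in> borel_measurable M"
  shows "(\<lambda>w. hist (F w) k) \<in> measurable M fun2_space"
  using assms
proof (induction k)
  case 0
  show ?case by (auto simp: measurable_fun2_iff)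
next
  case (Suc k)
  then have IH: "(\<lambda>w. hist (F w) k) \<in> measurable M fun2_space" by simp
  have "(\<lambda>w. F w (Suc k) (hist (F w) k) i) \<in> borel_measurable M" for i
    using Suc.prems[of "Suc k", OF _ IH] by simp
  moreover have "(\<lambda>w. hist (F w) k s i) \<in> borel_measurable M" for s i
    using IH unfolding measurable_fun2_iff by blast
  ultimately have "(\<lambda>w. hist (F w) (Suc k) s i) \<in> borel_measurable M" for s i
    by (cases "s = Suc k") auto
  then show ?case unfolding measurable_fun2_iff by blast
qed

lemma trunc_component_measurable:
  "(i < n \<Longrightarrow> (\<lambda>w. a w i) \<in> borel_measurable M) \<Longrightarrow> (\<lambda>w. trunc n (a w) i) \<in> borel_measurable M"
  by (cases "i < n") (simp_all add: trunc_def)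

lemma components_measurable_compose:
  "components_measurable n F \<Longrightarrow> X \<in> measurable M fun2_space \<Longrightarrow> i < n \<Longrightarrow> (\<lambda>w. F (X w) i) \<in> borel_measurable M"
  using measurable_compose[of X M fun2_space "\<lambda>xs. F xs i" borel] by (simp add: components_measurable_def)

lemma vinner_measurable:
  assumes "\<And>i. i < n \<Longrightarrow> (\<lambda>w. a w i) \<in> borel_measurable M" "\<And>i. i < n \<Longrightarrow> (\<lambda>w. b w i) \<in> borel_measurable M"
  shows "(\<lambda>w. vinner n (a w) (b w)) \<in> borel_measurable M"
  unfolding vinner_def using assms by (intro borel_measurable_sum borel_measurable_times) auto

lemma cmp_traj_measurable:
  assumes "\<And>t. t \<in> {1..k} \<Longrightarrow> components_measurable n (m t)"
  shows "cmp_traj n k m \<in> measurable fun2_space fun2_space"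
proof -
  have "(\<lambda>w. hist (\<lambda>t ys. trunc n (\<lambda>i. m t ys i + w t i)) k) \<in> measurable fun2_space fun2_space"
  proof (rule hist_measurable, rule trunc_component_measurable)
    fix t X i assume t: "t \<in> {1..k}" and X: "X \<in> measurable fun2_space fun2_space" and i: "i < n"
    have "(\<lambda>w. m t (X w) i) \<in> borel_measurable fun2_space"
      by (rule components_measurable_compose[OF assms[OF t] X i])
    then show "(\<lambda>w. m t (X w) i + w t i) \<in> borel_measurable fun2_space"
      by (rule borel_measurable_add[OF _ fun2_component])
  qed
  then show ?thesis unfolding cmp_traj_def[abs_def] .
qed

lemma fom_traj_measurable:
  assumes "\<And>t. t \<in> {1..T} \<Longrightarrow> components_measurable n (f t)" "\<And>t. t \<in> {1..T} \<Longrightarrow> components_measurable n (g t)"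
  shows "fom_traj n T f g \<in> measurable fun2_space fun2_space"
proof -
  have "(\<lambda>A. hist (\<lambda>t xs. trunc n (\<lambda>i. matvec n A (f t xs) i + g t xs i)) T) \<in> measurable fun2_space fun2_space"
  proof (rule hist_measurable, rule trunc_component_measurable)
    fix t X i assume t: "t \<in> {1..T}" and X: "X \<in> measurable fun2_space fun2_space" and i: "i < n"
    have f: "(\<lambda>w. f t (X w) j) \<in> borel_measurable fun2_space" if "j < n" for j
      by (rule components_measurable_compose[OF assms(1)[OF t] X that])
    have "(\<lambda>w. matvec n w (f t (X w)) i) \<in> borel_measurable fun2_space"
      unfolding matvec_def by (rule borel_measurable_sum, rule borel_measurable_times[OF fun2_component f]) simp
    moreover have "(\<lambda>w. g t (X w) i) \<in> borel_measurable fun2_space"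
      by (rule components_measurable_compose[OF assms(2)[OF t] X i])
    ultimately show "(\<lambda>w. matvec n w (f t (X w)) i + g t (X w) i) \<in> borel_measurable fun2_space"
      by (rule borel_measurable_add)
  qed
  then show ?thesis unfolding fom_traj_def[abs_def] .
qed

section \<open>Gram--Schmidt orthonormalisation\<close>

definition gs_residual :: "nat \<Rightarrow> (nat \<Rightarrow> nat \<Rightarrow> real) \<Rightarrow> nat \<Rightarrow> (nat \<Rightarrow> nat \<Rightarrow> real) \<Rightarrow> nat \<Rightarrow> real" where
  "gs_residual n F t us i = F t i - (\<Sum>s\<in>{1..<t}. vinner n (us s) (F t) * us s i)"

text \<open>Gram--Schmidt; in the degenerate case the junk value \<open>0 / 0 = 0\<close> yields the zero vector.\<close>

definition gram_schmidt :: "nat \<Rightarrow> (nat \<Rightarrow> nat \<Rightarrow> real) \<Rightarrow> nat \<Rightarrow> nat \<Rightarrow> nat \<Rightarrow> real" where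
  "gram_schmidt n F k = hist (\<lambda>t us. trunc n (\<lambda>i. gs_residual n F t us i / vnorm n (gs_residual n F t us))) k"

lemma vinner_cong: "(\<And>i. i < n \<Longrightarrow> a i = a' i) \<Longrightarrow> (\<And>i. i < n \<Longrightarrow> b i = b' i) \<Longrightarrow> vinner n a b = vinner n a' b'"
  by (simp add: vinner_def)

lemma vnorm_cong: "(\<And>i. i < n \<Longrightarrow> a i = b i) \<Longrightarrow> vnorm n a = vnorm n b"
  by (simp add: vnorm_def)

lemma gs_residual_cong:
  assumes "\<And>i. i < n \<Longrightarrow> F t i = F' t i" "\<And>s i. s \<in> {1..<t} \<Longrightarrow> i < n \<Longrightarrow> us s i = vs s i" "i < n"
  shows "gs_residual n F t us i = gs_residual n F' t vs i"
proof -
  have "vinner n (us s) (F t) = vinner n (vs s) (F' t)" if "s \<in> {1..<t}" for s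
    by (rule vinner_cong) (use assms that in auto)
  then show ?thesis using assms by (simp add: gs_residual_def)
qed

lemma gram_schmidt_step:
  assumes "t \<in> {1..k}"
  shows "gram_schmidt n F k t = trunc n (\<lambda>i. gs_residual n F t (gram_schmidt n F k) i / vnorm n (gs_residual n F t (gram_schmidt n F k)))"
  unfolding gram_schmidt_def
proof (rule hist_trunc_step[OF assms], unfold nonanticipative_def, intro allI impI)
  fix xs ys :: "nat \<Rightarrow> nat \<Rightarrow> real" and i assume *: "\<forall>s\<in>{1..<t}. \<forall>i<n. xs s i = ys s i" "i < n"
  have "gs_residual n F t xs j = gs_residual n F t ys j" if "j < n" for j
    by (rule gs_residual_cong) (use * that in auto)
  then show "gs_residual n F t xs i / vnorm n (gs_residual n F t xs) = gs_residual n F t ys i / vnorm n (gs_residual n F t ys)"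
    using * vnorm_cong[of n "gs_residual n F t xs" "gs_residual n F t ys"] by simp
qed

lemma gram_schmidt_mono: "t \<le> k \<Longrightarrow> gram_schmidt n F k t = gram_schmidt n F t t"
  unfolding gram_schmidt_def by (rule hist_mono)

lemma gram_schmidt_cong:
  assumes "\<And>t i. t \<in> {1..k} \<Longrightarrow> i < n \<Longrightarrow> F t i = F' t i"
  shows "gram_schmidt n F k = gram_schmidt n F' k"
  unfolding gram_schmidt_def
proof (rule hist_cong, rule trunc_cong)
  fix t us i assume t: "t \<in> {1..k}" and i: "i < n"
  have "gs_residual n F t us j = gs_residual n F' t us j" if "j < n" for j
    by (rule gs_residual_cong) (use assms that t in auto)
  then show "gs_residual n F t us i / vnorm n (gs_residual n F t us) = gs_residual n F' t us i / vnorm n (gs_residual n F' t us)"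
    using i vnorm_cong[of n "gs_residual n F t us" "gs_residual n F' t us"] by simp
qed

lemma gram_schmidt_measurable:
  assumes "\<And>t i. t \<in> {1..k} \<Longrightarrow> i < n \<Longrightarrow> (\<lambda>w. F w t i) \<in> borel_measurable M"
  shows "(\<lambda>w. gram_schmidt n (F w) k) \<in> measurable M fun2_space"
  unfolding gram_schmidt_def
proof (rule hist_measurable, rule trunc_component_measurable)
  fix t X i assume t: "t \<in> {1..k}" and X: "X \<in> measurable M fun2_space" and i: "i < n"
  have [measurable]: "(\<lambda>w. X w s i) \<in> borel_measurable M" for s i using X by (simp add: measurable_fun2_iff)
  have r: "(\<lambda>w. gs_residual n (F w) t (X w) i) \<in> borel_measurable M" if "i < n" for i
    unfolding gs_residual_def
    by (intro borel_measurable_diff borel_measurable_sum borel_measurable_times vinner_measurable) (use assms t that in auto)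
  have "(\<lambda>w. vnorm n (gs_residual n (F w) t (X w))) \<in> borel_measurable M"
    unfolding vnorm_def using r by (intro borel_measurable_sqrt[THEN measurable_compose[rotated]] borel_measurable_sum borel_measurable_power) auto
  then show "(\<lambda>w. gs_residual n (F w) t (X w) i / vnorm n (gs_residual n (F w) t (X w))) \<in> borel_measurable M"
    using r[OF i] by (rule borel_measurable_divide[rotated])
qed

lemma vnorm_sq: "(vnorm n x)\<^sup>2 = vinner n x x"
  by (simp add: vnorm_def vinner_def power2_eq_square sum_nonneg)

lemma vnorm_nonneg[simp]: "0 \<le> vnorm n x"
  by (simp add: vnorm_def sum_nonneg)

lemma vnorm_eq_0_iff: "vnorm n x = 0 \<longleftrightarrow> (\<forall>i<n. x i = 0)"
  by (auto simp: vnorm_def sum_nonneg_eq_0_iff)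

lemma vinner_zero_left: "(\<And>i. i < n \<Longrightarrow> a i = 0) \<Longrightarrow> vinner n a b = 0"
  by (simp add: vinner_def)

lemma vinner_sum_right: "vinner n w (\<lambda>i. \<Sum>s\<in>A. a s i) = (\<Sum>s\<in>A. vinner n w (a s))"
  unfolding vinner_def by (subst sum.swap) (simp add: sum_distrib_left)

context
  fixes n k :: nat and F u :: "nat \<Rightarrow> nat \<Rightarrow> real"
  defines "u \<equiv> gram_schmidt n F k"
begin

lemma gram_schmidt_apply:
  assumes "t \<in> {1..k}" "i < n"
  shows "u t i = gs_residual n F t u i / vnorm n (gs_residual n F t u)"
  using gram_schmidt_step[OF assms(1), of n F] assms(2) by (simp add: u_def trunc_def)

lemma gram_schmidt_residual: "t \<in> {1..k} \<Longrightarrow> i < n \<Longrightarrow> gs_residual n F t u i = vnorm n (gs_residual n F t u) * u t i"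
  using gram_schmidt_apply[of t i] vnorm_eq_0_iff[of n "gs_residual n F t u"] by (cases "vnorm n (gs_residual n F t u) = 0") auto

lemma gram_schmidt_unit_or_zero:
  assumes t: "t \<in> {1..k}"
  shows "unit_or_zero n (u t)"
proof (cases "vnorm n (gs_residual n F t u) = 0")
  case True
  then show ?thesis using gram_schmidt_apply[OF t] by (simp add: unit_or_zero_def)
next
  case False
  let ?r = "gs_residual n F t u"
  have "vinner n (u t) (u t) = vinner n ?r ?r / (vnorm n ?r)\<^sup>2"
    unfolding vinner_def using gram_schmidt_apply[OF t] by (simp add: sum_divide_distrib power2_eq_square)
  then show ?thesis using False by (simp add: vnorm_sq[symmetric] unit_or_zero_def)
qed

lemma gram_schmidt_orthogonal:
  assumes "s \<in> {1..k}" "t \<in> {1..k}" "s \<noteq> t"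
  shows "vinner n (u s) (u t) = 0"
proof -
  have *: "\<forall>s\<in>{1..<t}. vinner n (u s) (u t) = 0" if "t \<in> {1..k}" for t
    using that
  proof (induction t rule: less_induct)
    case (less t)
    show ?case
    proof
      fix s assume s: "s \<in> {1..<t}"
      have sk: "s \<in> {1..k}" using s less.prems by auto
      have orth: "vinner n (u s) (u r) = 0" if "r \<in> {1..<t}" "r \<noteq> s" for r
        using less.IH[of s] less.IH[of r] that s less.prems vinner_commute[of n "u s" "u r"]
        by (cases "r < s") auto
      have "vinner n (u s) (gs_residual n F t u) = vinner n (u s) (F t) - (\<Sum>r\<in>{1..<t}. vinner n (u r) (F t) * vinner n (u s) (u r))"
        unfolding gs_residual_def[abs_def] by (simp only: vinner_right_linear vinner_sum_right)
      also have "(\<Sum>r\<in>{1..<t}. vinner n (u r) (F t) * vinner n (u s) (u r)) = (\<Sum>r\<in>{s}. vinner n (u r) (F t) * vinner n (u s) (u r))"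
        by (rule sum.mono_neutral_right) (use s orth in auto)
      also have "\<dots> = vinner n (u s) (F t)"
        using gram_schmidt_unit_or_zero[OF sk] by (auto simp: unit_or_zero_def vinner_zero_left)
      finally have "vinner n (u s) (gs_residual n F t u) = 0" by simp
      moreover have "vinner n (u s) (u t) = vinner n (u s) (gs_residual n F t u) / vnorm n (gs_residual n F t u)"
        unfolding vinner_def using gram_schmidt_apply[OF less.prems] by (simp add: sum_divide_distrib)
      ultimately show "vinner n (u s) (u t) = 0" by simp
    qed
  qed
  show ?thesis using *[of s] *[of t] assms vinner_commute[of n "u s" "u t"] by (cases "s < t") auto
qed

text \<open>What matters later is the sign: a non-negative diagonal singles out the triangular
  factor that can be compared with the Cholesky factor of \<Sigma>.\<close>

lemma gram_schmidt_diag: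
  assumes t: "t \<in> {1..k}"
  shows "vinner n (u t) (F t) = vnorm n (gs_residual n F t u)"
proof -
  let ?r = "gs_residual n F t u"
  have F: "F t i = vnorm n ?r * u t i + (\<Sum>s\<in>{1..<t}. vinner n (u s) (F t) * u s i)" if "i < n" for i
    using gram_schmidt_residual[OF t that] by (simp add: gs_residual_def)
  have "vinner n (u t) (F t) = vinner n (u t) (\<lambda>i. vnorm n ?r * u t i + (\<Sum>s\<in>{1..<t}. vinner n (u s) (F t) * u s i))"
    by (rule vinner_cong_right) (rule F)
  also have "\<dots> = vnorm n ?r * vinner n (u t) (u t) + (\<Sum>s\<in>{1..<t}. vinner n (u s) (F t) * vinner n (u t) (u s))"
    by (simp only: vinner_right_linear vinner_sum_right)
  also have "(\<Sum>s\<in>{1..<t}. vinner n (u s) (F t) * vinner n (u t) (u s)) = 0"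
    by (rule sum.neutral) (use gram_schmidt_orthogonal[OF t] t in auto)
  also have "vnorm n ?r * vinner n (u t) (u t) = vnorm n ?r"
  proof (cases "vnorm n ?r = 0")
    case False
    then have "\<not> (\<forall>i<n. u t i = 0)"
      using gram_schmidt_residual[OF t] vnorm_eq_0_iff[of n ?r] by (metis mult_zero_right)
    then have "vinner n (u t) (u t) = 1" using gram_schmidt_unit_or_zero[OF t] unfolding unit_or_zero_def by blast
    then show ?thesis by simp
  qed simp
  finally show ?thesis by simp
qed

lemma gram_schmidt_expand:
  assumes t: "t \<in> {1..k}" and i: "i < n"
  shows "F t i = (\<Sum>s\<in>{1..t}. vinner n (u s) (F t) * u s i)"
proof -
  have "{1..t} = insert t {1..<t}" using t by auto
  then show ?thesis using gram_schmidt_residual[OF t i] gram_schmidt_diag[OF t] by (simp add: gs_residual_def)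
qed

end


section \<open>The iteration driven by the noise alone\<close>

text \<open>The image of a unit vector \<open>u s\<close> under the rebuilt matrix, as computed in
  \<open>rebuild_matvec_basis\<close>. For a zero vector it is not that image, but then it only
  occurs with coefficient 0.\<close>

definition noise_column :: "nat \<Rightarrow> (nat \<Rightarrow> nat \<Rightarrow> real) \<Rightarrow> (nat \<Rightarrow> nat \<Rightarrow> real) \<Rightarrow> nat \<Rightarrow> nat \<Rightarrow> real" where
  "noise_column n u z s i = (z s i + (sqrt 2 - 1) * vinner n (u s) (z s) * u s i
     - (\<Sum>j\<in>{1..<s}. u j i * vinner n (u j) (z s)) + (\<Sum>j\<in>{1..<s}. u j i * vinner n (z j) (u s))) / sqrt n"

lemma noise_column_cong:
  assumes "\<And>j i. j \<in> {1..s} \<Longrightarrow> i < n \<Longrightarrow> u j i = u' j i" "\<And>j i. j \<in> {1..s} \<Longrightarrow> i < n \<Longrightarrow> z j i = z' j i" "s \<ge> 1" "i < n"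
  shows "noise_column n u z s i = noise_column n u' z' s i"
proof -
  have "vinner n (u j) (z l) = vinner n (u' j) (z' l)" "vinner n (z j) (u l) = vinner n (z' j) (u' l)" if "j \<in> {1..s}" "l \<in> {1..s}" for j l
    by (rule vinner_cong; use assms that in auto)+
  then show ?thesis using assms unfolding noise_column_def
    by (intro arg_cong2[where f="(/)"] arg_cong2[where f="(+)"] arg_cong2[where f="(-)"] sum.cong) auto
qed

text \<open>The basis is recomputed from the history \<open>xs\<close>, so that a step is a function
  of noise and history and the trajectory is again an instance of \<open>hist\<close>.\<close>

definition coupled_step :: "nat \<Rightarrow> (nat \<Rightarrow> (nat \<Rightarrow> nat \<Rightarrow> real) \<Rightarrow> (nat \<Rightarrow> real)) \<Rightarrow> (nat \<Rightarrow> (nat \<Rightarrow> nat \<Rightarrow> real) \<Rightarrow> (nat \<Rightarrow> real))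
     \<Rightarrow> (nat \<Rightarrow> nat \<Rightarrow> real) \<Rightarrow> nat \<Rightarrow> (nat \<Rightarrow> nat \<Rightarrow> real) \<Rightarrow> nat \<Rightarrow> real" where
  "coupled_step n f g z t xs i = (let u = gram_schmidt n (\<lambda>s. f s xs) t in
     g t xs i + (\<Sum>s\<in>{1..t}. vinner n (u s) (f t xs) * noise_column n u z s i))"

definition coupled_traj :: "nat \<Rightarrow> nat \<Rightarrow> (nat \<Rightarrow> (nat \<Rightarrow> nat \<Rightarrow> real) \<Rightarrow> (nat \<Rightarrow> real)) \<Rightarrow> (nat \<Rightarrow> (nat \<Rightarrow> nat \<Rightarrow> real) \<Rightarrow> (nat \<Rightarrow> real))
     \<Rightarrow> (nat \<Rightarrow> nat \<Rightarrow> real) \<Rightarrow> (nat \<Rightarrow> nat \<Rightarrow> real)" where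
  "coupled_traj n T f g z = hist (\<lambda>t xs. trunc n (coupled_step n f g z t xs)) T"

definition coupled_basis :: "nat \<Rightarrow> nat \<Rightarrow> (nat \<Rightarrow> (nat \<Rightarrow> nat \<Rightarrow> real) \<Rightarrow> (nat \<Rightarrow> real)) \<Rightarrow> (nat \<Rightarrow> (nat \<Rightarrow> nat \<Rightarrow> real) \<Rightarrow> (nat \<Rightarrow> real))
     \<Rightarrow> (nat \<Rightarrow> nat \<Rightarrow> real) \<Rightarrow> (nat \<Rightarrow> nat \<Rightarrow> real)" where
  "coupled_basis n T f g z = gram_schmidt n (\<lambda>s. f s (coupled_traj n T f g z)) T"

locale fom =
  fixes n T :: nat and f g :: "nat \<Rightarrow> (nat \<Rightarrow> nat \<Rightarrow> real) \<Rightarrow> nat \<Rightarrow> real"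
  assumes n: "n > 0"
    and f_na: "\<And>t. t \<in> {1..T} \<Longrightarrow> nonanticipative n t (f t)" and g_na: "\<And>t. t \<in> {1..T} \<Longrightarrow> nonanticipative n t (g t)"
    and f_meas: "\<And>t. t \<in> {1..T} \<Longrightarrow> components_measurable n (f t)" and g_meas: "\<And>t. t \<in> {1..T} \<Longrightarrow> components_measurable n (g t)"
begin

abbreviation "x \<equiv> coupled_traj n T f g"
abbreviation "u \<equiv> coupled_basis n T f g"

lemma nonanticipativeD:
  assumes "nonanticipative n t F" "\<And>s i. s \<in> {1..<t} \<Longrightarrow> i < n \<Longrightarrow> xs s i = ys s i" "i < n"
  shows "F xs i = F ys i"
  using assms unfolding nonanticipative_def by blast

lemma coupled_step_cong:
  assumes t: "t \<in> {1..T}" and xs: "\<And>s i. s \<in> {1..<t} \<Longrightarrow> i < n \<Longrightarrow> xs s i = ys s i"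
    and z: "\<And>s i. s \<in> {1..t} \<Longrightarrow> i < n \<Longrightarrow> z s i = z' s i" and i: "i < n"
  shows "coupled_step n f g z t xs i = coupled_step n f g z' t ys i"
proof -
  have f: "f s xs i = f s ys i" if "s \<in> {1..t}" "i < n" for s i
    by (rule nonanticipativeD[OF f_na]) (use that t xs in auto)
  have "gram_schmidt n (\<lambda>s. f s xs) t = gram_schmidt n (\<lambda>s. f s ys) t"
    by (rule gram_schmidt_cong) (rule f)
  moreover have "vinner n v (f t xs) = vinner n v (f t ys)" for v
    by (rule vinner_cong_right) (use f t in auto)
  moreover have "noise_column n v z s i = noise_column n v z' s i" if "s \<in> {1..t}" for v s
    by (rule noise_column_cong) (use z that i in auto)
  moreover have "g t xs i = g t ys i"
    by (rule nonanticipativeD[OF g_na]) (use i t xs in auto)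
  ultimately show ?thesis unfolding coupled_step_def Let_def by simp
qed

lemma coupled_traj_step:
  assumes t: "t \<in> {1..T}"
  shows "x z t = trunc n (coupled_step n f g z t (x z))"
  unfolding coupled_traj_def
  by (rule hist_trunc_step[OF t], unfold nonanticipative_def, intro allI impI, rule coupled_step_cong[OF t]) auto

lemma coupled_traj_apply:
  assumes t: "t \<in> {1..T}" and i: "i < n"
  shows "x z t i = g t (x z) i + (\<Sum>s\<in>{1..t}. vinner n (u z s) (f t (x z)) * noise_column n (u z) z s i)"
proof -
  let ?u = "gram_schmidt n (\<lambda>s. f s (x z)) t"
  have us: "?u s = u z s" if "s \<in> {1..t}" for s
    using that t gram_schmidt_mono[of s t] gram_schmidt_mono[of s T] by (simp add: coupled_basis_def)
  then have "noise_column n ?u z s i = noise_column n (u z) z s i" if "s \<in> {1..t}" for s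
    by (intro noise_column_cong) (use that i in auto)
  then show ?thesis using coupled_traj_step[OF t, of z] us i by (simp add: trunc_def coupled_step_def Let_def)
qed

lemma basis_unit_or_zero: "t \<in> {1..T} \<Longrightarrow> unit_or_zero n (u z t)"
  unfolding coupled_basis_def by (rule gram_schmidt_unit_or_zero)

lemma basis_orthogonal: "s \<in> {1..T} \<Longrightarrow> t \<in> {1..T} \<Longrightarrow> s \<noteq> t \<Longrightarrow> vinner n (u z s) (u z t) = 0"
  unfolding coupled_basis_def by (rule gram_schmidt_orthogonal)

lemma basis_expand: "t \<in> {1..T} \<Longrightarrow> i < n \<Longrightarrow> f t (x z) i = (\<Sum>s\<in>{1..t}. vinner n (u z s) (f t (x z)) * u z s i)"
  unfolding coupled_basis_def using gram_schmidt_expand[of t T i n "\<lambda>s. f s (x z)"] by simp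

lemma basis_diag_nonneg: "t \<in> {1..T} \<Longrightarrow> vinner n (u z t) (f t (x z)) \<ge> 0"
  unfolding coupled_basis_def using gram_schmidt_diag[of t T n "\<lambda>s. f s (x z)"] by simp

text \<open>\<open>f s (x z)\<close> lies in the span of the first \<open>s\<close> basis vectors,
  on which the rebuilt matrix acts through the noise columns. The identity is pathwise and holds for
  every \<open>B\<close>; for the coupling only the law of the rebuilt matrix matters beyond
  it.\<close>

lemma coupled_traj_eq_fom_traj: "fom_traj n T f g (rebuild n (u z) z T B) = x z"
  unfolding fom_traj_def
proof (rule hist_unique)
  let ?A = "rebuild n (u z) z T B"
  fix s assume s: "s \<in> {1..T}"
  show "x z s = trunc n (\<lambda>i. matvec n ?A (f s (x z)) i + g s (x z) i)"
    unfolding coupled_traj_step[OF s]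
  proof (rule trunc_cong)
    fix i assume i: "i < n"
    have "matvec n ?A (f s (x z)) i = (\<Sum>j<n. ?A i j * (\<Sum>r\<in>{1..s}. vinner n (u z r) (f s (x z)) * u z r j))"
      unfolding matvec_def using basis_expand[OF s, of _ z] by (intro sum.cong refl) auto
    also have "\<dots> = (\<Sum>r\<in>{1..s}. vinner n (u z r) (f s (x z)) * matvec n ?A (u z r) i)"
      unfolding matvec_def sum_distrib_left by (subst sum.swap) (simp add: mult_ac)
    also have "\<dots> = (\<Sum>r\<in>{1..s}. vinner n (u z r) (f s (x z)) * noise_column n (u z) z r i)"
    proof (rule sum.cong[OF refl])
      fix r assume "r \<in> {1..s}"
      then have r: "r \<in> {1..T}" using s by auto
      show "vinner n (u z r) (f s (x z)) * matvec n ?A (u z r) i = vinner n (u z r) (f s (x z)) * noise_column n (u z) z r i"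
      proof (cases "vinner n (u z r) (u z r) = 1")
        case True
        then show ?thesis unfolding noise_column_def using rebuild_matvec_basis[of r T n "u z" i z B, OF r True basis_orthogonal i] by simp
      next
        case False
        \<comment> \<open>A degenerate direction: its noise column is not its image, but the
          coefficient in front is 0.\<close>
        then have "vinner n (u z r) (f s (x z)) = 0"
          using basis_unit_or_zero[OF r, of z] by (intro vinner_zero_left) (auto simp: unit_or_zero_def)
        then show ?thesis by simp
      qed
    qed
    finally have "matvec n ?A (f s (x z)) i + g s (x z) i = x z s i" using coupled_traj_apply[OF s i] by simp
    then show "coupled_step n f g z s (x z) i = matvec n ?A (f s (x z)) i + g s (x z) i"
      using coupled_traj_step[OF s, of z] i by (simp add: trunc_def)
  qed
next
  fix s assume "s \<notin> {1..T}"
  then show "x z s = (\<lambda>i. 0)" unfolding coupled_traj_def by (intro hist_outside) auto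
next
  fix s and xs ys :: "nat \<Rightarrow> nat \<Rightarrow> real" assume s: "s \<in> {1..T}" and eq: "\<And>r. r \<in> {1..<s} \<Longrightarrow> xs r = ys r"
  have f: "f s xs i = f s ys i" and g: "g s xs i = g s ys i" if "i < n" for i
    by (rule nonanticipativeD[OF f_na] nonanticipativeD[OF g_na]; use s eq that in auto)+
  then show "trunc n (\<lambda>i. matvec n (rebuild n (u z) z T B) (f s xs) i + g s xs i) = trunc n (\<lambda>i. matvec n (rebuild n (u z) z T B) (f s ys) i + g s ys i)"
    by (intro trunc_cong) (simp add: matvec_def)
qed

lemma coupled_traj_adapted:
  assumes "\<And>s i. s \<in> {1..t} \<Longrightarrow> i < n \<Longrightarrow> z s i = z' s i" "s \<le> t" "t \<le> T"
  shows "x z s = x z' s"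
  using assms(2)
proof (induction s rule: less_induct)
  case (less s)
  show ?case
  proof (cases "s = 0")
    case True
    then show ?thesis unfolding coupled_traj_def by (simp add: hist_outside)
  next
    case False
    then have s: "s \<in> {1..T}" using less.prems assms(3) by auto
    show ?thesis unfolding coupled_traj_step[OF s]
      by (rule trunc_cong, rule coupled_step_cong[OF s]) (use less assms(1) in auto)
  qed
qed

text \<open>The vector \<open>u k\<close> is built from \<open>f 1\<close> to \<open>f k\<close>
  along the trajectory before time \<open>k\<close>, which uses noise vectors of index below
  \<open>k\<close> only. This shift by one is what makes \<open>z k\<close> fresh relative to
  \<open>u k\<close> in \<open>rebuild_law\<close>.\<close>

lemma coupled_basis_adapted: "adapted n T u"
  unfolding adapted_def
proof (intro allI impI)
  fix z z' :: "nat \<Rightarrow> nat \<Rightarrow> real" and k i assume k: "k \<in> {1..T}" and i: "i < n" and eq: "\<forall>j\<in>{1..<k}. \<forall>i<n. z j i = z' j i"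
  have "x z s = x z' s" if "s \<in> {1..<k}" for s
    by (rule coupled_traj_adapted[of "k - 1"]) (use that k eq in auto)
  then have "f s (x z) i = f s (x z') i" if "s \<in> {1..k}" "i < n" for s i
    by (intro nonanticipativeD[OF f_na]) (use that k in auto)
  then have "gram_schmidt n (\<lambda>s. f s (x z)) k = gram_schmidt n (\<lambda>s. f s (x z')) k"
    by (rule gram_schmidt_cong)
  then show "u z k i = u z' k i"
    using k gram_schmidt_mono[of k T] by (simp add: coupled_basis_def)
qed

lemma coupled_traj_measurable: "x \<in> measurable (noise_space n T) fun2_space"
proof -
  have "(\<lambda>z. hist (\<lambda>t xs. trunc n (coupled_step n f g z t xs)) T) \<in> measurable (noise_space n T) fun2_space"
  proof (rule hist_measurable, rule trunc_component_measurable)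
    fix t X i assume t: "t \<in> {1..T}" and X: "X \<in> measurable (noise_space n T) fun2_space" and i: "i < n"
    have f: "(\<lambda>w. f s (X w) j) \<in> borel_measurable (noise_space n T)" if "s \<in> {1..t}" "j < n" for s j
      by (rule components_measurable_compose[OF f_meas X that(2)]) (use that t in auto)
    have "(\<lambda>w. gram_schmidt n (\<lambda>s. f s (X w)) t) \<in> measurable (noise_space n T) fun2_space"
      by (rule gram_schmidt_measurable) (rule f)
    then have v: "(\<lambda>w. gram_schmidt n (\<lambda>s. f s (X w)) t s j) \<in> borel_measurable (noise_space n T)" for s j
      unfolding measurable_fun2_iff by blast
    have zm: "(\<lambda>w. w s j) \<in> borel_measurable (noise_space n T)" if "s \<in> {1..t}" "j < n" for s j
      by (rule noise_component) (use that t in auto)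
    have vz: "(\<lambda>w. vinner n (gram_schmidt n (\<lambda>s. f s (X w)) t r) (w s)) \<in> borel_measurable (noise_space n T)"
      "(\<lambda>w. vinner n (w s) (gram_schmidt n (\<lambda>s. f s (X w)) t r)) \<in> borel_measurable (noise_space n T)" if "s \<in> {1..t}" for r s
      using that by (auto intro!: vinner_measurable v zm)
    have c: "(\<lambda>w. noise_column n (gram_schmidt n (\<lambda>s. f s (X w)) t) w s i) \<in> borel_measurable (noise_space n T)" if "s \<in> {1..t}" for s
      unfolding noise_column_def
    proof -
      have r: "r \<in> {1..t}" if "r \<in> {1..<s}" for r using that \<open>s \<in> {1..t}\<close> by auto
      show "(\<lambda>w. (w s i + (sqrt 2 - 1) * vinner n (gram_schmidt n (\<lambda>s. f s (X w)) t s) (w s) * gram_schmidt n (\<lambda>s. f s (X w)) t s i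
         - (\<Sum>j\<in>{1..<s}. gram_schmidt n (\<lambda>s. f s (X w)) t j i * vinner n (gram_schmidt n (\<lambda>s. f s (X w)) t j) (w s))
         + (\<Sum>j\<in>{1..<s}. gram_schmidt n (\<lambda>s. f s (X w)) t j i * vinner n (w j) (gram_schmidt n (\<lambda>s. f s (X w)) t s))) / sqrt n)
         \<in> borel_measurable (noise_space n T)"
        by (rule borel_measurable_divide borel_measurable_add borel_measurable_diff borel_measurable_sum borel_measurable_times
            v vz(1)[OF that] vz(2)[OF r] zm[OF that i] borel_measurable_const | assumption)+
    qed
    have "(\<lambda>w. vinner n (gram_schmidt n (\<lambda>s. f s (X w)) t s) (f t (X w))) \<in> borel_measurable (noise_space n T)" for s
      by (rule vinner_measurable) (use v f t in auto)
    then have "(\<lambda>w. \<Sum>s\<in>{1..t}. vinner n (gram_schmidt n (\<lambda>s. f s (X w)) t s) (f t (X w)) * noise_column n (gram_schmidt n (\<lambda>s. f s (X w)) t) w s i) \<in> borel_measurable (noise_space n T)"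
      using c by (intro borel_measurable_sum) (rule borel_measurable_times)
    moreover have "(\<lambda>w. g t (X w) i) \<in> borel_measurable (noise_space n T)"
      by (rule components_measurable_compose[OF g_meas[OF t] X i])
    ultimately show "(\<lambda>w. coupled_step n f g w t (X w) i) \<in> borel_measurable (noise_space n T)"
      unfolding coupled_step_def Let_def by (intro borel_measurable_add)
  qed
  then show ?thesis unfolding coupled_traj_def[abs_def] .
qed

lemma coupled_basis_measurable: "u \<in> measurable (noise_space n T) fun2_space"
  unfolding coupled_basis_def[abs_def]
  by (rule gram_schmidt_measurable, rule components_measurable_compose[OF f_meas coupled_traj_measurable]) auto

text \<open>The independent matrix \<open>B\<close> supplies the part of the GOE matrix that the
  directions never reveal; it is carried along to have a complete matrix whose law is
  \<open>GOE n\<close>.\<close>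

lemma coupled_traj_law:
  "distr (noise_space n T \<Otimes>\<^sub>M GOE n) fun2_space (\<lambda>(z, B). x z) = distr (GOE n) fun2_space (fom_traj n T f g)"
proof -
  let ?A = "\<lambda>(z, B). rebuild n (u z) z T B"
  have Um: "(\<lambda>z. u z k i) \<in> borel_measurable (noise_space n T)" for k i
    using coupled_basis_measurable unfolding measurable_fun2_iff by blast
  note law = rebuild_law[OF n coupled_basis_adapted basis_unit_or_zero Um]
  have "distr (GOE n) fun2_space (fom_traj n T f g) = distr (distr (noise_space n T \<Otimes>\<^sub>M GOE n) fun2_space ?A) fun2_space (fom_traj n T f g)"
    using law(2) by simp
  also have "\<dots> = distr (noise_space n T \<Otimes>\<^sub>M GOE n) fun2_space (fom_traj n T f g \<circ> ?A)"
    by (rule distr_distr[OF fom_traj_measurable[OF f_meas g_meas] law(1)])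
  also have "fom_traj n T f g \<circ> ?A = (\<lambda>(z, B). x z)"
    by (auto simp: fun_eq_iff coupled_traj_eq_fom_traj)
  finally show ?thesis ..
qed

end

section \<open>Positive definite matrices\<close>

definition bform :: "nat set \<Rightarrow> (nat \<Rightarrow> nat \<Rightarrow> real) \<Rightarrow> (nat \<Rightarrow> real) \<Rightarrow> (nat \<Rightarrow> real) \<Rightarrow> real" where
  "bform I S a b = (\<Sum>i\<in>I. \<Sum>j\<in>I. a i * S i j * b j)"

lemma bform_linear:
  "bform I S (\<lambda>i. a i + a' i) b = bform I S a b + bform I S a' b"
  "bform I S (\<lambda>i. a i - a' i) b = bform I S a b - bform I S a' b"
  "bform I S (\<lambda>i. c * a i) b = c * bform I S a b"
  "bform I S a (\<lambda>i. b i + b' i) = bform I S a b + bform I S a b'"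
  "bform I S a (\<lambda>i. b i - b' i) = bform I S a b - bform I S a b'"
  "bform I S a (\<lambda>i. c * b i) = c * bform I S a b"
  by (simp_all add: bform_def algebra_simps sum.distrib sum_subtractf sum_distrib_left)

lemma bform_zero: "bform I S (\<lambda>i. 0) b = 0" "bform I S a (\<lambda>i. 0) = 0"
  by (simp_all add: bform_def)

lemma bform_sum:
  "finite A \<Longrightarrow> bform I S (\<lambda>i. \<Sum>s\<in>A. c s * v s i) b = (\<Sum>s\<in>A. c s * bform I S (v s) b)"
  "finite A \<Longrightarrow> bform I S a (\<lambda>i. \<Sum>s\<in>A. c s * v s i) = (\<Sum>s\<in>A. c s * bform I S a (v s))"
  by (induction A rule: finite_induct) (simp_all add: bform_linear bform_zero)

lemma bform_cong: "(\<And>i. i \<in> I \<Longrightarrow> a i = a' i) \<Longrightarrow> (\<And>i. i \<in> I \<Longrightarrow> b i = b' i) \<Longrightarrow> bform I S a b = bform I S a' b'"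
  unfolding bform_def by (intro sum.cong refl) auto

lemma bform_commute:
  assumes "\<And>i j. i \<in> I \<Longrightarrow> j \<in> I \<Longrightarrow> S i j = S j i"
  shows "bform I S a b = bform I S b a"
  unfolding bform_def by (subst sum.swap) (intro sum.cong refl, use assms in \<open>auto simp: mult_ac\<close>)

lemma bform_unit:
  "finite I \<Longrightarrow> r \<in> I \<Longrightarrow> bform I S (\<lambda>i. if i = r then 1 else 0) b = (\<Sum>j\<in>I. S r j * b j)"
  unfolding bform_def by (subst sum.remove[of I r]) (auto intro!: sum.neutral)

text \<open>A zero of a non-negative form is a minimum, so the first variation in every coordinate
  direction vanishes.\<close>

lemma bform_psd_kernel:
  assumes I: "finite I" and sym: "\<And>i j. i \<in> I \<Longrightarrow> j \<in> I \<Longrightarrow> S i j = S j i"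
    and psd: "\<And>w. bform I S w w \<ge> 0" and v: "bform I S v v = 0" and r: "r \<in> I"
  shows "(\<Sum>j\<in>I. S r j * v j) = 0"
proof -
  define e where "e = (\<lambda>i. if i = r then 1 else (0::real))"
  define b q where "b = bform I S e v" and "q = bform I S e e"
  have q: "q \<ge> 0" using psd by (simp add: q_def)
  \<comment> \<open>The quadratic in \<open>t\<close> has its minimum at \<open>b / q\<close>; the
    added 1 avoids division by \<open>q = 0\<close> and still gives the value
    \<open>- t^2 * (q + 2)\<close>, which can only be non-negative for \<open>t = 0\<close>.\<close>
  define t where "t = b / (q + 1)"
  have "bform I S (\<lambda>i. v i - t * e i) (\<lambda>i. v i - t * e i) = t\<^sup>2 * q - 2 * t * b"
    using bform_commute[of I S v e, OF sym] unfolding bform_linear v q_def b_def by (simp add: power2_eq_square algebra_simps)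
  then have "t\<^sup>2 * q - 2 * t * b \<ge> 0" using psd by metis
  moreover have "b = t * (q + 1)" using q by (simp add: t_def)
  ultimately have "t\<^sup>2 * (q + 2) \<le> 0" by (simp add: power2_eq_square algebra_simps)
  then have "t = 0" using q by (simp add: mult_le_0_iff)
  then have "b = 0" using \<open>b = t * (q + 1)\<close> by simp
  then show ?thesis unfolding b_def e_def using bform_unit[OF I r] by simp
qed

text \<open>The maximum \<open>c\<close> of the form on the unit sphere bounds it everywhere by
  homogeneity, and the maximiser is a zero of the non-negative form of \<open>c I - S\<close>, hence
  an eigenvector by \<open>bform_psd_kernel\<close>.\<close>

lemma exists_top_eigenvalue:
  assumes I: "finite I" "I \<noteq> {}" and sym: "\<And>i j. i \<in> I \<Longrightarrow> j \<in> I \<Longrightarrow> S i j = S j i"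
  shows "\<exists>c\<in>eigenvalues_on I S. \<forall>w. bform I S w w \<le> c * (\<Sum>i\<in>I. (w i)\<^sup>2)"
proof -
  define N where "N w = (\<Sum>i\<in>I. (w i)\<^sup>2)" for w :: "nat \<Rightarrow> real"
  \<comment> \<open>Coordinates outside \<open>I\<close> are pinned to 0, so that the sphere is a
    closed subset of a product of compact sets in the function space.\<close>
  define K where "K = (\<Pi>\<^sub>E i\<in>UNIV. if i \<in> I then {-1..1} else {0::real}) \<inter> {w. N w = 1}"
  have cont: "continuous_on UNIV (\<lambda>w::nat \<Rightarrow> real. w i)" for i by (rule continuous_on_product_coordinates)
  have cN: "continuous_on UNIV N" unfolding N_def by (intro continuous_intros cont)
  have "compactin (product_topology (\<lambda>i. euclidean) UNIV) (\<Pi>\<^sub>E i\<in>UNIV. if i \<in> I then {-1..1} else {0::real})"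
    unfolding compactin_PiE by auto
  then have "compact (\<Pi>\<^sub>E i\<in>UNIV. if i \<in> I then {-1..1} else {0::real})"
    unfolding euclidean_product_topology compactin_euclidean_iff .
  moreover have "closed {w. N w = 1}" by (rule closed_Collect_eq[OF cN continuous_on_const])
  ultimately have "compact K" unfolding K_def by (rule compact_Int_closed)
  obtain r where r: "r \<in> I" using I by blast
  have "(\<lambda>i. if i = r then 1 else 0) \<in> K" using r I
    by (auto simp: K_def N_def sum.delta if_distrib[of "\<lambda>x. x\<^sup>2"] cong: if_cong split: if_split_asm)
  then have "K \<noteq> {}" by blast
  have "continuous_on K (\<lambda>w. bform I S w w)" unfolding bform_def
    by (rule continuous_on_subset[OF _ subset_UNIV]) (intro continuous_intros cont)
  then obtain v where v: "v \<in> K" "\<And>w. w \<in> K \<Longrightarrow> bform I S w w \<le> bform I S v v"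
    using continuous_attains_sup[OF \<open>compact K\<close> \<open>K \<noteq> {}\<close>] by blast
  define c where "c = bform I S v v"
  have Nv: "N v = 1" using v by (simp add: K_def)
  have le: "bform I S w w \<le> c * N w" for w
  proof (cases "N w = 0")
    case True
    then have "w i = 0" if "i \<in> I" for i using I that by (simp add: N_def sum_nonneg_eq_0_iff)
    then have "bform I S w w = 0" by (simp add: bform_def)
    then show ?thesis using True by simp
  next
    case False
    moreover have "N w \<ge> 0" unfolding N_def by (intro sum_nonneg) simp
    ultimately have pos: "N w > 0" by simp
    define y where "y = (\<lambda>i. if i \<in> I then (1 / sqrt (N w)) * w i else 0)"
    have "N y = (\<Sum>i\<in>I. (w i)\<^sup>2 / N w)" unfolding N_def[of y]
      using pos by (intro sum.cong refl) (simp add: y_def power_mult_distrib power_divide)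
    also have "\<dots> = N w / N w" unfolding N_def[of w] by (rule sum_divide_distrib[symmetric])
    finally have Ny: "N y = 1" using pos by simp
    have "\<bar>y i\<bar> \<le> 1" if "i \<in> I" for i
    proof -
      have "(y i)\<^sup>2 \<le> N y" unfolding N_def using I that by (intro member_le_sum) auto
      then show ?thesis using Ny by (simp add: abs_square_le_1)
    qed
    then have "y i \<in> (if i \<in> I then {-1..1} else {0})" for i
      by (cases "i \<in> I") (fastforce simp: abs_le_iff, simp add: y_def)
    then have "y \<in> K" using Ny unfolding K_def by blast
    then have "bform I S y y \<le> c" using v by (simp add: c_def)
    moreover have "bform I S y y = bform I S (\<lambda>i. (1 / sqrt (N w)) * w i) (\<lambda>i. (1 / sqrt (N w)) * w i)"
      by (rule bform_cong) (auto simp: y_def)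
    moreover have "\<dots> = bform I S w w / N w" unfolding bform_linear using pos by (simp add: field_simps)
    ultimately have "bform I S w w / N w \<le> c" by (simp only:)
    then show ?thesis using pos by (simp only: pos_divide_le_eq)
  qed
  define M where "M = (\<lambda>i j. (if i = j then c else 0) - S i j)"
  have Md: "(\<Sum>j\<in>I. M i j * w j) = c * w i - (\<Sum>j\<in>I. S i j * w j)" if "i \<in> I" for i w
    using I that by (simp add: M_def left_diff_distrib sum_subtractf if_distrib[of "\<lambda>x. x * _"] sum.delta cong: if_cong)
  have M: "bform I M w w = c * N w - bform I S w w" for w
  proof -
    have "bform I M w w = (\<Sum>i\<in>I. w i * (\<Sum>j\<in>I. M i j * w j))" by (simp add: bform_def sum_distrib_left mult.assoc)
    also have "\<dots> = (\<Sum>i\<in>I. w i * (c * w i - (\<Sum>j\<in>I. S i j * w j)))" using Md by simp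
    also have "\<dots> = c * N w - bform I S w w"
      by (simp add: N_def bform_def right_diff_distrib sum_subtractf sum_distrib_left power2_eq_square mult_ac)
    finally show ?thesis .
  qed
  have "(\<Sum>j\<in>I. M i j * v j) = 0" if "i \<in> I" for i
    by (rule bform_psd_kernel[OF I(1) _ _ _ that]) (use sym le M Nv in \<open>auto simp: M_def c_def\<close>)
  then have "\<forall>i\<in>I. (\<Sum>j\<in>I. S i j * v j) = c * v i" using Md by simp
  moreover have "\<exists>i\<in>I. v i \<noteq> 0"
  proof (rule ccontr)
    assume "\<not> ?thesis"
    then have "N v = 0" by (simp add: N_def)
    then show False using Nv by simp
  qed
  ultimately have "c \<in> eigenvalues_on I S" by (auto simp: eigenvalues_on_def)
  then show ?thesis using le by (auto simp: N_def)
qed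

text \<open>Eigenvectors of distinct eigenvalues are orthogonal, so Bessel's inequality bounds their number by \<open>card I\<close>.\<close>

lemma finite_eigenvalues:
  assumes I: "finite I" and sym: "\<And>i j. i \<in> I \<Longrightarrow> j \<in> I \<Longrightarrow> S i j = S j i"
  shows "finite (eigenvalues_on I S)"
proof (rule ccontr)
  assume "infinite (eigenvalues_on I S)"
  then obtain E where E: "finite E" "card E = Suc (card I)" "E \<subseteq> eigenvalues_on I S"
    using infinite_arbitrarily_large by blast
  have "\<forall>c\<in>E. \<exists>v. (\<exists>s\<in>I. v s \<noteq> 0) \<and> (\<forall>s\<in>I. (\<Sum>t\<in>I. S s t * v t) = c * v s)"
    using E(3) by (auto simp: eigenvalues_on_def)
  then obtain V where V: "\<And>c. c \<in> E \<Longrightarrow> \<exists>s\<in>I. V c s \<noteq> 0" "\<And>c s. c \<in> E \<Longrightarrow> s \<in> I \<Longrightarrow> (\<Sum>t\<in>I. S s t * V c t) = c * V c s"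
    by metis
  define P where "P a b = (\<Sum>i\<in>I. a i * b i)" for a b :: "nat \<Rightarrow> real"
  have pos: "P (V c) (V c) > 0" if "c \<in> E" for c
  proof -
    obtain s where s: "s \<in> I" "V c s \<noteq> 0" using V(1)[OF \<open>c \<in> E\<close>] by blast
    then have "0 < V c s * V c s" by (metis not_real_square_gt_zero)
    also have "\<dots> \<le> P (V c) (V c)" unfolding P_def using I s by (intro member_le_sum) auto
    finally show ?thesis .
  qed
  have B: "bform I S (V c) (V d) = d * P (V c) (V d)" if "d \<in> E" for c d
  proof -
    have "bform I S (V c) (V d) = (\<Sum>i\<in>I. V c i * (\<Sum>j\<in>I. S i j * V d j))"
      by (simp add: bform_def sum_distrib_left mult.assoc)
    also have "\<dots> = (\<Sum>i\<in>I. V c i * (d * V d i))" using V(2)[OF that] by simp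
    finally show ?thesis by (simp add: P_def sum_distrib_left mult_ac)
  qed
  have orth: "P (V c) (V d) = 0" if "c \<in> E" "d \<in> E" "c \<noteq> d" for c d
    using B[of d c] B[of c d] bform_commute[of I S "V c" "V d", OF sym] that by (simp add: P_def mult.commute)
  have bessel: "(\<Sum>c\<in>E. (V c i)\<^sup>2 / P (V c) (V c)) \<le> 1" if i: "i \<in> I" for i
  proof -
    define a where "a c = V c i / P (V c) (V c)" for c
    define w where "w = (\<lambda>j. \<Sum>c\<in>E. a c * V c j)"
    have cw: "(\<Sum>j\<in>I. V d j * w j) = V d i" if d: "d \<in> E" for d
    proof -
      have "(\<Sum>j\<in>I. V d j * w j) = (\<Sum>c\<in>E. a c * P (V d) (V c))"
        unfolding w_def P_def sum_distrib_left by (subst sum.swap) (simp add: mult_ac)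
      also have "\<dots> = (\<Sum>c\<in>{d}. a c * P (V d) (V c))"
        by (rule sum.mono_neutral_right) (use E d orth in auto)
      also have "\<dots> = V d i" using pos[OF d] by (simp add: a_def)
      finally show ?thesis .
    qed
    have ww: "(\<Sum>j\<in>I. (w j)\<^sup>2) = w i"
    proof -
      have "(\<Sum>j\<in>I. (w j)\<^sup>2) = (\<Sum>j\<in>I. \<Sum>c\<in>E. a c * (V c j * w j))"
        unfolding w_def power2_eq_square by (simp add: sum_distrib_right mult.assoc)
      also have "\<dots> = (\<Sum>c\<in>E. a c * (\<Sum>j\<in>I. V c j * w j))"
        by (subst sum.swap) (simp add: sum_distrib_left)
      finally show ?thesis using cw by (simp add: w_def)
    qed
    have "0 \<le> (\<Sum>j\<in>I. ((if j = i then 1 else 0) - w j)\<^sup>2)" by (intro sum_nonneg) auto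
    also have "\<dots> = (\<Sum>j\<in>I. if j = i then 1 - 2 * w j else 0) + (\<Sum>j\<in>I. (w j)\<^sup>2)"
      unfolding sum.distrib[symmetric] by (intro sum.cong refl) (auto simp: power2_eq_square algebra_simps)
    also have "\<dots> = 1 - 2 * w i + w i" using I i ww by (simp add: sum.delta)
    finally have "w i \<le> 1" by simp
    then show ?thesis by (simp add: w_def a_def power2_eq_square)
  qed
  have "real (Suc (card I)) = (\<Sum>c\<in>E. \<Sum>i\<in>I. (V c i)\<^sup>2 / P (V c) (V c))"
  proof -
    have "(\<Sum>i\<in>I. (V c i)\<^sup>2 / P (V c) (V c)) = 1" if "c \<in> E" for c
      using pos[OF that] by (simp add: P_def power2_eq_square flip: sum_divide_distrib)
    then show ?thesis using E by simp
  qed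
  also have "\<dots> = (\<Sum>i\<in>I. \<Sum>c\<in>E. (V c i)\<^sup>2 / P (V c) (V c))" by (rule sum.swap)
  also have "\<dots> \<le> (\<Sum>i\<in>I. 1)" by (intro sum_mono bessel)
  finally show False by simp
qed

lemma lambda_max_bound:
  assumes I: "finite I" "I \<noteq> {}" and sym: "\<And>i j. i \<in> I \<Longrightarrow> j \<in> I \<Longrightarrow> S i j = S j i"
  shows "bform I S w w \<le> lambda_max I S * (\<Sum>i\<in>I. (w i)\<^sup>2)"
proof -
  obtain c where c: "c \<in> eigenvalues_on I S" "\<And>w. bform I S w w \<le> c * (\<Sum>i\<in>I. (w i)\<^sup>2)"
    using exists_top_eigenvalue[of I S] assms by metis
  have "c \<le> lambda_max I S" unfolding lambda_max_def
    by (rule Max_ge[OF finite_eigenvalues[OF I(1) sym] c(1)])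
  then have "c * (\<Sum>i\<in>I. (w i)\<^sup>2) \<le> lambda_max I S * (\<Sum>i\<in>I. (w i)\<^sup>2)"
    by (intro mult_right_mono sum_nonneg) auto
  then show ?thesis using c(2)[of w] by linarith
qed

text \<open>The top eigenvalue of \<open>- S\<close>, with the sign reversed. That
  \<open>lambda_min\<close> is itself an eigenvalue rests on \<open>finite_eigenvalues\<close>, as
  \<open>Min\<close> is meaningful for finite non-empty sets.\<close>

lemma lambda_min_bound:
  assumes I: "finite I" "I \<noteq> {}" and sym: "\<And>i j. i \<in> I \<Longrightarrow> j \<in> I \<Longrightarrow> S i j = S j i"
  shows "lambda_min I S * (\<Sum>i\<in>I. (w i)\<^sup>2) \<le> bform I S w w" "lambda_min I S \<in> eigenvalues_on I S"
proof -
  have "\<exists>c\<in>eigenvalues_on I (\<lambda>i j. - S i j). \<forall>w. bform I (\<lambda>i j. - S i j) w w \<le> c * (\<Sum>i\<in>I. (w i)\<^sup>2)"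
    by (rule exists_top_eigenvalue[OF I]) (use sym in auto)
  then obtain c where c: "c \<in> eigenvalues_on I (\<lambda>i j. - S i j)" "\<And>w. bform I (\<lambda>i j. - S i j) w w \<le> c * (\<Sum>i\<in>I. (w i)\<^sup>2)"
    by blast
  have c': "- c \<in> eigenvalues_on I S"
  proof -
    obtain v where v: "\<exists>s\<in>I. v s \<noteq> 0" "\<forall>s\<in>I. (\<Sum>t\<in>I. - S s t * v t) = c * v s"
      using c(1) unfolding eigenvalues_on_def by blast
    have "\<forall>s\<in>I. (\<Sum>t\<in>I. S s t * v t) = - c * v s"
    proof
      fix s assume "s \<in> I"
      then have "- (\<Sum>t\<in>I. S s t * v t) = c * v s" using v(2) by (simp add: sum_negf)
      then show "(\<Sum>t\<in>I. S s t * v t) = - c * v s" by (simp add: minus_equation_iff)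
    qed
    then show ?thesis using v(1) unfolding eigenvalues_on_def by blast
  qed
  note fin = finite_eigenvalues[OF I(1) sym]
  have "lambda_min I S \<le> - c" unfolding lambda_min_def by (rule Min_le[OF fin c'])
  then have "lambda_min I S * (\<Sum>i\<in>I. (w i)\<^sup>2) \<le> - c * (\<Sum>i\<in>I. (w i)\<^sup>2)"
    by (intro mult_right_mono sum_nonneg) auto
  also have "\<dots> \<le> bform I S w w" using c(2)[of w] by (simp add: bform_def sum_negf)
  finally show "lambda_min I S * (\<Sum>i\<in>I. (w i)\<^sup>2) \<le> bform I S w w" .
  show "lambda_min I S \<in> eigenvalues_on I S" unfolding lambda_min_def
    by (rule Min_in[OF fin]) (use c' in auto)
qed

section \<open>Cholesky factor and inverse of a positive definite matrix\<close>

lemma pos_def_bform: "pos_def_on I S \<longleftrightarrow> (\<forall>s\<in>I. \<forall>t\<in>I. S s t = S t s) \<and> (\<forall>v. (\<exists>s\<in>I. v s \<noteq> 0) \<longrightarrow> bform I S v v > 0)"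
  by (simp add: pos_def_on_def bform_def)

lemma pos_def_bformD: "pos_def_on I S \<Longrightarrow> \<exists>s\<in>I. v s \<noteq> 0 \<Longrightarrow> 0 < bform I S v v"
  by (simp add: pos_def_bform)

lemma lambda_min_pos:
  assumes I: "finite I" "I \<noteq> {}" and pd: "pos_def_on I S"
  shows "lambda_min I S > 0"
proof -
  obtain v where v: "\<exists>s\<in>I. v s \<noteq> 0" "\<And>s. s \<in> I \<Longrightarrow> (\<Sum>t\<in>I. S s t * v t) = lambda_min I S * v s"
  proof -
    have "lambda_min I S \<in> eigenvalues_on I S"
      by (rule lambda_min_bound(2)[OF I]) (use pd in \<open>unfold pos_def_on_def, blast\<close>)
    then show ?thesis using that unfolding eigenvalues_on_def by blast
  qed
  have "0 < bform I S v v" using pd v(1) by (simp add: pos_def_bform)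
  also have "bform I S v v = (\<Sum>s\<in>I. v s * (\<Sum>t\<in>I. S s t * v t))"
    by (simp add: bform_def sum_distrib_left mult.assoc)
  also have "\<dots> = lambda_min I S * (\<Sum>s\<in>I. v s * v s)"
    using v(2) by (simp add: sum_distrib_left mult_ac)
  finally have "0 < lambda_min I S * (\<Sum>s\<in>I. v s * v s)" .
  moreover have "0 \<le> (\<Sum>s\<in>I. v s * v s)" by (intro sum_nonneg) simp
  ultimately show ?thesis by (metis not_less zero_less_mult_iff)
qed

text \<open>Test vectors on \<open>J\<close> are extended by 0 to \<open>I\<close>.\<close>

lemma pos_def_on_subset:
  assumes "pos_def_on I S" "J \<subseteq> I" "finite I"
  shows "pos_def_on J S"
  unfolding pos_def_bform
proof (intro conjI allI impI)
  show "\<forall>s\<in>J. \<forall>t\<in>J. S s t = S t s" using assms(1,2) unfolding pos_def_on_def by blast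
  fix v assume v: "\<exists>s\<in>J. v s \<noteq> (0::real)"
  let ?w = "\<lambda>i. if i \<in> J then v i else 0"
  have "\<exists>s\<in>I. ?w s \<noteq> 0" using assms(2) v by auto
  with assms(1) have "0 < bform I S ?w ?w" by (rule pos_def_bformD)
  also have "\<dots> = (\<Sum>i\<in>J. \<Sum>j\<in>I. ?w i * S i j * ?w j)"
    unfolding bform_def by (rule sum.mono_neutral_right) (use assms in auto)
  also have "\<dots> = (\<Sum>i\<in>J. \<Sum>j\<in>J. ?w i * S i j * ?w j)"
    by (intro sum.cong refl sum.mono_neutral_right) (use assms in auto)
  also have "\<dots> = bform J S v v" unfolding bform_def by (intro sum.cong refl) auto
  finally show "0 < bform J S v v" .
qed

text \<open>Gram--Schmidt of the unit vectors \<open>e\<^sub>1, e\<^sub>2, ...\<close> with respect to the inner product \<open>S\<close>.\<close>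

lemma pos_def_orthogonal_basis:
  assumes pd: "pos_def_on {1..T} S"
  obtains v c :: "nat \<Rightarrow> nat \<Rightarrow> real" where
    "\<And>t. t \<in> {1..T} \<Longrightarrow> v t t = 1" "\<And>t. t \<in> {1..T} \<Longrightarrow> c t t = 1" "\<And>t k. t < k \<Longrightarrow> c t k = 0"
    "\<And>t k. t \<in> {1..T} \<Longrightarrow> k \<in> {1..T} \<Longrightarrow> t \<noteq> k \<Longrightarrow> bform {1..T} S (v t) (v k) = 0"
    "\<And>t i. t \<in> {1..T} \<Longrightarrow> (if i = t then 1 else 0) = (\<Sum>k\<in>{1..T}. c t k * v k i)"
proof -
  let ?B = "bform {1..T} S"
  define e where "e t = (\<lambda>i. if i = t then 1 else (0::real))" for t :: nat
  define F where "F = (\<lambda>t vs i. e t i - (\<Sum>s\<in>{1..<t}. (?B (e t) (vs s) / ?B (vs s) (vs s)) * vs s i))"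
  define v where "v = hist F T"
  define c where "c t k = (if k = t then 1 else if k < t then ?B (e t) (v k) / ?B (v k) (v k) else 0)" for t k
  have sym: "\<And>a b. ?B a b = ?B b a" using pd by (intro bform_commute) (auto simp: pos_def_on_def)
  have vt: "v t i = e t i - (\<Sum>s\<in>{1..<t}. c t s * v s i)" if t: "t \<in> {1..T}" for t i
  proof -
    have ag: "hist F (t - Suc 0) s = v s" if "s \<in> {1..<t}" for s
      unfolding v_def using hist_agree[of s t T F] that t by auto
    have "v t i = F t (hist F (t - 1)) i" unfolding v_def hist_step[OF t] ..
    also have "\<dots> = e t i - (\<Sum>s\<in>{1..<t}. c t s * v s i)"
    proof -
      have "F t vs i = e t i - (\<Sum>s\<in>{1..<t}. (?B (e t) (vs s) / ?B (vs s) (vs s)) * vs s i)" for vs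
        by (simp only: F_def)
      then show ?thesis by (simp add: ag c_def)
    qed
    finally show ?thesis .
  qed
  have supp: "v t i = 0" if "t < i" "t \<in> {1..T}" for t i
    using that
  proof (induction t rule: less_induct)
    case (less t)
    have "(\<Sum>s\<in>{1..<t}. c t s * v s i) = 0" by (rule sum.neutral) (use less in auto)
    then show ?case using vt[OF less.prems(2)] less.prems by (simp add: e_def)
  qed
  have diag: "v t t = 1" if t: "t \<in> {1..T}" for t
  proof -
    have "(\<Sum>s\<in>{1..<t}. c t s * v s t) = 0" by (rule sum.neutral) (use supp t in auto)
    then show ?thesis using vt[OF t] by (simp add: e_def)
  qed
  have pos: "?B (v t) (v t) > 0" if "t \<in> {1..T}" for t
    by (rule pos_def_bformD[OF pd]) (use diag[OF that] that in force)
  have orth: "\<forall>s\<in>{1..<t}. ?B (v s) (v t) = 0" if "t \<in> {1..T}" for t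
    using that
  proof (induction t rule: less_induct)
    case (less t)
    show ?case
    proof
      fix s assume s: "s \<in> {1..<t}"
      have o: "?B (v s) (v r) = 0" if "r \<in> {1..<t}" "r \<noteq> s" for r
        using less.IH[of s] less.IH[of r] that s less.prems sym[of "v s" "v r"] by (cases "r < s") auto
      have "?B (v s) (v t) = ?B (v s) (\<lambda>i. e t i - (\<Sum>r\<in>{1..<t}. c t r * v r i))"
        by (rule bform_cong) (use vt[OF less.prems] in auto)
      also have "\<dots> = ?B (v s) (e t) - (\<Sum>r\<in>{1..<t}. c t r * ?B (v s) (v r))"
        by (simp only: bform_linear bform_sum(2)[OF finite_atLeastLessThan])
      also have "(\<Sum>r\<in>{1..<t}. c t r * ?B (v s) (v r)) = (\<Sum>r\<in>{s}. c t r * ?B (v s) (v r))"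
        by (rule sum.mono_neutral_right) (use s o in auto)
      also have "\<dots> = ?B (v s) (e t)"
        using pos[of s] s less.prems sym[of "e t" "v s"] by (simp add: c_def)
      finally show "?B (v s) (v t) = 0" by simp
    qed
  qed
  show thesis
  proof (rule that[of v c])
    fix t k assume tk: "t \<in> {1..T}" "k \<in> {1..T}" "t \<noteq> k"
    show "?B (v t) (v k) = 0" using orth[OF tk(1)] orth[OF tk(2)] sym[of "v t" "v k"] tk by (cases "t < k") auto
  next
    fix t i assume t: "t \<in> {1..T}"
    have "(\<Sum>k\<in>{1..T}. c t k * v k i) = (\<Sum>k\<in>insert t {1..<t}. c t k * v k i)"
      by (rule sum.mono_neutral_right) (use t in \<open>auto simp: c_def\<close>)
    also have "\<dots> = v t i + (\<Sum>k\<in>{1..<t}. c t k * v k i)" by (simp add: c_def)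
    also have "\<dots> = (if i = t then 1 else 0)" using vt[OF t] by (simp add: e_def)
    finally show "(if i = t then 1 else 0) = (\<Sum>k\<in>{1..T}. c t k * v k i)" by simp
  qed (use diag in \<open>auto simp: c_def\<close>)
qed

text \<open>The factor is the change of basis \<open>c\<close> with its columns scaled by the
  \<open>S\<close>-lengths of the orthogonal vectors. Because \<open>v t t = 1\<close>, each
  \<open>v t\<close> has Euclidean norm at least 1, and so the pivots inherit the lower bound from
  \<mu>.\<close>

lemma cholesky:
  assumes pd: "pos_def_on {1..T} S" and \<mu>: "\<mu> > 0" "\<And>w. \<mu> * (\<Sum>i\<in>{1..T}. (w i)\<^sup>2) \<le> bform {1..T} S w w"
  obtains R :: "nat \<Rightarrow> nat \<Rightarrow> real" where
    "\<And>r s. r \<in> {1..T} \<Longrightarrow> s \<in> {1..T} \<Longrightarrow> (\<Sum>k\<in>{1..T}. R r k * R s k) = S r s"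
    "\<And>r k. r < k \<Longrightarrow> R r k = 0" "\<And>r. r \<in> {1..T} \<Longrightarrow> R r r \<ge> sqrt \<mu>"
proof -
  let ?B = "bform {1..T} S"
  obtain v c :: "nat \<Rightarrow> nat \<Rightarrow> real" where v: "\<And>t. t \<in> {1..T} \<Longrightarrow> v t t = 1" "\<And>t. t \<in> {1..T} \<Longrightarrow> c t t = 1" "\<And>t k. t < k \<Longrightarrow> c t k = 0"
    "\<And>t k. t \<in> {1..T} \<Longrightarrow> k \<in> {1..T} \<Longrightarrow> t \<noteq> k \<Longrightarrow> ?B (v t) (v k) = 0"
    "\<And>t i. t \<in> {1..T} \<Longrightarrow> (if i = t then 1 else 0) = (\<Sum>k\<in>{1..T}. c t k * v k i)"
    by (rule pos_def_orthogonal_basis[OF pd]) (rule that)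
  have d: "\<mu> \<le> ?B (v t) (v t)" if t: "t \<in> {1..T}" for t
  proof -
    have "(v t t)\<^sup>2 \<le> (\<Sum>i\<in>{1..T}. (v t i)\<^sup>2)" using t by (intro member_le_sum) auto
    then have "\<mu> * 1 \<le> \<mu> * (\<Sum>i\<in>{1..T}. (v t i)\<^sup>2)" using \<mu>(1) v(1)[OF t] by (intro mult_left_mono) auto
    then show ?thesis using \<mu>(2)[of "v t"] by simp
  qed
  have S: "S r s = (\<Sum>k\<in>{1..T}. c r k * c s k * ?B (v k) (v k))" if r: "r \<in> {1..T}" and s: "s \<in> {1..T}" for r s
  proof -
    have "S r s = ?B (\<lambda>i. if i = r then 1 else 0) (\<lambda>i. if i = s then 1 else 0)"
    proof -
      have "?B (\<lambda>i. if i = r then 1 else 0) (\<lambda>i. if i = s then 1 else 0) = (\<Sum>j\<in>{1..T}. S r j * (if j = s then 1 else 0))"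
        by (rule bform_unit[OF finite_atLeastAtMost r])
      also have "\<dots> = (\<Sum>j\<in>{1..T}. if j = s then S r j else 0)" by (intro sum.cong) auto
      also have "\<dots> = S r s" using s by (simp add: sum.delta)
      finally show ?thesis ..
    qed
    also have "\<dots> = ?B (\<lambda>i. \<Sum>k\<in>{1..T}. c r k * v k i) (\<lambda>i. \<Sum>k\<in>{1..T}. c s k * v k i)"
      using v(5)[OF r] v(5)[OF s] by simp
    also have "\<dots> = (\<Sum>k\<in>{1..T}. c r k * (\<Sum>l\<in>{1..T}. c s l * ?B (v k) (v l)))"
      by (simp only: bform_sum[OF finite_atLeastAtMost])
    also have "\<dots> = (\<Sum>k\<in>{1..T}. c r k * (c s k * ?B (v k) (v k)))"
    proof (rule sum.cong[OF refl])
      fix k assume k: "k \<in> {1..T}"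
      have "(\<Sum>l\<in>{1..T}. c s l * ?B (v k) (v l)) = (\<Sum>l\<in>{k}. c s l * ?B (v k) (v l))"
        by (rule sum.mono_neutral_right) (use k v(4) in auto)
      then show "c r k * (\<Sum>l\<in>{1..T}. c s l * ?B (v k) (v l)) = c r k * (c s k * ?B (v k) (v k))" by simp
    qed
    finally show ?thesis by (simp add: mult.assoc)
  qed
  define R where "R t k = c t k * sqrt (?B (v k) (v k))" for t k
  have dp: "?B (v t) (v t) \<ge> 0" if "t \<in> {1..T}" for t using d[OF that] \<mu>(1) by linarith
  show thesis
  proof (rule that[of R])
    fix r s assume rs: "r \<in> {1..T}" "s \<in> {1..T}"
    have "R r k * R s k = c r k * c s k * ?B (v k) (v k)" if "k \<in> {1..T}" for k
      using dp[OF that] by (simp add: R_def mult_ac)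
    then show "(\<Sum>k\<in>{1..T}. R r k * R s k) = S r s" using S[OF rs] by simp
  qed (use v d in \<open>auto simp: R_def\<close>)
qed

lemma pos_def_inverse:
  assumes pd: "pos_def_on {1..T} S"
  obtains X where "\<And>r q. r \<in> {1..T} \<Longrightarrow> q \<in> {1..T} \<Longrightarrow> (\<Sum>s\<in>{1..T}. S r s * X s q) = (if q = r then 1 else 0)"
    "\<And>r q. r \<in> {1..T} \<Longrightarrow> q \<in> {1..T} \<Longrightarrow> (\<Sum>s\<in>{1..T}. X r s * S s q) = (if q = r then 1 else 0)"
    "\<And>r q. r \<notin> {1..T} \<or> q \<notin> {1..T} \<Longrightarrow> X r q = 0"
proof -
  let ?B = "bform {1..T} S"
  obtain v c :: "nat \<Rightarrow> nat \<Rightarrow> real" where v: "\<And>t. t \<in> {1..T} \<Longrightarrow> v t t = 1"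
    "\<And>t k. t \<in> {1..T} \<Longrightarrow> k \<in> {1..T} \<Longrightarrow> t \<noteq> k \<Longrightarrow> ?B (v t) (v k) = 0"
    "\<And>t i. t \<in> {1..T} \<Longrightarrow> (if i = t then 1 else 0) = (\<Sum>k\<in>{1..T}. c t k * v k i)"
    by (rule pos_def_orthogonal_basis[OF pd]) (rule that)
  define d where "d k = ?B (v k) (v k)" for k
  have d: "d k > 0" if "k \<in> {1..T}" for k
    unfolding d_def by (rule pos_def_bformD[OF pd]) (use v(1)[OF that] that in force)
  have ev: "(\<Sum>s\<in>{1..T}. S r s * v k s) = c r k * d k" if r: "r \<in> {1..T}" and k: "k \<in> {1..T}" for r k
  proof -
    have "(\<Sum>s\<in>{1..T}. S r s * v k s) = ?B (\<lambda>i. if i = r then 1 else 0) (v k)" using bform_unit[OF _ r] by simp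
    also have "\<dots> = ?B (\<lambda>i. \<Sum>l\<in>{1..T}. c r l * v l i) (v k)" using v(3)[OF r] by simp
    also have "\<dots> = (\<Sum>l\<in>{1..T}. c r l * ?B (v l) (v k))" by (simp only: bform_sum[OF finite_atLeastAtMost])
    also have "\<dots> = (\<Sum>l\<in>{k}. c r l * ?B (v l) (v k))" by (rule sum.mono_neutral_right) (use k v(2) in auto)
    finally show ?thesis by (simp add: d_def)
  qed
  \<comment> \<open>For an \<open>S\<close>-orthogonal basis with squared lengths \<open>d k\<close>
    the inverse of \<open>S\<close> is the sum of the matrices \<open>v_k v_k^T / d_k\<close>. It is
    set to 0 off the index range, as the characterisation in \<open>pinv_on\<close> demands.\<close>
  define X where "X s q = (if s \<in> {1..T} \<and> q \<in> {1..T} then \<Sum>k\<in>{1..T}. v k s * v k q / d k else 0)" for s q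
  have 1: "(\<Sum>s\<in>{1..T}. S r s * X s q) = (if q = r then 1 else 0)" if r: "r \<in> {1..T}" and q: "q \<in> {1..T}" for r q
  proof -
    have "(\<Sum>s\<in>{1..T}. S r s * X s q) = (\<Sum>s\<in>{1..T}. \<Sum>k\<in>{1..T}. (S r s * v k s) * (v k q / d k))"
      using q by (simp add: X_def sum_distrib_left mult.assoc)
    also have "\<dots> = (\<Sum>k\<in>{1..T}. (\<Sum>s\<in>{1..T}. S r s * v k s) * (v k q / d k))"
      by (subst sum.swap) (simp only: sum_distrib_right)
    also have "\<dots> = (\<Sum>k\<in>{1..T}. c r k * v k q)"
    proof (rule sum.cong[OF refl])
      fix k assume k: "k \<in> {1..T}"
      show "(\<Sum>s\<in>{1..T}. S r s * v k s) * (v k q / d k) = c r k * v k q"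
        unfolding ev[OF r k] using d[OF k] by simp
    qed
    finally show ?thesis using v(3)[OF r, of q] by simp
  qed
  have "X r s = X s r" for r s by (simp add: X_def mult.commute)
  then have "(\<Sum>s\<in>{1..T}. X r s * S s q) = (\<Sum>s\<in>{1..T}. S q s * X s r)" if "q \<in> {1..T}" for r q
    using pd that by (intro sum.cong refl) (auto simp: pos_def_on_def mult.commute)
  then have 2: "(\<Sum>s\<in>{1..T}. X r s * S s q) = (if q = r then 1 else 0)" if "r \<in> {1..T}" "q \<in> {1..T}" for r q
    using 1[OF that(2,1)] that by auto
  show thesis by (rule that[OF 1 2]) (auto simp: X_def)
qed

lemma mat_mult_on_assoc: "mat_mult_on I (mat_mult_on I A B) C i j = mat_mult_on I A (mat_mult_on I B C) i j"
  unfolding mat_mult_on_def sum_distrib_left sum_distrib_right by (subst sum.swap) (simp add: mult.assoc)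

lemma mat_mult_on_cong:
  "(\<And>k. k \<in> I \<Longrightarrow> A i k = A' i k) \<Longrightarrow> (\<And>k. k \<in> I \<Longrightarrow> B k j = B' k j) \<Longrightarrow> mat_mult_on I A B i j = mat_mult_on I A' B' i j"
  unfolding mat_mult_on_def by (intro sum.cong refl) auto

text \<open>Multiplying the Penrose equation \<open>S Y S = S\<close> by the inverse on both sides
  forces \<open>Y = X\<close>, so that the \<open>THE\<close> in \<open>pinv_on\<close> denotes the
  ordinary inverse.\<close>

lemma pinv_on_pos_def:
  assumes pd: "pos_def_on {1..T} S" and r: "r \<in> {1..T}" and q: "q \<in> {1..T}"
  shows "(\<Sum>s\<in>{1..T}. S r s * pinv_on {1..T} S s q) = (if q = r then 1 else 0)"
proof -
  let ?I = "{1..T}"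
  let ?m = "mat_mult_on ?I"
  let ?id = "\<lambda>i j. if j = i then 1 else (0::real)"
  obtain X where X': "\<And>r q. r \<in> ?I \<Longrightarrow> q \<in> ?I \<Longrightarrow> (\<Sum>s\<in>?I. S r s * X s q) = ?id r q"
    "\<And>r q. r \<in> ?I \<Longrightarrow> q \<in> ?I \<Longrightarrow> (\<Sum>s\<in>?I. X r s * S s q) = ?id r q" "\<And>r q. r \<notin> ?I \<or> q \<notin> ?I \<Longrightarrow> X r q = 0"
    by (rule pos_def_inverse[OF pd]) (rule that)
  have X: "?m S X r q = ?id r q" "?m X S r q = ?id r q" if "r \<in> ?I" "q \<in> ?I" for r q
    using X'(1,2)[OF that] by (simp_all only: mat_mult_on_def)
  have idl: "?m ?id A i j = A i j" and idr: "?m A ?id i j = A i j" if "i \<in> ?I" "j \<in> ?I" for A i j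
    using that by (simp_all add: mat_mult_on_def if_distrib[of "\<lambda>x. x * _"] if_distrib[of "\<lambda>x. _ * x"] sum.delta sum.delta' cong: if_cong)
  have 1: "?m (?m S X) A i j = A i j" "?m (?m X S) A i j = A i j" if "i \<in> ?I" "j \<in> ?I" for A i j
    using mat_mult_on_cong[of ?I "?m S X" i ?id A j A] mat_mult_on_cong[of ?I "?m X S" i ?id A j A] X idl that by auto
  have 2: "?m A (?m S X) i j = A i j" if "i \<in> ?I" "j \<in> ?I" for A i j
    using mat_mult_on_cong[of ?I A i A "?m S X" j ?id] X idr that by auto
  have "pinv_on ?I S = X" unfolding pinv_on_def
  proof (rule the_equality)
    show "(\<forall>i j. (i \<notin> ?I \<or> j \<notin> ?I) \<longrightarrow> X i j = 0)
      \<and> (\<forall>i\<in>?I. \<forall>j\<in>?I. ?m (?m S X) S i j = S i j)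
      \<and> (\<forall>i\<in>?I. \<forall>j\<in>?I. ?m (?m X S) X i j = X i j)
      \<and> (\<forall>i\<in>?I. \<forall>j\<in>?I. ?m S X i j = ?m S X j i)
      \<and> (\<forall>i\<in>?I. \<forall>j\<in>?I. ?m X S i j = ?m X S j i)"
      using X X'(3) 1 by auto
  next
    fix Y assume Y: "(\<forall>i j. (i \<notin> ?I \<or> j \<notin> ?I) \<longrightarrow> Y i j = 0)
      \<and> (\<forall>i\<in>?I. \<forall>j\<in>?I. ?m (?m S Y) S i j = S i j)
      \<and> (\<forall>i\<in>?I. \<forall>j\<in>?I. ?m (?m Y S) Y i j = Y i j)
      \<and> (\<forall>i\<in>?I. \<forall>j\<in>?I. ?m S Y i j = ?m S Y j i)
      \<and> (\<forall>i\<in>?I. \<forall>j\<in>?I. ?m Y S i j = ?m Y S j i)"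
    have "Y i j = X i j" if ij: "i \<in> ?I" "j \<in> ?I" for i j
    proof -
      have "Y i j = ?m (?m X S) Y i j" using 1(2)[OF ij] by simp
      also have "\<dots> = ?m X (?m S Y) i j" by (rule mat_mult_on_assoc)
      also have "\<dots> = ?m (?m X (?m S Y)) (?m S X) i j" using 2[OF ij] by simp
      also have "\<dots> = ?m X (?m (?m S Y) (?m S X)) i j" by (rule mat_mult_on_assoc)
      also have "\<dots> = ?m X (?m (?m (?m S Y) S) X) i j"
        by (rule mat_mult_on_cong) (auto simp: mat_mult_on_assoc)
      also have "\<dots> = ?m X (?m S X) i j"
        by (rule mat_mult_on_cong[OF refl], rule mat_mult_on_cong[OF _ refl]) (use Y ij in auto)
      also have "\<dots> = X i j" by (rule 2[OF ij])
      finally show ?thesis .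
    qed
    then show "Y = X" using Y X'(3) by (intro ext) metis
  qed
  then show ?thesis using X(1)[OF r q] by (simp add: mat_mult_on_def)
qed

section \<open>Deterministic comparison of the trajectories\<close>

text \<open>This is \<open>f = O(E)\<close> with one constant for all instances in \<open>S\<close>.
  With \<open>S\<close> a class of problems of varying dimension, uniformity in the dimension, the
  functions and the noise comes without tracking any constant.\<close>

definition dominated :: "'c set \<Rightarrow> ('c \<Rightarrow> real) \<Rightarrow> ('c \<Rightarrow> real) \<Rightarrow> bool" where
  "dominated S f E \<longleftrightarrow> (\<exists>C. \<forall>c\<in>S. \<bar>f c\<bar> \<le> C * E c)"

lemma dominatedI: "(\<And>c. c \<in> S \<Longrightarrow> \<bar>f c\<bar> \<le> C * E c) \<Longrightarrow> dominated S f E"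
  by (auto simp: dominated_def)

lemma dominated_mono: "dominated S f E \<Longrightarrow> (\<And>c. c \<in> S \<Longrightarrow> \<bar>g c\<bar> \<le> \<bar>f c\<bar>) \<Longrightarrow> dominated S g E"
  unfolding dominated_def by (meson order_trans)

lemma dominated_cong: "(\<And>c. c \<in> S \<Longrightarrow> f c = g c) \<Longrightarrow> dominated S f E = dominated S g E"
  by (simp add: dominated_def)

lemma dominated_add: "dominated S f E \<Longrightarrow> dominated S g E \<Longrightarrow> dominated S (\<lambda>c. f c + g c) E"
proof -
  assume "dominated S f E" "dominated S g E"
  then obtain C D where *: "\<And>c. c \<in> S \<Longrightarrow> \<bar>f c\<bar> \<le> C * E c" "\<And>c. c \<in> S \<Longrightarrow> \<bar>g c\<bar> \<le> D * E c"
    by (auto simp: dominated_def)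
  show ?thesis by (rule dominatedI[of _ _ "C + D"]) (use * in \<open>fastforce simp: distrib_right intro: order_trans[OF abs_triangle_ineq] add_mono\<close>)
qed

lemma dominated_uminus: "dominated S f E \<Longrightarrow> dominated S (\<lambda>c. - f c) E"
  by (simp add: dominated_def)

lemma dominated_diff: "dominated S f E \<Longrightarrow> dominated S g E \<Longrightarrow> dominated S (\<lambda>c. f c - g c) E"
  using dominated_add[of S f E "\<lambda>c. - g c"] by (simp add: dominated_uminus)

lemma dominated_sum: "(\<And>i. i \<in> A \<Longrightarrow> dominated S (f i) E) \<Longrightarrow> dominated S (\<lambda>c. \<Sum>i\<in>A. f i c) E"
proof (induction A rule: infinite_finite_induct)
  case (insert i A)
  then show ?case by (simp add: dominated_add)
qed (auto intro!: dominatedI[of _ _ 0])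

lemma dominated_mult: "dominated S f E \<Longrightarrow> dominated S g D \<Longrightarrow> dominated S (\<lambda>c. f c * g c) (\<lambda>c. E c * D c)"
proof -
  assume "dominated S f E" "dominated S g D"
  then obtain K M where *: "\<And>c. c \<in> S \<Longrightarrow> \<bar>f c\<bar> \<le> K * E c" "\<And>c. c \<in> S \<Longrightarrow> \<bar>g c\<bar> \<le> M * D c"
    by (auto simp: dominated_def)
  show ?thesis
  proof (rule dominatedI[of _ _ "K * M"])
    fix c assume c: "c \<in> S"
    have "\<bar>f c * g c\<bar> \<le> (K * E c) * (M * D c)"
      unfolding abs_mult by (intro mult_mono * c order_trans[OF abs_ge_zero *(1)]) auto
    then show "\<bar>f c * g c\<bar> \<le> K * M * (E c * D c)" by (simp add: mult_ac)
  qed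
qed

lemma dominated_weaken:
  assumes "dominated S f E" "\<And>c. c \<in> S \<Longrightarrow> 0 \<le> E c" "\<And>c. c \<in> S \<Longrightarrow> E c \<le> D c"
  shows "dominated S f D"
proof -
  obtain K where *: "\<And>c. c \<in> S \<Longrightarrow> \<bar>f c\<bar> \<le> K * E c" using assms(1) by (auto simp: dominated_def)
  show ?thesis
  proof (rule dominatedI[of _ _ "\<bar>K\<bar>"])
    fix c assume c: "c \<in> S"
    have "\<bar>f c\<bar> \<le> K * E c" by (rule *[OF c])
    also have "\<dots> \<le> \<bar>K\<bar> * E c" using assms(2)[OF c] by (intro mult_right_mono) auto
    also have "\<dots> \<le> \<bar>K\<bar> * D c" using assms(3)[OF c] by (intro mult_left_mono) auto
    finally show "\<bar>f c\<bar> \<le> \<bar>K\<bar> * D c" .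
  qed
qed

lemma dominated_const: "dominated S (\<lambda>_. k) (\<lambda>_. 1)"
  by (rule dominatedI[of _ _ "\<bar>k\<bar>"]) simp

lemma dominated_bounded_mult:
  "dominated S f (\<lambda>_. 1) \<Longrightarrow> dominated S g D \<Longrightarrow> dominated S (\<lambda>c. f c * g c) D"
  using dominated_mult[of S f "\<lambda>_. 1" g D] by simp

text \<open>Division by \<open>d\<close>, which is at least a constant multiple of \<rho>, cancels
  the factor \<rho>. In this way bounds of order \<open>\<epsilon> * \<rho>\<close> on products
  become bounds of order \<epsilon> on Gram--Schmidt coefficients.\<close>

lemma dominated_cancel:
  assumes fg: "dominated S (\<lambda>c. f c * d c) (\<lambda>c. E c * \<rho> c)" and d: "dominated S (\<lambda>c. \<rho> c / d c) (\<lambda>_. 1)"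
    and pos: "\<And>c. c \<in> S \<Longrightarrow> d c > 0" "\<And>c. c \<in> S \<Longrightarrow> \<rho> c > 0"
  shows "dominated S f E"
proof -
  obtain K M where *: "\<And>c. c \<in> S \<Longrightarrow> \<bar>f c * d c\<bar> \<le> K * (E c * \<rho> c)" "\<And>c. c \<in> S \<Longrightarrow> \<bar>\<rho> c / d c\<bar> \<le> M"
    using fg d by (auto simp: dominated_def)
  show ?thesis
  proof (rule dominatedI[of _ _ "K * M"])
    fix c assume c: "c \<in> S"
    note p = pos[OF c]
    have "0 \<le> K * (E c * \<rho> c)" using *(1)[OF c] by linarith
    then have KE: "0 \<le> K * E c" using p by (simp add: mult.assoc[symmetric] zero_le_mult_iff)
    have "\<bar>f c\<bar> = \<bar>f c * d c\<bar> / d c" using p by (simp add: abs_mult)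
    also have "\<dots> \<le> K * (E c * \<rho> c) / d c" using *(1)[OF c] p by (intro divide_right_mono) auto
    also have "\<dots> = (K * E c) * (\<rho> c / d c)" by simp
    also have "\<dots> \<le> (K * E c) * M" by (intro mult_left_mono KE order_trans[OF abs_ge_self *(2)[OF c]])
    finally show "\<bar>f c\<bar> \<le> K * M * E c" by (simp add: mult_ac)
  qed
qed

lemma dominated_sqrt:
  assumes "dominated S (\<lambda>c. (f c)\<^sup>2) (\<lambda>c. E c * E c)" "\<And>c. c \<in> S \<Longrightarrow> 0 \<le> E c"
  shows "dominated S f E"
proof -
  obtain K where K: "\<And>c. c \<in> S \<Longrightarrow> \<bar>(f c)\<^sup>2\<bar> \<le> K * (E c * E c)" using assms(1) by (auto simp: dominated_def)
  show ?thesis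
  proof (rule dominatedI[of _ _ "sqrt \<bar>K\<bar>"])
    fix c assume c: "c \<in> S"
    have "(f c)\<^sup>2 \<le> K * (E c * E c)" using K[OF c] by simp
    also have "\<dots> \<le> \<bar>K\<bar> * (E c * E c)" by (intro mult_right_mono) auto
    finally have "sqrt ((f c)\<^sup>2) \<le> sqrt (\<bar>K\<bar> * (E c * E c))" by (rule real_sqrt_le_mono)
    then show "\<bar>f c\<bar> \<le> sqrt \<bar>K\<bar> * E c" using assms(2)[OF c] by (simp add: real_sqrt_mult)
  qed
qed

lemma vnorm_triangle: "vnorm n (\<lambda>i. a i + b i) \<le> vnorm n a + vnorm n b"
  using L2_set_triangle_ineq[of a b "{..<n}"] by (simp add: vnorm_def L2_set_def)

lemma vnorm_scale: "vnorm n (\<lambda>i. c * a i) = \<bar>c\<bar> * vnorm n a"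
  by (simp add: vnorm_def power_mult_distrib real_sqrt_mult flip: sum_distrib_left)

lemma vinner_le_vnorm: "\<bar>vinner n a b\<bar> \<le> vnorm n a * vnorm n b"
proof -
  have "\<bar>vinner n a b\<bar> \<le> (\<Sum>i<n. \<bar>a i\<bar> * \<bar>b i\<bar>)"
    unfolding vinner_def by (rule order_trans[OF sum_abs]) (simp add: abs_mult)
  also have "\<dots> \<le> vnorm n a * vnorm n b"
    using L2_set_mult_ineq[of a b "{..<n}"] by (simp add: vnorm_def L2_set_def)
  finally show ?thesis .
qed

lemma vinner_left_linear:
  "vinner n (\<lambda>i. a i + b i) w = vinner n a w + vinner n b w"
  "vinner n (\<lambda>i. a i - b i) w = vinner n a w - vinner n b w"
  "vinner n (\<lambda>i. c * a i) w = c * vinner n a w"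
  using vinner_right_linear[of n w] by (simp_all add: vinner_commute[of n _ w])

lemma vinner_sum_left: "vinner n (\<lambda>i. \<Sum>s\<in>A. c s * a s i) w = (\<Sum>s\<in>A. c s * vinner n (a s) w)"
  using vinner_sum_right[of n w "\<lambda>s i. c s * a s i" A] by (simp only: vinner_right_linear vinner_commute[of n _ w])

text \<open>The dimension belongs to the instance, so one bound can compare vectors from different
  spaces.\<close>

locale vector_family =
  fixes S :: "'c set" and n :: "'c \<Rightarrow> nat"
begin

abbreviation dom :: "('c \<Rightarrow> real) \<Rightarrow> ('c \<Rightarrow> real) \<Rightarrow> bool" where "dom \<equiv> dominated S"

definition vdom :: "('c \<Rightarrow> nat \<Rightarrow> real) \<Rightarrow> ('c \<Rightarrow> real) \<Rightarrow> bool" where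
  "vdom X E \<longleftrightarrow> dom (\<lambda>c. vnorm (n c) (X c)) E"

lemma vdom_cong: "(\<And>c i. c \<in> S \<Longrightarrow> i < n c \<Longrightarrow> X c i = Y c i) \<Longrightarrow> vdom X E \<longleftrightarrow> vdom Y E"
  unfolding vdom_def by (intro dominated_cong vnorm_cong)

lemma vdom_add: "vdom X E \<Longrightarrow> vdom Y E \<Longrightarrow> vdom (\<lambda>c i. X c i + Y c i) E"
  unfolding vdom_def
  by (rule dominated_mono[OF dominated_add[of S "\<lambda>c. vnorm (n c) (X c)" E "\<lambda>c. vnorm (n c) (Y c)"]]) (simp_all add: vnorm_triangle)

lemma vdom_scale: "dom a D \<Longrightarrow> vdom X E \<Longrightarrow> vdom (\<lambda>c i. a c * X c i) (\<lambda>c. D c * E c)"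
  unfolding vdom_def by (rule dominated_mono[OF dominated_mult]) (auto simp: vnorm_scale abs_mult)

lemma vdom_bounded_scale: "dom a (\<lambda>_. 1) \<Longrightarrow> vdom X E \<Longrightarrow> vdom (\<lambda>c i. a c * X c i) E"
  using vdom_scale[of a "\<lambda>_. 1" X E] by simp

lemma vdom_unit_scale: "dom a E \<Longrightarrow> vdom X (\<lambda>_. 1) \<Longrightarrow> vdom (\<lambda>c i. a c * X c i) E"
  using vdom_scale[of a E X "\<lambda>_. 1"] by simp

lemma vdom_diff: "vdom X E \<Longrightarrow> vdom Y E \<Longrightarrow> vdom (\<lambda>c i. X c i - Y c i) E"
  using vdom_add[of X E "\<lambda>c i. -1 * Y c i"] vdom_bounded_scale[OF dominated_const, of Y E "-1"] by simp

lemma vdom_sum: "(\<And>s. s \<in> A \<Longrightarrow> vdom (X s) E) \<Longrightarrow> vdom (\<lambda>c i. \<Sum>s\<in>A. X s c i) E"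
proof (induction A rule: infinite_finite_induct)
  case (insert s A)
  then show ?case by (simp add: vdom_add)
qed (auto simp: vdom_def vnorm_def intro!: dominatedI[of _ _ 0])

lemma dom_vinner: "vdom X D \<Longrightarrow> vdom Y E \<Longrightarrow> dom (\<lambda>c. vinner (n c) (X c) (Y c)) (\<lambda>c. D c * E c)"
  unfolding vdom_def by (rule dominated_mono[OF dominated_mult]) (auto simp: abs_mult vinner_le_vnorm)

lemma vdom_weaken: "vdom X E \<Longrightarrow> (\<And>c. c \<in> S \<Longrightarrow> 0 \<le> E c) \<Longrightarrow> (\<And>c. c \<in> S \<Longrightarrow> E c \<le> D c) \<Longrightarrow> vdom X D"
  unfolding vdom_def by (rule dominated_weaken)

text \<open>Back substitution starting from \<open>s = t - 1\<close>: with bounded data and pivots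
  bounded away from 0 each unknown is bounded once the later ones are.\<close>

lemma triangular_system_bounded:
  fixes t :: nat
  assumes \<beta>: "\<And>s. s \<in> {1..<t} \<Longrightarrow> dom (\<beta> s) (\<lambda>_. 1)"
    and R: "\<And>s r. s \<in> {1..<t} \<Longrightarrow> r \<in> {1..<t} \<Longrightarrow> dom (R s r) (\<lambda>_. 1)"
    and R_diag: "\<And>s c. s \<in> {1..<t} \<Longrightarrow> c \<in> S \<Longrightarrow> R s s c > 0" "\<And>s. s \<in> {1..<t} \<Longrightarrow> dom (\<lambda>c. 1 / R s s c) (\<lambda>_. 1)"
    and b: "\<And>k c. k \<in> {1..<t} \<Longrightarrow> c \<in> S \<Longrightarrow> (\<Sum>s\<in>{k..<t}. b s c * R s k c) = \<beta> k c"
    and "s \<in> {1..<t}"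
  shows "dom (b s) (\<lambda>_. 1)"
  using \<open>s \<in> {1..<t}\<close>
proof (induction "t - s" arbitrary: s rule: less_induct)
  case less
  have "dom (\<lambda>c. (\<beta> s c - (\<Sum>r\<in>{s+1..<t}. b r c * R r s c)) * (1 / R s s c)) (\<lambda>_. 1)"
  proof (rule dominated_bounded_mult[OF dominated_diff[OF \<beta>[OF less.prems] dominated_sum] R_diag(2)[OF less.prems]])
    fix r assume r: "r \<in> {s+1..<t}"
    have "dom (b r) (\<lambda>_. 1)" by (rule less.hyps) (use r less.prems in auto)
    then show "dom (\<lambda>c. b r c * R r s c) (\<lambda>_. 1)"
      by (rule dominated_bounded_mult) (use R r less.prems in auto)
  qed
  then show ?case
  proof (rule dominated_mono)
    fix c assume c: "c \<in> S"
    have "{s..<t} = insert s {s+1..<t}" using less.prems by auto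
    then have "b s c * R s s c = \<beta> s c - (\<Sum>r\<in>{s+1..<t}. b r c * R r s c)"
      using b[OF less.prems c] by simp
    then have "b s c = (\<beta> s c - (\<Sum>r\<in>{s+1..<t}. b r c * R r s c)) * (1 / R s s c)"
      using R_diag(1)[OF less.prems c] by (simp add: field_simps)
    then show "\<bar>b s c\<bar> \<le> \<bar>(\<beta> s c - (\<Sum>r\<in>{s+1..<t}. b r c * R r s c)) * (1 / R s s c)\<bar>" by simp
  qed
qed

lemma vdom_lipschitz:
  fixes t :: nat
  assumes IH: "\<And>s. s \<in> {1..<t} \<Longrightarrow> vdom (D s) E"
    and le: "\<And>c. c \<in> S \<Longrightarrow> vnorm (n c) (H c) \<le> L * sqrt (\<Sum>s\<in>{1..<t}. (vnorm (n c) (D s c))\<^sup>2)"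
  shows "vdom H E"
proof -
  have "dom (\<lambda>c. \<bar>L\<bar> * (\<Sum>s\<in>{1..<t}. vnorm (n c) (D s c))) E"
    using IH by (intro dominated_bounded_mult dominated_const dominated_sum) (simp add: vdom_def)
  then show ?thesis unfolding vdom_def
  proof (rule dominated_mono)
    fix c assume c: "c \<in> S"
    let ?d = "\<lambda>s. vnorm (n c) (D s c)"
    have "sqrt (\<Sum>s\<in>{1..<t}. (?d s)\<^sup>2) \<le> (\<Sum>s\<in>{1..<t}. ?d s)"
      using L2_set_le_sum[of "{1..<t}" ?d] by (simp add: L2_set_def)
    then have "L * sqrt (\<Sum>s\<in>{1..<t}. (?d s)\<^sup>2) \<le> \<bar>L\<bar> * (\<Sum>s\<in>{1..<t}. ?d s)"
      by (intro mult_mono) (auto intro: sum_nonneg)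
    then show "\<bar>vnorm (n c) (H c)\<bar> \<le> \<bar>\<bar>L\<bar> * (\<Sum>s\<in>{1..<t}. ?d s)\<bar>"
      using le[OF c] by (auto intro: order_trans[OF _ abs_ge_self])
  qed
qed

text \<open>\<open>D\<close> stands for the difference of two runs of the recursion and
  \<open>Z\<close> for that of their noises. With \<open>E\<close> the distance of the noises, the
  conclusion says that \<open>y\<close> and \<open>f t (y z)\<close> are Lipschitz in the
  noise.\<close>

lemma recursion_lipschitz:
  fixes T :: nat
  assumes FD: "\<And>t c. t \<in> {1..T} \<Longrightarrow> c \<in> S \<Longrightarrow> vnorm (n c) (FD t c) \<le> L * sqrt (\<Sum>s\<in>{1..<t}. (vnorm (n c) (D s c))\<^sup>2)"
    and GD: "\<And>t c. t \<in> {1..T} \<Longrightarrow> c \<in> S \<Longrightarrow> vnorm (n c) (GD t c) \<le> L * sqrt (\<Sum>s\<in>{1..<t}. (vnorm (n c) (D s c))\<^sup>2)"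
    and b: "\<And>s t. t \<in> {1..T} \<Longrightarrow> s \<in> {1..<t} \<Longrightarrow> dom (b s t) (\<lambda>_. 1)"
    and R: "\<And>s t. s \<in> {1..T} \<Longrightarrow> t \<in> {1..T} \<Longrightarrow> dom (R t s) (\<lambda>_. 1)"
    and Z: "\<And>s. s \<in> {1..T} \<Longrightarrow> vdom (Z s) E"
    and D_eq: "\<And>t c i. t \<in> {1..T} \<Longrightarrow> c \<in> S \<Longrightarrow> i < n c \<Longrightarrow> D t c i = GD t c i + (\<Sum>s\<in>{1..<t}. b s t c * FD s c i) + (\<Sum>s\<in>{1..t}. R t s c * Z s c i)"
  shows "t \<in> {1..T} \<Longrightarrow> vdom (D t) E" "t \<in> {1..T} \<Longrightarrow> vdom (FD t) E"
proof -
  have D: "vdom (D t) E" if "t \<in> {1..T}" for t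
    using that
  proof (induction t rule: less_induct)
    case (less t)
    have IH: "vdom (D s) E" if "s \<in> {1..<t}" for s by (rule less.IH) (use that less.prems in auto)
    have G: "vdom (GD t) E" by (rule vdom_lipschitz[OF IH GD[OF less.prems]])
    have F: "vdom (FD s) E" if s: "s \<in> {1..<t}" for s
      by (rule vdom_lipschitz[where t = s and L = L and D = D]) (use IH FD s less.prems in auto)
    have "vdom (\<lambda>c i. GD t c i + (\<Sum>s\<in>{1..<t}. b s t c * FD s c i) + (\<Sum>s\<in>{1..t}. R t s c * Z s c i)) E"
      by (rule vdom_add[OF vdom_add[OF G vdom_sum[OF vdom_bounded_scale[OF b F]]] vdom_sum[OF vdom_bounded_scale[OF R Z]]]) (use less.prems in auto)
    then show ?case using vdom_cong[of "D t", OF D_eq[OF less.prems]] by simp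
  qed
  then show "t \<in> {1..T} \<Longrightarrow> vdom (D t) E" .
  show "vdom (FD t) E" if t: "t \<in> {1..T}"
    by (rule vdom_lipschitz[where t = t and L = L and D = D]) (use D FD t in auto)
qed

end

text \<open>All bounds below are uniform over the index set \<open>S\<close> of problem instances; \<open>\<epsilon>\<close> plays the role of the square root of the
  deviation level \<open>r\<close>, and \<open>\<rho>\<close> that of the square root of \<open>n\<close>.\<close>

locale comparison = vector_family S n
  for S :: "'c set" and n :: "'c \<Rightarrow> nat" +
  fixes T :: nat and L :: real and \<epsilon> \<rho> :: "'c \<Rightarrow> real"
    and x y z u Fx Fy Gx Gy :: "nat \<Rightarrow> 'c \<Rightarrow> nat \<Rightarrow> real"
    and R b \<beta> \<Sigma> :: "nat \<Rightarrow> nat \<Rightarrow> 'c \<Rightarrow> real"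
  assumes \<rho>: "\<And>c. c \<in> S \<Longrightarrow> \<rho> c > 0" "\<And>c. c \<in> S \<Longrightarrow> \<rho> c * \<rho> c = n c"
    and \<epsilon>: "\<And>c. c \<in> S \<Longrightarrow> 0 \<le> \<epsilon> c" "\<And>c. c \<in> S \<Longrightarrow> \<epsilon> c \<le> \<rho> c"
    and lipF: "\<And>t c. t \<in> {1..T} \<Longrightarrow> c \<in> S \<Longrightarrow> vnorm (n c) (\<lambda>i. Fx t c i - Fy t c i) \<le> L * sqrt (\<Sum>s\<in>{1..<t}. (vnorm (n c) (\<lambda>i. x s c i - y s c i))\<^sup>2)"
    and lipG: "\<And>t c. t \<in> {1..T} \<Longrightarrow> c \<in> S \<Longrightarrow> vnorm (n c) (\<lambda>i. Gx t c i - Gy t c i) \<le> L * sqrt (\<Sum>s\<in>{1..<t}. (vnorm (n c) (\<lambda>i. x s c i - y s c i))\<^sup>2)"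
    and gram: "\<And>s t. s \<in> {1..T} \<Longrightarrow> t \<in> {1..T} \<Longrightarrow> dom (\<lambda>c. vinner (n c) (Fy s c) (Fy t c) - \<rho> c * \<rho> c * \<Sigma> s t c) (\<lambda>c. \<epsilon> c * \<rho> c)"
    and cross: "\<And>r t. r \<in> {1..T} \<Longrightarrow> t \<in> {1..T} \<Longrightarrow> dom (\<lambda>c. vinner (n c) (z r c) (Fy t c) - \<rho> c * \<rho> c * \<beta> r t c) (\<lambda>c. \<epsilon> c * \<rho> c)"
    and z: "\<And>r. r \<in> {1..T} \<Longrightarrow> vdom (z r) \<rho>"
    and \<Sigma>: "\<And>s t. s \<in> {1..T} \<Longrightarrow> t \<in> {1..T} \<Longrightarrow> dom (\<Sigma> s t) (\<lambda>_. 1)"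
    and \<beta>: "\<And>s t. s \<in> {1..T} \<Longrightarrow> t \<in> {1..T} \<Longrightarrow> dom (\<beta> s t) (\<lambda>_. 1)"
    and \<beta>0: "\<And>s t c. t \<in> {1..T} \<Longrightarrow> s \<in> {t..T} \<Longrightarrow> c \<in> S \<Longrightarrow> \<beta> s t c = 0"
    and R: "\<And>s t. s \<in> {1..T} \<Longrightarrow> t \<in> {1..T} \<Longrightarrow> dom (R s t) (\<lambda>_. 1)"
    and R_tri: "\<And>s t c. s < t \<Longrightarrow> c \<in> S \<Longrightarrow> R s t c = 0"
    and R_diag: "\<And>s c. s \<in> {1..T} \<Longrightarrow> c \<in> S \<Longrightarrow> R s s c > 0" "\<And>s. s \<in> {1..T} \<Longrightarrow> dom (\<lambda>c. 1 / R s s c) (\<lambda>_. 1)"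
    and RR: "\<And>s t c. s \<in> {1..T} \<Longrightarrow> t \<in> {1..T} \<Longrightarrow> c \<in> S \<Longrightarrow> (\<Sum>k\<in>{1..T}. R s k c * R t k c) = \<Sigma> s t c"
    and b: "\<And>k t c. t \<in> {1..T} \<Longrightarrow> k \<in> {1..<t} \<Longrightarrow> c \<in> S \<Longrightarrow> (\<Sum>s\<in>{k..<t}. b s t c * R s k c) = \<beta> k t c"
    and u_unit: "\<And>s c. s \<in> {1..T} \<Longrightarrow> c \<in> S \<Longrightarrow> unit_or_zero (n c) (u s c)"
    and u_expand: "\<And>t c i. t \<in> {1..T} \<Longrightarrow> c \<in> S \<Longrightarrow> i < n c \<Longrightarrow> Fx t c i = (\<Sum>s\<in>{1..t}. vinner (n c) (u s c) (Fx t c) * u s c i)"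
    and u_diag: "\<And>t c. t \<in> {1..T} \<Longrightarrow> c \<in> S \<Longrightarrow> vinner (n c) (u t c) (Fx t c) \<ge> 0"
    and x_eq: "\<And>t c i. t \<in> {1..T} \<Longrightarrow> c \<in> S \<Longrightarrow> i < n c \<Longrightarrow> x t c i = Gx t c i + (\<Sum>s\<in>{1..t}. vinner (n c) (u s c) (Fx t c) *
         ((z s c i + (sqrt 2 - 1) * vinner (n c) (u s c) (z s c) * u s c i
     - (\<Sum>j\<in>{1..<s}. u j c i * vinner (n c) (u j c) (z s c)) + (\<Sum>j\<in>{1..<s}. u j c i * vinner (n c) (z j c) (u s c))) / \<rho> c))"
    and y_eq: "\<And>t c i. t \<in> {1..T} \<Longrightarrow> c \<in> S \<Longrightarrow> i < n c \<Longrightarrow> y t c i = Gy t c i + (\<Sum>s\<in>{1..<t}. b s t c * Fy s c i) + (\<Sum>s\<in>{1..t}. R t s c * z s c i)"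
begin

definition A :: "nat \<Rightarrow> nat \<Rightarrow> 'c \<Rightarrow> real" where
  "A t s c = vinner (n c) (u s c) (Fx t c)"

definition zu :: "nat \<Rightarrow> nat \<Rightarrow> 'c \<Rightarrow> real" where
  "zu r s c = vinner (n c) (z r c) (u s c)"

lemma dom_\<rho>\<rho>: "dom f (\<lambda>c. \<epsilon> c * \<rho> c) \<Longrightarrow> dom f (\<lambda>c. \<rho> c * \<rho> c)"
proof (rule dominated_weaken)
  fix c assume c: "c \<in> S"
  show "0 \<le> \<epsilon> c * \<rho> c" using \<epsilon>(1)[OF c] \<rho>(1)[OF c] by simp
  show "\<epsilon> c * \<rho> c \<le> \<rho> c * \<rho> c" using \<epsilon>(2)[OF c] \<rho>(1)[OF c] by simp
qed

lemma dom_self: "dom \<rho> \<rho>" "dom (\<lambda>c. \<rho> c * \<rho> c) (\<lambda>c. \<rho> c * \<rho> c)"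
proof -
  show "dom \<rho> \<rho>" by (rule dominatedI[of _ _ 1]) (simp add: \<rho>(1) less_imp_le)
  then show "dom (\<lambda>c. \<rho> c * \<rho> c) (\<lambda>c. \<rho> c * \<rho> c)" by (intro dominated_mult)
qed

lemma cancel_diag:
  assumes "dom (\<lambda>c. f c * (\<rho> c * R s s c)) (\<lambda>c. \<epsilon> c * \<rho> c)" "s \<in> {1..T}"
  shows "dom f \<epsilon>"
proof (rule dominated_cancel[OF assms(1)])
  show "dom (\<lambda>c. \<rho> c / (\<rho> c * R s s c)) (\<lambda>_. 1)"
    using R_diag(2)[OF assms(2)] by (rule dominated_mono) (use \<rho>(1) in force)
qed (use R_diag(1)[OF assms(2)] \<rho>(1) in auto)

lemma u_bounded: "s \<in> {1..T} \<Longrightarrow> vdom (u s) (\<lambda>_. 1)"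
  unfolding vdom_def
proof (rule dominatedI[of _ _ 1])
  fix c assume s: "s \<in> {1..T}" and c: "c \<in> S"
  have "vnorm (n c) (u s c) = 1 \<or> vnorm (n c) (u s c) = 0"
    using u_unit[OF s c] unfolding unit_or_zero_def vnorm_eq_0_iff vnorm_sq[symmetric]
    by (metis abs_of_nonneg power2_eq_1_iff vnorm_nonneg abs_minus_cancel abs_1)
  then show "\<bar>vnorm (n c) (u s c)\<bar> \<le> 1 * 1" by auto
qed

lemma Fy_bounded: "t \<in> {1..T} \<Longrightarrow> vdom (Fy t) \<rho>"
  unfolding vdom_def
proof (rule dominated_sqrt)
  assume t: "t \<in> {1..T}"
  have "dom (\<lambda>c. (vinner (n c) (Fy t c) (Fy t c) - \<rho> c * \<rho> c * \<Sigma> t t c) + \<Sigma> t t c * (\<rho> c * \<rho> c)) (\<lambda>c. \<rho> c * \<rho> c)"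
    by (intro dominated_add dom_\<rho>\<rho> gram dominated_bounded_mult \<Sigma> dom_self t)
  then show "dom (\<lambda>c. (vnorm (n c) (Fy t c))\<^sup>2) (\<lambda>c. \<rho> c * \<rho> c)" by (simp add: vnorm_sq mult_ac)
qed (simp add: \<rho>(1) less_imp_le)

lemma b_bounded:
  assumes t: "t \<in> {1..T}" and "s \<in> {1..<t}"
  shows "dom (b s t) (\<lambda>_. 1)"
  by (rule triangular_system_bounded[of t "\<lambda>s. \<beta> s t" R "\<lambda>s. b s t"]) (use assms \<beta> R R_diag b in auto)

section \<open>One time step of the comparison\<close>

context
  fixes t :: nat
  assumes t: "t \<in> {1..T}" and IH: "\<And>s. s \<in> {1..<t} \<Longrightarrow> vdom (\<lambda>c i. x s c i - y s c i) \<epsilon>"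
begin

lemma Fdiff: "s \<in> {1..t} \<Longrightarrow> vdom (\<lambda>c i. Fx s c i - Fy s c i) \<epsilon>"
  by (rule vdom_lipschitz[where t = s and L = L and D = "\<lambda>s c i. x s c i - y s c i"]) (use IH t lipF in auto)

lemma Gdiff: "vdom (\<lambda>c i. Gx t c i - Gy t c i) \<epsilon>"
  by (rule vdom_lipschitz[where t = t and L = L and D = "\<lambda>s c i. x s c i - y s c i"]) (use IH t lipG in auto)

lemma Fx_bounded: "s \<in> {1..t} \<Longrightarrow> vdom (Fx s) \<rho>"
proof -
  assume s: "s \<in> {1..t}"
  have "vdom (\<lambda>c i. Fx s c i - Fy s c i) \<rho>" using vdom_weaken[OF Fdiff[OF s] \<epsilon>] by simp
  then have "vdom (\<lambda>c i. (Fx s c i - Fy s c i) + Fy s c i) \<rho>" using s t by (intro vdom_add Fy_bounded) auto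
  then show ?thesis by simp
qed

lemma gram_x:
  assumes s: "s \<in> {1..t}" and r: "r \<in> {1..t}"
  shows "dom (\<lambda>c. vinner (n c) (Fx s c) (Fx r c) - \<rho> c * \<rho> c * \<Sigma> s r c) (\<lambda>c. \<epsilon> c * \<rho> c)"
proof -
  have "dom (\<lambda>c. vinner (n c) (\<lambda>i. Fx s c i - Fy s c i) (Fx r c) + vinner (n c) (\<lambda>i. Fx r c i - Fy r c i) (Fy s c)
     + (vinner (n c) (Fy s c) (Fy r c) - \<rho> c * \<rho> c * \<Sigma> s r c)) (\<lambda>c. \<epsilon> c * \<rho> c)"
    using s r t by (intro dominated_add dom_vinner Fdiff Fx_bounded Fy_bounded gram) auto
  then show ?thesis by (simp add: vinner_left_linear vinner_commute[of _ "Fy s _"] vinner_commute[of _ "Fx s _"])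
qed

lemma cross_x:
  assumes s: "s \<in> {1..t}" and r: "r \<in> {1..T}"
  shows "dom (\<lambda>c. vinner (n c) (z r c) (Fx s c) - \<rho> c * \<rho> c * \<beta> r s c) (\<lambda>c. \<epsilon> c * \<rho> c)"
proof -
  have "dom (\<lambda>c. vinner (n c) (\<lambda>i. Fx s c i - Fy s c i) (z r c) 
     + (vinner (n c) (z r c) (Fy s c) - \<rho> c * \<rho> c * \<beta> r s c)) (\<lambda>c. \<epsilon> c * \<rho> c)"
    using s r t by (intro dominated_add dom_vinner Fdiff z cross) auto
  then show ?thesis by (simp add: vinner_left_linear vinner_commute[of _ "z r _"])
qed

lemma A_bounded: "s \<in> {1..T} \<Longrightarrow> r \<in> {1..t} \<Longrightarrow> dom (A r s) \<rho>"
  unfolding A_def[abs_def] using dom_vinner[OF u_bounded Fx_bounded, of s r] by simp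

lemma zu_bounded: "s \<in> {1..T} \<Longrightarrow> r \<in> {1..T} \<Longrightarrow> dom (zu r s) \<rho>"
  unfolding zu_def[abs_def] using dom_vinner[OF z u_bounded, of r s] by simp

lemma inner_expand:
  assumes s: "s \<in> {1..T}" and c: "c \<in> S"
  shows "vinner (n c) (Fx s c) w = (\<Sum>k\<in>{1..s}. A s k c * vinner (n c) (u k c) w)"
proof -
  have "vinner (n c) (Fx s c) w = vinner (n c) (\<lambda>i. \<Sum>k\<in>{1..s}. A s k c * u k c i) w"
    by (rule vinner_cong) (use u_expand[OF s c] in \<open>auto simp: A_def\<close>)
  then show ?thesis by (simp only: vinner_sum_left)
qed

lemma insert_top: "s \<ge> 1 \<Longrightarrow> {1..s} = insert s {1..<s::nat}" by auto

text \<open>\<open>A\<close> and \<open>\<rho> R\<close> are lower triangular factors with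
  non-negative diagonal of two Gram matrices that differ by \<open>O(\<epsilon> \<rho>)\<close>.
  Going column by column, the sums over earlier columns are controlled by induction, and division by
  the pivot, of order \<rho>, leaves an error \<open>O(\<epsilon>)\<close>.\<close>

lemma A_approx:
  assumes "s \<in> {1..t}" "r \<in> {s..t}"
  shows "dom (\<lambda>c. A r s c - \<rho> c * R r s c) \<epsilon>"
  using assms
proof (induction s arbitrary: r rule: less_induct)
  case (less s)
  have sT: "s \<in> {1..T}" using less.prems t by auto
  have D: "dom (\<lambda>c. A s s c * A r s c - (\<rho> c * R s s c) * (\<rho> c * R r s c)) (\<lambda>c. \<epsilon> c * \<rho> c)" if r: "r \<in> {s..t}" for r
  proof -
    have rt: "r \<in> {1..t}" "r \<in> {1..T}" using r less.prems t by auto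
    have "dom (\<lambda>c. (vinner (n c) (Fx s c) (Fx r c) - \<rho> c * \<rho> c * \<Sigma> s r c)
       - (\<Sum>k\<in>{1..<s}. (A s k c - \<rho> c * R s k c) * A r k c + R s k c * ((A r k c - \<rho> c * R r k c) * \<rho> c))) (\<lambda>c. \<epsilon> c * \<rho> c)"
    proof (rule dominated_diff[OF gram_x dominated_sum])
      fix k assume k: "k \<in> {1..<s}"
      have a: "dom (\<lambda>c. A s k c - \<rho> c * R s k c) \<epsilon>" "dom (\<lambda>c. A r k c - \<rho> c * R r k c) \<epsilon>"
        by (rule less.IH; use k r less.prems in auto)+
      have b: "dom (A r k) \<rho>" by (rule A_bounded) (use k less.prems t rt in auto)
      have c: "dom (R s k) (\<lambda>_. 1)" by (rule R) (use k less.prems t rt in auto)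
      show "dom (\<lambda>c. (A s k c - \<rho> c * R s k c) * A r k c + R s k c * ((A r k c - \<rho> c * R r k c) * \<rho> c)) (\<lambda>c. \<epsilon> c * \<rho> c)"
        by (rule dominated_add[OF dominated_mult[OF a(1) b] dominated_bounded_mult[OF c dominated_mult[OF a(2) dom_self(1)]]])
    qed (use less.prems rt in auto)
    then show ?thesis
    proof (subst dominated_cong)
      fix c assume c: "c \<in> S"
      have "(\<Sum>k\<in>{1..T}. R s k c * R r k c) = (\<Sum>k\<in>{1..s}. R s k c * R r k c)"
        by (rule sum.mono_neutral_right) (use sT R_tri[OF _ c] in auto)
      then have 1: "\<Sigma> s r c = R s s c * R r s c + (\<Sum>k\<in>{1..<s}. R s k c * R r k c)"
        using RR[OF sT rt(2) c] insert_top[of s] less.prems by simp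
      have 2: "vinner (n c) (Fx s c) (Fx r c) = A s s c * A r s c + (\<Sum>k\<in>{1..<s}. A s k c * A r k c)"
        using inner_expand[OF sT c, of "Fx r c"] insert_top[of s] less.prems by (simp add: A_def)
      have "(\<Sum>k\<in>{1..<s}. (A s k c - \<rho> c * R s k c) * A r k c + R s k c * ((A r k c - \<rho> c * R r k c) * \<rho> c))
        = (\<Sum>k\<in>{1..<s}. A s k c * A r k c) - \<rho> c * \<rho> c * (\<Sum>k\<in>{1..<s}. R s k c * R r k c)"
        unfolding sum_distrib_left sum_subtractf[symmetric] by (intro sum.cong refl) (simp add: algebra_simps)
      then show "A s s c * A r s c - (\<rho> c * R s s c) * (\<rho> c * R r s c) = (vinner (n c) (Fx s c) (Fx r c) - \<rho> c * \<rho> c * \<Sigma> s r c)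
       - (\<Sum>k\<in>{1..<s}. (A s k c - \<rho> c * R s k c) * A r k c + R s k c * ((A r k c - \<rho> c * R r k c) * \<rho> c))"
        unfolding 1 2 by (simp add: algebra_simps)
    qed
  qed
  \<comment> \<open>Difference of squares: since \<open>A s s\<close> is non-negative, the factor
    \<open>A s s + \<rho> R s s\<close> is at least \<open>\<rho> R s s\<close>, so the squares
    being close makes the pivots close.\<close>
  have diag: "dom (\<lambda>c. A s s c - \<rho> c * R s s c) \<epsilon>"
  proof (rule cancel_diag[OF _ sT])
    have "dom (\<lambda>c. A s s c * A s s c - (\<rho> c * R s s c) * (\<rho> c * R s s c)) (\<lambda>c. \<epsilon> c * \<rho> c)"
      by (rule D) (use less.prems in auto)
    then show "dom (\<lambda>c. (A s s c - \<rho> c * R s s c) * (\<rho> c * R s s c)) (\<lambda>c. \<epsilon> c * \<rho> c)"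
    proof (rule dominated_mono)
      fix c assume c: "c \<in> S"
      have a: "A s s c \<ge> 0" unfolding A_def by (rule u_diag[OF sT c])
      have p: "\<rho> c * R s s c \<ge> 0" using \<rho>(1)[OF c] R_diag(1)[OF sT c] by simp
      have "\<bar>(A s s c - \<rho> c * R s s c) * (\<rho> c * R s s c)\<bar> \<le> \<bar>A s s c - \<rho> c * R s s c\<bar> * (A s s c + \<rho> c * R s s c)"
        unfolding abs_mult using a p by (intro mult_left_mono) auto
      also have "\<dots> = \<bar>A s s c * A s s c - (\<rho> c * R s s c) * (\<rho> c * R s s c)\<bar>"
        using a p by (simp add: square_diff_square_factored abs_mult mult.commute)
      finally show "\<bar>(A s s c - \<rho> c * R s s c) * (\<rho> c * R s s c)\<bar> \<le> \<bar>A s s c * A s s c - (\<rho> c * R s s c) * (\<rho> c * R s s c)\<bar>" .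
    qed
  qed
  show ?case
  proof (rule cancel_diag[OF _ sT])
    have "dom (\<lambda>c. (A s s c * A r s c - (\<rho> c * R s s c) * (\<rho> c * R r s c)) - (A s s c - \<rho> c * R s s c) * A r s c) (\<lambda>c. \<epsilon> c * \<rho> c)"
      by (rule dominated_diff[OF D dominated_mult[OF diag A_bounded]]) (use less.prems t in auto)
    then show "dom (\<lambda>c. (A r s c - \<rho> c * R r s c) * (\<rho> c * R s s c)) (\<lambda>c. \<epsilon> c * \<rho> c)" by (simp add: algebra_simps)
  qed
qed

text \<open>For \<open>r \<ge> s\<close> the vector \<open>f s (y z)\<close> is uncorrelated with
  \<open>z r\<close>, as expressed by \<open>\<beta> r s = 0\<close>. When \<open>Fx s\<close> is
  expanded in the basis, the earlier directions are small by induction and the pivot isolates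
  \<open>u s\<close>.\<close>

lemma zu_small:
  assumes "s \<in> {1..t}" "r \<in> {s..T}"
  shows "dom (zu r s) \<epsilon>"
  using assms
proof (induction s arbitrary: r rule: less_induct)
  case (less s)
  have sT: "s \<in> {1..T}" and rT: "r \<in> {1..T}" using less.prems t by auto
  have "dom (\<lambda>c. (vinner (n c) (z r c) (Fx s c) - \<rho> c * \<rho> c * \<beta> r s c) - (\<Sum>k\<in>{1..<s}. zu r k c * A s k c)
       - (A s s c - \<rho> c * R s s c) * zu r s c) (\<lambda>c. \<epsilon> c * \<rho> c)"
  proof (rule dominated_diff[OF dominated_diff[OF cross_x dominated_sum] dominated_mult[OF A_approx zu_bounded]])
    fix k assume k: "k \<in> {1..<s}"
    have "dom (zu r k) \<epsilon>" by (rule less.IH) (use k less.prems in auto)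
    moreover have "dom (A s k) \<rho>" by (rule A_bounded) (use k less.prems t in auto)
    ultimately show "dom (\<lambda>c. zu r k c * A s k c) (\<lambda>c. \<epsilon> c * \<rho> c)" by (rule dominated_mult)
  qed (use less.prems sT rT in auto)
  then have "dom (\<lambda>c. zu r s c * (\<rho> c * R s s c)) (\<lambda>c. \<epsilon> c * \<rho> c)"
  proof (subst dominated_cong)
    fix c assume c: "c \<in> S"
    have "vinner (n c) (z r c) (Fx s c) = A s s c * zu r s c + (\<Sum>k\<in>{1..<s}. zu r k c * A s k c)"
      using inner_expand[OF sT c, of "z r c"] insert_top[of s] less.prems
      by (simp add: zu_def vinner_commute[of _ "z r c"] mult.commute)
    moreover have "\<beta> r s c = 0" by (rule \<beta>0[OF sT _ c]) (use less.prems in auto)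
    ultimately show "zu r s c * (\<rho> c * R s s c) = (vinner (n c) (z r c) (Fx s c) - \<rho> c * \<rho> c * \<beta> r s c) - (\<Sum>k\<in>{1..<s}. zu r k c * A s k c)
       - (A s s c - \<rho> c * R s s c) * zu r s c" by (simp add: algebra_simps)
  qed
  then show ?case by (rule cancel_diag[OF _ sT])
qed

text \<open>The origin of the memory term. In the basis expansion of the inner product of
  \<open>z j\<close> with \<open>Fx t\<close>, the terms with \<open>s \<le> j\<close> are small by
  \<open>zu_small\<close>, so those with \<open>s > j\<close> carry its whole leading part
  \<open>\<rho>^2 \<beta> j t\<close>.\<close>

lemma onsager_coefficient:
  assumes j: "j \<in> {1..<t}"
  shows "dom (\<lambda>c. (\<Sum>s\<in>{j+1..t}. A t s c * zu j s c) - \<rho> c * \<rho> c * \<beta> j t c) (\<lambda>c. \<epsilon> c * \<rho> c)"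
proof -
  have "dom (\<lambda>c. (vinner (n c) (z j c) (Fx t c) - \<rho> c * \<rho> c * \<beta> j t c) - (\<Sum>s\<in>{1..j}. zu j s c * A t s c)) (\<lambda>c. \<epsilon> c * \<rho> c)"
    by (rule dominated_diff[OF cross_x dominated_sum], use j t in auto) (rule dominated_mult[OF zu_small A_bounded], use j t in auto)
  then show ?thesis
  proof (subst dominated_cong)
    fix c assume c: "c \<in> S"
    have "{1..t} = {1..j} \<union> {j+1..t}" using j by auto
    then have "(\<Sum>s\<in>{1..t}. A t s c * zu j s c) = (\<Sum>s\<in>{1..j}. A t s c * zu j s c) + (\<Sum>s\<in>{j+1..t}. A t s c * zu j s c)"
      by (simp only:) (rule sum.union_disjoint, auto)
    then show "(\<Sum>s\<in>{j+1..t}. A t s c * zu j s c) - \<rho> c * \<rho> c * \<beta> j t c =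
      (vinner (n c) (z j c) (Fx t c) - \<rho> c * \<rho> c * \<beta> j t c) - (\<Sum>s\<in>{1..j}. zu j s c * A t s c)"
      using inner_expand[OF t c, of "z j c"] by (simp add: zu_def vinner_commute[of _ "z j c"] mult.commute)
  qed
qed

text \<open>After multiplication by \<rho> the difference is a combination of seven terms of order
  \<open>\<epsilon> \<rho>\<close>. The two memory terms meet in \<open>\<rho>^2\<close> times the
  sum of \<open>\<beta> k t u k\<close>: the sum produced by the matrix is near it by
  \<open>P5\<close>, and \<rho> times the sum of \<open>b s t Fx s\<close> is near it by
  \<open>P7\<close>, because \<open>Fx s\<close> is close to \<rho> times the sum of
  \<open>R s k u k\<close> and the triangular system links \<open>b\<close>, \<open>R\<close> and
  \<beta>. \<open>P6\<close> then replaces \<open>Fx\<close> by \<open>Fy\<close>.\<close>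

lemma step: "vdom (\<lambda>c i. x t c i - y t c i) \<epsilon>"
proof -
  let ?E = "\<lambda>c. \<epsilon> c * \<rho> c"
  define P1 where "P1 = (\<lambda>c i. \<rho> c * (Gx t c i - Gy t c i))"
  define P2 where "P2 = (\<lambda>c i. \<Sum>s\<in>{1..t}. (A t s c - \<rho> c * R t s c) * z s c i)"
  \<comment> \<open>Due to the doubled variance of the diagonal entry in direction
    \<open>u s\<close>.\<close>
  define P3 where "P3 = (\<lambda>c i. \<Sum>s\<in>{1..t}. ((sqrt 2 - 1) * (zu s s c * A t s c)) * u s c i)"
  define P4 where "P4 = (\<lambda>c i. \<Sum>s\<in>{1..t}. \<Sum>j\<in>{1..<s}. (zu s j c * A t s c) * u j c i)"
  define P5 where "P5 = (\<lambda>c i. \<Sum>j\<in>{1..<t}. ((\<Sum>s\<in>{j+1..t}. A t s c * zu j s c) - \<rho> c * \<rho> c * \<beta> j t c) * u j c i)"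
  define P6 where "P6 = (\<lambda>c i. \<Sum>s\<in>{1..<t}. b s t c * (\<rho> c * (Fx s c i - Fy s c i)))"
  define P7 where "P7 = (\<lambda>c i. \<Sum>s\<in>{1..<t}. \<Sum>k\<in>{1..s}. (b s t c * ((A s k c - \<rho> c * R s k c) * \<rho> c)) * u k c i)"
  have comm: "(\<lambda>c. \<rho> c * \<epsilon> c) = ?E" by (simp add: mult.commute)
  have p1: "vdom P1 ?E" unfolding P1_def using vdom_scale[OF dom_self(1) Gdiff] unfolding comm .
  have p2: "vdom P2 ?E" unfolding P2_def using t by (intro vdom_sum vdom_scale A_approx z) auto
  have zA: "dom (\<lambda>c. zu r j c * A t s c) ?E" if "s \<in> {1..t}" "j \<in> {1..t}" "r \<in> {j..T}" for r s j
    using that t by (intro dominated_mult zu_small A_bounded) auto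
  have p3: "vdom P3 ?E" unfolding P3_def
    using t by (intro vdom_sum vdom_unit_scale dominated_bounded_mult[OF dominated_const] zA u_bounded) auto
  have p4: "vdom P4 ?E" unfolding P4_def
    using t by (intro vdom_sum vdom_unit_scale zA u_bounded) auto
  have p5: "vdom P5 ?E" unfolding P5_def
    using t by (intro vdom_sum vdom_unit_scale onsager_coefficient u_bounded) auto
  have p6: "vdom P6 ?E" unfolding P6_def
  proof (rule vdom_sum, rule vdom_bounded_scale[OF b_bounded[OF t]])
    fix s assume s: "s \<in> {1..<t}"
    then show "s \<in> {1..<t}" .
    show "vdom (\<lambda>c i. \<rho> c * (Fx s c i - Fy s c i)) ?E"
      using vdom_scale[OF dom_self(1) Fdiff[of s]] s unfolding comm by auto
  qed
  have p7: "vdom P7 ?E" unfolding P7_def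
    by (rule vdom_sum, rule vdom_sum, rule vdom_unit_scale[OF dominated_bounded_mult[OF b_bounded[OF t] dominated_mult[OF A_approx dom_self(1)]] u_bounded])
      (use t in auto)
  have all: "vdom (\<lambda>c i. P1 c i + P2 c i + P3 c i - P4 c i + P5 c i + P6 c i - P7 c i) ?E"
    by (intro vdom_add vdom_diff p1 p2 p3 p4 p5 p6 p7)
  have id: "P1 c i + P2 c i + P3 c i - P4 c i + P5 c i + P6 c i - P7 c i = \<rho> c * (x t c i - y t c i)" if c: "c \<in> S" and i: "i < n c" for c i
  proof -
    have ons: "(\<Sum>s\<in>{1..t}. A t s c * (\<Sum>j\<in>{1..<s}. u j c i * zu j s c)) = (\<Sum>j\<in>{1..<t}. (\<Sum>s\<in>{j+1..t}. A t s c * zu j s c) * u j c i)"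
    proof -
      have "(\<Sum>s\<in>{1..t}. A t s c * (\<Sum>j\<in>{1..<s}. u j c i * zu j s c)) = (\<Sum>s\<in>{1..t}. \<Sum>j\<in>{1..<s}. A t s c * zu j s c * u j c i)"
        by (simp add: sum_distrib_left mult_ac)
      also have "\<dots> = (\<Sum>(s,j)\<in>Sigma {1..t} (\<lambda>s. {1..<s}). A t s c * zu j s c * u j c i)" by (rule sum.Sigma) auto
      also have "\<dots> = (\<Sum>(j,s)\<in>Sigma {1..<t} (\<lambda>j. {j+1..t}). A t s c * zu j s c * u j c i)"
        by (rule sum.reindex_bij_witness[of _ prod.swap prod.swap]) auto
      also have "\<dots> = (\<Sum>j\<in>{1..<t}. \<Sum>s\<in>{j+1..t}. A t s c * zu j s c * u j c i)" by (rule sum.Sigma[symmetric]) auto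
      finally show ?thesis by (simp add: sum_distrib_right)
    qed
    have bR: "(\<Sum>s\<in>{1..<t}. \<Sum>k\<in>{1..s}. b s t c * R s k c * u k c i) = (\<Sum>k\<in>{1..<t}. \<beta> k t c * u k c i)"
    proof -
      have "(\<Sum>s\<in>{1..<t}. \<Sum>k\<in>{1..s}. b s t c * R s k c * u k c i) = (\<Sum>(s,k)\<in>Sigma {1..<t} (\<lambda>s. {1..s}). b s t c * R s k c * u k c i)" by (rule sum.Sigma) auto
      also have "\<dots> = (\<Sum>(k,s)\<in>Sigma {1..<t} (\<lambda>k. {k..<t}). b s t c * R s k c * u k c i)"
        by (rule sum.reindex_bij_witness[of _ prod.swap prod.swap]) auto
      also have "\<dots> = (\<Sum>k\<in>{1..<t}. \<Sum>s\<in>{k..<t}. b s t c * R s k c * u k c i)" by (rule sum.Sigma[symmetric]) auto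
      also have "\<dots> = (\<Sum>k\<in>{1..<t}. \<beta> k t c * u k c i)"
        by (intro sum.cong refl) (use b[OF t _ c] in \<open>simp flip: sum_distrib_right\<close>)
      finally show ?thesis .
    qed
    have Fs: "Fx s c i = (\<Sum>k\<in>{1..s}. A s k c * u k c i)" if "s \<in> {1..<t}" for s
      using u_expand[OF _ c i, of s] that t by (simp add: A_def)
    have q6: "P6 c i = \<rho> c * (\<Sum>s\<in>{1..<t}. b s t c * Fx s c i) - \<rho> c * (\<Sum>s\<in>{1..<t}. b s t c * Fy s c i)"
      unfolding P6_def sum_distrib_left sum_subtractf[symmetric] by (intro sum.cong refl) (simp add: algebra_simps)
    have q7: "P7 c i = \<rho> c * (\<Sum>s\<in>{1..<t}. b s t c * Fx s c i) - \<rho> c * \<rho> c * (\<Sum>k\<in>{1..<t}. \<beta> k t c * u k c i)"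
    proof -
      have "P7 c i = (\<Sum>s\<in>{1..<t}. \<rho> c * (b s t c * (\<Sum>k\<in>{1..s}. A s k c * u k c i)) - \<rho> c * \<rho> c * (\<Sum>k\<in>{1..s}. b s t c * R s k c * u k c i))"
        unfolding P7_def sum_distrib_left sum_subtractf[symmetric] by (intro sum.cong refl) (simp add: algebra_simps)
      then show ?thesis using Fs bR by (simp add: sum_subtractf flip: sum_distrib_left)
    qed
    have q5: "P5 c i = (\<Sum>s\<in>{1..t}. A t s c * (\<Sum>j\<in>{1..<s}. u j c i * zu j s c)) - \<rho> c * \<rho> c * (\<Sum>k\<in>{1..<t}. \<beta> k t c * u k c i)"
      unfolding ons P5_def by (simp add: left_diff_distrib sum_subtractf sum_distrib_left mult.assoc)
    have q2: "P2 c i = (\<Sum>s\<in>{1..t}. A t s c * z s c i) - \<rho> c * (\<Sum>s\<in>{1..t}. R t s c * z s c i)"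
      unfolding P2_def by (simp add: left_diff_distrib sum_subtractf sum_distrib_left mult.assoc)
    have q4: "P4 c i = (\<Sum>s\<in>{1..t}. A t s c * (\<Sum>j\<in>{1..<s}. u j c i * zu s j c))"
      unfolding P4_def by (simp add: sum_distrib_left mult_ac)
    have q3: "P3 c i = (\<Sum>s\<in>{1..t}. A t s c * ((sqrt 2 - 1) * zu s s c * u s c i))"
      unfolding P3_def by (intro sum.cong refl) (simp add: mult_ac)
    have "\<rho> c * x t c i = \<rho> c * Gx t c i + (\<Sum>s\<in>{1..t}. A t s c * (z s c i + (sqrt 2 - 1) * zu s s c * u s c i
       - (\<Sum>j\<in>{1..<s}. u j c i * zu s j c) + (\<Sum>j\<in>{1..<s}. u j c i * zu j s c)))"
      unfolding x_eq[OF t c i] A_def zu_def distrib_left[of "\<rho> c"] sum_distrib_left[of "\<rho> c"]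
      using \<rho>(1)[OF c] by (intro arg_cong2[where f="(+)"] refl sum.cong) (simp add: vinner_commute[of _ "u _ c" "z _ c"])
    also have "\<dots> = \<rho> c * Gx t c i + (\<Sum>s\<in>{1..t}. A t s c * z s c i) + P3 c i - P4 c i + (\<Sum>s\<in>{1..t}. A t s c * (\<Sum>j\<in>{1..<s}. u j c i * zu j s c))"
      unfolding q3 q4 by (simp add: sum.distrib[symmetric] sum_subtractf[symmetric] add.assoc[symmetric]) (intro sum.cong refl, simp add: distrib_left right_diff_distrib)
    finally have X: "\<rho> c * x t c i = \<dots>" .
    have Y: "\<rho> c * y t c i = \<rho> c * Gy t c i + \<rho> c * (\<Sum>s\<in>{1..<t}. b s t c * Fy s c i) + \<rho> c * (\<Sum>s\<in>{1..t}. R t s c * z s c i)"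
      unfolding y_eq[OF t c i] by (simp only: distrib_left)
    show ?thesis unfolding right_diff_distrib X Y q2 q5 q6 q7 P1_def by (simp add: right_diff_distrib)
  qed
  have "vdom (\<lambda>c i. \<rho> c * (x t c i - y t c i)) ?E" using all vdom_cong[OF id] by simp
  then have "dom (\<lambda>c. vnorm (n c) (\<lambda>i. x t c i - y t c i) * \<rho> c) ?E"
    unfolding vdom_def vnorm_scale by (rule dominated_mono) (simp add: abs_mult mult.commute)
  then show ?thesis unfolding vdom_def
    by (rule dominated_cancel) (use \<rho>(1) in \<open>auto intro!: dominatedI[of _ _ 1]\<close>)
qed

end

lemma comparison: "t \<in> {1..T} \<Longrightarrow> vdom (\<lambda>c i. x t c i - y t c i) \<epsilon>"
proof (induction t rule: less_induct)
  case (less t)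
  show ?case by (rule step[OF less.prems], rule less.IH) (use less.prems in auto)
qed

end

section \<open>State evolution\<close>

definition noise_dist_sq :: "nat \<Rightarrow> nat \<Rightarrow> (nat \<Rightarrow> nat \<Rightarrow> real) \<Rightarrow> (nat \<Rightarrow> nat \<Rightarrow> real) \<Rightarrow> real" where
  "noise_dist_sq n T z z' = (\<Sum>r\<in>{1..T}. \<Sum>i<n. (z r i - z' r i)\<^sup>2)"

text \<open>Tensorization is used twice, over the coordinates of each vector and over the
  vectors.\<close>

lemma noise_tau_space: "tau_space (noise_space n T) (noise_dist_sq n T)"
proof -
  interpret prob_space "noise_space n T" by (rule prob_space_noise)
  have 1: "prop_tau (PiM {..<n} (\<lambda>_. gauss 1)) (\<lambda>x y. \<Sum>i<n. (x i - y i)\<^sup>2 / 4)"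
    by (rule prop_tau_PiM[of "{..<n}" "\<lambda>_. gauss 1" "\<lambda>_ x y. (x - y)\<^sup>2 / 4"]) (auto simp: prob_space_gauss prop_tau_gauss)
  have "prop_tau (noise_space n T) (\<lambda>x y. \<Sum>r\<in>{1..T}. \<Sum>i<n. (x r i - y r i)\<^sup>2 / 4)"
    unfolding noise_space_def
    by (rule prop_tau_PiM[of "{1..T}" "\<lambda>_. PiM {..<n} (\<lambda>_. gauss 1)" "\<lambda>_ x y. \<Sum>i<n. (x i - y i)\<^sup>2 / 4"])
      (auto simp: prob_space_gauss_vec 1)
  then show ?thesis
    by (simp add: tau_space_def tau_space_axioms_def prob_space_axioms noise_dist_sq_def sum_divide_distrib)
qed

lemma noise_component_dist:
  "r \<in> {1..T} \<Longrightarrow> (vnorm n (\<lambda>i. z r i - z' r i))\<^sup>2 \<le> noise_dist_sq n T z z'"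
  unfolding noise_dist_sq_def vnorm_sq vinner_def power2_eq_square[symmetric]
  by (rule member_le_sum[of r "{1..T}" "\<lambda>r. \<Sum>i<n. (z r i - z' r i)\<^sup>2"]) (auto intro: sum_nonneg)

lemma noise_second_moment:
  assumes r: "r \<in> {1..T}"
  shows "(\<integral>z. (vnorm n (z r))\<^sup>2 \<partial>noise_space n T) = n"
proof -
  let ?V = "PiM {..<n} (\<lambda>_. gauss 1)"
  have m: "(\<lambda>z. z r) \<in> measurable (noise_space n T) ?V"
    unfolding noise_space_def using r by (rule measurable_component_singleton)
  have d1: "distr (noise_space n T) ?V (\<lambda>z. z r) = ?V"
  proof -
    interpret product_prob_space "\<lambda>_::nat. ?V" "{1..T}"
      by (simp add: product_prob_space_def product_prob_space_axioms_def product_sigma_finite_def prob_space_gauss_vec prob_space_imp_sigma_finite)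
    show ?thesis unfolding noise_space_def using PiM_component[OF r] .
  qed
  have d2: "distr ?V (gauss 1) (\<lambda>x. x i) = gauss 1" if "i < n" for i
  proof -
    interpret product_prob_space "\<lambda>_::nat. gauss 1" "{..<n}"
      by (simp add: product_prob_space_def product_prob_space_axioms_def product_sigma_finite_def prob_space_gauss prob_space_imp_sigma_finite)
    show ?thesis using PiM_component[of i] that by simp
  qed
  have g: "(\<integral>x. x\<^sup>2 \<partial>gauss 1) = 1" "integrable (gauss 1) (\<lambda>x. x\<^sup>2)"
    unfolding gauss_1 using std_normal_distribution_even_moments[of 1] by (simp_all add: fact_2)
  have mi: "(\<lambda>x. x i) \<in> measurable ?V (gauss 1)" if "i < n" for i
    using that by (intro measurable_component_singleton) auto
  have i: "integrable ?V (\<lambda>x. (x i)\<^sup>2)" "(\<integral>x. (x i)\<^sup>2 \<partial>?V) = 1" if "i < n" for i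
    using integrable_distr[OF mi[OF that], of "\<lambda>x. x\<^sup>2"] integral_distr[OF mi[OF that], of "\<lambda>x. x\<^sup>2"] d2[OF that] g by simp_all
  have q: "(\<lambda>x. (vnorm n x)\<^sup>2) = (\<lambda>x. \<Sum>i<n. (x i)\<^sup>2)" by (simp add: vnorm_def sum_nonneg)
  have "(\<lambda>x. \<Sum>i<n. (x i)\<^sup>2) \<in> borel_measurable ?V"
    by (intro borel_measurable_sum borel_measurable_power gauss_vec_component) auto
  then have "(\<integral>z. (vnorm n (z r))\<^sup>2 \<partial>noise_space n T) = (\<integral>x. (\<Sum>i<n. (x i)\<^sup>2) \<partial>?V)"
    using integral_distr[OF m, of "\<lambda>x. \<Sum>i<n. (x i)\<^sup>2"] d1 fun_cong[OF q] by simp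
  also have "\<dots> = n" using i by simp
  finally show ?thesis .
qed

section \<open>Identities and bounds for matched parameters\<close>

text \<open>The root \<open>R\<close> is a parameter and not constructed inside, so that an instance
  together with its root can later form a single element of a problem class.\<close>

locale matched =
  fixes n T :: nat and L :: real and f g m :: "nat \<Rightarrow> (nat \<Rightarrow> nat \<Rightarrow> real) \<Rightarrow> nat \<Rightarrow> real" and Sig R :: "nat \<Rightarrow> nat \<Rightarrow> real"
  assumes T1: "1 \<le> T" and Tn: "T \<le> n"
    and f_lip: "\<And>t. t \<in> {1..T} \<Longrightarrow> hist_lipschitz n t L (f t)" and g_lip: "\<And>t. t \<in> {1..T} \<Longrightarrow> hist_lipschitz n t L (g t)"
    and se: "state_evolution n T f g m Sig" and pd: "pos_def_on {1..T} Sig"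
    and RR: "\<And>r s. r \<in> {1..T} \<Longrightarrow> s \<in> {1..T} \<Longrightarrow> (\<Sum>k\<in>{1..T}. R r k * R s k) = Sig r s"
    and R_tri: "\<And>r k. r < k \<Longrightarrow> R r k = 0"
    and R_diag: "\<And>r. r \<in> {1..T} \<Longrightarrow> R r r \<ge> sqrt (lambda_min {1..T} Sig)"
begin

lemma n0: "n > 0" using T1 Tn by simp

sublocale fom n T f g
  by unfold_locales
    ((rule n0 hist_lipschitz_nonanticipative[OF f_lip] hist_lipschitz_nonanticipative[OF g_lip]
      hist_lipschitz_components_measurable[OF f_lip] hist_lipschitz_components_measurable[OF g_lip]; assumption)+)

abbreviation "N \<equiv> noise_space n T"

sublocale tau_space N "noise_dist_sq n T" by (rule noise_tau_space)

definition y :: "(nat \<Rightarrow> nat \<Rightarrow> real) \<Rightarrow> nat \<Rightarrow> nat \<Rightarrow> real" where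
  "y z = cmp_traj n T m (mix_noise n T R z)"

definition coef :: "nat \<Rightarrow> nat \<Rightarrow> real" where
  "coef s t = (1 / real n) * (\<Sum>r\<in>{1..<t}. pinv_on {1..<t} Sig s r *
     (\<integral>w. vinner n (w r) (f t (cmp_traj n (t - 1) m w)) \<partial>gauss_proc n T Sig))"

text \<open>The \<beta> of the comparison. Being expressed in the independent \<open>z\<close>
  instead of the correlated \<open>w\<close>, it is the right-hand side of a triangular system for
  \<open>coef\<close>.\<close>

definition corr :: "nat \<Rightarrow> nat \<Rightarrow> real" where
  "corr r t = (\<integral>z. vinner n (z r) (f t (y z)) \<partial>N) / n"

lemma axioms_fom: "fom n T f g"
  by (rule fom_axioms)

lemma m_eq:
  assumes "t \<in> {1..T}"
  shows "m t = (\<lambda>ys i. g t ys i + (\<Sum>s\<in>{1..<t}. coef s t * f s ys i))"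
proof (cases "t = 1")
  case True
  then show ?thesis using se by (simp add: state_evolution_def Let_def)
next
  case False
  then have "t \<in> {2..T}" using assms by auto
  then show ?thesis using se unfolding state_evolution_def Let_def coef_def by blast
qed

lemma m_na: "t \<in> {1..T} \<Longrightarrow> nonanticipative n t (m t)"
  unfolding nonanticipative_def
proof (intro allI impI)
  fix xs ys :: "nat \<Rightarrow> nat \<Rightarrow> real" and i
  assume t: "t \<in> {1..T}" and eq: "\<forall>s\<in>{1..<t}. \<forall>i<n. xs s i = ys s i" and i: "i < n"
  have "f s xs i = f s ys i" if "s \<in> {1..<t}" for s
    by (rule nonanticipativeD[OF f_na]) (use that t eq i in auto)
  moreover have "g t xs i = g t ys i"
    by (rule nonanticipativeD[OF g_na]) (use t eq i in auto)
  ultimately show "m t xs i = m t ys i" unfolding m_eq[OF t] by simp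
qed

lemma m_meas: "t \<in> {1..T} \<Longrightarrow> components_measurable n (m t)"
  unfolding components_measurable_def
proof (intro allI impI)
  fix i assume t: "t \<in> {1..T}" and i: "i < n"
  have "(\<lambda>xs. f s xs i) \<in> borel_measurable fun2_space" if "s \<in> {1..<t}" for s
    using f_meas[of s] that t i by (auto simp: components_measurable_def)
  moreover have "(\<lambda>xs. g t xs i) \<in> borel_measurable fun2_space"
    using g_meas[OF t] i by (auto simp: components_measurable_def)
  ultimately show "(\<lambda>xs. m t xs i) \<in> borel_measurable fun2_space"
    unfolding m_eq[OF t] by (intro borel_measurable_add borel_measurable_sum borel_measurable_times borel_measurable_const)
qed

lemma cmp_measurable: "cmp_traj n T m \<in> measurable fun2_space fun2_space"
  by (rule cmp_traj_measurable[OF m_meas])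

lemma y_measurable: "y \<in> measurable N fun2_space"
  unfolding y_def[abs_def] by (rule measurable_compose[OF mix_noise_measurable cmp_measurable])

lemma cmp_step:
  assumes t: "t \<in> {1..T}" and i: "i < n"
  shows "cmp_traj n T m w t i = m t (cmp_traj n T m w) i + w t i"
proof -
  have "nonanticipative n t (\<lambda>ys i. m t ys i + w t i)"
    using m_na[OF t] unfolding nonanticipative_def by simp
  then show ?thesis
    using hist_trunc_step[OF t, of n "\<lambda>t ys i. m t ys i + w t i"] i by (simp add: cmp_traj_def trunc_def)
qed

lemma mix_noise_lower:
  assumes t: "t \<in> {1..T}" and i: "i < n"
  shows "mix_noise n T R z t i = (\<Sum>s\<in>{1..t}. R t s * z s i)"
proof -
  have "(\<Sum>k\<in>{1..T}. R t k * z k i) = (\<Sum>s\<in>{1..t}. R t s * z s i)"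
    by (rule sum.mono_neutral_right) (use t R_tri in auto)
  then show ?thesis using assms by (simp add: mix_noise_def)
qed

lemma y_eq:
  assumes t: "t \<in> {1..T}" and i: "i < n"
  shows "y z t i = g t (y z) i + (\<Sum>s\<in>{1..<t}. coef s t * f s (y z) i) + (\<Sum>s\<in>{1..t}. R t s * z s i)"
  using cmp_step[OF t i, of "mix_noise n T R z"] unfolding mix_noise_lower[OF t i] y_def[symmetric] m_eq[OF t] .

lemma f_cmp:
  assumes t: "t \<in> {1..T}" and i: "i < n"
  shows "f t (cmp_traj n (t - 1) m w) i = f t (cmp_traj n T m w) i"
proof (rule nonanticipativeD[OF f_na[OF t] _ i])
  fix s j assume s: "s \<in> {1..<t}"
  have "hist (\<lambda>t ys. trunc n (\<lambda>i. m t ys i + w t i)) (t - 1) s = hist (\<lambda>t ys. trunc n (\<lambda>i. m t ys i + w t i)) T s"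
    by (rule hist_agree) (use s t in auto)
  then show "cmp_traj n (t - 1) m w s j = cmp_traj n T m w s j" by (simp add: cmp_traj_def)
qed

lemma gauss_proc_eq: "gauss_proc n T Sig = distr N fun2_space (mix_noise n T R)"
  by (rule gauss_proc_eq_mix_noise[OF RR])

lemma integral_gauss_proc:
  fixes \<phi> :: "(nat \<Rightarrow> nat \<Rightarrow> real) \<Rightarrow> real"
  shows "\<phi> \<in> borel_measurable fun2_space \<Longrightarrow> (\<integral>w. \<phi> w \<partial>gauss_proc n T Sig) = (\<integral>z. \<phi> (mix_noise n T R z) \<partial>N)"
  unfolding gauss_proc_eq by (rule integral_distr[OF mix_noise_measurable])

lemma f_cmp_measurable: "t \<in> {1..T} \<Longrightarrow> i < n \<Longrightarrow> (\<lambda>w. f t (cmp_traj n T m w) i) \<in> borel_measurable fun2_space"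
  by (rule components_measurable_compose[OF f_meas cmp_measurable])

lemma f_y_measurable: "t \<in> {1..T} \<Longrightarrow> i < n \<Longrightarrow> (\<lambda>z. f t (y z) i) \<in> borel_measurable N"
  by (rule components_measurable_compose[OF f_meas y_measurable])

lemma sqrt_dist_sum:
  "vnorm n (\<lambda>i. f t (y z) i - f t (y z') i) \<le> L * sqrt (\<Sum>s\<in>{1..<t}. (vnorm n (\<lambda>i. y z s i - y z' s i))\<^sup>2)" if "t \<in> {1..T}"
  using f_lip[OF that] unfolding hist_lipschitz_def by blast

text \<open>The constant may still depend on the instance; it is there to obtain integrability. A
  constant uniform over the class requires bounded \<open>coef\<close>, which rests on
  \<open>corr_bound\<close>, and that in turn presupposes the integrability obtained here.\<close>

lemma f_y_lipschitz: "\<exists>K>0. \<forall>t\<in>{1..T}. \<forall>z z'. (vnorm n (\<lambda>i. f t (y z) i - f t (y z') i))\<^sup>2 \<le> K\<^sup>2 * noise_dist_sq n T z z'"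
proof -
  \<comment> \<open>Instances are pairs of noise arrays, so a dominated difference is precisely a
    Lipschitz bound.\<close>
  interpret vector_family "UNIV :: ((nat \<Rightarrow> nat \<Rightarrow> real) \<times> (nat \<Rightarrow> nat \<Rightarrow> real)) set" "\<lambda>_. n" .
  have "\<exists>K. \<forall>z z'. vnorm n (\<lambda>i. f t (y z) i - f t (y z') i) \<le> K * sqrt (noise_dist_sq n T z z')" if t: "t \<in> {1..T}" for t
  proof -
    have "vdom (\<lambda>c i. f t (y (fst c)) i - f t (y (snd c)) i) (\<lambda>c. sqrt (noise_dist_sq n T (fst c) (snd c)))"
    proof (rule recursion_lipschitz(2)[where T = T and L = L and D = "\<lambda>t c i. y (fst c) t i - y (snd c) t i"
          and FD = "\<lambda>t c i. f t (y (fst c)) i - f t (y (snd c)) i" and GD = "\<lambda>t c i. g t (y (fst c)) i - g t (y (snd c)) i"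
          and b = "\<lambda>s t c. coef s t" and R = "\<lambda>s t c. R s t" and Z = "\<lambda>s c i. fst c s i - snd c s i"])
      show "dominated UNIV (\<lambda>c. k) (\<lambda>_. 1)" for k by (rule dominatedI[of _ _ "\<bar>k\<bar>"]) simp
      then show "dominated UNIV (\<lambda>c. k) (\<lambda>_. 1)" for k .
      fix s assume s: "s \<in> {1..T}"
      show "vdom (\<lambda>c i. fst c s i - snd c s i) (\<lambda>c. sqrt (noise_dist_sq n T (fst c) (snd c)))"
        unfolding vdom_def
        by (rule dominatedI[of _ _ 1]) (auto intro!: real_le_rsqrt noise_component_dist[OF s])
    next
      show "vnorm n (\<lambda>i. g t (y (fst c)) i - g t (y (snd c)) i) \<le> L * sqrt (\<Sum>s\<in>{1..<t}. (vnorm n (\<lambda>i. y (fst c) s i - y (snd c) s i))\<^sup>2)" if "t \<in> {1..T}" for t c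
        using g_lip[OF that] unfolding hist_lipschitz_def by blast
    next
      fix t i and c :: "(nat \<Rightarrow> nat \<Rightarrow> real) \<times> (nat \<Rightarrow> nat \<Rightarrow> real)" assume t: "t \<in> {1..T}" and i: "i < n"
      show "y (fst c) t i - y (snd c) t i = g t (y (fst c)) i - g t (y (snd c)) i +
          (\<Sum>s\<in>{1..<t}. coef s t * (f s (y (fst c)) i - f s (y (snd c)) i)) + (\<Sum>s\<in>{1..t}. R t s * (fst c s i - snd c s i))"
        unfolding y_eq[OF t i] by (simp add: right_diff_distrib sum_subtractf)
    qed (use t sqrt_dist_sum in auto)
    then show ?thesis unfolding vdom_def dominated_def by auto
  qed
  then obtain K where K: "\<And>t z z'. t \<in> {1..T} \<Longrightarrow> vnorm n (\<lambda>i. f t (y z) i - f t (y z') i) \<le> K t * sqrt (noise_dist_sq n T z z')"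
    by metis
  define K' where "K' = 1 + (\<Sum>t\<in>{1..T}. \<bar>K t\<bar>)"
  have "K' > 0" unfolding K'_def by (smt (verit) sum_nonneg abs_ge_zero)
  moreover have "(vnorm n (\<lambda>i. f t (y z) i - f t (y z') i))\<^sup>2 \<le> K'\<^sup>2 * noise_dist_sq n T z z'" if t: "t \<in> {1..T}" for t z z'
  proof -
    have d: "noise_dist_sq n T z z' \<ge> 0" unfolding noise_dist_sq_def by (intro sum_nonneg) auto
    have "\<bar>K t\<bar> \<le> (\<Sum>t\<in>{1..T}. \<bar>K t\<bar>)" using t by (intro member_le_sum) auto
    then have "K t \<le> K'" unfolding K'_def by linarith
    then have "vnorm n (\<lambda>i. f t (y z) i - f t (y z') i) \<le> K' * sqrt (noise_dist_sq n T z z')"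
      using K[OF t, of z z'] d by (meson mult_right_mono order_trans real_sqrt_ge_zero)
    then have "(vnorm n (\<lambda>i. f t (y z) i - f t (y z') i))\<^sup>2 \<le> (K' * sqrt (noise_dist_sq n T z z'))\<^sup>2"
      by (intro power_mono) auto
    then show ?thesis using d by (simp add: power_mult_distrib)
  qed
  ultimately show ?thesis by blast
qed

lemma inner_integrable:
  assumes V: "\<And>i. i < n \<Longrightarrow> (\<lambda>z. V z i) \<in> borel_measurable N" and W: "\<And>i. i < n \<Longrightarrow> (\<lambda>z. W z i) \<in> borel_measurable N" and K: "K > 0"
    and lipV: "\<And>z z'. (vnorm n (\<lambda>i. V z i - V z' i))\<^sup>2 \<le> K\<^sup>2 * noise_dist_sq n T z z'"
    and lipW: "\<And>z z'. (vnorm n (\<lambda>i. W z i - W z' i))\<^sup>2 \<le> K\<^sup>2 * noise_dist_sq n T z z'"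
  shows "integrable N (\<lambda>z. vinner n (V z) (W z))"
proof -
  \<comment> \<open>Any \<open>d\<close> with \<open>d^2 * n\<close> above both second moments
    serves; as \<open>n \<ge> 1\<close>, the root of their sum qualifies.\<close>
  define d where "d = sqrt ((\<integral>z. (vnorm n (V z))\<^sup>2 \<partial>N) + (\<integral>z. (vnorm n (W z))\<^sup>2 \<partial>N))"
  have nn: "0 \<le> (\<integral>z. (vnorm n (V z))\<^sup>2 \<partial>N)" "0 \<le> (\<integral>z. (vnorm n (W z))\<^sup>2 \<partial>N)"
    by (auto intro!: integral_nonneg_AE)
  have d2: "d\<^sup>2 = (\<integral>z. (vnorm n (V z))\<^sup>2 \<partial>N) + (\<integral>z. (vnorm n (W z))\<^sup>2 \<partial>N)" using nn by (simp add: d_def)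
  have "d\<^sup>2 * 1 \<le> d\<^sup>2 * n" using n0 by (intro mult_left_mono) auto
  then have "(\<integral>z. (vnorm n (V z))\<^sup>2 \<partial>N) \<le> d\<^sup>2 * n" "(\<integral>z. (vnorm n (W z))\<^sup>2 \<partial>N) \<le> d\<^sup>2 * n" using d2 nn by linarith+
  then show ?thesis
    by (intro lipschitz_inner_tail(1)[where K = K and d = d and r = "1/2" and \<rho> = 0]) (use V W K lipV lipW n0 nn in \<open>auto simp: d_def\<close>)
qed

lemma noise_lipschitz:
  assumes "K \<ge> 1" "r \<in> {1..T}"
  shows "(vnorm n (\<lambda>i. z r i - z' r i))\<^sup>2 \<le> K\<^sup>2 * noise_dist_sq n T z z'"
proof -
  have "1 * noise_dist_sq n T z z' \<le> K\<^sup>2 * noise_dist_sq n T z z'"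
    using assms(1) by (intro mult_right_mono) (auto simp: noise_dist_sq_def intro!: sum_nonneg)
  then show ?thesis using noise_component_dist[OF assms(2), of n z z'] by simp
qed

lemma f_y_lipschitz1: obtains K where "K \<ge> 1" "\<And>t z z'. t \<in> {1..T} \<Longrightarrow> (vnorm n (\<lambda>i. f t (y z) i - f t (y z') i))\<^sup>2 \<le> K\<^sup>2 * noise_dist_sq n T z z'"
proof -
  obtain K where K: "K > 0" "\<And>t z z'. t \<in> {1..T} \<Longrightarrow> (vnorm n (\<lambda>i. f t (y z) i - f t (y z') i))\<^sup>2 \<le> K\<^sup>2 * noise_dist_sq n T z z'"
    using f_y_lipschitz by blast
  have "K\<^sup>2 * noise_dist_sq n T z z' \<le> (K + 1)\<^sup>2 * noise_dist_sq n T z z'" for z z'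
    using K(1) by (intro mult_right_mono power_mono) (auto simp: noise_dist_sq_def intro!: sum_nonneg)
  then show thesis using that[of "K + 1"] K by (meson le_add_same_cancel2 less_imp_le order_trans)
qed

lemma integrable_pairs:
  assumes t: "t \<in> {1..T}" and r: "r \<in> {1..T}"
  shows "integrable N (\<lambda>z. vinner n (z r) (f t (y z)))" "integrable N (\<lambda>z. vinner n (f r (y z)) (f t (y z)))" "integrable N (\<lambda>z. vinner n (z r) (z r))"
proof -
  obtain K where K: "K \<ge> 1" "\<And>t z z'. t \<in> {1..T} \<Longrightarrow> (vnorm n (\<lambda>i. f t (y z) i - f t (y z') i))\<^sup>2 \<le> K\<^sup>2 * noise_dist_sq n T z z'"
    by (rule f_y_lipschitz1) (rule that)
  have K0: "K > 0" using K(1) by simp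
  show "integrable N (\<lambda>z. vinner n (z r) (f t (y z)))"
    by (rule inner_integrable[OF noise_component[OF r] f_y_measurable[OF t] K0 noise_lipschitz[OF K(1) r] K(2)[OF t]])
  show "integrable N (\<lambda>z. vinner n (f r (y z)) (f t (y z)))"
    by (rule inner_integrable[OF f_y_measurable[OF r] f_y_measurable[OF t] K0 K(2)[OF r] K(2)[OF t]])
  show "integrable N (\<lambda>z. vinner n (z r) (z r))"
    by (rule inner_integrable[OF noise_component[OF r] noise_component[OF r] K0 noise_lipschitz[OF K(1) r] noise_lipschitz[OF K(1) r]])
qed

lemma Sig_sym: "s \<in> {1..T} \<Longrightarrow> t \<in> {1..T} \<Longrightarrow> Sig s t = Sig t s"
  using pd unfolding pos_def_on_def by blast

lemma Sig_eq:
  assumes s: "s \<in> {1..T}" and t: "t \<in> {1..T}"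
  shows "(\<integral>z. vinner n (f s (y z)) (f t (y z)) \<partial>N) = n * Sig s t"
proof -
  have le: "(\<integral>z. vinner n (f s (y z)) (f t (y z)) \<partial>N) = n * Sig s t" if s: "s \<in> {1..T}" and t: "t \<in> {1..T}" and "s \<le> t" for s t
  proof -
    have "Sig s t = (1 / real n) * (\<integral>w. vinner n (f s (cmp_traj n (s - 1) m w)) (f t (cmp_traj n (t - 1) m w)) \<partial>gauss_proc n T Sig)"
      using se that unfolding state_evolution_def Let_def by auto
    also have "(\<integral>w. vinner n (f s (cmp_traj n (s - 1) m w)) (f t (cmp_traj n (t - 1) m w)) \<partial>gauss_proc n T Sig)
      = (\<integral>w. vinner n (f s (cmp_traj n T m w)) (f t (cmp_traj n T m w)) \<partial>gauss_proc n T Sig)"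
      by (intro Bochner_Integration.integral_cong refl vinner_cong f_cmp s t)
    also have "\<dots> = (\<integral>z. vinner n (f s (y z)) (f t (y z)) \<partial>N)"
      unfolding y_def by (rule integral_gauss_proc, rule vinner_measurable; rule f_cmp_measurable; use s t in auto)
    finally show ?thesis using n0 by simp
  qed
  show ?thesis
  proof (cases "s \<le> t")
    case False
    then show ?thesis using le[OF t s] Sig_sym[OF s t] by (simp add: vinner_commute[of n "f s _"])
  qed (use le s t in auto)
qed

text \<open>In matrix form: the normalised means of the inner products of \<open>w r\<close> with
  \<open>f t\<close> are \<open>R \<beta>\<close>, so inverting the block of \<open>Sig\<close>
  below \<open>t\<close> gives \<open>Sig b = R \<beta>\<close>. With \<open>Sig = R R^T\<close>
  this reads \<open>R (R^T b - \<beta>) = 0\<close>, and \<open>R\<close> is triangular with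
  positive diagonal. The pseudoinverse is thereby replaced by a system whose pivots are controlled
  by the smallest eigenvalue.\<close>

lemma coef_triangular:
  assumes t: "t \<in> {1..T}" and k: "k \<in> {1..<t}"
  shows "(\<Sum>s\<in>{k..<t}. coef s t * R s k) = corr k t"
proof -
  let ?I = "{1..<t}"
  have I: "?I = {1..t - 1}" using t by auto
  have IT: "?I \<subseteq> {1..T}" using t by auto
  have E: "(\<integral>w. vinner n (w r) (f t (cmp_traj n (t - 1) m w)) \<partial>gauss_proc n T Sig) = n * (\<Sum>k\<in>{1..T}. R r k * corr k t)" if r: "r \<in> {1..T}" for r
  proof -
    have "(\<integral>w. vinner n (w r) (f t (cmp_traj n (t - 1) m w)) \<partial>gauss_proc n T Sig)
       = (\<integral>w. vinner n (w r) (f t (cmp_traj n T m w)) \<partial>gauss_proc n T Sig)"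
      by (intro Bochner_Integration.integral_cong refl vinner_cong f_cmp t)
    also have "\<dots> = (\<integral>z. vinner n (mix_noise n T R z r) (f t (y z)) \<partial>N)"
      unfolding y_def by (rule integral_gauss_proc, rule vinner_measurable[OF fun2_component f_cmp_measurable[OF t]]) auto
    also have "\<dots> = (\<integral>z. (\<Sum>k\<in>{1..T}. R r k * vinner n (z k) (f t (y z))) \<partial>N)"
    proof (rule Bochner_Integration.integral_cong[OF refl])
      fix z
      have "vinner n (mix_noise n T R z r) (f t (y z)) = vinner n (\<lambda>i. \<Sum>k\<in>{1..T}. R r k * z k i) (f t (y z))"
        by (rule vinner_cong) (use r in \<open>auto simp: mix_noise_def\<close>)
      then show "vinner n (mix_noise n T R z r) (f t (y z)) = (\<Sum>k\<in>{1..T}. R r k * vinner n (z k) (f t (y z)))"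
        by (simp only: vinner_sum_left)
    qed
    also have "\<dots> = (\<Sum>k\<in>{1..T}. R r k * (\<integral>z. vinner n (z k) (f t (y z)) \<partial>N))"
      by (subst Bochner_Integration.integral_sum) (use integrable_pairs(1)[OF t] in auto)
    finally show ?thesis using n0 by (simp add: corr_def sum_distrib_left)
  qed
  have c: "coef s t = (\<Sum>r\<in>?I. pinv_on ?I Sig s r * (\<Sum>k\<in>{1..T}. R r k * corr k t))" for s
  proof -
    have "(\<Sum>r\<in>?I. pinv_on ?I Sig s r * (\<integral>w. vinner n (w r) (f t (cmp_traj n (t - 1) m w)) \<partial>gauss_proc n T Sig))
      = (\<Sum>r\<in>?I. pinv_on ?I Sig s r * (n * (\<Sum>k\<in>{1..T}. R r k * corr k t)))"
      by (intro sum.cong refl) (use E IT in auto)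
    then show ?thesis unfolding coef_def using n0 by (simp add: sum_distrib_left)
  qed
  have pdI: "pos_def_on {1..t - 1} Sig" using pos_def_on_subset[OF pd IT] I by simp
  have S: "(\<Sum>s\<in>?I. Sig q s * coef s t) = (\<Sum>k\<in>{1..T}. R q k * corr k t)" if q: "q \<in> ?I" for q
  proof -
    have "(\<Sum>s\<in>?I. Sig q s * coef s t) = (\<Sum>r\<in>?I. (\<Sum>s\<in>?I. Sig q s * pinv_on ?I Sig s r) * (\<Sum>k\<in>{1..T}. R r k * corr k t))"
      unfolding c sum_distrib_left[of "Sig q _"] sum_distrib_right[where r = "\<Sum>k\<in>{1..T}. R _ k * corr k t"]
      by (subst sum.swap) (simp only: mult.assoc)
    also have "\<dots> = (\<Sum>r\<in>?I. if r = q then (\<Sum>k\<in>{1..T}. R r k * corr k t) else 0)"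
      by (intro sum.cong refl) (use pinv_on_pos_def[OF pdI, folded I] q in auto)
    also have "\<dots> = (\<Sum>k\<in>{1..T}. R q k * corr k t)" using q by simp
    finally show ?thesis .
  qed
  \<comment> \<open>The residual of the triangular system; it vanishes by forward substitution in
    \<open>k\<close>.\<close>
  define d where "d k = (\<Sum>s\<in>?I. R s k * coef s t) - corr k t" for k
  have Rd: "(\<Sum>k\<in>{1..T}. R q k * d k) = 0" if q: "q \<in> ?I" for q
  proof -
    have "(\<Sum>k\<in>{1..T}. R q k * (\<Sum>s\<in>?I. R s k * coef s t)) = (\<Sum>s\<in>?I. (\<Sum>k\<in>{1..T}. R q k * R s k) * coef s t)"
      unfolding sum_distrib_left sum_distrib_right by (subst sum.swap) (simp only: mult.assoc)
    also have "\<dots> = (\<Sum>s\<in>?I. Sig q s * coef s t)"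
    proof (rule sum.cong[OF refl])
      fix s assume "s \<in> ?I"
      then have "s \<in> {1..T}" "q \<in> {1..T}" using q IT by blast+
      then show "(\<Sum>k\<in>{1..T}. R q k * R s k) * coef s t = Sig q s * coef s t" using RR by simp
    qed
    finally show ?thesis using S[OF q] by (simp add: d_def right_diff_distrib sum_subtractf)
  qed
  have "d k = 0" if "k \<in> ?I" for k
    using that
  proof (induction k rule: less_induct)
    case (less k)
    have kT: "k \<in> {1..T}" using less.prems IT by auto
    have "(\<Sum>l\<in>{1..T}. R k l * d l) = (\<Sum>l\<in>{k}. R k l * d l)"
    proof (rule sum.mono_neutral_right)
      show "\<forall>l\<in>{1..T} - {k}. R k l * d l = 0"
      proof
        fix l assume l: "l \<in> {1..T} - {k}"
        show "R k l * d l = 0" using l less.IH[of l] less.prems R_tri[of k l] by (cases "l < k") auto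
      qed
    qed (use kT in auto)
    then have "R k k * d k = 0" using Rd[OF less.prems] by simp
    moreover have "R k k > 0" using R_diag[OF kT] lambda_min_pos[OF _ _ pd] T1
      by (meson atLeastatMost_empty_iff finite_atLeastAtMost less_le_trans not_less real_sqrt_gt_zero)
    ultimately show ?case by simp
  qed
  then have "(\<Sum>s\<in>?I. R s k * coef s t) = corr k t" using k by (simp add: d_def)
  moreover have "(\<Sum>s\<in>?I. R s k * coef s t) = (\<Sum>s\<in>{k..<t}. R s k * coef s t)"
    by (rule sum.mono_neutral_right) (use k R_tri in auto)
  ultimately show ?thesis by (simp add: mult.commute)
qed

text \<open>Flipping the sign of \<open>z\<^sub>r\<close> preserves the law of the noise but does not affect \<open>y\<^sub>1, ..., y\<^sub>t\<^sub>-\<^sub>1\<close>.\<close>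

lemma corr_eq_0:
  assumes t: "t \<in> {1..T}" and r: "r \<in> {t..T}"
  shows "corr r t = 0"
proof -
  have rT: "r \<in> {1..T}" using r t by auto
  \<comment> \<open>The identity and a single sign flip are both roots of the identity matrix, so
    \<open>mix_noise_law_eq\<close> gives them the same law.\<close>
  define I where "I = (\<lambda>i j::nat. if i = j then 1 else (0::real))"
  define F where "F = (\<lambda>i j::nat. if i = j then (if i = r then -1 else 1) else (0::real))"
  have mI: "mix_noise n T I z k i = z k i" and mF: "mix_noise n T F z k i = (if k = r then -1 else 1) * z k i"
    if "k \<in> {1..T}" "i < n" for z k i
    using that by (simp_all add: mix_noise_def I_def F_def if_distrib[of "\<lambda>x. x * _"] sum.delta' cong: if_cong)
  have law: "distr N fun2_space (mix_noise n T I) = distr N fun2_space (mix_noise n T F)"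
    by (rule mix_noise_law_eq)
      (auto simp: I_def F_def if_distrib[of "\<lambda>x. x * _"] if_distrib[of "\<lambda>x. _ * x"] sum.delta sum.delta' cong: if_cong)
  define \<phi> where "\<phi> v = vinner n (v r) (f t (cmp_traj n T m (mix_noise n T R v)))" for v
  have mm: "mix_noise n T R \<in> measurable fun2_space fun2_space"
  proof -
    have "(\<lambda>v. mix_noise n T R v k i) \<in> borel_measurable fun2_space" for k i
      unfolding mix_noise_def by (cases "k \<in> {1..T} \<and> i < n") (simp_all del: atLeastAtMost_iff)
    then show ?thesis unfolding measurable_fun2_iff by blast
  qed
  have \<phi>m: "\<phi> \<in> borel_measurable fun2_space" unfolding \<phi>_def[abs_def]
    by (rule vinner_measurable[OF fun2_component components_measurable_compose[OF f_meas[OF t] measurable_compose[OF mm cmp_measurable]]]) auto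
  have eq: "(\<integral>z. \<phi> (mix_noise n T I z) \<partial>N) = (\<integral>z. \<phi> (mix_noise n T F z) \<partial>N)"
    using integral_distr[OF mix_noise_measurable \<phi>m, of n T I] integral_distr[OF mix_noise_measurable \<phi>m, of n T F] law by simp
  have 1: "\<phi> (mix_noise n T I z) = vinner n (z r) (f t (y z))" for z
  proof -
    have "mix_noise n T R (mix_noise n T I z) = mix_noise n T R z"
      by (intro ext) (auto simp: mix_noise_def[of n T R] mI intro!: sum.cong)
    then show ?thesis unfolding \<phi>_def y_def by (intro vinner_cong) (use mI rT in auto)
  qed
  have 2: "\<phi> (mix_noise n T F z) = - vinner n (z r) (f t (y z))" for z
  proof -
    let ?w = "mix_noise n T R z" and ?w' = "mix_noise n T R (mix_noise n T F z)"
    \<comment> \<open>Since \<open>s < t \<le> r\<close> and \<open>R\<close> is lower triangular,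
      the mixed noise at time \<open>s\<close> does not contain \<open>z r\<close>.\<close>
    have w: "?w' s i = ?w s i" if s: "s \<in> {1..<t}" and i: "i < n" for s i
    proof -
      have sT: "s \<in> {1..T}" using s t by auto
      show ?thesis unfolding mix_noise_lower[OF sT i]
        by (intro sum.cong refl) (use mF s r sT i in auto)
    qed
    have "cmp_traj n T m ?w' s i = cmp_traj n T m ?w s i" if "s \<in> {1..<t}" "i < n" for s i
      using that
    proof (induction s arbitrary: i rule: less_induct)
      case (less s)
      have sT: "s \<in> {1..T}" using less.prems t by auto
      have "m s (cmp_traj n T m ?w') i = m s (cmp_traj n T m ?w) i"
        by (rule nonanticipativeD[OF m_na[OF sT] _ less.prems(2)]) (use less.IH less.prems in auto)
      then show ?case unfolding cmp_step[OF sT less.prems(2)] using w less.prems by simp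
    qed
    then have "f t (cmp_traj n T m ?w') i = f t (y z) i" if "i < n" for i
      unfolding y_def by (intro nonanticipativeD[OF f_na[OF t] _ that]) auto
    then have "\<phi> (mix_noise n T F z) = vinner n (\<lambda>i. (-1) * z r i) (f t (y z))"
      unfolding \<phi>_def by (intro vinner_cong) (use mF rT in auto)
    then show ?thesis unfolding vinner_left_linear by simp
  qed
  have "(\<integral>z. vinner n (z r) (f t (y z)) \<partial>N) = - (\<integral>z. vinner n (z r) (f t (y z)) \<partial>N)"
    using eq unfolding 1 2 by simp
  then show ?thesis by (simp add: corr_def)
qed

lemma Sig_diag_le:
  assumes s: "s \<in> {1..T}"
  shows "Sig s s \<le> lambda_max {1..T} Sig"
proof -
  let ?e = "\<lambda>i. if i = s then 1 else (0::real)"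
  have "bform {1..T} Sig ?e ?e = (\<Sum>j\<in>{1..T}. Sig s j * ?e j)" by (rule bform_unit[OF _ s]) simp
  also have "\<dots> = (\<Sum>j\<in>{1..T}. if j = s then Sig s j else 0)" by (intro sum.cong) auto
  also have "\<dots> = Sig s s" using s by (simp add: sum.delta)
  finally have e: "bform {1..T} Sig ?e ?e = Sig s s" .
  have "(\<Sum>i\<in>{1..T}. (?e i)\<^sup>2) = (\<Sum>i\<in>{1..T}. if i = s then 1 else 0)" by (intro sum.cong) auto
  also have "\<dots> = (1::real)" using s by (simp add: sum.delta)
  finally have "(\<Sum>i\<in>{1..T}. (?e i)\<^sup>2) = 1" .
  then show ?thesis using lambda_max_bound[of "{1..T}" Sig ?e] e Sig_sym s by auto
qed

text \<open>Cauchy--Schwarz and AM-GM, with \<open>n\<close> and \<open>n * Sig t t\<close> as the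
  means of the squared norms of \<open>z r\<close> and \<open>f t (y z)\<close>. The bound therefore
  depends on the instance through its largest eigenvalue alone.\<close>

lemma corr_bound:
  assumes t: "t \<in> {1..T}" and r: "r \<in> {1..T}"
  shows "\<bar>corr r t\<bar> \<le> (1 + lambda_max {1..T} Sig) / 2"
proof -
  have ab: "\<bar>vinner n a b\<bar> \<le> (vinner n a a + vinner n b b) / 2" for a b
  proof -
    have "\<bar>vinner n a b\<bar> \<le> vnorm n a * vnorm n b" by (rule vinner_le_vnorm)
    also have "\<dots> \<le> ((vnorm n a)\<^sup>2 + (vnorm n b)\<^sup>2) / 2"
      using zero_le_power2[of "vnorm n a - vnorm n b"] by (simp add: power2_diff)
    finally show ?thesis by (simp add: vnorm_sq)
  qed
  have "\<bar>\<integral>z. vinner n (z r) (f t (y z)) \<partial>N\<bar> \<le> (\<integral>z. \<bar>vinner n (z r) (f t (y z))\<bar> \<partial>N)"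
    using integral_norm_bound[of N "\<lambda>z. vinner n (z r) (f t (y z))"] by simp
  also have "\<dots> \<le> (\<integral>z. (vinner n (z r) (z r) + vinner n (f t (y z)) (f t (y z))) / 2 \<partial>N)"
    by (rule integral_mono) (use integrable_pairs[OF t r] integrable_pairs(2)[OF t t] ab in auto)
  also have "\<dots> = (n + n * Sig t t) / 2"
    using integrable_pairs(3)[OF t r] integrable_pairs(2)[OF t t] noise_second_moment[OF r, of n] Sig_eq[OF t t] by (simp add: vnorm_sq)
  also have "\<dots> = n * ((1 + Sig t t) / 2)" by (simp add: algebra_simps)
  also have "\<dots> \<le> n * ((1 + lambda_max {1..T} Sig) / 2)" using Sig_diag_le[OF t] by (intro mult_left_mono) auto
  finally have "\<bar>\<integral>z. vinner n (z r) (f t (y z)) \<partial>N\<bar> / n \<le> (1 + lambda_max {1..T} Sig) / 2"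
    using n0 by (simp add: field_simps)
  then show ?thesis by (simp add: corr_def abs_divide)
qed

lemma R_bound: "s \<in> {1..T} \<Longrightarrow> k \<in> {1..T} \<Longrightarrow> (R s k)\<^sup>2 \<le> lambda_max {1..T} Sig"
proof -
  assume s: "s \<in> {1..T}" and k: "k \<in> {1..T}"
  have "(R s k)\<^sup>2 \<le> (\<Sum>k\<in>{1..T}. (R s k)\<^sup>2)" using k by (intro member_le_sum) auto
  also have "\<dots> = Sig s s" using RR[OF s s] by (simp add: power2_eq_square)
  also have "\<dots> \<le> lambda_max {1..T} Sig" by (rule Sig_diag_le[OF s])
  finally show ?thesis .
qed

end

section \<open>The coupling bound\<close>

text \<open>Bundling an instance with a chosen root of its covariance makes the problem class a set,
  to which \<open>dominated\<close> applies. The dimension is a field because the constants must not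
  depend on it.\<close>

record problem =
  dim :: nat
  ff :: "nat \<Rightarrow> (nat \<Rightarrow> nat \<Rightarrow> real) \<Rightarrow> nat \<Rightarrow> real"
  gg :: "nat \<Rightarrow> (nat \<Rightarrow> nat \<Rightarrow> real) \<Rightarrow> nat \<Rightarrow> real"
  mm :: "nat \<Rightarrow> (nat \<Rightarrow> nat \<Rightarrow> real) \<Rightarrow> nat \<Rightarrow> real"
  cov :: "nat \<Rightarrow> nat \<Rightarrow> real"
  chol :: "nat \<Rightarrow> nat \<Rightarrow> real"

abbreviation ytraj :: "nat \<Rightarrow> problem \<Rightarrow> (nat \<Rightarrow> nat \<Rightarrow> real) \<Rightarrow> nat \<Rightarrow> nat \<Rightarrow> real" where
  "ytraj T P \<equiv> matched.y (dim P) T (mm P) (chol P)"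

abbreviation pcoef :: "nat \<Rightarrow> problem \<Rightarrow> nat \<Rightarrow> nat \<Rightarrow> real" where
  "pcoef T P \<equiv> matched.coef (dim P) T (ff P) (mm P) (cov P)"

abbreviation pcorr :: "nat \<Rightarrow> problem \<Rightarrow> nat \<Rightarrow> nat \<Rightarrow> real" where
  "pcorr T P \<equiv> matched.corr (dim P) T (ff P) (mm P) (chol P)"

abbreviation xtraj :: "nat \<Rightarrow> problem \<Rightarrow> (nat \<Rightarrow> nat \<Rightarrow> real) \<Rightarrow> nat \<Rightarrow> nat \<Rightarrow> real" where
  "xtraj T P \<equiv> coupled_traj (dim P) T (ff P) (gg P)"

definition problems :: "nat \<Rightarrow> real \<Rightarrow> real \<Rightarrow> real \<Rightarrow> problem set" where
  "problems T L a b = {P. matched (dim P) T L (ff P) (gg P) (mm P) (cov P) (chol P)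
     \<and> lambda_max {1..T} (cov P) = a \<and> lambda_min {1..T} (cov P) = b}"

lemma problemsD:
  assumes "P \<in> problems T L a b"
  shows "matched (dim P) T L (ff P) (gg P) (mm P) (cov P) (chol P)" "lambda_max {1..T} (cov P) = a" "lambda_min {1..T} (cov P) = b"
  using assms by (simp_all add: problems_def)

lemma problems_lambda_min_pos: "P \<in> problems T L a b \<Longrightarrow> b > 0"
  using lambda_min_pos[of "{1..T}" "cov P"] problemsD[of P T L a b] matched.T1[of "dim P" T L "ff P" "gg P" "mm P" "cov P" "chol P"]
    matched.pd[of "dim P" T L "ff P" "gg P" "mm P" "cov P" "chol P"] by simp

context
  fixes T :: nat and L a b :: real and S :: "'c set" and pr :: "'c \<Rightarrow> problem"
  assumes S: "\<And>c. c \<in> S \<Longrightarrow> pr c \<in> problems T L a b"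
begin

lemmas mt = problemsD(1)[OF S]

lemma chol_dominated:
  assumes "s \<in> {1..T}" "k \<in> {1..T}"
  shows "dominated S (\<lambda>c. chol (pr c) s k) (\<lambda>_. 1)"
proof (rule dominatedI[of _ _ "sqrt a"])
  fix c assume c: "c \<in> S"
  have "(chol (pr c) s k)\<^sup>2 \<le> a" using matched.R_bound[OF mt[OF c] assms] problemsD(2)[OF S[OF c]] by simp
  then have "sqrt ((chol (pr c) s k)\<^sup>2) \<le> sqrt a" by (rule real_sqrt_le_mono)
  then show "\<bar>chol (pr c) s k\<bar> \<le> sqrt a * 1" by simp
qed

lemma chol_diag_pos: "s \<in> {1..T} \<Longrightarrow> c \<in> S \<Longrightarrow> chol (pr c) s s \<ge> sqrt b \<and> chol (pr c) s s > 0"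
  using matched.R_diag[OF mt, of c s] problemsD(3)[OF S, of c] problems_lambda_min_pos[OF S, of c]
  by (smt (verit) real_sqrt_gt_zero)

lemma chol_diag_dominated:
  assumes "s \<in> {1..T}"
  shows "dominated S (\<lambda>c. 1 / chol (pr c) s s) (\<lambda>_. 1)"
proof (rule dominatedI[of _ _ "1 / sqrt b"])
  fix c assume c: "c \<in> S"
  have "sqrt b > 0" using problems_lambda_min_pos[OF S[OF c]] by simp
  then show "\<bar>1 / chol (pr c) s s\<bar> \<le> 1 / sqrt b * 1"
    using chol_diag_pos[OF assms c] by (simp add: frac_le)
qed

lemma cov_dominated:
  assumes "s \<in> {1..T}" "t \<in> {1..T}"
  shows "dominated S (\<lambda>c. cov (pr c) s t) (\<lambda>_. 1)"
proof -
  have "dominated S (\<lambda>c. \<Sum>k\<in>{1..T}. chol (pr c) s k * chol (pr c) t k) (\<lambda>_. 1)"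
    by (intro dominated_sum dominated_bounded_mult chol_dominated assms)
  then show ?thesis by (rule dominated_mono) (use matched.RR[OF mt] assms in auto)
qed

lemma corr_dominated:
  assumes "r \<in> {1..T}" "t \<in> {1..T}"
  shows "dominated S (\<lambda>c. pcorr T (pr c) r t) (\<lambda>_. 1)"
proof (rule dominatedI[of _ _ "(1 + a) / 2"])
  fix c assume c: "c \<in> S"
  show "\<bar>pcorr T (pr c) r t\<bar> \<le> (1 + a) / 2 * 1"
    using matched.corr_bound[OF mt[OF c] assms(2,1)] problemsD(2)[OF S[OF c]] by simp
qed

lemma coef_dominated:
  assumes t: "t \<in> {1..T}" and s: "s \<in> {1..<t}"
  shows "dominated S (\<lambda>c. pcoef T (pr c) s t) (\<lambda>_. 1)"
proof (rule vector_family.triangular_system_bounded[where t = t and b = "\<lambda>s c. pcoef T (pr c) s t" and \<beta> = "\<lambda>s c. pcorr T (pr c) s t" and R = "\<lambda>s k c. chol (pr c) s k"])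
  show "(\<Sum>s\<in>{k..<t}. pcoef T (pr c) s t * chol (pr c) s k) = pcorr T (pr c) k t" if "k \<in> {1..<t}" "c \<in> S" for k c
    by (rule matched.coef_triangular[OF mt[OF that(2)] t that(1)])
qed (use s t corr_dominated chol_dominated chol_diag_pos chol_diag_dominated in auto)

end

text \<open>An instance is now a problem with two noise arrays, so the domination constant is common
  to all problems in the class. The finitely many constants, one for each \<open>t\<close>, are
  merged into a single one.\<close>

lemma uniform_lipschitz:
  "\<exists>K\<ge>1. \<forall>P\<in>problems T L a b. \<forall>t\<in>{1..T}. \<forall>z z'.
     (vnorm (dim P) (\<lambda>i. ff P t (ytraj T P z) i - ff P t (ytraj T P z') i))\<^sup>2 \<le> K\<^sup>2 * noise_dist_sq (dim P) T z z'"
proof -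
  define S where "S = {c :: problem \<times> (nat \<Rightarrow> nat \<Rightarrow> real) \<times> (nat \<Rightarrow> nat \<Rightarrow> real). fst c \<in> problems T L a b}"
  have S: "fst c \<in> problems T L a b" if "c \<in> S" for c using that by (simp add: S_def)
  note mt = problemsD(1)[OF S]
  let ?y = "\<lambda>c. ytraj T (fst c) (fst (snd c))" and ?y' = "\<lambda>c. ytraj T (fst c) (snd (snd c))"
  let ?E = "\<lambda>c. sqrt (noise_dist_sq (dim (fst c)) T (fst (snd c)) (snd (snd c)))"
  interpret vector_family S "\<lambda>c. dim (fst c)" .
  have "\<exists>K. \<forall>c\<in>S. \<bar>vnorm (dim (fst c)) (\<lambda>i. ff (fst c) t (?y c) i - ff (fst c) t (?y' c) i)\<bar> \<le> K * ?E c" if t: "t \<in> {1..T}" for t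
  proof -
    have "vdom (\<lambda>c i. ff (fst c) t (?y c) i - ff (fst c) t (?y' c) i) ?E"
    proof (rule recursion_lipschitz(2)[where T = T and L = L and D = "\<lambda>t c i. ?y c t i - ?y' c t i"
          and FD = "\<lambda>t c i. ff (fst c) t (?y c) i - ff (fst c) t (?y' c) i" and GD = "\<lambda>t c i. gg (fst c) t (?y c) i - gg (fst c) t (?y' c) i"
          and b = "\<lambda>s t c. pcoef T (fst c) s t" and R = "\<lambda>s t c. chol (fst c) s t" and Z = "\<lambda>s c i. fst (snd c) s i - snd (snd c) s i"])
      show "vnorm (dim (fst c)) (\<lambda>i. ff (fst c) t (?y c) i - ff (fst c) t (?y' c) i) \<le> L * sqrt (\<Sum>s\<in>{1..<t}. (vnorm (dim (fst c)) (\<lambda>i. ?y c s i - ?y' c s i))\<^sup>2)"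
        if "t \<in> {1..T}" "c \<in> S" for t c
        using matched.f_lip[OF mt[OF that(2)] that(1)] unfolding hist_lipschitz_def by blast
      show "vnorm (dim (fst c)) (\<lambda>i. gg (fst c) t (?y c) i - gg (fst c) t (?y' c) i) \<le> L * sqrt (\<Sum>s\<in>{1..<t}. (vnorm (dim (fst c)) (\<lambda>i. ?y c s i - ?y' c s i))\<^sup>2)"
        if "t \<in> {1..T}" "c \<in> S" for t c
        using matched.g_lip[OF mt[OF that(2)] that(1)] unfolding hist_lipschitz_def by blast
      show "dom (\<lambda>c. pcoef T (fst c) s t) (\<lambda>_. 1)" if "t \<in> {1..T}" "s \<in> {1..<t}" for s t
        by (rule coef_dominated[OF S that])
      show "dom (\<lambda>c. chol (fst c) t s) (\<lambda>_. 1)" if "s \<in> {1..T}" "t \<in> {1..T}" for s t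
        by (rule chol_dominated[OF S that(2,1)])
      show "vdom (\<lambda>c i. fst (snd c) s i - snd (snd c) s i) ?E" if s: "s \<in> {1..T}" for s
        unfolding vdom_def
        by (rule dominatedI[of _ _ 1]) (auto intro!: real_le_rsqrt noise_component_dist[OF s])
    next
      fix t c i assume t: "t \<in> {1..T}" and c: "c \<in> S" and i: "i < dim (fst c)"
      show "?y c t i - ?y' c t i = gg (fst c) t (?y c) i - gg (fst c) t (?y' c) i +
          (\<Sum>s\<in>{1..<t}. pcoef T (fst c) s t * (ff (fst c) s (?y c) i - ff (fst c) s (?y' c) i)) + (\<Sum>s\<in>{1..t}. chol (fst c) t s * (fst (snd c) s i - snd (snd c) s i))"
        unfolding matched.y_eq[OF mt[OF c] t i] by (simp add: right_diff_distrib sum_subtractf)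
    qed (rule t)
    then show ?thesis unfolding vdom_def dominated_def .
  qed
  then have "\<forall>t\<in>{1..T}. \<exists>K. \<forall>c\<in>S. \<bar>vnorm (dim (fst c)) (\<lambda>i. ff (fst c) t (?y c) i - ff (fst c) t (?y' c) i)\<bar> \<le> K * ?E c" by blast
  then have "\<exists>K. \<forall>t\<in>{1..T}. \<forall>c\<in>S. \<bar>vnorm (dim (fst c)) (\<lambda>i. ff (fst c) t (?y c) i - ff (fst c) t (?y' c) i)\<bar> \<le> K t * ?E c"
    by (rule bchoice)
  then obtain K where K: "\<forall>t\<in>{1..T}. \<forall>c\<in>S. \<bar>vnorm (dim (fst c)) (\<lambda>i. ff (fst c) t (?y c) i - ff (fst c) t (?y' c) i)\<bar> \<le> K t * ?E c" ..
  define K' where "K' = 1 + (\<Sum>t\<in>{1..T}. \<bar>K t\<bar>)"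
  have K1: "K' \<ge> 1" unfolding K'_def by (simp add: sum_nonneg)
  have "(vnorm (dim P) (\<lambda>i. ff P t (ytraj T P z) i - ff P t (ytraj T P z') i))\<^sup>2 \<le> K'\<^sup>2 * noise_dist_sq (dim P) T z z'"
    if P: "P \<in> problems T L a b" and t: "t \<in> {1..T}" for P t z z'
  proof -
    let ?v = "vnorm (dim P) (\<lambda>i. ff P t (ytraj T P z) i - ff P t (ytraj T P z') i)"
    have d: "noise_dist_sq (dim P) T z z' \<ge> 0" unfolding noise_dist_sq_def by (intro sum_nonneg) auto
    have "\<bar>K t\<bar> \<le> (\<Sum>t\<in>{1..T}. \<bar>K t\<bar>)" using t by (intro member_le_sum) auto
    then have "K t \<le> K'" unfolding K'_def by linarith
    then have "K t * sqrt (noise_dist_sq (dim P) T z z') \<le> K' * sqrt (noise_dist_sq (dim P) T z z')"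
      using d by (intro mult_right_mono) auto
    moreover have "?v \<le> K t * sqrt (noise_dist_sq (dim P) T z z')" using bspec[OF bspec[OF K t], of "(P, z, z')"] P by (simp add: S_def)
    ultimately have "?v \<le> K' * sqrt (noise_dist_sq (dim P) T z z')" by linarith
    then have "?v\<^sup>2 \<le> (K' * sqrt (noise_dist_sq (dim P) T z z'))\<^sup>2" by (intro power_mono) auto
    then show ?thesis using d by (simp add: power_mult_distrib)
  qed
  then show ?thesis using K1 by blast
qed

text \<open>The event on which all the Gram-type quantities entering the comparison are within \<open>H\<close> times the square root of \<open>n r\<close>
  of their means.\<close>

definition good_noise :: "real \<Rightarrow> nat \<Rightarrow> problem \<Rightarrow> real \<Rightarrow> (nat \<Rightarrow> nat \<Rightarrow> real) \<Rightarrow> bool" where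
  "good_noise H T P r z \<longleftrightarrow> (let n = dim P; y = ytraj T P z in
     (\<forall>s\<in>{1..T}. \<forall>t\<in>{1..T}. \<bar>vinner n (ff P s y) (ff P t y) - n * cov P s t\<bar> \<le> H * sqrt (real n * r)
        \<and> \<bar>vinner n (z s) (ff P t y) - n * pcorr T P s t\<bar> \<le> H * sqrt (real n * r)
        \<and> \<bar>vinner n (z s) (z s) - n\<bar> \<le> H * sqrt (real n * r)))"

lemma good_noise_probability:
  "\<exists>H. \<forall>P\<in>problems T L a b. \<forall>r::real. 1/2 \<le> r \<and> r \<le> real (dim P) \<longrightarrow>
     {z \<in> space (noise_space (dim P) T). \<not> good_noise H T P r z} \<in> sets (noise_space (dim P) T)
     \<and> measure (noise_space (dim P) T) {z \<in> space (noise_space (dim P) T). \<not> good_noise H T P r z} \<le> 2 * exp (- r)"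
proof -
  obtain K where K: "K \<ge> 1" "\<And>P t z z'. P \<in> problems T L a b \<Longrightarrow> t \<in> {1..T} \<Longrightarrow>
     (vnorm (dim P) (\<lambda>i. ff P t (ytraj T P z) i - ff P t (ytraj T P z') i))\<^sup>2 \<le> K\<^sup>2 * noise_dist_sq (dim P) T z z'"
    using uniform_lipschitz[of T L a b] by blast
  have K0: "K > 0" using K(1) by simp
  \<comment> \<open>Absorbs the union bound over \<open>T^2\<close> pairs with three events of
    probability at most \<open>4 * exp (- \<rho> * r)\<close> each: as \<open>2 * r \<ge> 1\<close>,
    the exponent gains at least \<open>ln (12 * T^2 + 1)\<close> beyond \<open>r\<close>.\<close>
  define \<rho> where "\<rho> = 1 + 2 * ln (12 * (real T)\<^sup>2 + 1)"
  \<comment> \<open>Serves both kinds of vectors: the mean squared norm is \<open>n\<close> for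
    \<open>z s\<close> and at most \<open>n * a\<close> for \<open>f t (y z)\<close>.\<close>
  define d where "d = sqrt (\<bar>a\<bar> + 1)"
  define H where "H = 8 * \<rho> * K\<^sup>2 + 8 * d * K * sqrt \<rho> + 48 * K\<^sup>2"
  have \<rho>: "\<rho> \<ge> 0" unfolding \<rho>_def by simp
  have d0: "d \<ge> 0" and d2: "d\<^sup>2 = \<bar>a\<bar> + 1" by (simp_all add: d_def)
  have "{z \<in> space (noise_space (dim P) T). \<not> good_noise H T P r z} \<in> sets (noise_space (dim P) T)
     \<and> measure (noise_space (dim P) T) {z \<in> space (noise_space (dim P) T). \<not> good_noise H T P r z} \<le> 2 * exp (- r)"
    if P: "P \<in> problems T L a b" and r: "1/2 \<le> r" "r \<le> real (dim P)" for P and r :: real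
  proof -
    let ?n = "dim P" and ?N = "noise_space (dim P) T"
    let ?f = "\<lambda>t z. ff P t (ytraj T P z)"
    interpret matched ?n T L "ff P" "gg P" "mm P" "cov P" "chol P" by (rule problemsD(1)[OF P])
    have fm: "\<And>i. i < ?n \<Longrightarrow> (\<lambda>z. ?f t z i) \<in> borel_measurable ?N" if "t \<in> {1..T}" for t by (rule f_y_measurable[OF that])
    have zm: "\<And>i. i < ?n \<Longrightarrow> (\<lambda>z. z t i) \<in> borel_measurable ?N" if "t \<in> {1..T}" for t by (rule noise_component[OF that])
    have fl: "(vnorm ?n (\<lambda>i. ?f t z i - ?f t z' i))\<^sup>2 \<le> K\<^sup>2 * noise_dist_sq ?n T z z'" if "t \<in> {1..T}" for t z z'
      by (rule K(2)[OF P that])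
    have zl: "(vnorm ?n (\<lambda>i. z t i - z' t i))\<^sup>2 \<le> K\<^sup>2 * noise_dist_sq ?n T z z'" if "t \<in> {1..T}" for t z z'
      by (rule noise_lipschitz[OF K(1) that])
    have fe: "expectation (\<lambda>z. (vnorm ?n (?f t z))\<^sup>2) \<le> d\<^sup>2 * ?n" if t: "t \<in> {1..T}" for t
    proof -
      have "expectation (\<lambda>z. (vnorm ?n (?f t z))\<^sup>2) = ?n * cov P t t" unfolding vnorm_sq by (rule Sig_eq[OF t t])
      also have "\<dots> \<le> ?n * d\<^sup>2" using Sig_diag_le[OF t] problemsD(2)[OF P] d2 by (intro mult_left_mono) auto
      finally show ?thesis by (simp add: mult.commute)
    qed
    have ze: "expectation (\<lambda>z. (vnorm ?n (z t))\<^sup>2) \<le> d\<^sup>2 * ?n" if t: "t \<in> {1..T}" for t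
      unfolding noise_second_moment[OF t] d2 by (simp add: algebra_simps)
    define B1 where "B1 s t = {z\<in>space ?N. \<bar>vinner ?n (?f s z) (?f t z) - ?n * cov P s t\<bar> > H * sqrt (real ?n * r)}" for s t
    define B2 where "B2 s t = {z\<in>space ?N. \<bar>vinner ?n (z s) (?f t z) - ?n * pcorr T P s t\<bar> > H * sqrt (real ?n * r)}" for s t
    define B3 where "B3 s = {z\<in>space ?N. \<bar>vinner ?n (z s) (z s) - ?n\<bar> > H * sqrt (real ?n * r)}" for s
    have p1: "prob (B1 s t) \<le> 4 * exp (- \<rho> * r)" if s: "s \<in> {1..T}" and t: "t \<in> {1..T}" for s t
      using lipschitz_inner_tail(2)[OF fm[OF s] fm[OF t] K0 fl[OF s] fl[OF t] d0 fe[OF s] fe[OF t] r \<rho>]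
      unfolding B1_def H_def Sig_eq[OF s t] .
    have p2: "prob (B2 s t) \<le> 4 * exp (- \<rho> * r)" if s: "s \<in> {1..T}" and t: "t \<in> {1..T}" for s t
    proof -
      have "expectation (\<lambda>z. vinner ?n (z s) (?f t z)) = ?n * pcorr T P s t" using n0 by (simp add: corr_def)
      then show ?thesis
        using lipschitz_inner_tail(2)[OF zm[OF s] fm[OF t] K0 zl[OF s] fl[OF t] d0 ze[OF s] fe[OF t] r \<rho>]
        unfolding B2_def H_def by simp
    qed
    have p3: "prob (B3 s) \<le> 4 * exp (- \<rho> * r)" if s: "s \<in> {1..T}" for s
    proof -
      have "expectation (\<lambda>z. vinner ?n (z s) (z s)) = ?n" using noise_second_moment[OF s, of ?n] by (simp add: vnorm_sq)
      then show ?thesis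
        using lipschitz_inner_tail(2)[OF zm[OF s] zm[OF s] K0 zl[OF s] zl[OF s] d0 ze[OF s] ze[OF s] r \<rho>]
        unfolding B3_def H_def by simp
    qed
    have m: "B1 s t \<in> events" "B2 s t \<in> events" "B3 s \<in> events" if s: "s \<in> {1..T}" and t: "t \<in> {1..T}" for s t
    proof -
      have lev: "{z\<in>space ?N. \<bar>X z - e\<bar> > c} \<in> events" if "X \<in> borel_measurable ?N" for X :: "_ \<Rightarrow> real" and e c
        using that by measurable
      show "B1 s t \<in> events" unfolding B1_def by (rule lev[OF vinner_measurable[OF fm[OF s] fm[OF t]]])
      show "B2 s t \<in> events" unfolding B2_def by (rule lev[OF vinner_measurable[OF zm[OF s] fm[OF t]]])
      show "B3 s \<in> events" unfolding B3_def by (rule lev[OF vinner_measurable[OF zm[OF s] zm[OF s]]])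
    qed
    have bad: "{z \<in> space ?N. \<not> good_noise H T P r z} = (\<Union>p\<in>{1..T}\<times>{1..T}. B1 (fst p) (snd p) \<union> B2 (fst p) (snd p) \<union> B3 (fst p))"
    proof (rule set_eqI)
      fix z
      have "z \<in> {z \<in> space ?N. \<not> good_noise H T P r z} \<longleftrightarrow> (\<exists>s\<in>{1..T}. \<exists>t\<in>{1..T}. z \<in> B1 s t \<union> B2 s t \<union> B3 s)"
        unfolding good_noise_def Let_def B1_def B2_def B3_def mem_Collect_eq Un_iff not_le[symmetric] by blast
      also have "\<dots> \<longleftrightarrow> z \<in> (\<Union>p\<in>{1..T}\<times>{1..T}. B1 (fst p) (snd p) \<union> B2 (fst p) (snd p) \<union> B3 (fst p))"
        unfolding UN_iff by (metis SigmaE SigmaI fst_conv snd_conv)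
      finally show "z \<in> {z \<in> space ?N. \<not> good_noise H T P r z} \<longleftrightarrow> z \<in> (\<Union>p\<in>{1..T}\<times>{1..T}. B1 (fst p) (snd p) \<union> B2 (fst p) (snd p) \<union> B3 (fst p))" .
    qed
    have mU: "B1 (fst p) (snd p) \<union> B2 (fst p) (snd p) \<union> B3 (fst p) \<in> events" if "p \<in> {1..T}\<times>{1..T}" for p
      using that m by (intro sets.Un) auto
    have pU: "prob (B1 (fst p) (snd p) \<union> B2 (fst p) (snd p) \<union> B3 (fst p)) \<le> 12 * exp (- \<rho> * r)" if "p \<in> {1..T}\<times>{1..T}" for p
    proof -
      have p: "fst p \<in> {1..T}" "snd p \<in> {1..T}" using that by auto
      have "prob (B1 (fst p) (snd p) \<union> B2 (fst p) (snd p) \<union> B3 (fst p)) \<le> prob (B1 (fst p) (snd p)) + prob (B2 (fst p) (snd p)) + prob (B3 (fst p))"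
        using measure_Un_le[OF m(1)[OF p] m(2)[OF p]] measure_Un_le[OF sets.Un[OF m(1)[OF p] m(2)[OF p]] m(3)[OF p]] by linarith
      then show ?thesis using p1[OF p] p2[OF p] p3[OF p(1)] by linarith
    qed
    have "prob {z \<in> space ?N. \<not> good_noise H T P r z} \<le> (\<Sum>p\<in>{1..T}\<times>{1..T}. prob (B1 (fst p) (snd p) \<union> B2 (fst p) (snd p) \<union> B3 (fst p)))"
      unfolding bad by (rule finite_measure_subadditive_finite) (use mU in auto)
    also have "\<dots> \<le> (\<Sum>p\<in>{1..T}\<times>{1..T}. 12 * exp (- \<rho> * r))" by (rule sum_mono) (rule pU)
    also have "\<dots> = 12 * (real T)\<^sup>2 * exp (- \<rho> * r)" by (simp add: power2_eq_square)
    also have "\<dots> \<le> (12 * (real T)\<^sup>2 + 1) * exp (- \<rho> * r)" by (intro mult_right_mono) auto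
    also have "\<dots> \<le> 2 * exp (- r)"
    proof -
      let ?M = "12 * (real T)\<^sup>2 + 1"
      have M: "?M \<ge> 1" by simp
      have "ln ?M * 1 \<le> ln ?M * (2 * r)" using r M by (intro mult_left_mono) auto
      then have "ln ?M + - \<rho> * r \<le> - r" by (simp add: \<rho>_def algebra_simps)
      then have "exp (ln ?M + - \<rho> * r) \<le> exp (- r)" by (subst exp_le_cancel_iff)
      then have "?M * exp (- \<rho> * r) \<le> exp (- r)" using M by (simp only: exp_add exp_ln)
      then show ?thesis using exp_ge_zero[of "- r"] by linarith
    qed
    finally have "prob {z \<in> space ?N. \<not> good_noise H T P r z} \<le> 2 * exp (- r)" .
    moreover have "{z \<in> space ?N. \<not> good_noise H T P r z} \<in> events" unfolding bad using mU by (intro sets.finite_UN) auto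
    ultimately show ?thesis by blast
  qed
  then show ?thesis by blast
qed

text \<open>An instance is a problem with a level \<open>r\<close> and a good noise array;
  \<epsilon> is \<open>sqrt r\<close> and \<rho> is \<open>sqrt n\<close>, so the deviations allowed
  by \<open>good_noise\<close> are of order \<open>\<epsilon> \<rho>\<close> and the conclusion is
  an error of order \<open>sqrt r\<close>.\<close>

lemma deterministic_comparison:
  "\<exists>C. \<forall>P\<in>problems T L a b. \<forall>(r::real) z. 1/2 \<le> r \<and> r \<le> real (dim P) \<and> good_noise H T P r z \<longrightarrow>
     (\<forall>t\<in>{1..T}. vnorm (dim P) (\<lambda>i. xtraj T P z t i - ytraj T P z t i) \<le> C * sqrt r)"
proof -
  define S where "S = {c :: problem \<times> real \<times> (nat \<Rightarrow> nat \<Rightarrow> real). fst c \<in> problems T L a b \<and> 1/2 \<le> fst (snd c) \<and> fst (snd c) \<le> dim (fst c)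
     \<and> good_noise H T (fst c) (fst (snd c)) (snd (snd c))}"
  have S: "fst c \<in> problems T L a b" if "c \<in> S" for c using that by (simp add: S_def)
  note mt = problemsD(1)[OF S]
  let ?n = "\<lambda>c. dim (fst c)" and ?r = "\<lambda>c. fst (snd c)" and ?z = "\<lambda>c. snd (snd c)"
  let ?y = "\<lambda>c. ytraj T (fst c) (?z c)" and ?x = "\<lambda>c. xtraj T (fst c) (?z c)"
  have rS: "1/2 \<le> ?r c" "?r c \<le> real (?n c)" if "c \<in> S" for c using that by (auto simp: S_def)
  have fm: "fom (?n c) T (ff (fst c)) (gg (fst c))" if "c \<in> S" for c
    by (rule matched.axioms_fom[OF mt[OF that]])
  have good: "\<bar>vinner (?n c) (ff (fst c) s (?y c)) (ff (fst c) t (?y c)) - real (?n c) * cov (fst c) s t\<bar> \<le> H * sqrt (real (?n c) * ?r c)"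
    "\<bar>vinner (?n c) (?z c s) (ff (fst c) t (?y c)) - real (?n c) * pcorr T (fst c) s t\<bar> \<le> H * sqrt (real (?n c) * ?r c)"
    "\<bar>vinner (?n c) (?z c s) (?z c s) - ?n c\<bar> \<le> H * sqrt (real (?n c) * ?r c)"
    if "c \<in> S" "s \<in> {1..T}" "t \<in> {1..T}" for c s t
    using that unfolding S_def good_noise_def Let_def by blast+
  have sq: "sqrt (?n c) * sqrt (?n c) = ?n c" for c :: "problem \<times> real \<times> (nat \<Rightarrow> nat \<Rightarrow> real)" by simp
  interpret comparison S ?n T L "\<lambda>c. sqrt (?r c)" "\<lambda>c. sqrt (?n c)" "\<lambda>t c. ?x c t" "\<lambda>t c. ?y c t" "\<lambda>t c. ?z c t"
    "\<lambda>t c. coupled_basis (?n c) T (ff (fst c)) (gg (fst c)) (?z c) t"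
    "\<lambda>t c. ff (fst c) t (?x c)" "\<lambda>t c. ff (fst c) t (?y c)" "\<lambda>t c. gg (fst c) t (?x c)" "\<lambda>t c. gg (fst c) t (?y c)"
    "\<lambda>s t c. chol (fst c) s t" "\<lambda>s t c. pcoef T (fst c) s t" "\<lambda>s t c. pcorr T (fst c) s t" "\<lambda>s t c. cov (fst c) s t"
  proof
    fix c assume c: "c \<in> S"
    show "sqrt (?n c) > 0" using matched.n0[OF mt[OF c]] by simp
    show "sqrt (?n c) * sqrt (?n c) = ?n c" by simp
    show "0 \<le> sqrt (?r c)" "sqrt (?r c) \<le> sqrt (?n c)" using rS[OF c] by auto
  next
    fix t c assume t: "t \<in> {1..T}" and c: "c \<in> S"
    show "vnorm (?n c) (\<lambda>i. ff (fst c) t (?x c) i - ff (fst c) t (?y c) i) \<le> L * sqrt (\<Sum>s\<in>{1..<t}. (vnorm (?n c) (\<lambda>i. ?x c s i - ?y c s i))\<^sup>2)"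
      using matched.f_lip[OF mt[OF c] t] unfolding hist_lipschitz_def by blast
    show "vnorm (?n c) (\<lambda>i. gg (fst c) t (?x c) i - gg (fst c) t (?y c) i) \<le> L * sqrt (\<Sum>s\<in>{1..<t}. (vnorm (?n c) (\<lambda>i. ?x c s i - ?y c s i))\<^sup>2)"
      using matched.g_lip[OF mt[OF c] t] unfolding hist_lipschitz_def by blast
  next
    fix s t assume st: "s \<in> {1..T}" "t \<in> {1..T}"
    show "dominated S (\<lambda>c. vinner (?n c) (ff (fst c) s (?y c)) (ff (fst c) t (?y c)) - sqrt (?n c) * sqrt (?n c) * cov (fst c) s t) (\<lambda>c. sqrt (?r c) * sqrt (?n c))"
      by (rule dominatedI[of _ _ H]) (use good(1)[OF _ st] in \<open>simp add: real_sqrt_mult mult.commute\<close>)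
    show "dominated S (\<lambda>c. vinner (?n c) (?z c s) (ff (fst c) t (?y c)) - sqrt (?n c) * sqrt (?n c) * pcorr T (fst c) s t) (\<lambda>c. sqrt (?r c) * sqrt (?n c))"
      by (rule dominatedI[of _ _ H]) (use good(2)[OF _ st] in \<open>simp add: real_sqrt_mult mult.commute\<close>)
    show "dominated S (\<lambda>c. cov (fst c) s t) (\<lambda>_. 1)" by (rule cov_dominated[OF S st])
    show "dominated S (\<lambda>c. pcorr T (fst c) s t) (\<lambda>_. 1)" by (rule corr_dominated[OF S st])
    show "dominated S (\<lambda>c. chol (fst c) s t) (\<lambda>_. 1)" by (rule chol_dominated[OF S st])
  next
    fix s assume s: "s \<in> {1..T}"
    show "vector_family.vdom S ?n (\<lambda>c. ?z c s) (\<lambda>c. sqrt (?n c))"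
      unfolding vector_family.vdom_def
    proof (rule dominatedI[of _ _ "sqrt (1 + \<bar>H\<bar>)"])
      fix c assume c: "c \<in> S"
      \<comment> \<open>As \<open>r \<le> n\<close>, the permitted deviation is at most
        \<open>\<bar>H\<bar> * n\<close>, so a good noise vector has norm of order
        \<open>sqrt n\<close>.\<close>
      have "?r c * real (?n c) \<le> real (?n c) * real (?n c)" using rS[OF c] by (intro mult_right_mono) auto
      then have "sqrt (real (?n c) * ?r c) \<le> sqrt (real (?n c) * real (?n c))" by (intro real_sqrt_le_mono) (simp add: mult.commute)
      then have "sqrt (real (?n c) * ?r c) \<le> real (?n c)" by simp
      then have "H * sqrt (real (?n c) * ?r c) \<le> \<bar>H\<bar> * ?n c"
        using rS[OF c] by (intro mult_mono) auto
      then have "(vnorm (?n c) (?z c s))\<^sup>2 \<le> (1 + \<bar>H\<bar>) * ?n c"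
        using good(3)[OF c s s] unfolding vnorm_sq by (simp add: distrib_right)
      then have "sqrt ((vnorm (?n c) (?z c s))\<^sup>2) \<le> sqrt ((1 + \<bar>H\<bar>) * ?n c)" by (rule real_sqrt_le_mono)
      then show "\<bar>vnorm (?n c) (?z c s)\<bar> \<le> sqrt (1 + \<bar>H\<bar>) * sqrt (?n c)" by (simp add: real_sqrt_mult)
    qed
    show "dominated S (\<lambda>c. 1 / chol (fst c) s s) (\<lambda>_. 1)" by (rule chol_diag_dominated[OF S s])
  next
    fix s c assume s: "s \<in> {1..T}" and c: "c \<in> S"
    show "chol (fst c) s s > 0" using chol_diag_pos[where pr = fst and S = S, OF S s c] by blast
    show "unit_or_zero (?n c) (coupled_basis (?n c) T (ff (fst c)) (gg (fst c)) (?z c) s)"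
      by (rule fom.basis_unit_or_zero[OF fm[OF c] s])
    show "vinner (?n c) (coupled_basis (?n c) T (ff (fst c)) (gg (fst c)) (?z c) s) (ff (fst c) s (?x c)) \<ge> 0"
      by (rule fom.basis_diag_nonneg[OF fm[OF c] s])
  next
    fix s t c assume "t \<in> {1..T}" "s \<in> {t..T}" "c \<in> S"
    then show "pcorr T (fst c) s t = 0" using matched.corr_eq_0[OF mt] by blast
  next
    fix s t :: nat and c assume "s < t" "c \<in> S"
    then show "chol (fst c) s t = 0" using matched.R_tri[OF mt] by blast
  next
    fix s t c assume "s \<in> {1..T}" "t \<in> {1..T}" "c \<in> S"
    then show "(\<Sum>k\<in>{1..T}. chol (fst c) s k * chol (fst c) t k) = cov (fst c) s t" using matched.RR[OF mt] by blast
  next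
    fix k t c assume "t \<in> {1..T}" "k \<in> {1..<t}" "c \<in> S"
    then show "(\<Sum>s\<in>{k..<t}. pcoef T (fst c) s t * chol (fst c) s k) = pcorr T (fst c) k t" using matched.coef_triangular[OF mt] by blast
  next
    fix t c i assume t: "t \<in> {1..T}" and c: "c \<in> S" and i: "i < ?n c"
    show "ff (fst c) t (?x c) i = (\<Sum>s\<in>{1..t}. vinner (?n c) (coupled_basis (?n c) T (ff (fst c)) (gg (fst c)) (?z c) s) (ff (fst c) t (?x c)) * coupled_basis (?n c) T (ff (fst c)) (gg (fst c)) (?z c) s i)"
      by (rule fom.basis_expand[OF fm[OF c] t i])
    show "?y c t i = gg (fst c) t (?y c) i + (\<Sum>s\<in>{1..<t}. pcoef T (fst c) s t * ff (fst c) s (?y c) i) + (\<Sum>s\<in>{1..t}. chol (fst c) t s * ?z c s i)"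
      by (rule matched.y_eq[OF mt[OF c] t i])
    let ?u = "coupled_basis (?n c) T (ff (fst c)) (gg (fst c)) (?z c)"
    show "?x c t i = gg (fst c) t (?x c) i + (\<Sum>s\<in>{1..t}. vinner (?n c) (?u s) (ff (fst c) t (?x c)) *
         ((?z c s i + (sqrt 2 - 1) * vinner (?n c) (?u s) (?z c s) * ?u s i
     - (\<Sum>j\<in>{1..<s}. ?u j i * vinner (?n c) (?u j) (?z c s)) + (\<Sum>j\<in>{1..<s}. ?u j i * vinner (?n c) (?z c j) (?u s))) / sqrt (?n c)))"
      using fom.coupled_traj_apply[OF fm[OF c] t i] unfolding noise_column_def .
  qed
  have "\<forall>t\<in>{1..T}. \<exists>C. \<forall>c\<in>S. \<bar>vnorm (?n c) (\<lambda>i. ?x c t i - ?y c t i)\<bar> \<le> C * sqrt (?r c)"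
    using comparison unfolding vdom_def dominated_def by blast
  then have "\<exists>C. \<forall>t\<in>{1..T}. \<forall>c\<in>S. \<bar>vnorm (?n c) (\<lambda>i. ?x c t i - ?y c t i)\<bar> \<le> C t * sqrt (?r c)" by (rule bchoice)
  then obtain C where C: "\<forall>t\<in>{1..T}. \<forall>c\<in>S. \<bar>vnorm (?n c) (\<lambda>i. ?x c t i - ?y c t i)\<bar> \<le> C t * sqrt (?r c)" ..
  define C' where "C' = (\<Sum>t\<in>{1..T}. \<bar>C t\<bar>)"
  have "vnorm (dim P) (\<lambda>i. xtraj T P z t i - ytraj T P z t i) \<le> C' * sqrt r"
    if P: "P \<in> problems T L a b" and r: "1/2 \<le> r \<and> r \<le> real (dim P) \<and> good_noise H T P r z" and t: "t \<in> {1..T}" for P and r :: real and z t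
  proof -
    have "(P, r, z) \<in> S" using P r by (simp add: S_def)
    then have "vnorm (dim P) (\<lambda>i. xtraj T P z t i - ytraj T P z t i) \<le> C t * sqrt r" using bspec[OF bspec[OF C t], of "(P, r, z)"] by simp
    also have "\<bar>C t\<bar> \<le> C'" unfolding C'_def using t by (intro member_le_sum) auto
    then have "C t * sqrt r \<le> C' * sqrt r" using r by (intro mult_right_mono) auto
    finally show ?thesis .
  qed
  then show ?thesis by blast
qed

lemma coupling_bound:
  "\<exists>C>0. \<forall>P\<in>problems T L a b. \<forall>r::real. 0 \<le> r \<and> r \<le> real (dim P) \<longrightarrow>
     measure (noise_space (dim P) T) {z \<in> space (noise_space (dim P) T).
        C * sqrt r \<le> Max ((\<lambda>t. vnorm (dim P) (\<lambda>i. xtraj T P z t i - ytraj T P z t i)) ` {1..T})} \<le> 2 * exp (- r)"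
proof -
  obtain H where H: "\<And>P (r::real). P \<in> problems T L a b \<Longrightarrow> 1/2 \<le> r \<Longrightarrow> r \<le> real (dim P) \<Longrightarrow>
     {z \<in> space (noise_space (dim P) T). \<not> good_noise H T P r z} \<in> sets (noise_space (dim P) T)
     \<and> measure (noise_space (dim P) T) {z \<in> space (noise_space (dim P) T). \<not> good_noise H T P r z} \<le> 2 * exp (- r)"
    using good_noise_probability[of T L a b] by blast
  obtain C where C: "\<And>P (r::real) z t. P \<in> problems T L a b \<Longrightarrow> 1/2 \<le> r \<Longrightarrow> r \<le> real (dim P) \<Longrightarrow> good_noise H T P r z \<Longrightarrow> t \<in> {1..T} \<Longrightarrow>
      vnorm (dim P) (\<lambda>i. xtraj T P z t i - ytraj T P z t i) \<le> C * sqrt r"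
    using deterministic_comparison[of T L a b H] by blast
  \<comment> \<open>On the good event the maximum is at most \<open>C * sqrt r\<close>. The larger
    constant \<open>\<bar>C\<bar> + 1\<close> makes this strict, as the event in question is defined
    by a non-strict inequality, and it is positive.\<close>
  have "measure (noise_space (dim P) T) {z \<in> space (noise_space (dim P) T).
        (\<bar>C\<bar> + 1) * sqrt r \<le> Max ((\<lambda>t. vnorm (dim P) (\<lambda>i. xtraj T P z t i - ytraj T P z t i)) ` {1..T})} \<le> 2 * exp (- r)"
    if P: "P \<in> problems T L a b" and r: "0 \<le> r" "r \<le> real (dim P)" for P and r :: real
  proof -
    interpret prob_space "noise_space (dim P) T" by (rule prob_space_noise)
    let ?A = "{z \<in> space (noise_space (dim P) T).
        (\<bar>C\<bar> + 1) * sqrt r \<le> Max ((\<lambda>t. vnorm (dim P) (\<lambda>i. xtraj T P z t i - ytraj T P z t i)) ` {1..T})}"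
    show ?thesis
    proof (cases "1/2 \<le> r")
      case False
      \<comment> \<open>Below the level 1/2 the claimed bound exceeds 1.\<close>
      have "prob ?A \<le> 1" by simp
      also have "1 \<le> 2 * exp (- r)" using exp_ge_add_one_self[of "- r"] False by linarith
      finally show ?thesis .
    next
      case True
      have T: "{1..T} \<noteq> {}" using matched.T1[OF problemsD(1)[OF P]] by simp
      have "?A \<subseteq> {z \<in> space (noise_space (dim P) T). \<not> good_noise H T P r z}"
      proof safe
        fix z assume le: "(\<bar>C\<bar> + 1) * sqrt r \<le> Max ((\<lambda>t. vnorm (dim P) (\<lambda>i. xtraj T P z t i - ytraj T P z t i)) ` {1..T})"
          and g: "good_noise H T P r z"
        have "Max ((\<lambda>t. vnorm (dim P) (\<lambda>i. xtraj T P z t i - ytraj T P z t i)) ` {1..T}) \<le> C * sqrt r"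
          using T C[OF P True r(2) g] by (subst Max_le_iff) auto
        also have "\<dots> \<le> \<bar>C\<bar> * sqrt r" by (intro mult_right_mono) (use r in auto)
        also have "\<dots> < (\<bar>C\<bar> + 1) * sqrt r" using True by (simp add: distrib_right)
        finally show False using le by simp
      qed
      then have "prob ?A \<le> prob {z \<in> space (noise_space (dim P) T). \<not> good_noise H T P r z}"
        using H[OF P True r(2)] by (intro finite_measure_mono) auto
      then show ?thesis using H[OF P True r(2)] by linarith
    qed
  qed
  moreover have "\<bar>C\<bar> + 1 > 0" by simp
  ultimately show ?thesis by blast
qed

theorem theorem1:
  "\<exists>C :: nat \<Rightarrow> real \<Rightarrow> real \<Rightarrow> real \<Rightarrow> real.
     (\<forall>T L a b. C T L a b > 0) \<and>
     (\<forall>(n::nat) (T::nat) (L::real) f g m Sig.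
        1 \<le> T \<longrightarrow> T \<le> n \<longrightarrow>
        (\<forall>t\<in>{1..T}. hist_lipschitz n t L (f t) \<and> hist_lipschitz n t L (g t)) \<longrightarrow>
        state_evolution n T f g m Sig \<longrightarrow>
        pos_def_on {1..T} Sig \<longrightarrow>
        (\<exists>\<mu> :: ((nat \<Rightarrow> nat \<Rightarrow> real) \<times> (nat \<Rightarrow> nat \<Rightarrow> real)) measure.
           prob_space \<mu> \<and>
           sets \<mu> = sets (fun2_space \<Otimes>\<^sub>M fun2_space) \<and>
           distr \<mu> fun2_space fst = distr (GOE n) fun2_space (fom_traj n T f g) \<and>
           distr \<mu> fun2_space snd = distr (gauss_proc n T Sig) fun2_space (cmp_traj n T m) \<and>
           (\<forall>r::real. 0 \<le> r \<and> r \<le> real n \<longrightarrow>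
              measure \<mu> {p \<in> space \<mu>.
                 C T L (lambda_max {1..T} Sig) (lambda_min {1..T} Sig) * sqrt r
                   \<le> Max ((\<lambda>t. vnorm n (\<lambda>i. fst p t i - snd p t i)) ` {1..T})}
              \<le> 2 * exp (- r))))"
proof -
  define good where "good = (\<lambda>T L a b C. C > 0 \<and> (\<forall>P\<in>problems T L a b. \<forall>r::real. 0 \<le> r \<and> r \<le> real (dim P) \<longrightarrow>
     measure (noise_space (dim P) T) {z \<in> space (noise_space (dim P) T).
        C * sqrt r \<le> Max ((\<lambda>t. vnorm (dim P) (\<lambda>i. xtraj T P z t i - ytraj T P z t i)) ` {1..T})} \<le> 2 * exp (- r)))"
  \<comment> \<open>The bound depends on a problem only through the class containing it, so one
    choice per parameter tuple turns the constant into a function of \<open>T\<close>,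
    \<open>L\<close> and the two eigenvalues.\<close>
  define C where "C = (\<lambda>T L a b. SOME C. good T L a b C)"
  have good: "good T L a b (C T L a b)" for T L a b
    unfolding C_def by (rule someI_ex) (unfold good_def, rule coupling_bound)
  have C0: "C T L a b > 0" for T L a b
    using good[of T L a b] unfolding good_def by (rule conjunct1)
  have C: "measure (noise_space (dim P) T) {z \<in> space (noise_space (dim P) T).
        C T L a b * sqrt r \<le> Max ((\<lambda>t. vnorm (dim P) (\<lambda>i. xtraj T P z t i - ytraj T P z t i)) ` {1..T})} \<le> 2 * exp (- r)"
    if "P \<in> problems T L a b" "0 \<le> r" "r \<le> real (dim P)" for T L a b P and r :: real
    using conjunct2[OF good[of T L a b, unfolded good_def]] that by blast
  show ?thesis
  proof (intro exI[of _ C] conjI allI impI)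
    show "C T L a b > 0" for T L a b by (rule C0)
  next
    fix n T :: nat and L :: real and f g m :: "nat \<Rightarrow> (nat \<Rightarrow> nat \<Rightarrow> real) \<Rightarrow> nat \<Rightarrow> real" and Sig :: "nat \<Rightarrow> nat \<Rightarrow> real"
    assume T: "1 \<le> T" "T \<le> n" and lip: "\<forall>t\<in>{1..T}. hist_lipschitz n t L (f t) \<and> hist_lipschitz n t L (g t)"
      and se: "state_evolution n T f g m Sig" and pd: "pos_def_on {1..T} Sig"
    let ?a = "lambda_max {1..T} Sig" and ?b = "lambda_min {1..T} Sig"
    have ne: "{1..T} \<noteq> {}" using T by simp
    have sym: "Sig i j = Sig j i" if "i \<in> {1..T}" "j \<in> {1..T}" for i j
      using pd that unfolding pos_def_on_def by blast
    obtain R where R: "\<And>r s. r \<in> {1..T} \<Longrightarrow> s \<in> {1..T} \<Longrightarrow> (\<Sum>k\<in>{1..T}. R r k * R s k) = Sig r s"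
      "\<And>r k. r < k \<Longrightarrow> R r k = 0" "\<And>r. r \<in> {1..T} \<Longrightarrow> R r r \<ge> sqrt ?b"
      by (rule cholesky[OF pd lambda_min_pos[OF finite_atLeastAtMost ne pd] lambda_min_bound(1)[OF finite_atLeastAtMost ne sym]])
        blast+
    interpret matched n T L f g m Sig R
      by unfold_locales (use T lip se pd R in auto)
    define P where "P = \<lparr>dim = n, ff = f, gg = g, mm = m, cov = Sig, chol = R\<rparr>"
    have P: "P \<in> problems T L ?a ?b" unfolding problems_def P_def by (simp add: matched_axioms)
    let ?F = "fun2_space \<Otimes>\<^sub>M fun2_space :: ((nat \<Rightarrow> nat \<Rightarrow> real) \<times> (nat \<Rightarrow> nat \<Rightarrow> real)) measure"
    let ?p = "\<lambda>z. (x z, y z)"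
    note [measurable] = coupled_traj_measurable y_measurable
    have pm: "?p \<in> measurable N ?F" by measurable
    define \<mu> where "\<mu> = distr N ?F ?p"
    show "\<exists>\<mu> :: ((nat \<Rightarrow> nat \<Rightarrow> real) \<times> (nat \<Rightarrow> nat \<Rightarrow> real)) measure.
           prob_space \<mu> \<and>
           sets \<mu> = sets (fun2_space \<Otimes>\<^sub>M fun2_space) \<and>
           distr \<mu> fun2_space fst = distr (GOE n) fun2_space (fom_traj n T f g) \<and>
           distr \<mu> fun2_space snd = distr (gauss_proc n T Sig) fun2_space (cmp_traj n T m) \<and>
           (\<forall>r::real. 0 \<le> r \<and> r \<le> real n \<longrightarrow>
              measure \<mu> {p \<in> space \<mu>.
                 C T L (lambda_max {1..T} Sig) (lambda_min {1..T} Sig) * sqrt r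
                   \<le> Max ((\<lambda>t. vnorm n (\<lambda>i. fst p t i - snd p t i)) ` {1..T})}
              \<le> 2 * exp (- r))"
    proof (intro exI[of _ \<mu>] conjI allI impI)
      show "prob_space \<mu>" unfolding \<mu>_def by (rule prob_space_distr[OF pm])
      show "sets \<mu> = sets ?F" by (simp add: \<mu>_def)
      interpret G: prob_space "GOE n" by (rule prob_space_GOE[OF n0])
      have "distr \<mu> fun2_space fst = distr N fun2_space x"
        unfolding \<mu>_def by (subst distr_distr[OF _ pm]) (auto simp: comp_def)
      \<comment> \<open>The auxiliary GOE matrix is no component of the coupling; it is adjoined
        here only to identify the first marginal through \<open>coupled_traj_law\<close>.\<close>
      also have "\<dots> = distr (distr (N \<Otimes>\<^sub>M GOE n) N fst) fun2_space x" by (simp add: G.distr_pair_fst)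
      also have "\<dots> = distr (N \<Otimes>\<^sub>M GOE n) fun2_space (\<lambda>(z, B). x z)"
        by (subst distr_distr) (auto simp: comp_def split_beta' coupled_traj_measurable)
      also have "\<dots> = distr (GOE n) fun2_space (fom_traj n T f g)" by (rule coupled_traj_law)
      finally show "distr \<mu> fun2_space fst = distr (GOE n) fun2_space (fom_traj n T f g)" .
      have "distr \<mu> fun2_space snd = distr N fun2_space y"
        unfolding \<mu>_def by (subst distr_distr[OF _ pm]) (auto simp: comp_def)
      also have "\<dots> = distr (gauss_proc n T Sig) fun2_space (cmp_traj n T m)"
        unfolding gauss_proc_eq by (subst distr_distr[OF cmp_measurable mix_noise_measurable]) (simp add: comp_def y_def[abs_def])
      finally show "distr \<mu> fun2_space snd = distr (gauss_proc n T Sig) fun2_space (cmp_traj n T m)" .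
      fix r :: real assume r: "0 \<le> r \<and> r \<le> real n"
      let ?c = "C T L ?a ?b * sqrt r"
      let ?M = "\<lambda>p :: (nat \<Rightarrow> nat \<Rightarrow> real) \<times> (nat \<Rightarrow> nat \<Rightarrow> real). Max ((\<lambda>t. vnorm n (\<lambda>i. fst p t i - snd p t i)) ` {1..T})"
      have cm: "(\<lambda>p. vnorm n (\<lambda>i. fst p t i - snd p t i)) \<in> borel_measurable ?F" for t :: nat
        unfolding vnorm_def by measurable
      have ev: "{p \<in> space \<mu>. ?c \<le> ?M p} = (\<Union>t\<in>{1..T}. {p \<in> space ?F. ?c \<le> vnorm n (\<lambda>i. fst p t i - snd p t i)})"
        using ne by (auto simp: \<mu>_def Max_ge_iff)
      have A: "{p \<in> space \<mu>. ?c \<le> ?M p} \<in> sets ?F"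
        unfolding ev using cm by (intro sets.finite_UN) auto
      have "measure \<mu> {p \<in> space \<mu>. ?c \<le> ?M p} = measure N (?p -` {p \<in> space \<mu>. ?c \<le> ?M p} \<inter> space N)"
        unfolding \<mu>_def by (rule measure_distr[OF pm A[unfolded \<mu>_def]])
      also have "?p -` {p \<in> space \<mu>. ?c \<le> ?M p} \<inter> space N = {z \<in> space N. ?c \<le> Max ((\<lambda>t. vnorm n (\<lambda>i. x z t i - y z t i)) ` {1..T})}"
        by (auto simp: \<mu>_def space_pair_measure)
      also have "measure N \<dots> \<le> 2 * exp (- r)"
        using C[OF P, of r] r by (simp add: P_def)
      finally show "measure \<mu> {p \<in> space \<mu>. ?c \<le> ?M p} \<le> 2 * exp (- r)" .
    qed
  qed
qed

end
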